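(* Let $X\in\mathcal{M}$ have transition matrix $P$ and reference measure $\pi$. (1) Assume that $\mathfrak{r}<\infty$ and $Q$ is the transition kernel of an irreducible birth-death process. Then $P\stackrel{\Lambda}{\sim}Q$ if and only if $P$ has real and distinct eigenvalues. (2) $(X,\mathbb{P})\in\mathcal{S}$ with $P\stackrel{\Lambda}{\sim}Q$ if and only if $(X,\widehat{\mathbb{P}})\in\widehat{\mathcal{S}}$ with $Q\stackrel{\widehat\Lambda}{\sim}\widehat P$, where $\widehat\Lambda$ is the adjoint operator of $\Lambda$. Assume from now on that $(X,\mathbb{P})\in\mathcal{S}$ with $P\stackrel{\Lambda}{\sim}Q$. Then the following hold. (a) For any $h\in\mathcal{E}$, $(X,\mathbb{P}^h)\in\mathcal{S}$ with $P^h\stackrel{\Lambda^h}{\sim}Q$ and $\Lambda^h=D_h^{-1}\Lambda$, where $D_h$ is the diagonal matrix of $h$. (b) If $P$ is normal, i.e. $P\widehat P=\widehat PP$, then $P$ is self-adjoint, i.e. $P=\widehat P$. (c) $P$ is compact (resp. trace class) if and only if $Q$ is. (d) Assume that $P$ is compact. Then for any $f\in\ell^2(\pi)$ and $n\in\mathbb{N}$, $$P^nf=\sum_{k=0}^{\mathfrak{r}}\lambda_k^n\langle f,f_k^*\rangle_\pi f_k,$$ where $(f_k)_{k=0}^{\mathfrak{r}}$ are real eigenfunctions of $P$ associated to the real eigenvalues $(\lambda_k)_{k=0}^{\mathfrak{r}}$ and form a Riesz basis of $\ell^2(\pi)$, and $(f_k^* )_{k=0}^{\mathfrak{r}}$ is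 the unique Riesz basis biorthogonal to $(f_k)_{k=0}^{\mathfrak{r}}$. In particular, for any $x,y\in E$ and $n\in\mathbb{N}$, the spectral expansion of $P$ is given by $$P^n(x,y)=\sum_{k=0}^{\mathfrak{r}}\lambda_k^nf_k(x)f_k^*(y)\pi(y).$$ (e) $\mathcal{MC}\subseteq\mathcal{S}^M$. (f) Assume that $P$ is compact, with $(\lambda_k),(f_k),(f_k^* )$ as in (d). If $\mathfrak{r}<\infty$ is absorbing and $\mathfrak{l}$ is regular, then $$\mathbb{P}_x(T_{\mathfrak{r}}=n)=\sum_{k=0}^{\mathfrak{r}}\lambda_k^n(1-\lambda_k)\langle\mathbf{1},f_k^*\rangle_\pi f_k(x),$$ and if $\mathfrak{l}$ is finite and absorbing and $\mathfrak{r}<\infty$ is regular, then $$\mathbb{P}_x(T_{\mathfrak{l}}=n)=\sum_{k=0}^{\mathfrak{r}}\lambda_k^n(1-\lambda_k)\langle\mathbf{1},f_k^*\rangle_\pi f_k(x).$$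
   Context: $E\subseteq\mathbb{Z}$ is a countable interval of integers with endpoints $\mathfrak{l},\mathfrak{r}$, which may or may not belong to $E$ (a boundary point belongs to $E$ and is called regular if it is not absorbing; absorbing boundary points are not in $E$). $\mathcal{M}$ is the set of Markov chains $X$ (equivalently transition matrices $P=(p(x,y))_{x,y\in E}$) on $E$ that are irreducible (for all $x,y$ strictly between $\mathfrak{l}$ and $\mathfrak{r}$, $p^{(n)}(x,y)>0$ for some $n$) and upward skip-free ($p(x,x+1)>0$, $p(x,x+y)=0$ for $y\ge2$). $\pi$ is a reference measure for $P$: a positive finite-valued excessive measure, $\pi P\le\pi$. $\widehat P$ is the time-reversal ($\pi$-dual): $\pi(x)\widehat p(x,y)=\pi(y)p(y,x)$; $\widehat{\mathbb{P}}$ is the law of the corresponding chain. $\ell^2(\pi)$ is the weighted Hilbert space of real functions on $E$ with $\langle f,g\rangle_\pi=\sum_{x\in E}f(x)g(x)\pi(x)$. $\mathcal{E}$ is the set of excessive functions $h:E\to\mathbb{R}^+$, $Ph\le h$, and $P^h(x,y)=p(x,y)h(y)/h(x)$ is the Doob transform with law $\mathbb{P}^h$. $T_a=\inf\{n\ge0:X_n=a\}$. $\mathbf{1}$ is the constant function one. Birth-death: $Q\in\mathcal{M}$ with moreover $Q(x,x-1)>0$ and $Q(x,x-y)=0$ for $y\ge2$. $\mathcal{B}$ is the set of transition matrices on $E$ of irreducible (or with at most one absorbing or entrance state) birth-death chains; $\pi_Q$ is the reference (reversible) measure of $Q$. Similarity: $P\sim Q$ (or $P\stackrel{\Lambda}{\sim}Q$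 to specify $\Lambda$) if there is a bounded linear operator $\Lambda:\ell^2(\pi_Q)\to\ell^2(\pi)$ with bounded inverse such that $P\Lambda=\Lambda Q$. For $Q\in\mathcal{B}$, $\mathcal{S}(Q)=\{P\in\mathcal{M}:P\sim Q\}$, and $\mathcal{S}=\bigcup_{Q\in\mathcal{B}}\mathcal{S}(Q)$. $\widehat{\mathcal{S}}(Q)$ and $\widehat{\mathcal{S}}$ are defined by replacing $P$ with $\widehat P$. $X\in\mathcal{S}^M$ if $X\in\mathcal{S}$ and $(X,\widehat{\mathbb{P}})$ is stochastically monotone, i.e. $y\mapsto\widehat{\mathbb{P}}_y(X_1\le x)$ is non-increasing for every fixed $x$. The class $\mathcal{MC}=\mathcal{MC}_{\mathfrak{r}}$, $\mathfrak{r}\ge3$: $X\in\mathcal{M}$ with $E=\{0,1,\dots,\mathfrak{r}\}$ such that for every $x\in\{0,\dots,\mathfrak{r}-1\}$ the time-reversal satisfies: (i) $\widehat{\mathbb{P}}_{x+1}(X_1\le x)\le\widehat{\mathbb{P}}_x(X_1\le x)$; (ii) $\widehat{\mathbb{P}}_{x+1}(X_1\le x+1)<\widehat{\mathbb{P}}_x(X_1\le x+1)$ for $x\ne\mathfrak{r}-1$; (iii) $\widehat{\mathbb{P}}_{x+1}(X_1\le x+k)=\widehat{\mathbb{P}}_x(X_1\le x+k)$ for $x\neq\mathfrak{r}-1$ and $k\in\{2,\dots,\mathfrak{r}-1-x\}$. A Riesz basis of a Hilbert space is the image of an orthonormal basis under a bounded invertible operator; $(f_k^* )$ is biorthogonal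 to $(f_k)$ if $\langle f_k,f_m^*\rangle_\pi=\delta_{k,m}$. The index $k=0,\dots,\mathfrak{r}$ enumerates the eigenvalues of $P$.
   Formalization: In (1), for the given Q, the right side reads "P has real and distinct eigenvalues, and they are those of Q"; in (f) the left sides have T=n+1 instead of T=n; in (a) h is strictly positive and P^h acts on ℓ²(w) with w comparable to h²π. *)

theory Defs
  imports "HOL-Probability.Probability_Measure"
begin

section \<open>State spaces and matrices\<close>

text \<open>A finite endpoint belongs to the state space iff it is regular. An absorbing endpoint is
  outside the state space, so a transition matrix indexed by the state space is in general
  sub-Markovian: the missing mass of a row is the probability of leaving the state space.\<close>

datatype endpoint = Infinite | Regular int | Absorbing int

definition state_space :: "endpoint \<Rightarrow> endpoint \<Rightarrow> int set" where
  "state_space lb rb =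
     {x. (case lb of Infinite \<Rightarrow> True | Regular l \<Rightarrow> l \<le> x | Absorbing l \<Rightarrow> l < x) \<and>
         (case rb of Infinite \<Rightarrow> True | Regular r \<Rightarrow> x \<le> r | Absorbing r \<Rightarrow> x < r)}"

definition strictly_between :: "endpoint \<Rightarrow> endpoint \<Rightarrow> int set" where
  "strictly_between lb rb =
     {x. (case lb of Infinite \<Rightarrow> True | Regular l \<Rightarrow> l < x | Absorbing l \<Rightarrow> l < x) \<and>
         (case rb of Infinite \<Rightarrow> True | Regular r \<Rightarrow> x < r | Absorbing r \<Rightarrow> x < r)}"

type_synonym matrix = "int \<Rightarrow> int \<Rightarrow> real"

definition mat_mult :: "int set \<Rightarrow> matrix \<Rightarrow> matrix \<Rightarrow> matrix" where
  "mat_mult E a b = (\<lambda>x y. \<Sum>\<^sub>\<infinity>z\<in>E. a x z * b z y)"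

fun mat_pow :: "int set \<Rightarrow> matrix \<Rightarrow> nat \<Rightarrow> matrix" where
  "mat_pow E p 0 = (\<lambda>x y. if x = y then 1 else 0)"
| "mat_pow E p (Suc n) = mat_mult E p (mat_pow E p n)"

text \<open>Functions on \<open>E\<close> are represented by functions on the integers that vanish off \<open>E\<close>.\<close>

definition mat_op :: "int set \<Rightarrow> matrix \<Rightarrow> (int \<Rightarrow> real) \<Rightarrow> int \<Rightarrow> real" where
  "mat_op E p f = (\<lambda>x. if x \<in> E then (\<Sum>\<^sub>\<infinity>y\<in>E. p x y * f y) else 0)"

definition sub_markov :: "int set \<Rightarrow> matrix \<Rightarrow> bool" where
  "sub_markov E p \<longleftrightarrow> (\<forall>x\<in>E. \<forall>y\<in>E. 0 \<le> p x y) \<and>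
     (\<forall>x\<in>E. p x summable_on E \<and> (\<Sum>\<^sub>\<infinity>y\<in>E. p x y) \<le> 1)"

text \<open>The class of upward skip-free chains. The Doob transform of a Markov matrix by an excessive
  function may lose mass in any row, hence no row is required to have total mass 1.\<close>

definition class_M :: "endpoint \<Rightarrow> endpoint \<Rightarrow> matrix set" where
  "class_M lb rb = {p. let E = state_space lb rb in
     E \<noteq> {} \<and> sub_markov E p \<and>
     (\<forall>l. lb = Regular l \<longrightarrow> p l l \<noteq> 1) \<and> (\<forall>r. rb = Regular r \<longrightarrow> p r r \<noteq> 1) \<and>
     (\<forall>x\<in>strictly_between lb rb. \<forall>y\<in>strictly_between lb rb. \<exists>n. 0 < mat_pow E p n x y) \<and>
     (\<forall>x\<in>E. x + 1 \<in> E \<longrightarrow> 0 < p x (x + 1)) \<and>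
     (\<forall>x\<in>E. \<forall>y\<in>E. x + 2 \<le> y \<longrightarrow> p x y = 0)}"

definition reference_measure :: "int set \<Rightarrow> matrix \<Rightarrow> (int \<Rightarrow> real) \<Rightarrow> bool" where
  "reference_measure E p \<pi> \<longleftrightarrow> (\<forall>x\<in>E. 0 < \<pi> x) \<and>
     (\<forall>y\<in>E. (\<lambda>x. \<pi> x * p x y) summable_on E \<and> (\<Sum>\<^sub>\<infinity>x\<in>E. \<pi> x * p x y) \<le> \<pi> y)"

definition time_reversal :: "(int \<Rightarrow> real) \<Rightarrow> matrix \<Rightarrow> matrix" where
  "time_reversal \<pi> p = (\<lambda>x y. \<pi> y * p y x / \<pi> x)"

text \<open>The values of an excessive function are taken strictly positive, so that the Doob transform
  is defined on all of \<open>E\<close>.\<close>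

definition excessive :: "int set \<Rightarrow> matrix \<Rightarrow> (int \<Rightarrow> real) set" where
  "excessive E p = {h. (\<forall>x\<in>E. 0 < h x) \<and>
     (\<forall>x\<in>E. (\<lambda>y. p x y * h y) summable_on E \<and> (\<Sum>\<^sub>\<infinity>y\<in>E. p x y * h y) \<le> h x)}"

definition doob_transform :: "(int \<Rightarrow> real) \<Rightarrow> matrix \<Rightarrow> matrix" where
  "doob_transform h p = (\<lambda>x y. p x y * h y / h x)"

definition birth_death :: "endpoint \<Rightarrow> endpoint \<Rightarrow> matrix set" where
  "birth_death lb rb = {q \<in> class_M lb rb. let E = state_space lb rb in
     (\<forall>x\<in>E. x - 1 \<in> E \<longrightarrow> 0 < q x (x - 1)) \<and>
     (\<forall>x\<in>E. \<forall>y\<in>E. y + 2 \<le> x \<longrightarrow> q x y = 0)}"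

text \<open>Below, \<open>A\<close> is the set of absorbing states; they lie outside \<open>E\<close>, there is at most one, and it
  can be entered only from a neighbour. An entrance state cannot be entered from \<open>E\<close>, so it puts no
  condition on the matrix.\<close>

definition class_B :: "endpoint \<Rightarrow> endpoint \<Rightarrow> matrix set" where
  "class_B lb rb = {q \<in> birth_death lb rb. let E = state_space lb rb in
     \<exists>A. finite A \<and> card A \<le> 1 \<and> A \<inter> E = {} \<and>
       (\<forall>x\<in>E. (\<Sum>\<^sub>\<infinity>y\<in>E. q x y) < 1 \<longrightarrow> (\<exists>a\<in>A. \<bar>x - a\<bar> = 1))}"

definition reversible_measure :: "int set \<Rightarrow> matrix \<Rightarrow> (int \<Rightarrow> real) \<Rightarrow> bool" where
  "reversible_measure E q \<kappa> \<longleftrightarrow> (\<forall>x\<in>E. 0 < \<kappa> x) \<and>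
     (\<forall>x\<in>E. \<forall>y\<in>E. \<kappa> x * q x y = \<kappa> y * q y x)"

section \<open>Weighted sequence spaces and their operators\<close>

definition l2 :: "int set \<Rightarrow> (int \<Rightarrow> real) \<Rightarrow> (int \<Rightarrow> real) set" where
  "l2 E w = {f. (\<forall>x. x \<notin> E \<longrightarrow> f x = 0) \<and> (\<lambda>x. (f x)\<^sup>2 * w x) summable_on E}"

definition l2_inner :: "int set \<Rightarrow> (int \<Rightarrow> real) \<Rightarrow> (int \<Rightarrow> real) \<Rightarrow> (int \<Rightarrow> real) \<Rightarrow> real" where
  "l2_inner E w f g = (\<Sum>\<^sub>\<infinity>x\<in>E. f x * g x * w x)"

definition l2_norm :: "int set \<Rightarrow> (int \<Rightarrow> real) \<Rightarrow> (int \<Rightarrow> real) \<Rightarrow> real" where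
  "l2_norm E w f = sqrt (l2_inner E w f f)"

type_synonym operator = "(int \<Rightarrow> real) \<Rightarrow> int \<Rightarrow> real"

definition bounded_operator :: "int set \<Rightarrow> (int \<Rightarrow> real) \<Rightarrow> (int \<Rightarrow> real) \<Rightarrow> operator \<Rightarrow> bool" where
  "bounded_operator E v w A \<longleftrightarrow>
     (\<forall>f\<in>l2 E v. A f \<in> l2 E w) \<and>
     (\<forall>f\<in>l2 E v. \<forall>g\<in>l2 E v. \<forall>a b.
        A (\<lambda>x. a * f x + b * g x) = (\<lambda>x. a * A f x + b * A g x)) \<and>
     (\<exists>C. \<forall>f\<in>l2 E v. l2_norm E w (A f) \<le> C * l2_norm E v f)"

definition bounded_invertible :: "int set \<Rightarrow> (int \<Rightarrow> real) \<Rightarrow> (int \<Rightarrow> real) \<Rightarrow> operator \<Rightarrow> bool" where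
  "bounded_invertible E v w A \<longleftrightarrow> bounded_operator E v w A \<and>
     (\<exists>B. bounded_operator E w v B \<and>
        (\<forall>f\<in>l2 E v. B (A f) = f) \<and> (\<forall>g\<in>l2 E w. A (B g) = g))"

definition l2_adjoint :: "int set \<Rightarrow> (int \<Rightarrow> real) \<Rightarrow> (int \<Rightarrow> real) \<Rightarrow> operator \<Rightarrow> operator" where
  "l2_adjoint E v w A = (SOME B. bounded_operator E w v B \<and>
     (\<forall>f\<in>l2 E v. \<forall>g\<in>l2 E w. l2_inner E w (A f) g = l2_inner E v f (B g)))"

definition compact_operator :: "int set \<Rightarrow> (int \<Rightarrow> real) \<Rightarrow> operator \<Rightarrow> bool" where
  "compact_operator E w A \<longleftrightarrow> bounded_operator E w w A \<and>
     (\<forall>f :: nat \<Rightarrow> int \<Rightarrow> real. (\<forall>n. f n \<in> l2 E w \<and> l2_norm E w (f n) \<le> 1) \<longrightarrow>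
        (\<exists>g\<in>l2 E w. \<exists>s. strict_mono s \<and>
           (\<lambda>n. l2_norm E w (\<lambda>x. A (f (s n)) x - g x)) \<longlonglongrightarrow> 0))"

text \<open>A basis has as many elements as \<open>E\<close>, i.e. its index set is \<open>{..<card E}\<close> for finite \<open>E\<close> and
  all of the natural numbers otherwise. Values of a family outside the index set are irrelevant.\<close>

definition index_set :: "int set \<Rightarrow> nat set" where
  "index_set E = {k. finite E \<longrightarrow> k < card E}"

definition biorthogonal ::
    "int set \<Rightarrow> (int \<Rightarrow> real) \<Rightarrow> (nat \<Rightarrow> int \<Rightarrow> real) \<Rightarrow> (nat \<Rightarrow> int \<Rightarrow> real) \<Rightarrow> bool" where
  "biorthogonal E w f g \<longleftrightarrow>
     (\<forall>j\<in>index_set E. \<forall>k\<in>index_set E. l2_inner E w (f j) (g k) = (if j = k then 1 else 0))"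

definition orthonormal_basis :: "int set \<Rightarrow> (int \<Rightarrow> real) \<Rightarrow> (nat \<Rightarrow> int \<Rightarrow> real) \<Rightarrow> bool" where
  "orthonormal_basis E w e \<longleftrightarrow> (\<forall>k\<in>index_set E. e k \<in> l2 E w) \<and> biorthogonal E w e e \<and>
     (\<forall>f\<in>l2 E w. (\<forall>k\<in>index_set E. l2_inner E w f (e k) = 0) \<longrightarrow> f = (\<lambda>x. 0))"

definition riesz_basis :: "int set \<Rightarrow> (int \<Rightarrow> real) \<Rightarrow> (nat \<Rightarrow> int \<Rightarrow> real) \<Rightarrow> bool" where
  "riesz_basis E w f \<longleftrightarrow> (\<exists>e T. orthonormal_basis E w e \<and> bounded_invertible E w w T \<and>
     (\<forall>k\<in>index_set E. f k = T (e k)))"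

text \<open>\<open>S\<close> is the absolute value of \<open>A\<close>, i.e. the positive square root of \<open>A\<^sup>*A\<close>; it must have
  finite trace.\<close>

definition trace_class :: "int set \<Rightarrow> (int \<Rightarrow> real) \<Rightarrow> operator \<Rightarrow> bool" where
  "trace_class E w A \<longleftrightarrow> bounded_operator E w w A \<and>
     (\<exists>S. bounded_operator E w w S \<and>
        (\<forall>f\<in>l2 E w. \<forall>g\<in>l2 E w. l2_inner E w (S f) g = l2_inner E w f (S g)) \<and>
        (\<forall>f\<in>l2 E w. 0 \<le> l2_inner E w (S f) f) \<and>
        (\<forall>f\<in>l2 E w. S (S f) = l2_adjoint E w w A (A f)) \<and>
        (\<exists>e. orthonormal_basis E w e \<and>
           (\<lambda>k. l2_inner E w (S (e k)) (e k)) summable_on index_set E))"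

section \<open>Similarity\<close>

text \<open>\<open>similar_via E p \<pi> q \<kappa> \<Lambda>\<close>: \<open>\<Lambda>\<close> maps \<open>\<ell>\<^sup>2(\<kappa>)\<close> to \<open>\<ell>\<^sup>2(\<pi>)\<close> and intertwines \<open>p\<close> with \<open>q\<close>.\<close>

definition similar_via ::
    "int set \<Rightarrow> matrix \<Rightarrow> (int \<Rightarrow> real) \<Rightarrow> matrix \<Rightarrow> (int \<Rightarrow> real) \<Rightarrow> operator \<Rightarrow> bool" where
  "similar_via E p \<pi> q \<kappa> \<Lambda> \<longleftrightarrow> bounded_invertible E \<kappa> \<pi> \<Lambda> \<and>
     (\<forall>f\<in>l2 E \<kappa>. mat_op E p (\<Lambda> f) = \<Lambda> (mat_op E q f))"

text \<open>Similarity depends on the weight of the space on which the chain acts, so the following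
  classes consist of pairs of a transition matrix and a weight.\<close>

definition class_S_of ::
    "endpoint \<Rightarrow> endpoint \<Rightarrow> matrix \<Rightarrow> (int \<Rightarrow> real) \<Rightarrow> (matrix \<times> (int \<Rightarrow> real)) set" where
  "class_S_of lb rb q \<kappa> = {(p, \<pi>). p \<in> class_M lb rb \<and> (\<forall>x\<in>state_space lb rb. 0 < \<pi> x) \<and>
     (\<exists>\<Lambda>. similar_via (state_space lb rb) p \<pi> q \<kappa> \<Lambda>)}"

definition class_S :: "endpoint \<Rightarrow> endpoint \<Rightarrow> (matrix \<times> (int \<Rightarrow> real)) set" where
  "class_S lb rb = (\<Union>q\<in>class_B lb rb. \<Union>\<kappa>\<in>{\<kappa>. reversible_measure (state_space lb rb) q \<kappa>}.
     class_S_of lb rb q \<kappa>)"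

definition class_S_hat_of ::
    "endpoint \<Rightarrow> endpoint \<Rightarrow> matrix \<Rightarrow> (int \<Rightarrow> real) \<Rightarrow> (matrix \<times> (int \<Rightarrow> real)) set" where
  "class_S_hat_of lb rb q \<kappa> = {(p, \<pi>). p \<in> class_M lb rb \<and> (\<forall>x\<in>state_space lb rb. 0 < \<pi> x) \<and>
     (\<exists>\<Lambda>. similar_via (state_space lb rb) (time_reversal \<pi> p) \<pi> q \<kappa> \<Lambda>)}"

definition class_S_hat :: "endpoint \<Rightarrow> endpoint \<Rightarrow> (matrix \<times> (int \<Rightarrow> real)) set" where
  "class_S_hat lb rb = (\<Union>q\<in>class_B lb rb. \<Union>\<kappa>\<in>{\<kappa>. reversible_measure (state_space lb rb) q \<kappa>}.
     class_S_hat_of lb rb q \<kappa>)"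

text \<open>The one-step distribution function: the probability of a jump from \<open>y\<close> to a state \<open>\<le> x\<close>.\<close>

definition step_cdf :: "int set \<Rightarrow> matrix \<Rightarrow> int \<Rightarrow> int \<Rightarrow> real" where
  "step_cdf E p y x = (\<Sum>\<^sub>\<infinity>z\<in>E \<inter> {..x}. p y z)"

definition stochastically_monotone :: "int set \<Rightarrow> matrix \<Rightarrow> bool" where
  "stochastically_monotone E p \<longleftrightarrow>
     (\<forall>x\<in>E. \<forall>y\<in>E. \<forall>y'\<in>E. y \<le> y' \<longrightarrow> step_cdf E p y' x \<le> step_cdf E p y x)"

definition class_SM :: "endpoint \<Rightarrow> endpoint \<Rightarrow> (matrix \<times> (int \<Rightarrow> real)) set" where
  "class_SM lb rb = {(p, \<pi>) \<in> class_S lb rb.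
     stochastically_monotone (state_space lb rb) (time_reversal \<pi> p)}"

text \<open>Both endpoints of \<open>{0..r}\<close> are regular, so the chain never leaves the state space and the
  matrix is stochastic.\<close>

definition class_MC :: "int \<Rightarrow> (matrix \<times> (int \<Rightarrow> real)) set" where
  "class_MC r = {(p, \<pi>). p \<in> class_M (Regular 0) (Regular r) \<and> (\<forall>x\<in>{0..r}. (\<Sum>y\<in>{0..r}. p x y) = 1) \<and>
     reference_measure {0..r} p \<pi> \<and>
     (let F = step_cdf {0..r} (time_reversal \<pi> p) in
       \<forall>x\<in>{0..r - 1}.
         F (x + 1) x \<le> F x x \<and>
         (x \<noteq> r - 1 \<longrightarrow> F (x + 1) (x + 1) < F x (x + 1)) \<and>
         (x \<noteq> r - 1 \<longrightarrow> (\<forall>k\<in>{2..r - 1 - x}. F (x + 1) (x + k) = F x (x + k))))}"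

section \<open>Spectral notions\<close>

definition eigenvalues :: "int set \<Rightarrow> matrix \<Rightarrow> complex set" where
  "eigenvalues E p = {\<mu>. \<exists>v. (\<exists>x\<in>E. v x \<noteq> 0) \<and>
     (\<forall>x\<in>E. (\<Sum>y\<in>E. complex_of_real (p x y) * v y) = \<mu> * v x)}"

text \<open>For finite \<open>E\<close>: the \<open>card E\<close> complex eigenvalues, counted with algebraic multiplicity, are
  real and pairwise different.\<close>

definition real_distinct_eigenvalues :: "int set \<Rightarrow> matrix \<Rightarrow> bool" where
  "real_distinct_eigenvalues E p \<longleftrightarrow> eigenvalues E p \<subseteq> \<real> \<and> card (eigenvalues E p) = card E"

definition l2_eigenvalues :: "int set \<Rightarrow> (int \<Rightarrow> real) \<Rightarrow> matrix \<Rightarrow> real set" where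
  "l2_eigenvalues E w p =
     {\<mu>. \<exists>g\<in>l2 E w. g \<noteq> (\<lambda>x. 0) \<and> mat_op E p g = (\<lambda>x. \<mu> * g x)}"

definition eigen_riesz_basis ::
    "int set \<Rightarrow> (int \<Rightarrow> real) \<Rightarrow> matrix \<Rightarrow> (nat \<Rightarrow> real) \<Rightarrow> (nat \<Rightarrow> int \<Rightarrow> real) \<Rightarrow> bool" where
  "eigen_riesz_basis E w p \<mu> f \<longleftrightarrow> riesz_basis E w f \<and>
     (\<forall>k\<in>index_set E. f k \<noteq> (\<lambda>x. 0) \<and> mat_op E p (f k) = (\<lambda>x. \<mu> k * f k x))"

section \<open>Absorption times\<close>

text \<open>The chain on \<open>E \<union> {a}\<close> that sends the missing mass of \<open>p\<close> to the absorbing state \<open>a\<close>.\<close>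

definition absorbed_kernel :: "int set \<Rightarrow> int \<Rightarrow> matrix \<Rightarrow> matrix" where
  "absorbed_kernel E a p = (\<lambda>x y.
     if x = a then (if y = a then 1 else 0)
     else if y = a then 1 - (\<Sum>\<^sub>\<infinity>z\<in>E. p x z) else p x y)"

definition markov_chain ::
    "int set \<Rightarrow> matrix \<Rightarrow> int \<Rightarrow> 'w measure \<Rightarrow> (nat \<Rightarrow> 'w \<Rightarrow> int) \<Rightarrow> bool" where
  "markov_chain S k x0 \<Omega> X \<longleftrightarrow> prob_space \<Omega> \<and>
     (\<forall>n. X n \<in> measurable \<Omega> (count_space S)) \<and>
     (\<forall>n s. (\<forall>i\<le>n. s i \<in> S) \<longrightarrow>
        measure \<Omega> {\<omega>\<in>space \<Omega>. \<forall>i\<le>n. X i \<omega> = s i} =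
          (if s 0 = x0 then 1 else 0) * (\<Prod>i<n. k (s i) (s (Suc i))))"

definition hitting_event ::
    "'w measure \<Rightarrow> (nat \<Rightarrow> 'w \<Rightarrow> int) \<Rightarrow> int \<Rightarrow> nat \<Rightarrow> 'w set" where
  "hitting_event \<Omega> X a n = {\<omega>\<in>space \<Omega>. X n \<omega> = a \<and> (\<forall>m<n. X m \<omega> \<noteq> a)}"

end

theory Submission
  imports Defs "HOL-Complex_Analysis.Great_Picard" "HOL-Computational_Algebra.Polynomial" "HOL-Real_Asymp.Real_Asymp"
begin

text \<open>Multiplication by \<open>sqrt w\<close> identifies the weighted spaces with closed subspaces of one Hilbert
  space, in which \<open>P\<close> is a contraction with adjoint the time reversal and \<open>Q\<close> is self-adjoint. Compactness
  and the trace ideal are invariant under similarity, and the spectral theorem for \<open>Q\<close> is transported by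
  \<open>\<Lambda>\<close> to a Riesz basis of eigenfunctions of \<open>P\<close>. If \<open>P\<close> is normal, then for all real \<open>s\<close> the norm of
  \<open>P - i s\<close> equals its spectral radius, which is that of \<open>Q - i s\<close>; this forces \<open>P\<close> to be self-adjoint.
  On a finite state space the eigenvalues of a birth-death matrix are simple, so \<open>\<Lambda>\<close> can be chosen to
  map eigenfunctions to eigenfunctions as soon as the spectra agree.

  For a chain in \<open>\<M>\<C>\<close> the Siegmund dual of the time reversal is tridiagonal and nonnegative, and its
  spectrum together with 1 is the spectrum of \<open>P\<close>. The eigenvalues \<open>t\<^sub>0 > t\<^sub>1 > \<dots>\<close> of a nonnegative
  Jacobi matrix of size \<open>N\<close> satisfy \<open>t\<^sub>j + t\<^sub>N\<^sub>-\<^sub>1\<^sub>-\<^sub>j \<ge> 0\<close>, and 1 dominates strictly. Therefore the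
  spectrum \<open>l\<^sub>0 > \<dots> > l\<^sub>N\<close> of \<open>P\<close> satisfies \<open>l\<^sub>i + l\<^sub>N\<^sub>-\<^sub>i > 0\<close>, which suffices for it to be the
  spectrum of a Jacobi matrix with positive diagonal. A Doob transform by the eigenfunction of the
  eigenvalue 1 turns the latter into a birth-death chain that is similar to \<open>P\<close>.\<close>

section \<open>Orthonormal families and compact operators\<close>

text \<open>Three obstacles shape the proof. Trace class is defined through the absolute value of an
  operator, which similarity does not respect. What bounded maps do transport is a representation as
  a sum of rank-one operators with summable norms, and for compact operators this is equivalent to
  the trace condition.

  The prescribed spectrum is realised by perturbation: the two outermost eigenvalues are added
  around a Jacobi matrix for the inner ones, with a new diagonal entry equal to their mean and
  another close to it. Positivity of the remaining entries survives only because it is an open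
  condition, so the pair sums must be strictly positive, while the dual yields only weak
  inequalities. Prepending the eigenvalue 1 shifts the pairing by one place, and simplicity of the
  spectrum then gives strictness.

  A Jacobi matrix becomes a transition matrix only after conjugation by a positive eigenvector for
  1. Positivity of the orthogonal polynomials at 1 is therefore carried through the whole
  construction.\<close>

definition orthonormal_on :: "'i set \<Rightarrow> ('i \<Rightarrow> 'a::real_inner) \<Rightarrow> bool" where
  "orthonormal_on I e \<longleftrightarrow> (\<forall>j\<in>I. \<forall>k\<in>I. e j \<bullet> e k = (if j = k then 1 else 0))"

text \<open>Totality is encoded as a trivial orthogonal complement inside \<open>H\<close>: this is
  the form in which a maximality argument delivers it, and it makes sense for a subspace of a larger
  type.\<close>

definition onb :: "'a::real_inner set \<Rightarrow> 'i set \<Rightarrow> ('i \<Rightarrow> 'a) \<Rightarrow> bool" where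
  "onb H I e \<longleftrightarrow> (\<forall>k\<in>I. e k \<in> H) \<and> orthonormal_on I e \<and>
     (\<forall>f\<in>H. (\<forall>k\<in>I. f \<bullet> e k = 0) \<longrightarrow> f = 0)"

lemma orthonormal_onD: "orthonormal_on I e \<Longrightarrow> j \<in> I \<Longrightarrow> k \<in> I \<Longrightarrow> e j \<bullet> e k = (if j = k then 1 else 0)"
  by (simp add: orthonormal_on_def)

lemma inner_sum_orthonormal:
  assumes "orthonormal_on I e" "finite F" "F \<subseteq> I" "j \<in> F"
  shows "(\<Sum>k\<in>F. c k *\<^sub>R e k) \<bullet> e j = c j"
proof -
  have "(\<Sum>k\<in>F. c k *\<^sub>R e k) \<bullet> e j = (\<Sum>k\<in>F. c k * (e k \<bullet> e j))"
    by (simp add: inner_sum_left)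
  also have "\<dots> = (\<Sum>k\<in>F. if k = j then c j else 0)"
    using assms by (intro sum.cong refl) (simp add: orthonormal_onD[OF assms(1)] subset_iff)
  finally show ?thesis using assms by simp
qed

lemma norm_sum_orthonormal:
  assumes "orthonormal_on I e" "finite F" "F \<subseteq> I"
  shows "(norm (\<Sum>k\<in>F. c k *\<^sub>R e k))\<^sup>2 = (\<Sum>k\<in>F. (c k)\<^sup>2)"
proof -
  have "(norm (\<Sum>k\<in>F. c k *\<^sub>R e k))\<^sup>2 = (\<Sum>j\<in>F. c j * ((\<Sum>k\<in>F. c k *\<^sub>R e k) \<bullet> e j))"
    by (simp add: power2_norm_eq_inner inner_sum_right)
  also have "\<dots> = (\<Sum>j\<in>F. (c j)\<^sup>2)"
    by (intro sum.cong) (auto simp: inner_sum_orthonormal[OF assms] power2_eq_square)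
  finally show ?thesis .
qed

lemma bessel:
  assumes "orthonormal_on I e" "finite F" "F \<subseteq> I"
  shows "(\<Sum>k\<in>F. (f \<bullet> e k)\<^sup>2) \<le> (norm f)\<^sup>2"
proof -
  let ?s = "\<Sum>k\<in>F. (f \<bullet> e k) *\<^sub>R e k"
  have 1: "f \<bullet> ?s = (\<Sum>k\<in>F. (f \<bullet> e k)\<^sup>2)"
    by (simp add: inner_sum_right power2_eq_square)
  have 2: "?s \<bullet> ?s = (\<Sum>k\<in>F. (f \<bullet> e k)\<^sup>2)"
    using norm_sum_orthonormal[OF assms, of "\<lambda>k. f \<bullet> e k"] by (simp add: power2_norm_eq_inner)
  have "0 \<le> (f - ?s) \<bullet> (f - ?s)" by simp
  also have "\<dots> = f \<bullet> f - 2 * (f \<bullet> ?s) + ?s \<bullet> ?s"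
    by (simp add: inner_diff_left inner_diff_right inner_commute[of ?s f])
  finally show ?thesis unfolding 1 2 by (simp add: power2_norm_eq_inner)
qed

lemma summable_on_real_bounded:
  fixes f :: "'i \<Rightarrow> real"
  assumes "\<And>x. x \<in> A \<Longrightarrow> 0 \<le> f x" "\<And>F. finite F \<Longrightarrow> F \<subseteq> A \<Longrightarrow> sum f F \<le> C"
  shows "f summable_on A" "infsum f A \<le> C"
proof -
  show *: "f summable_on A"
    by (rule nonneg_bdd_above_summable_on) (use assms in \<open>auto intro!: bdd_aboveI[where M = C]\<close>)
  show "infsum f A \<le> C"
    by (rule infsum_le_finite_sums[OF *]) (use assms in auto)
qed

lemma bessel_summable:
  assumes "orthonormal_on I e"
  shows "(\<lambda>k. (f \<bullet> e k)\<^sup>2) summable_on I"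
  by (rule summable_on_real_bounded(1)[where C = "(norm f)\<^sup>2"]) (auto intro: bessel[OF assms])

text \<open>By Pythagoras the squared distance of two nested partial sums is the difference of the
  corresponding sums of \<open>(c k)\<^sup>2\<close>. So the net of partial sums is Cauchy, and
  completeness applies.\<close>

lemma summable_on_orthonormal:
  fixes e :: "'i \<Rightarrow> 'a::{real_inner,banach}"
  assumes on: "orthonormal_on I e" and c: "(\<lambda>k. (c k)\<^sup>2) summable_on I"
  shows "(\<lambda>k. c k *\<^sub>R e k) summable_on I"
proof -
  let ?f = "\<lambda>k. c k *\<^sub>R e k" and ?q = "\<lambda>k. (c k)\<^sup>2"
  obtain L where lim: "(sum ?q \<longlongrightarrow> L) (finite_subsets_at_top I)"
    using c unfolding has_sum_def summable_on_def by blast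
  have "\<exists>P. eventually P (finite_subsets_at_top I) \<and>
          (\<forall>F F'. P F \<and> P F' \<longrightarrow> dist (sum ?f F) (sum ?f F') < e)" if "e > 0" for e
  proof -
    \<comment> \<open>Two numbers within \<open>d\<close> of \<open>L\<close> differ by less than
      \<open>(e / 2)\<^sup>2\<close>; arbitrary partial sums are then compared through
      \<open>F0\<close>, each at distance below \<open>e / 2\<close>.\<close>
    define d where "d = (e / 2)\<^sup>2 / 2"
    define Q where "Q F \<longleftrightarrow> finite F \<and> F \<subseteq> I \<and> dist (sum ?q F) L < d" for F
    have d: "d > 0" using that by (simp add: d_def)
    have "eventually Q (finite_subsets_at_top I)"
      using lim d by (auto simp: Q_def[abs_def] eventually_conj_iff
          eventually_finite_subsets_at_top_weakI tendsto_iff)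
    then obtain F0 where F0: "finite F0" "F0 \<subseteq> I" "\<And>F. finite F \<and> F0 \<subseteq> F \<and> F \<subseteq> I \<Longrightarrow> Q F"
      by atomize_elim (simp add: eventually_finite_subsets_at_top)
    have near: "dist (sum ?f F) (sum ?f F0) < e / 2" if "finite F" "F0 \<subseteq> F" "F \<subseteq> I" for F
    proof -
      have "(dist (sum ?f F) (sum ?f F0))\<^sup>2 = (norm (sum ?f (F - F0)))\<^sup>2"
        unfolding dist_norm using that by (subst sum_diff) (auto intro: finite_subset)
      also have "\<dots> = sum ?q (F - F0)"
        by (rule norm_sum_orthonormal[OF on]) (use that in auto)
      also have "\<dots> = sum ?q F - sum ?q F0"
        using that by (subst sum_diff) (auto intro: finite_subset)
      also have "\<dots> < (e / 2)\<^sup>2"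
      proof -
        have "Q F" "Q F0" using F0(1,2) that by (auto intro!: F0(3))
        then have "\<bar>sum ?q F - L\<bar> < (e / 2)\<^sup>2 / 2" "\<bar>sum ?q F0 - L\<bar> < (e / 2)\<^sup>2 / 2"
          by (simp_all only: Q_def dist_real_def d_def)
        then show ?thesis by linarith
      qed
      finally show ?thesis
        by (rule power2_less_imp_less) (use \<open>e > 0\<close> in auto)
    qed
    define R where "R F \<longleftrightarrow> finite F \<and> F0 \<subseteq> F \<and> F \<subseteq> I" for F
    have "eventually R (finite_subsets_at_top I)"
      unfolding R_def[abs_def] eventually_finite_subsets_at_top using F0 by blast
    moreover have "dist (sum ?f F) (sum ?f F') < e" if "R F" "R F'" for F F'
      using near[of F] near[of F'] that dist_triangle_half_r[of "sum ?f F0"]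
      unfolding R_def by (smt (verit) dist_commute dist_triangle)
    ultimately show ?thesis by blast
  qed
  then have "cauchy_filter (filtermap (sum ?f) (finite_subsets_at_top I))"
    by (simp add: cauchy_filter_metric_filtermap)
  moreover have "complete (UNIV::'a set)"
    by (meson Cauchy_convergent UNIV_I complete_def convergent_def)
  ultimately obtain L' where "(sum ?f \<longlongrightarrow> L') (finite_subsets_at_top I)"
    using complete_uniform[where S=UNIV] by (force simp add: filterlim_def)
  then show ?thesis using summable_on_def has_sum_def by blast
qed

lemma has_sum_in_closed_subspace:
  fixes H :: "'a::real_normed_vector set"
  assumes "(f has_sum s) I" "\<And>k. k \<in> I \<Longrightarrow> f k \<in> H" "subspace H" "closed H"
  shows "s \<in> H"
proof (rule Lim_in_closed_set[OF assms(4)])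
  show "(sum f \<longlongrightarrow> s) (finite_subsets_at_top I)"
    using assms(1) by (simp add: has_sum_def)
  show "\<forall>\<^sub>F F in finite_subsets_at_top I. sum f F \<in> H"
    by (rule eventually_finite_subsets_at_top_weakI) (use assms in \<open>auto intro!: subspace_sum\<close>)
qed simp

lemma inner_has_sum_orthonormal:
  assumes on: "orthonormal_on I e" and s: "((\<lambda>k. c k *\<^sub>R e k) has_sum s) I" and j: "j \<in> I"
  shows "s \<bullet> e j = c j"
proof -
  have "((\<lambda>k. (c k *\<^sub>R e k) \<bullet> e j) has_sum s \<bullet> e j) I"
    by (rule has_sum_bounded_linear[OF bounded_linear_inner_left s])
  moreover have "((\<lambda>k. (c k *\<^sub>R e k) \<bullet> e j) has_sum c j) I"
  proof (rule has_sum_finite_neutralI[of "{j}"])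
    show "\<And>x. x \<in> I - {j} \<Longrightarrow> (c x *\<^sub>R e x) \<bullet> e j = 0"
      using on j by (auto simp: orthonormal_on_def)
  qed (use on j in \<open>auto simp: orthonormal_on_def\<close>)
  ultimately show ?thesis by (rule has_sum_unique)
qed

lemma norm_has_sum_orthonormal:
  assumes on: "orthonormal_on I e" and s: "((\<lambda>k. c k *\<^sub>R e k) has_sum s) I"
  shows "((\<lambda>k. (c k)\<^sup>2) has_sum (norm s)\<^sup>2) I"
proof -
  have "((\<lambda>k. s \<bullet> (c k *\<^sub>R e k)) has_sum s \<bullet> s) I"
    by (rule has_sum_bounded_linear[OF bounded_linear_inner_right s])
  moreover have "((\<lambda>k. s \<bullet> (c k *\<^sub>R e k)) has_sum s \<bullet> s) I \<longleftrightarrow> ((\<lambda>k. (c k)\<^sup>2) has_sum s \<bullet> s) I"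
    by (rule has_sum_cong) (simp add: inner_has_sum_orthonormal[OF on s] power2_eq_square)
  ultimately show ?thesis by (simp add: power2_norm_eq_inner)
qed

section \<open>Orthonormal expansions in closed subspaces\<close>

locale hilbert_subspace =
  fixes H :: "'a::{real_inner,banach} set"
  assumes subspace_H: "subspace H" and closed_H: "closed H"
begin

lemma onb_expansion:
  assumes "onb H I e" "f \<in> H"
  shows "((\<lambda>k. (f \<bullet> e k) *\<^sub>R e k) has_sum f) I"
proof -
  have on: "orthonormal_on I e" and eH: "\<And>k. k \<in> I \<Longrightarrow> e k \<in> H" using assms by (auto simp: onb_def)
  obtain s where s: "((\<lambda>k. (f \<bullet> e k) *\<^sub>R e k) has_sum s) I"
    using summable_on_orthonormal[OF on bessel_summable[OF on, of f]] by (auto simp: summable_on_def)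
  have "s \<in> H"
    by (rule has_sum_in_closed_subspace[OF s _ subspace_H closed_H])
      (use subspace_H eH in \<open>auto intro: subspace_scale\<close>)
  then have "f - s \<in> H" using assms subspace_H by (auto intro: subspace_diff)
  moreover have "(f - s) \<bullet> e k = 0" if "k \<in> I" for k
    using inner_has_sum_orthonormal[OF on s that] by (simp add: inner_diff_left)
  ultimately have "f - s = 0" using assms by (auto simp: onb_def)
  with s show ?thesis by simp
qed

lemma parseval_inner:
  assumes "onb H I e" "f \<in> H"
  shows "((\<lambda>k. (f \<bullet> e k) * (e k \<bullet> g)) has_sum f \<bullet> g) I"
  using has_sum_bounded_linear[OF bounded_linear_inner_left onb_expansion[OF assms], of g] by simp

lemma parseval:
  assumes "onb H I e" "f \<in> H"
  shows "((\<lambda>k. (f \<bullet> e k)\<^sup>2) has_sum (norm f)\<^sup>2) I"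
  using parseval_inner[OF assms, of f] unfolding power2_norm_eq_inner by (simp add: power2_eq_square inner_commute)

lemma onb_operator_expansion:
  assumes "onb H I e" "f \<in> H" "bounded_linear A"
  shows "((\<lambda>k. (f \<bullet> e k) *\<^sub>R A (e k)) has_sum A f) I"
  using has_sum_bounded_linear[OF assms(3) onb_expansion[OF assms(1,2)]]
  by (simp add: linear_scale bounded_linear.linear[OF assms(3)])

end

section \<open>Compact operators relative to a subspace\<close>

definition compact_on :: "'a::real_normed_vector set \<Rightarrow> ('a \<Rightarrow> 'a) \<Rightarrow> bool" where
  "compact_on H A \<longleftrightarrow> (\<forall>f :: nat \<Rightarrow> 'a. (\<forall>n. f n \<in> H \<and> norm (f n) \<le> 1) \<longrightarrow>
     (\<exists>g\<in>H. \<exists>s. strict_mono s \<and> (\<lambda>n. A (f (s n))) \<longlonglongrightarrow> g))"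

lemma compact_on_bounded:
  assumes c: "compact_on H A" and A: "bounded_linear A" and H: "subspace H"
    and f: "\<And>n. f n \<in> H" "\<And>n. norm (f n) \<le> C"
  obtains g and s :: "nat \<Rightarrow> nat" where "g \<in> H" "strict_mono s" "(\<lambda>n. A (f (s n))) \<longlonglongrightarrow> g"
proof -
  define D where "D = \<bar>C\<bar> + 1"
  have D: "D > 0" by (simp add: D_def)
  have "\<forall>n. (1 / D) *\<^sub>R f n \<in> H \<and> norm ((1 / D) *\<^sub>R f n) \<le> 1"
  proof (intro allI conjI)
    fix n
    show "(1 / D) *\<^sub>R f n \<in> H" using f H by (simp add: subspace_scale)
    have "norm (f n) \<le> D" using f(2)[of n] by (simp add: D_def)
    then show "norm ((1 / D) *\<^sub>R f n) \<le> 1" using D by simp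
  qed
  from c[unfolded compact_on_def, THEN spec[of _ "\<lambda>n. (1 / D) *\<^sub>R f n"], THEN mp, OF this]
  obtain g s where g: "g \<in> H" "strict_mono s" "(\<lambda>n. A ((1 / D) *\<^sub>R f (s n))) \<longlonglongrightarrow> g"
    by blast
  have "(\<lambda>n. D *\<^sub>R A ((1 / D) *\<^sub>R f (s n))) \<longlonglongrightarrow> D *\<^sub>R g"
    by (intro tendsto_intros g)
  then have "(\<lambda>n. A (f (s n))) \<longlonglongrightarrow> D *\<^sub>R g"
    using D by (simp add: linear_scale bounded_linear.linear[OF A])
  with g that H show ?thesis by (meson subspace_scale)
qed

lemma compact_on_compose:
  assumes c: "compact_on H A" and A: "bounded_linear A" and H: "subspace H"
    and B: "bounded_linear B" "\<And>f. f \<in> H \<Longrightarrow> B f \<in> H" and C: "bounded_linear C" "\<And>f. f \<in> H \<Longrightarrow> C f \<in> H"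
    and eq: "\<And>f. f \<in> H \<Longrightarrow> A' f = B (A (C f))"
  shows "compact_on H A'"
  unfolding compact_on_def
proof (intro allI impI)
  fix f :: "nat \<Rightarrow> 'a" assume f: "\<forall>n. f n \<in> H \<and> norm (f n) \<le> 1"
  obtain K where K: "\<And>x. norm (C x) \<le> norm x * K" and "K > 0" using bounded_linear.pos_bounded[OF C(1)] by blast
  have "norm (C (f n)) \<le> K" for n
    using order_trans[OF K[of "f n"] mult_right_mono[of "norm (f n)" 1 K]] f \<open>K > 0\<close> by simp
  then obtain g s where "g \<in> H" "strict_mono s" "(\<lambda>n. A (C (f (s n)))) \<longlonglongrightarrow> g"
    using compact_on_bounded[OF c A H, of "\<lambda>n. C (f n)" K] f C(2) by blast
  then show "\<exists>g\<in>H. \<exists>s. strict_mono s \<and> (\<lambda>n. A' (f (s n))) \<longlonglongrightarrow> g"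
    using f B eq bounded_linear.tendsto[OF B(1)] by (intro bexI[of _ "B g"] exI[of _ s]) auto
qed

subsection \<open>The spectral theorem for compact self-adjoint operators\<close>

text \<open>The norm \<open>norm (A f)\<close> is maximised, not the quadratic form, so the two need
  not be compared. Along a maximising sequence \<open>A (A f) - m\<^sup>2 f\<close> tends to 0,
  compactness gives a limit \<open>h\<close> with \<open>A (A h) = m\<^sup>2 h\<close>, and the
  factorisation \<open>(A + m) (A - m) h = 0\<close> leaves an eigenvector for \<open>m\<close> or
  for \<open>- m\<close>.\<close>

lemma compact_self_adjoint_eigenvector:
  fixes A :: "'a::{real_inner,banach} \<Rightarrow> 'a"
  assumes A: "bounded_linear A" and H: "subspace H" "closed H" and AH: "\<And>f. f \<in> H \<Longrightarrow> A f \<in> H"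
    and sa: "\<And>f g. f \<in> H \<Longrightarrow> g \<in> H \<Longrightarrow> A f \<bullet> g = f \<bullet> A g"
    and c: "compact_on H A" and ne: "\<exists>f\<in>H. f \<noteq> 0"
  obtains f t where "f \<in> H" "norm f = 1" "A f = t *\<^sub>R f"
proof -
  note lin = bounded_linear.linear[OF A]
  have unit: "\<exists>u\<in>H. norm u = 1 \<and> A u = t *\<^sub>R u" if "f \<in> H" "f \<noteq> 0" "A f = t *\<^sub>R f" for f t
    using that H by (intro bexI[of _ "(1 / norm f) *\<^sub>R f"])
      (auto simp: linear_scale[OF lin] subspace_scale)
  define U where "U = {f \<in> H. norm f = 1}"
  define m where "m = (SUP f\<in>U. norm (A f))"
  obtain K where K: "\<And>x. norm (A x) \<le> norm x * K" using bounded_linear.bounded[OF A] by blast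
  have bdd: "bdd_above ((\<lambda>f. norm (A f)) ` U)"
  proof (rule bdd_aboveI2[of _ _ K])
    show "norm (A f) \<le> K" if "f \<in> U" for f using K[of f] that by (simp add: U_def)
  qed
  obtain f0 where f0: "f0 \<in> H" "f0 \<noteq> 0" using ne by blast
  then have U: "(1 / norm f0) *\<^sub>R f0 \<in> U" using H by (auto simp: U_def subspace_scale)
  have le_m: "norm (A f) \<le> m" if "f \<in> U" for f
    unfolding m_def by (rule cSUP_upper[OF that bdd])
  have m0: "0 \<le> m" using le_m[OF U] norm_ge_zero order_trans by blast
  have le_m': "norm (A f) \<le> m * norm f" if "f \<in> H" for f
  proof (cases "f = 0")
    case False
    then have "(1 / norm f) *\<^sub>R f \<in> U" using that H by (auto simp: U_def subspace_scale)
    from le_m[OF this] False show ?thesis by (simp add: linear_scale[OF lin] field_simps)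
  qed (simp add: linear_0[OF lin])
  show thesis
  proof (cases "m = 0")
    case True
    then have "A f0 = 0 *\<^sub>R f0" using le_m'[OF f0(1)] by simp
    with unit[OF f0] that show ?thesis by blast
  next
    case False
    with m0 have m: "m > 0" by simp
    have "\<exists>f\<in>U. m - 1 / Suc n < norm (A f)" for n
      using less_cSUP_iff[OF _ bdd, of "m - 1 / Suc n"] U unfolding m_def[symmetric] by auto
    then obtain f where f: "\<And>n. f n \<in> U" "\<And>n. m - 1 / Suc n < norm (A (f n))" by metis
    have nf: "norm (f n) = 1" "f n \<in> H" for n using f by (auto simp: U_def)
    have lim_norm: "(\<lambda>n. norm (A (f n))) \<longlonglongrightarrow> m"
    proof (rule tendsto_sandwich[of "\<lambda>n. m - 1 / Suc n" _ _ "\<lambda>n. m"])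
      have "(\<lambda>n. m - 1 / Suc n) \<longlonglongrightarrow> m - 0"
        by (intro tendsto_intros LIMSEQ_Suc[OF lim_1_over_n])
      then show "(\<lambda>n. m - 1 / Suc n) \<longlonglongrightarrow> m" by simp
    qed (use f le_m in \<open>auto intro!: always_eventually intro: less_imp_le\<close>)
    have res: "(\<lambda>n. A (A (f n)) - m\<^sup>2 *\<^sub>R f n) \<longlonglongrightarrow> 0"
    proof -
      \<comment> \<open>The square is expanded by self-adjointness; its first term is at most
        \<open>m\<^sup>2 * (norm (A (f n)))\<^sup>2\<close> because \<open>A (f n)\<close> lies in
        \<open>H\<close> again.\<close>
      have bd: "(norm (A (A (f n)) - m\<^sup>2 *\<^sub>R f n))\<^sup>2 \<le> m^4 - m\<^sup>2 * (norm (A (f n)))\<^sup>2" for n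
      proof -
        have i: "A (A (f n)) \<bullet> f n = (norm (A (f n)))\<^sup>2"
          using sa[of "A (f n)" "f n"] nf AH by (simp add: power2_norm_eq_inner)
        have "(norm (A (A (f n)) - m\<^sup>2 *\<^sub>R f n))\<^sup>2
           = (norm (A (A (f n))))\<^sup>2 - 2 * m\<^sup>2 * (A (A (f n)) \<bullet> f n) + m^4 * (norm (f n))\<^sup>2"
          unfolding power2_norm_eq_inner
          by (simp add: inner_diff_left inner_diff_right inner_commute algebra_simps power4_eq_xxxx power2_eq_square)
        also have "(norm (A (A (f n))))\<^sup>2 \<le> (m * norm (A (f n)))\<^sup>2"
          by (rule power_mono[OF le_m']) (use nf AH in auto)
        finally show ?thesis unfolding i nf by (simp add: algebra_simps power_mult_distrib)
      qed
      have "(\<lambda>n. m^4 - m\<^sup>2 * (norm (A (f n)))\<^sup>2) \<longlonglongrightarrow> m^4 - m\<^sup>2 * m\<^sup>2"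
        by (intro tendsto_intros lim_norm)
      then have "(\<lambda>n. m^4 - m\<^sup>2 * (norm (A (f n)))\<^sup>2) \<longlonglongrightarrow> 0"
        by (simp add: power4_eq_xxxx power2_eq_square)
      then have "(\<lambda>n. (norm (A (A (f n)) - m\<^sup>2 *\<^sub>R f n))\<^sup>2) \<longlonglongrightarrow> 0"
        by (rule tendsto_sandwich[OF _ _ tendsto_const, rotated 2]) (use bd in auto)
      then have "(\<lambda>n. sqrt ((norm (A (A (f n)) - m\<^sup>2 *\<^sub>R f n))\<^sup>2)) \<longlonglongrightarrow> sqrt 0"
        by (rule tendsto_real_sqrt)
      then show ?thesis by (simp add: tendsto_norm_zero_iff)
    qed
    obtain g s where g: "g \<in> H" "strict_mono s" "(\<lambda>n. A (f (s n))) \<longlonglongrightarrow> g"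
      using compact_on_bounded[OF c A H(1), of f 1] nf by (metis order_refl)
    have "(\<lambda>n. A (A (f (s n)))) \<longlonglongrightarrow> A g"
      by (rule bounded_linear.tendsto[OF A g(3)])
    moreover have "(\<lambda>n. A (A (f (s n))) - m\<^sup>2 *\<^sub>R f (s n)) \<longlonglongrightarrow> 0"
      using LIMSEQ_subseq_LIMSEQ[OF res g(2)] by (simp add: o_def)
    ultimately have "(\<lambda>n. A (A (f (s n))) - (A (A (f (s n))) - m\<^sup>2 *\<^sub>R f (s n))) \<longlonglongrightarrow> A g - 0"
      by (rule tendsto_diff)
    \<comment> \<open>Convergence passes from the images to the vectors \<open>f (s n)\<close>
      themselves, since the residual vanishes and \<open>m > 0\<close>.\<close>
    then have "(\<lambda>n. (1 / m\<^sup>2) *\<^sub>R (m\<^sup>2 *\<^sub>R f (s n))) \<longlonglongrightarrow> (1 / m\<^sup>2) *\<^sub>R A g"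
      by (intro tendsto_intros) simp
    then have lim: "(\<lambda>n. f (s n)) \<longlonglongrightarrow> (1 / m\<^sup>2) *\<^sub>R A g" (is "_ \<longlonglongrightarrow> ?h") using m by simp
    have hH: "?h \<in> H" using AH g H by (auto intro: subspace_scale)
    have "norm ?h = 1"
      using tendsto_norm[OF lim] unfolding nf LIMSEQ_const_iff by (rule sym)
    then have h0: "?h \<noteq> 0" by (metis norm_zero zero_neq_one)
    have "g = A ?h"
      using LIMSEQ_unique[OF g(3) bounded_linear.tendsto[OF A lim]] .
    then have AAh: "A (A ?h) = m\<^sup>2 *\<^sub>R ?h" using m by simp
    show ?thesis
    proof (cases "A ?h = m *\<^sub>R ?h")
      case True
      with unit[OF hH h0] that show ?thesis by blast
    next
      case ne: False
      let ?k = "A ?h - m *\<^sub>R ?h"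
      have "A ?k = A (A ?h) - m *\<^sub>R A ?h" by (simp only: linear_diff[OF lin] linear_scale[OF lin])
      also have "\<dots> = (- m) *\<^sub>R ?k" unfolding AAh by (simp add: algebra_simps power2_eq_square)
      finally have "A ?k = (- m) *\<^sub>R ?k" .
      moreover have "?k \<in> H" by (rule subspace_diff[OF H(1) AH[OF hH] subspace_scale[OF H(1) hH]])
      moreover have "?k \<noteq> 0" using ne unfolding right_minus_eq .
      ultimately show ?thesis using unit[of ?k "- m"] that by blast
    qed
  qed
qed

text \<open>Zorn's lemma gives a maximal orthonormal set of eigenvectors. Its orthogonal complement
  \<open>H'\<close> is closed, it is invariant by self-adjointness, and it inherits compactness, so
  a nonzero \<open>H'\<close> would contain one more eigenvector. The basis is a set of vectors,
  because its size is not known at this point.\<close>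

theorem compact_self_adjoint_spectral:
  fixes A :: "'a::{real_inner,banach} \<Rightarrow> 'a"
  assumes A: "bounded_linear A" and H: "subspace H" "closed H" and AH: "\<And>f. f \<in> H \<Longrightarrow> A f \<in> H"
    and sa: "\<And>f g. f \<in> H \<Longrightarrow> g \<in> H \<Longrightarrow> A f \<bullet> g = f \<bullet> A g"
    and c: "compact_on H A"
  obtains S where "onb H S (\<lambda>x. x)" "\<And>x. x \<in> S \<Longrightarrow> \<exists>t. A x = t *\<^sub>R x"
proof -
  define \<A> where "\<A> = {S. S \<subseteq> H \<and> orthonormal_on S (\<lambda>x. x) \<and> (\<forall>x\<in>S. \<exists>t. A x = t *\<^sub>R x)}"
  have "\<exists>M\<in>\<A>. \<forall>X\<in>\<A>. M \<subseteq> X \<longrightarrow> X = M"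
  proof (rule subset_Zorn')
    fix C assume C: "subset.chain \<A> C"
    then have CA: "C \<subseteq> \<A>" by (simp add: subset.chain_def)
    have "orthonormal_on (\<Union>C) (\<lambda>x. x)"
      unfolding orthonormal_on_def
    proof (intro ballI)
      fix j k assume "j \<in> \<Union>C" "k \<in> \<Union>C"
      then obtain X Y where XY: "X \<in> C" "Y \<in> C" "j \<in> X" "k \<in> Y" by blast
      then have "X \<subseteq> Y \<or> Y \<subseteq> X" using C by (auto simp: subset.chain_def)
      then obtain Z where "Z \<in> C" "j \<in> Z" "k \<in> Z" using XY by blast
      then show "j \<bullet> k = (if j = k then 1 else 0)"
        using CA by (auto simp: \<A>_def orthonormal_on_def)
    qed
    then show "\<Union>C \<in> \<A>" using CA by (auto simp: \<A>_def)
  qed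
  then obtain M where M: "M \<in> \<A>" and max: "\<And>X. X \<in> \<A> \<Longrightarrow> M \<subseteq> X \<Longrightarrow> X = M" by blast
  have MH: "M \<subseteq> H" and on: "orthonormal_on M (\<lambda>x. x)" and eig: "\<And>x. x \<in> M \<Longrightarrow> \<exists>t. A x = t *\<^sub>R x"
    using M by (auto simp: \<A>_def)
  define H' where "H' = {f \<in> H. \<forall>x\<in>M. f \<bullet> x = 0}"
  have H': "H' = H \<inter> (\<Inter>x\<in>M. {f. f \<bullet> x = 0})" by (auto simp: H'_def)
  have sub': "subspace H'"
    using H(1) by (auto simp: H'_def subspace_def inner_add_left)
  have closed': "closed H'"
    unfolding H' by (intro closed_Int H closed_INT ballI closed_Collect_eq continuous_intros)
  have AH': "A f \<in> H'" if "f \<in> H'" for f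
    unfolding H'_def
  proof (intro CollectI conjI ballI)
    show "A f \<in> H" using that AH by (auto simp: H'_def)
    fix x assume x: "x \<in> M"
    then obtain t where "A x = t *\<^sub>R x" using eig by blast
    then show "A f \<bullet> x = 0" using sa[of f x] that x MH by (auto simp: H'_def)
  qed
  have c': "compact_on H' A"
    unfolding compact_on_def
  proof (intro allI impI)
    fix f :: "nat \<Rightarrow> 'a" assume f: "\<forall>n. f n \<in> H' \<and> norm (f n) \<le> 1"
    then have "\<forall>n. f n \<in> H \<and> norm (f n) \<le> 1" by (auto simp: H'_def)
    then obtain g s where g: "g \<in> H" "strict_mono s" "(\<lambda>n. A (f (s n))) \<longlonglongrightarrow> g"
      using c unfolding compact_on_def by meson
    have "g \<in> H'" by (rule closed_sequentially[OF closed' _ g(3)]) (use f AH' in auto)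
    with g show "\<exists>g\<in>H'. \<exists>s. strict_mono s \<and> (\<lambda>n. A (f (s n))) \<longlonglongrightarrow> g" by blast
  qed
  have "\<forall>f\<in>H'. f = 0"
  proof (rule ccontr)
    assume "\<not> ?thesis"
    then have ex: "\<exists>f\<in>H'. f \<noteq> 0" by blast
    have sa': "A f \<bullet> g = f \<bullet> A g" if "f \<in> H'" "g \<in> H'" for f g
      using that sa by (simp add: H'_def)
    obtain f t where f: "f \<in> H'" "norm f = 1" "A f = t *\<^sub>R f"
      using compact_self_adjoint_eigenvector[OF A sub' closed' AH' sa' c' ex] by blast
    have fx: "f \<bullet> x = 0" "x \<bullet> f = 0" if "x \<in> M" for x
      using f(1) that by (auto simp: H'_def inner_commute)
    have "f \<bullet> f = 1" using f(2) by (simp add: dot_square_norm)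
    moreover have "f \<notin> M" using fx[of f] \<open>f \<bullet> f = 1\<close> by auto
    ultimately have "orthonormal_on (insert f M) (\<lambda>x. x)"
      using fx orthonormal_onD[OF on] unfolding orthonormal_on_def by auto
    then have "insert f M \<in> \<A>"
      using f MH eig unfolding \<A>_def H'_def by blast
    then have "f \<in> M" using max by blast
    then have "f \<bullet> f = 0" using f by (auto simp: H'_def)
    with f show False by simp
  qed
  then have "onb H M (\<lambda>x. x)" using MH on by (auto simp: onb_def H'_def)
  with eig that show ?thesis by blast
qed

lemma has_sum_sum:
  fixes f :: "'j \<Rightarrow> 'i \<Rightarrow> 'a::topological_comm_monoid_add"
  assumes "finite F" "\<And>k. k \<in> F \<Longrightarrow> (f k has_sum s k) I"
  shows "((\<lambda>x. \<Sum>k\<in>F. f k x) has_sum (\<Sum>k\<in>F. s k)) I"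
  using assms by (induction F rule: finite_induct) (auto intro: has_sum_add)

text \<open>On the unit ball \<open>A\<close> is a uniform limit of its truncations to finitely many
  basis vectors: Cauchy-Schwarz and Bessel bound the error by the tail of the Hilbert-Schmidt sum. A
  truncation sees only finitely many coefficients, and these converge along a diagonal
  subsequence.\<close>

lemma (in hilbert_subspace) hilbert_schmidt_compact:
  assumes e: "onb H I e" and I: "countable I" and A: "bounded_linear A" and AH: "\<And>f. f \<in> H \<Longrightarrow> A f \<in> H"
    and hs: "(\<lambda>k. (norm (A (e k)))\<^sup>2) summable_on I"
  shows "compact_on H A"
  unfolding compact_on_def
proof (intro allI impI)
  fix f :: "nat \<Rightarrow> 'a" assume f: "\<forall>n. f n \<in> H \<and> norm (f n) \<le> 1"
  note lin = bounded_linear.linear[OF A]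
  have on: "orthonormal_on I e" using e by (simp add: onb_def)
  let ?a = "\<lambda>k. (norm (A (e k)))\<^sup>2"
  have ne: "norm (e k) = 1" if "k \<in> I" for k
    using orthonormal_onD[OF on that that] by (simp add: norm_eq_sqrt_inner)
  have "norm (f n \<bullet> e k) \<le> 1" if "k \<in> I" for n k
    using order_trans[OF Cauchy_Schwarz_ineq2[of "f n" "e k"]] f unfolding ne[OF that] real_norm_def by simp
  then obtain s where s: "strict_mono (s :: nat \<Rightarrow> nat)"
    and conv: "\<And>k. k \<in> I \<Longrightarrow> \<exists>l. (\<lambda>n. f (s n) \<bullet> e k) \<longlonglongrightarrow> l"
    using function_convergent_subsequence[OF I, of "\<lambda>n k. f n \<bullet> e k" 1] by blast
  have tail: "\<exists>F. finite F \<and> F \<subseteq> I \<and>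
      (\<forall>d\<in>H. norm (A d - (\<Sum>k\<in>F. (d \<bullet> e k) *\<^sub>R A (e k))) \<le> norm d * \<delta>)" if \<delta>: "\<delta> > 0" for \<delta> :: real
  proof -
    obtain F where F: "finite F" "F \<subseteq> I" "dist (sum ?a F) (infsum ?a I) \<le> \<delta>\<^sup>2"
      using infsum_finite_approximation[OF hs, of "\<delta>\<^sup>2"] \<delta> by auto
    have small: "sum ?a G \<le> \<delta>\<^sup>2" if "finite G" "G \<subseteq> I - F" for G
    proof -
      have "sum ?a G + sum ?a F = sum ?a (G \<union> F)"
        using that F by (subst sum.union_disjoint) auto
      also have "\<dots> \<le> infsum ?a I"
        by (rule finite_sum_le_infsum[OF hs]) (use that F in auto)
      finally show ?thesis using F(3) by (simp add: dist_real_def)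
    qed
    have "norm (A d - (\<Sum>k\<in>F. (d \<bullet> e k) *\<^sub>R A (e k))) \<le> norm d * \<delta>" if d: "d \<in> H" for d
    proof (rule tendsto_upperbound)
      let ?g = "\<lambda>k. (d \<bullet> e k) *\<^sub>R A (e k)"
      have "(sum ?g \<longlongrightarrow> A d) (finite_subsets_at_top I)"
        using onb_operator_expansion[OF e d A] by (simp add: has_sum_def)
      then show "((\<lambda>G. norm (sum ?g G - sum ?g F)) \<longlongrightarrow> norm (A d - sum ?g F)) (finite_subsets_at_top I)"
        by (intro tendsto_intros)
      show "\<forall>\<^sub>F G in finite_subsets_at_top I. norm (sum ?g G - sum ?g F) \<le> norm d * \<delta>"
        unfolding eventually_finite_subsets_at_top
      proof (intro exI[of _ F] conjI allI impI F)
        fix G assume G: "finite G \<and> F \<subseteq> G \<and> G \<subseteq> I"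
        have "norm (sum ?g G - sum ?g F) = norm (sum ?g (G - F))"
          using G F by (subst sum_diff) auto
        also have "\<dots> \<le> (\<Sum>k\<in>G - F. \<bar>d \<bullet> e k\<bar> * norm (A (e k)))"
          by (rule sum_norm_le) simp
        also have "\<dots> = (\<Sum>k\<in>G - F. \<bar>d \<bullet> e k\<bar> * \<bar>norm (A (e k))\<bar>)"
          by simp
        also have "\<dots> \<le> L2_set (\<lambda>k. d \<bullet> e k) (G - F) * L2_set (\<lambda>k. norm (A (e k))) (G - F)"
          by (rule L2_set_mult_ineq)
        also have "\<dots> \<le> norm d * \<delta>"
        proof (rule mult_mono)
          show "L2_set (\<lambda>k. d \<bullet> e k) (G - F) \<le> norm d"
            unfolding L2_set_def by (rule real_le_lsqrt) (use bessel[OF on, of "G - F" d] G in auto)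
          show "L2_set (\<lambda>k. norm (A (e k))) (G - F) \<le> \<delta>"
            unfolding L2_set_def by (rule real_le_lsqrt) (use small[of "G - F"] G \<delta> in auto)
        qed (auto simp: L2_set_nonneg)
        finally show "norm (sum ?g G - sum ?g F) \<le> norm d * \<delta>" .
      qed
    qed simp
    with F show ?thesis by blast
  qed
  have "Cauchy (\<lambda>n. A (f (s n)))"
  proof (rule metric_CauchyI)
    fix \<epsilon> :: real assume \<epsilon>: "\<epsilon> > 0"
    \<comment> \<open>A quarter of \<open>\<epsilon>\<close> suffices because differences of vectors
      in the unit ball have norm at most 2.\<close>
    obtain F where F: "finite F" "F \<subseteq> I"
      "\<And>d. d \<in> H \<Longrightarrow> norm (A d - (\<Sum>k\<in>F. (d \<bullet> e k) *\<^sub>R A (e k))) \<le> norm d * (\<epsilon> / 4)"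
      using tail[of "\<epsilon> / 4"] \<epsilon> by auto
    define y where "y n = (\<Sum>k\<in>F. (f (s n) \<bullet> e k) *\<^sub>R A (e k))" for n
    obtain l where l: "\<And>k. k \<in> I \<Longrightarrow> (\<lambda>n. f (s n) \<bullet> e k) \<longlonglongrightarrow> l k" using conv by metis
    have "y \<longlonglongrightarrow> (\<Sum>k\<in>F. l k *\<^sub>R A (e k))"
      unfolding y_def using F by (intro tendsto_intros l) auto
    then have "Cauchy y" by (rule LIMSEQ_imp_Cauchy)
    then obtain M where M: "\<And>m n. m \<ge> M \<Longrightarrow> n \<ge> M \<Longrightarrow> dist (y m) (y n) < \<epsilon> / 2"
      using \<epsilon> unfolding Cauchy_def by (meson half_gt_zero)
    have "dist (A (f (s m))) (A (f (s n))) < \<epsilon>" if "m \<ge> M" "n \<ge> M" for m n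
    proof -
      let ?d = "f (s m) - f (s n)"
      have d: "?d \<in> H" using f subspace_H by (auto intro: subspace_diff)
      have nd: "norm ?d \<le> 2"
        using norm_triangle_ineq4[of "f (s m)" "f (s n)"] f by (smt (verit))
      have y: "(\<Sum>k\<in>F. (?d \<bullet> e k) *\<^sub>R A (e k)) = y m - y n"
        by (simp add: y_def inner_diff_left scaleR_diff_left sum_subtractf)
      have "norm (A ?d) \<le> norm (A ?d - (y m - y n)) + norm (y m - y n)"
        using norm_triangle_sub[of "A ?d" "y m - y n"] by linarith
      also have "norm (A ?d - (y m - y n)) \<le> norm ?d * (\<epsilon> / 4)" using F(3)[OF d] unfolding y .
      also have "norm ?d * (\<epsilon> / 4) \<le> 2 * (\<epsilon> / 4)" using nd \<epsilon> by (intro mult_right_mono) auto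
      also have "norm (y m - y n) < \<epsilon> / 2" using M[OF that] by (simp add: dist_norm)
      finally show ?thesis by (simp add: dist_norm linear_diff[OF lin])
    qed
    then show "\<exists>M. \<forall>m\<ge>M. \<forall>n\<ge>M. dist (A (f (s m))) (A (f (s n))) < \<epsilon>" by blast
  qed
  then obtain g where g: "(\<lambda>n. A (f (s n))) \<longlonglongrightarrow> g"
    using Cauchy_convergent convergent_def by blast
  have "g \<in> H" by (rule closed_sequentially[OF closed_H _ g]) (use f AH in auto)
  with g s show "\<exists>g\<in>H. \<exists>s. strict_mono s \<and> (\<lambda>n. A (f (s n))) \<longlonglongrightarrow> g" by blast
qed

section \<open>Trace class operators\<close>

text \<open>The parameter \<open>A'\<close> takes the place of the adjoint, so that \<open>S\<close>
  is the absolute value of \<open>A\<close>.\<close>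

definition trace_class_on :: "'a::real_inner set \<Rightarrow> 'i set \<Rightarrow> ('a \<Rightarrow> 'a) \<Rightarrow> ('a \<Rightarrow> 'a) \<Rightarrow> bool" where
  "trace_class_on H I A A' \<longleftrightarrow> (\<exists>S. bounded_linear S \<and> (\<forall>f\<in>H. S f \<in> H) \<and>
     (\<forall>f\<in>H. \<forall>g\<in>H. S f \<bullet> g = f \<bullet> S g) \<and> (\<forall>f\<in>H. 0 \<le> S f \<bullet> f) \<and> (\<forall>f\<in>H. S (S f) = A' (A f)) \<and>
     (\<exists>e. onb H I e \<and> (\<lambda>k. S (e k) \<bullet> e k) summable_on I))"

text \<open>The weak form of writing \<open>A\<close> as the sum of the maps sending
  \<open>f\<close> to \<open>(f \<bullet> a k) *\<^sub>R b k\<close>. Composition on the left acts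
  on \<open>b\<close>, composition on the right acts on \<open>a\<close> by the adjoint. The
  absolute value of a product obeys no such rule, which is why similarity is treated through this
  notion.\<close>

definition nuclear_on :: "'a::real_inner set \<Rightarrow> 'i set \<Rightarrow> ('a \<Rightarrow> 'a) \<Rightarrow> bool" where
  "nuclear_on H I A \<longleftrightarrow> (\<exists>a b. (\<forall>k\<in>I. a k \<in> H \<and> b k \<in> H) \<and>
     (\<lambda>k. norm (a k) * norm (b k)) summable_on I \<and>
     (\<forall>f\<in>H. \<forall>g\<in>H. ((\<lambda>k. (f \<bullet> a k) * (b k \<bullet> g)) has_sum A f \<bullet> g) I))"

text \<open>\<open>ex_index\<close> turns the set of eigenvectors produced by the spectral theorem
  into a family over the prescribed index set.\<close>

locale indexed_hilbert_subspace = hilbert_subspace H for H :: "'a::{real_inner,banach} set" +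
  fixes I :: "'i set"
  assumes countable_I: "countable I"
    and ex_index: "\<And>S. onb H S (\<lambda>x. x) \<Longrightarrow> \<exists>b. bij_betw b I S"
begin

lemma spectral_onb:
  assumes A: "bounded_linear A" and AH: "\<And>f. f \<in> H \<Longrightarrow> A f \<in> H"
    and sa: "\<And>f g. f \<in> H \<Longrightarrow> g \<in> H \<Longrightarrow> A f \<bullet> g = f \<bullet> A g"
    and c: "compact_on H A"
  obtains e t where "onb H I e" "\<And>k. k \<in> I \<Longrightarrow> A (e k) = t k *\<^sub>R e k"
proof -
  obtain S where S: "onb H S (\<lambda>x. x)" "\<And>x. x \<in> S \<Longrightarrow> \<exists>t. A x = t *\<^sub>R x"
    using compact_self_adjoint_spectral[OF A subspace_H closed_H AH sa c] by blast
  obtain b where b: "bij_betw b I S" using ex_index[OF S(1)] by blast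
  have inj: "inj_on b I" and im: "b ` I = S" using b by (auto simp: bij_betw_def)
  have "onb H I b"
    using S(1) unfolding onb_def orthonormal_on_def im[symmetric] by (simp add: inj_on_eq_iff[OF inj])
  moreover have "\<exists>t. \<forall>k\<in>I. A (b k) = t k *\<^sub>R b k"
    using S(2) im by (intro bchoice) auto
  ultimately show ?thesis using that by blast
qed

text \<open>From \<open>norm (A f) = norm (S f)\<close> and
  \<open>(norm (S f))\<^sup>2 \<le> K * (S f \<bullet> f)\<close> both \<open>S\<close> and
  \<open>A\<close> are Hilbert-Schmidt, hence compact. In an eigenbasis \<open>g\<close> of
  \<open>S\<close> the expansion of \<open>A\<close> has the terms
  \<open>(f \<bullet> g k) *\<^sub>R A (g k)\<close>, whose norms \<open>norm (A (g k))\<close> are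
  the eigenvalues of \<open>S\<close>.\<close>

lemma trace_class_imp_nuclear_compact:
  assumes A: "bounded_linear A" and AH: "\<And>f. f \<in> H \<Longrightarrow> A f \<in> H"
    and adj: "\<And>f g. f \<in> H \<Longrightarrow> g \<in> H \<Longrightarrow> A f \<bullet> g = f \<bullet> A' g"
    and tr: "trace_class_on H I A A'"
  shows "nuclear_on H I A" "compact_on H A"
proof -
  obtain S e where S: "bounded_linear S" and SH: "\<And>f. f \<in> H \<Longrightarrow> S f \<in> H"
    and Ssa: "\<And>f g. f \<in> H \<Longrightarrow> g \<in> H \<Longrightarrow> S f \<bullet> g = f \<bullet> S g" and pos: "\<And>f. f \<in> H \<Longrightarrow> 0 \<le> S f \<bullet> f"
    and SS: "\<And>f. f \<in> H \<Longrightarrow> S (S f) = A' (A f)"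
    and e: "onb H I e" and sum: "(\<lambda>k. S (e k) \<bullet> e k) summable_on I"
    using tr unfolding trace_class_on_def by blast
  note lin = bounded_linear.linear[OF S]
  have norm_eq: "norm (A f) = norm (S f)" if "f \<in> H" for f
  proof -
    have "A f \<bullet> A f = f \<bullet> A' (A f)" using that AH adj by blast
    also have "\<dots> = S f \<bullet> S f" using that SH SS[OF that] Ssa[of f "S f"] by simp
    finally show ?thesis by (simp add: norm_eq_sqrt_inner)
  qed
  have eH: "e k \<in> H" if "k \<in> I" for k using e that by (simp add: onb_def)
  \<comment> \<open>Cauchy-Schwarz for the form \<open>S f \<bullet> g\<close>, which may be
    degenerate. If \<open>S g \<bullet> g = 0\<close>, the expression \<open>quad\<close> is affine
    in \<open>x\<close>, and a nonzero slope would let it reach -1.\<close>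
  have cs: "(S f \<bullet> g)\<^sup>2 \<le> (S f \<bullet> f) * (S g \<bullet> g)" if f: "f \<in> H" and g: "g \<in> H" for f g
  proof -
    have quad: "0 \<le> S f \<bullet> f + 2 * x * (S f \<bullet> g) + x\<^sup>2 * (S g \<bullet> g)" for x
    proof -
      have "f + x *\<^sub>R g \<in> H" using f g subspace_H by (auto intro: subspace_add subspace_scale)
      from pos[OF this] have "0 \<le> (S f + x *\<^sub>R S g) \<bullet> (f + x *\<^sub>R g)"
        by (simp add: linear_add[OF lin] linear_scale[OF lin])
      also have "\<dots> = S f \<bullet> f + 2 * x * (S f \<bullet> g) + x\<^sup>2 * (S g \<bullet> g)"
        using Ssa[OF g f] by (simp add: inner_add_left inner_add_right inner_commute power2_eq_square algebra_simps)
      finally show ?thesis .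
    qed
    show ?thesis
    proof (cases "S g \<bullet> g = 0")
      case True
      show ?thesis
      proof (cases "S f \<bullet> g = 0")
        case False
        then have "2 * (- (S f \<bullet> f + 1) / (2 * (S f \<bullet> g))) * (S f \<bullet> g) = - (S f \<bullet> f + 1)" by simp
        from quad[of "- (S f \<bullet> f + 1) / (2 * (S f \<bullet> g))", unfolded this True] have False by simp
        then show ?thesis ..
      qed (use True in simp)
    next
      case False
      with pos[OF g] have p: "S g \<bullet> g > 0" by simp
      have "0 \<le> S f \<bullet> f - (S f \<bullet> g)\<^sup>2 / (S g \<bullet> g)"
        using quad[of "- (S f \<bullet> g) / (S g \<bullet> g)"] p by (simp add: power2_eq_square field_simps)
      then show ?thesis using p by (simp add: field_simps)
    qed
  qed
  obtain K where K: "\<And>x. norm (S x) \<le> norm x * K" and "K > 0"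
    using bounded_linear.pos_bounded[OF S] by blast
  have bound: "(norm (S f))\<^sup>2 \<le> K * (S f \<bullet> f)" if f: "f \<in> H" for f
  proof (cases "S f = 0")
    case False
    have "(norm (S f))\<^sup>2 * (norm (S f))\<^sup>2 = (S f \<bullet> S f)\<^sup>2" unfolding power2_norm_eq_inner by (simp add: power2_eq_square)
    also have "\<dots> \<le> (S f \<bullet> f) * (S (S f) \<bullet> S f)" by (rule cs[OF f SH[OF f]])
    also have "\<dots> \<le> (S f \<bullet> f) * (norm (S f) * K * norm (S f))"
      using K[of "S f"] norm_cauchy_schwarz[of "S (S f)" "S f"] pos[OF f]
      by (intro mult_left_mono) (meson mult_right_mono norm_ge_zero order_trans, simp)
    also have "\<dots> = (K * (S f \<bullet> f)) * (norm (S f))\<^sup>2" by (simp add: power2_eq_square)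
    finally show ?thesis by (rule mult_right_le_imp_le) (use False in simp)
  qed (use \<open>K > 0\<close> in simp)
  have "(\<lambda>k. K * (S (e k) \<bullet> e k)) summable_on I" using sum by (rule summable_on_cmult_right)
  then have hs: "(\<lambda>k. (norm (S (e k)))\<^sup>2) summable_on I"
    by (rule summable_on_comparison_test) (use bound eH in auto)
  then have "(\<lambda>k. (norm (A (e k)))\<^sup>2) summable_on I"
    by (rule summable_on_cong[THEN iffD1, rotated]) (simp add: norm_eq eH)
  then show "compact_on H A"
    by (rule hilbert_schmidt_compact[OF e countable_I A, rotated]) (rule AH)
  have "compact_on H S" by (rule hilbert_schmidt_compact[OF e countable_I S SH hs])
  then obtain g t where g: "onb H I g" and t: "\<And>k. k \<in> I \<Longrightarrow> S (g k) = t k *\<^sub>R g k"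
    using spectral_onb[OF S SH Ssa] by blast
  have gH: "g k \<in> H" "g k \<bullet> g k = 1" if "k \<in> I" for k
    using g that by (auto simp: onb_def orthonormal_on_def)
  have t0: "0 \<le> t k" if "k \<in> I" for k
    using pos[OF gH(1)[OF that]] t[OF that] gH(2)[OF that] by simp
  \<comment> \<open>Each diagonal entry of \<open>S\<close> in the basis \<open>e\<close> is the sum
    of \<open>t k * (g k \<bullet> e j)\<^sup>2\<close> over \<open>k\<close>, and summing over
    \<open>j\<close> first returns \<open>t k\<close>. By nonnegativity the trace in
    \<open>e\<close> bounds every finite sum of eigenvalues.\<close>
  have tsum: "t summable_on I"
  proof (rule summable_on_real_bounded(1)[OF t0])
    fix F assume F: "finite F" "F \<subseteq> I"
    have "((\<lambda>j. \<Sum>k\<in>F. t k * (g k \<bullet> e j)\<^sup>2) has_sum (\<Sum>k\<in>F. t k * (norm (g k))\<^sup>2)) I"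
      using F gH by (intro has_sum_sum has_sum_cmult_right parseval[OF e]) auto
    moreover have "(\<Sum>k\<in>F. t k * (norm (g k))\<^sup>2) = sum t F"
      using F gH by (intro sum.cong) (auto simp: power2_norm_eq_inner subset_iff)
    ultimately have 1: "((\<lambda>j. \<Sum>k\<in>F. t k * (g k \<bullet> e j)\<^sup>2) has_sum sum t F) I" by simp
    show "sum t F \<le> infsum (\<lambda>k. S (e k) \<bullet> e k) I"
    proof (rule has_sum_mono[OF 1 has_sum_infsum[OF sum]])
      fix j assume j: "j \<in> I"
      have "((\<lambda>k. (e j \<bullet> g k) * (g k \<bullet> S (e j))) has_sum e j \<bullet> S (e j)) I"
        by (rule parseval_inner[OF g eH[OF j]])
      moreover have "((\<lambda>k. (e j \<bullet> g k) * (g k \<bullet> S (e j))) has_sum e j \<bullet> S (e j)) I \<longleftrightarrow>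
          ((\<lambda>k. t k * (g k \<bullet> e j)\<^sup>2) has_sum e j \<bullet> S (e j)) I"
        by (rule has_sum_cong)
          (simp add: Ssa[OF gH(1) eH[OF j], symmetric] t power2_eq_square inner_commute[of "e j"])
      ultimately have "((\<lambda>k. t k * (g k \<bullet> e j)\<^sup>2) has_sum S (e j) \<bullet> e j) I"
        by (simp add: inner_commute)
      then show "(\<Sum>k\<in>F. t k * (g k \<bullet> e j)\<^sup>2) \<le> S (e j) \<bullet> e j"
        by (rule finite_sum_le_has_sum) (use F t0 in auto)
    qed
  qed
  have nA: "norm (g k) * norm (A (g k)) = t k" if "k \<in> I" for k
    using norm_eq[OF gH(1)[OF that]] t[OF that] gH(2)[OF that] t0[OF that] by (simp add: norm_eq_sqrt_inner)
  have "(\<lambda>k. norm (g k) * norm (A (g k))) summable_on I"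
    using tsum by (rule summable_on_cong[THEN iffD1, rotated]) (simp add: nA)
  moreover have "((\<lambda>k. (f \<bullet> g k) * (A (g k) \<bullet> h)) has_sum A f \<bullet> h) I" if "f \<in> H" for f h
    using has_sum_bounded_linear[OF bounded_linear_inner_left onb_operator_expansion[OF g that A], of h] by simp
  ultimately show "nuclear_on H I A"
    unfolding nuclear_on_def
    by (intro exI[of _ g] exI[of _ "\<lambda>k. A (g k)"]) (auto simp: gH(1) AH)
qed

text \<open>This is the polar decomposition. An eigenbasis \<open>e\<close> of \<open>A' A\<close>
  carries the singular values \<open>s k = norm (A (e k))\<close>, and \<open>S\<close> is diagonal
  in it. The normalised images \<open>h k\<close> are orthonormal, so the trace, as the sum of
  \<open>A (e k) \<bullet> h k\<close>, is bounded term by term in the nuclear expansion by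
  Cauchy-Schwarz and Bessel.\<close>

lemma nuclear_compact_imp_trace_class:
  assumes A: "bounded_linear A" and AH: "\<And>f. f \<in> H \<Longrightarrow> A f \<in> H"
    and A': "bounded_linear A'" and A'H: "\<And>f. f \<in> H \<Longrightarrow> A' f \<in> H"
    and adj: "\<And>f g. f \<in> H \<Longrightarrow> g \<in> H \<Longrightarrow> A f \<bullet> g = f \<bullet> A' g"
    and nuc: "nuclear_on H I A" and c: "compact_on H A"
  shows "trace_class_on H I A A'"
proof -
  have 1: "bounded_linear (\<lambda>f. A' (A f))" using bounded_linear_compose[OF A' A] .
  have 2: "compact_on H (\<lambda>f. A' (A f))"
    by (rule compact_on_compose[OF c A subspace_H A' A'H bounded_linear_ident]) auto
  have adj2: "A' f \<bullet> g = f \<bullet> A g" if "f \<in> H" "g \<in> H" for f g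
    using adj[OF that(2,1)] by (simp add: inner_commute)
  obtain e t where e: "onb H I e" and t: "\<And>k. k \<in> I \<Longrightarrow> A' (A (e k)) = t k *\<^sub>R e k"
    using spectral_onb[OF 1 _ _ 2] AH A'H adj adj2 by metis
  have on: "orthonormal_on I e" and eH: "\<And>k. k \<in> I \<Longrightarrow> e k \<in> H" using e by (auto simp: onb_def)
  define s where "s k = norm (A (e k))" for k
  have AA: "A (e j) \<bullet> A (e k) = (if j = k then t k else 0)" if "j \<in> I" "k \<in> I" for j k
    using adj2[of "A (e k)" "e j"] that eH AH t[OF that(2)] orthonormal_onD[OF on that(2,1)]
    by (auto simp: inner_commute)
  have st: "s k * s k = t k" if "k \<in> I" for k
    using AA[OF that that] by (simp add: s_def power2_norm_eq_inner flip: power2_eq_square)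
  have s0: "0 \<le> s k" for k by (simp add: s_def)
  obtain K where K: "\<And>x. norm (A x) \<le> norm x * K" and K0: "K > 0"
    using bounded_linear.pos_bounded[OF A] by blast
  have sK: "s k \<le> K" if "k \<in> I" for k
    using K[of "e k"] orthonormal_onD[OF on that that] by (simp add: s_def norm_eq_sqrt_inner)
  have sq: "(s k * (f \<bullet> e k))\<^sup>2 \<le> K\<^sup>2 * (f \<bullet> e k)\<^sup>2" if "k \<in> I" for f k
    using power_mono[OF sK[OF that] s0, of 2] by (simp add: power_mult_distrib mult_right_mono)
  have sums: "(\<lambda>k. (s k * (f \<bullet> e k))\<^sup>2) summable_on I" for f
    by (rule summable_on_comparison_test[OF summable_on_cmult_right[OF bessel_summable[OF on, of f], of "K\<^sup>2"]])
      (use sq in auto)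
  define S where "S f = (\<Sum>\<^sub>\<infinity>k\<in>I. (s k * (f \<bullet> e k)) *\<^sub>R e k)" for f
  have S: "((\<lambda>k. (s k * (f \<bullet> e k)) *\<^sub>R e k) has_sum S f) I" for f
    unfolding S_def by (rule has_sum_infsum[OF summable_on_orthonormal[OF on sums]])
  have SH: "S f \<in> H" for f
    by (rule has_sum_in_closed_subspace[OF S _ subspace_H closed_H])
      (use eH subspace_H in \<open>auto intro: subspace_scale\<close>)
  have Se: "S f \<bullet> e k = s k * (f \<bullet> e k)" if "k \<in> I" for f k
    by (rule inner_has_sum_orthonormal[OF on S that])
  have blS: "bounded_linear S"
  proof (rule bounded_linear_intro[where K = K])
    show "S (x + y) = S x + S y" for x y
      by (rule has_sum_unique[OF S])
        (use has_sum_add[OF S[of x] S[of y]] in \<open>simp add: inner_add_left distrib_left scaleR_add_left\<close>)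
    show "S (r *\<^sub>R x) = r *\<^sub>R S x" for r x
      by (rule has_sum_unique[OF S])
        (use has_sum_bounded_linear[OF bounded_linear_scaleR_right S[of x], of r] in \<open>simp add: ac_simps\<close>)
    show "norm (S x) \<le> norm x * K" for x
    proof (rule power2_le_imp_le)
      have "((\<lambda>k. (s k * (x \<bullet> e k))\<^sup>2) has_sum (norm (S x))\<^sup>2) I"
        by (rule norm_has_sum_orthonormal[OF on S])
      then have "(norm (S x))\<^sup>2 \<le> K\<^sup>2 * (norm x)\<^sup>2"
      proof (rule has_sum_le_finite_sums)
        fix F assume F: "finite F" "F \<subseteq> I"
        have "(\<Sum>k\<in>F. (s k * (x \<bullet> e k))\<^sup>2) \<le> K\<^sup>2 * (\<Sum>k\<in>F. (x \<bullet> e k)\<^sup>2)"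
          unfolding sum_distrib_left by (rule sum_mono) (use sq F in auto)
        also have "\<dots> \<le> K\<^sup>2 * (norm x)\<^sup>2"
          by (rule mult_left_mono[OF bessel[OF on F]]) simp
        finally show "(\<Sum>k\<in>F. (s k * (x \<bullet> e k))\<^sup>2) \<le> K\<^sup>2 * (norm x)\<^sup>2" .
      qed
      then show "(norm (S x))\<^sup>2 \<le> (norm x * K)\<^sup>2" by (simp add: power_mult_distrib mult.commute)
    qed (use K0 in simp)
  qed
  have ip: "((\<lambda>k. s k * (f \<bullet> e k) * (e k \<bullet> g)) has_sum S f \<bullet> g) I" for f g
    using has_sum_bounded_linear[OF bounded_linear_inner_left S[of f], of g] by simp
  have sym: "S f \<bullet> g = f \<bullet> S g" for f g
    using has_sum_unique[OF ip[of f g]] ip[of g f] by (simp add: inner_commute mult_ac)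
  have pos: "0 \<le> S f \<bullet> f" for f
    by (rule has_sum_nonneg[OF ip[of f f]]) (simp add: inner_commute[of _ f] s0 mult.assoc)
  have SS: "S (S f) = A' (A f)" if "f \<in> H" for f
  proof (rule has_sum_unique[OF S])
    have "((\<lambda>k. (f \<bullet> e k) *\<^sub>R A' (A (e k))) has_sum A' (A f)) I"
      by (rule onb_operator_expansion[OF e that 1])
    then show "((\<lambda>k. (s k * (S f \<bullet> e k)) *\<^sub>R e k) has_sum A' (A f)) I"
      by (rule has_sum_cong[THEN iffD1, rotated]) (simp add: Se t st[symmetric] mult_ac)
  qed
  obtain a b where "\<forall>k\<in>I. a k \<in> H \<and> b k \<in> H"
    and absum: "(\<lambda>k. norm (a k) * norm (b k)) summable_on I"
    and nuc0: "\<forall>f\<in>H. \<forall>g\<in>H. ((\<lambda>k. (f \<bullet> a k) * (b k \<bullet> g)) has_sum A f \<bullet> g) I"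
    using nuc unfolding nuclear_on_def by blast
  note nuc = nuc0[rule_format]
  have "s summable_on I"
  proof (rule summable_on_real_bounded(1)[OF s0])
    fix F assume F: "finite F" "F \<subseteq> I"
    \<comment> \<open>Vanishing singular values are dropped, since \<open>h k\<close> would be 0
      there and not a unit vector.\<close>
    define G where "G = {k\<in>F. s k \<noteq> 0}"
    have G: "finite G" "G \<subseteq> I" using F by (auto simp: G_def)
    define h where "h k = (1 / s k) *\<^sub>R A (e k)" for k
    have hon: "orthonormal_on G h"
      unfolding orthonormal_on_def
    proof (intro ballI)
      fix j k assume "j \<in> G" "k \<in> G"
      then have "j \<in> I" "k \<in> I" "s j \<noteq> 0" "s k \<noteq> 0" using G by (auto simp: G_def)
      then show "h j \<bullet> h k = (if j = k then 1 else 0)"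
        using AA[of j k] st[of k] by (auto simp: h_def)
    qed
    have hH: "h k \<in> H" if "k \<in> G" for k using that eH AH G subspace_H by (auto simp: h_def intro!: subspace_scale)
    have Ah: "A (e k) \<bullet> h k = s k" if "k \<in> G" for k
      using that by (simp add: h_def s_def G_def dot_square_norm power2_eq_square)
    have "((\<lambda>j. \<Sum>k\<in>G. (e k \<bullet> a j) * (b j \<bullet> h k)) has_sum (\<Sum>k\<in>G. A (e k) \<bullet> h k)) I"
      using G eH hH by (intro has_sum_sum nuc) auto
    then have 1: "((\<lambda>j. \<Sum>k\<in>G. (e k \<bullet> a j) * (b j \<bullet> h k)) has_sum sum s G) I"
      using Ah by (simp cong: sum.cong)
    have "sum s G \<le> infsum (\<lambda>k. norm (a k) * norm (b k)) I"
    proof (rule has_sum_mono[OF 1 has_sum_infsum[OF absum]])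
      fix j
      have "(\<Sum>k\<in>G. (e k \<bullet> a j) * (b j \<bullet> h k)) \<le> (\<Sum>k\<in>G. \<bar>a j \<bullet> e k\<bar> * \<bar>b j \<bullet> h k\<bar>)"
        by (rule sum_mono) (simp add: inner_commute abs_mult[symmetric])
      also have "\<dots> \<le> L2_set (\<lambda>k. a j \<bullet> e k) G * L2_set (\<lambda>k. b j \<bullet> h k) G"
        by (rule L2_set_mult_ineq)
      also have "\<dots> \<le> norm (a j) * norm (b j)"
      proof (rule mult_mono)
        show "L2_set (\<lambda>k. a j \<bullet> e k) G \<le> norm (a j)"
          unfolding L2_set_def by (rule real_le_lsqrt) (use bessel[OF on G] in auto)
        show "L2_set (\<lambda>k. b j \<bullet> h k) G \<le> norm (b j)"
          unfolding L2_set_def by (rule real_le_lsqrt) (use bessel[OF hon G(1)] in auto)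
      qed (auto simp: L2_set_nonneg)
      finally show "(\<Sum>k\<in>G. (e k \<bullet> a j) * (b j \<bullet> h k)) \<le> norm (a j) * norm (b j)" .
    qed
    also have "sum s G = sum s F" unfolding G_def using F by (intro sum.mono_neutral_left) auto
    finally show "sum s F \<le> infsum (\<lambda>k. norm (a k) * norm (b k)) I" .
  qed
  then have "(\<lambda>k. S (e k) \<bullet> e k) summable_on I"
    by (rule summable_on_cong[THEN iffD1, rotated]) (simp add: Se orthonormal_onD[OF on])
  with e blS SH sym pos SS show ?thesis unfolding trace_class_on_def by blast
qed

lemma trace_class_on_compose:
  assumes A: "bounded_linear A" and AH: "\<And>f. f \<in> H \<Longrightarrow> A f \<in> H"
    and A': "\<And>f g. f \<in> H \<Longrightarrow> g \<in> H \<Longrightarrow> A f \<bullet> g = f \<bullet> A' g"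
    and B: "bounded_linear B" and BH: "\<And>f. f \<in> H \<Longrightarrow> B f \<in> H"
    and B'H: "\<And>f. f \<in> H \<Longrightarrow> B' f \<in> H" and B': "\<And>f g. f \<in> H \<Longrightarrow> g \<in> H \<Longrightarrow> B f \<bullet> g = f \<bullet> B' g"
    and C: "bounded_linear C" and CH: "\<And>f. f \<in> H \<Longrightarrow> C f \<in> H"
    and C'H: "\<And>f. f \<in> H \<Longrightarrow> C' f \<in> H" and C': "\<And>f g. f \<in> H \<Longrightarrow> g \<in> H \<Longrightarrow> C f \<bullet> g = f \<bullet> C' g"
    and C'b: "bounded_linear C'"
    and T: "bounded_linear T" and TH: "\<And>f. f \<in> H \<Longrightarrow> T f \<in> H"
    and Tb: "bounded_linear T'" and T'H: "\<And>f. f \<in> H \<Longrightarrow> T' f \<in> H"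
    and T': "\<And>f g. f \<in> H \<Longrightarrow> g \<in> H \<Longrightarrow> T f \<bullet> g = f \<bullet> T' g"
    and eq: "\<And>f. f \<in> H \<Longrightarrow> T f = B (A (C f))"
    and tr: "trace_class_on H I A A'"
  shows "trace_class_on H I T T'"
proof (rule nuclear_compact_imp_trace_class[OF T TH Tb T'H T'])
  have cA: "compact_on H A" and nA: "nuclear_on H I A"
    using trace_class_imp_nuclear_compact[OF A _ _ tr] AH A' by blast+
  show "compact_on H T"
    by (rule compact_on_compose[OF cA A subspace_H B BH C CH eq])
  obtain a b where ab0: "\<forall>k\<in>I. a k \<in> H \<and> b k \<in> H"
    and absum: "(\<lambda>k. norm (a k) * norm (b k)) summable_on I"
    and nuc0: "\<forall>f\<in>H. \<forall>g\<in>H. ((\<lambda>k. (f \<bullet> a k) * (b k \<bullet> g)) has_sum A f \<bullet> g) I"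
    using nA unfolding nuclear_on_def by blast
  have ab: "a k \<in> H" "b k \<in> H" if "k \<in> I" for k using ab0 that by auto
  note nuc = nuc0[rule_format]
  obtain K where K: "\<And>x. norm (C' x) \<le> norm x * K" "K > 0"
    using bounded_linear.pos_bounded[OF C'b] by blast
  obtain L where L: "\<And>x. norm (B x) \<le> norm x * L" "L > 0"
    using bounded_linear.pos_bounded[OF B] by blast
  have "(\<lambda>k. (K * L) * (norm (a k) * norm (b k))) summable_on I"
    using absum by (rule summable_on_cmult_right)
  then have "(\<lambda>k. norm (C' (a k)) * norm (B (b k))) summable_on I"
  proof (rule summable_on_comparison_test)
    fix k
    have "norm (C' (a k)) * norm (B (b k)) \<le> (norm (a k) * K) * (norm (b k) * L)"
      using K L by (intro mult_mono) auto
    then show "norm (C' (a k)) * norm (B (b k)) \<le> (K * L) * (norm (a k) * norm (b k))" by (simp add: ac_simps)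
  qed simp
  moreover have "((\<lambda>k. (f \<bullet> C' (a k)) * (B (b k) \<bullet> g)) has_sum T f \<bullet> g) I" if f: "f \<in> H" and g: "g \<in> H" for f g
  proof -
    have "T f \<bullet> g = A (C f) \<bullet> B' g" using f g B' CH AH eq by simp
    moreover have "((\<lambda>k. (C f \<bullet> a k) * (b k \<bullet> B' g)) has_sum A (C f) \<bullet> B' g) I"
      by (rule nuc) (use f g CH B'H in auto)
    moreover have "((\<lambda>k. (C f \<bullet> a k) * (b k \<bullet> B' g)) has_sum A (C f) \<bullet> B' g) I \<longleftrightarrow>
        ((\<lambda>k. (f \<bullet> C' (a k)) * (B (b k) \<bullet> g)) has_sum A (C f) \<bullet> B' g) I"
      by (rule has_sum_cong) (use ab f g B' C' in auto)
    ultimately show ?thesis by simp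
  qed
  ultimately show "nuclear_on H I T"
    unfolding nuclear_on_def
    by (intro exI[of _ "\<lambda>k. C' (a k)"] exI[of _ "\<lambda>k. B (b k)"]) (auto simp: ab BH C'H)
qed

end

section \<open>Normal operators that are similar to self-adjoint ones\<close>

text \<open>The reason is that \<open>n \<mapsto> norm (M^n f)\<close> is log-convex for normal \<open>M\<close>.\<close>

lemma normal_norm_le_growth_rate:
  fixes M M' :: "'a::real_inner \<Rightarrow> 'a"
  assumes MH: "\<And>f. f \<in> H \<Longrightarrow> M f \<in> H" and M'H: "\<And>f. f \<in> H \<Longrightarrow> M' f \<in> H"
    and adj: "\<And>f g. f \<in> H \<Longrightarrow> g \<in> H \<Longrightarrow> M f \<bullet> g = f \<bullet> M' g"
    and comm: "\<And>f. f \<in> H \<Longrightarrow> M (M' f) = M' (M f)"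
    and f: "f \<in> H" and r: "r > 0" and growth: "\<And>n. norm ((M ^^ n) f) \<le> C * r ^ n"
  shows "norm (M f) \<le> r * norm f"
proof -
  \<comment> \<open>Normality gives \<open>norm (M' (M g)) = norm (M (M g))\<close>, so
    Cauchy-Schwarz for \<open>g \<bullet> M' (M g)\<close> is exactly the log-convexity.\<close>
  have step: "(norm (M g))\<^sup>2 \<le> norm (M (M g)) * norm g" if g: "g \<in> H" for g
  proof -
    have Mg: "M g \<in> H" "M (M g) \<in> H" "M' (M g) \<in> H" using g MH M'H by auto
    have "M' (M g) \<bullet> M' (M g) = M (M' (M g)) \<bullet> M g" using adj[of "M' (M g)" "M g"] Mg by simp
    also have "\<dots> = M g \<bullet> M' (M (M g))" using comm[OF Mg(1)] by (simp add: inner_commute)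
    also have "\<dots> = M (M g) \<bullet> M (M g)" using adj[of "M g" "M (M g)"] Mg by simp
    finally have n: "norm (M' (M g)) = norm (M (M g))" by (simp add: norm_eq_sqrt_inner)
    have "(norm (M g))\<^sup>2 = g \<bullet> M' (M g)" using adj[OF g Mg(1)] by (simp add: power2_norm_eq_inner)
    also have "\<dots> \<le> norm g * norm (M' (M g))" by (rule norm_cauchy_schwarz)
    finally show ?thesis unfolding n by (simp add: mult.commute)
  qed
  define a where "a n = norm ((M ^^ n) f)" for n
  have H: "(M ^^ n) f \<in> H" for n by (induction n) (use f MH in auto)
  have a: "(a (Suc n))\<^sup>2 \<le> a (Suc (Suc n)) * a n" for n
    using step[OF H[of n]] by (simp add: a_def)
  have a01: "a 0 = norm f" "a (Suc 0) = norm (M f)" by (simp_all add: a_def)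
  show ?thesis
  proof (rule ccontr)
    assume "\<not> ?thesis"
    then have gt: "a (Suc 0) > r * a 0" unfolding a01 by simp
    have "a 0 \<noteq> 0" using a[of 0] gt by (auto simp: a_def)
    then have a0: "a 0 > 0" by (simp add: a_def)
    \<comment> \<open>\<open>q\<close> is the first ratio of successive norms. Log-convexity keeps
      all later ratios at least \<open>q > r\<close>, so the norms outgrow every multiple of
      \<open>r ^ n\<close>.\<close>
    define q where "q = a (Suc 0) / a 0"
    have q: "q > r" using gt a0 by (simp add: q_def pos_less_divide_eq)
    have ind: "a n > 0 \<and> a (Suc n) \<ge> q * a n" for n
    proof (induction n)
      case 0 then show ?case using a0 by (simp add: q_def)
    next
      case (Suc n)
      have p: "a (Suc n) > 0" using Suc q r by (smt (verit) mult_pos_pos)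
      have "q * a n * a (Suc n) \<le> (a (Suc n))\<^sup>2"
        using Suc p by (simp add: power2_eq_square mult_right_mono)
      also have "\<dots> \<le> a (Suc (Suc n)) * a n" by (rule a)
      finally have "a n * (q * a (Suc n)) \<le> a n * a (Suc (Suc n))" by (simp add: ac_simps)
      with Suc p show ?case by simp
    qed
    have lower: "a 0 * q ^ n \<le> a n" for n
    proof (induction n)
      case (Suc n)
      have "a 0 * q ^ Suc n = q * (a 0 * q ^ n)" by simp
      also have "\<dots> \<le> q * a n" using Suc q r by (intro mult_left_mono) auto
      also have "\<dots> \<le> a (Suc n)" using ind by blast
      finally show ?case .
    qed simp
    have "(q / r) ^ n \<le> C / a 0" for n
    proof -
      have "a 0 * q ^ n \<le> C * r ^ n" using lower[of n] growth[of n] by (simp add: a_def)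
      then show ?thesis using a0 r by (simp add: power_divide field_simps)
    qed
    moreover have "q / r > 1" using q r by simp
    then obtain n where "(q / r) ^ n > C / a 0" using real_arch_pow by blast
    ultimately show False using not_le by blast
  qed
qed

text \<open>The complexification of the space is the product \<open>H \<times> H\<close>; there the operator \<open>N - i s\<close> is
  \<open>(u, v) \<mapsto> (N u + s v, N v - s u)\<close>. It is normal and similar to \<open>Q - i s\<close>, so its norm is at most
  \<open>sqrt (c\<^sup>2 + s\<^sup>2)\<close>. As this holds for every real \<open>s\<close>, the numerical range of \<open>N\<close> is real.\<close>

theorem normal_similar_self_adjoint:
  fixes N N' Q L B :: "'a::real_inner \<Rightarrow> 'a"
  assumes H: "subspace H"
    and N: "linear N" and NH: "\<And>f. f \<in> H \<Longrightarrow> N f \<in> H" and N': "linear N'" and N'H: "\<And>f. f \<in> H \<Longrightarrow> N' f \<in> H"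
    and adj: "\<And>f g. f \<in> H \<Longrightarrow> g \<in> H \<Longrightarrow> N f \<bullet> g = f \<bullet> N' g"
    and comm: "\<And>f. f \<in> H \<Longrightarrow> N (N' f) = N' (N f)"
    and Q: "bounded_linear Q" and QH: "\<And>f. f \<in> H \<Longrightarrow> Q f \<in> H"
    and sa: "\<And>f g. f \<in> H \<Longrightarrow> g \<in> H \<Longrightarrow> Q f \<bullet> g = f \<bullet> Q g"
    and L: "bounded_linear L" and BH: "\<And>f. f \<in> H \<Longrightarrow> B f \<in> H"
    and LB: "\<And>f. f \<in> H \<Longrightarrow> L (B f) = f" and inter: "\<And>f. f \<in> H \<Longrightarrow> N (L f) = L (Q f)"
    and u: "u \<in> H" and v: "v \<in> H"
  shows "N u \<bullet> v = u \<bullet> N v"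
proof -
  obtain c where c: "\<And>x. norm (Q x) \<le> norm x * c" "c > 0" using bounded_linear.pos_bounded[OF Q] by blast
  obtain l where l: "\<And>x. norm (L x) \<le> norm x * l" "l > 0" using bounded_linear.pos_bounded[OF L] by blast
  have bound: "(norm (N u + s *\<^sub>R v))\<^sup>2 + (norm (N v - s *\<^sub>R u))\<^sup>2 \<le> (c\<^sup>2 + s\<^sup>2) * ((norm u)\<^sup>2 + (norm v)\<^sup>2)" for s
  proof -
    define M where "M w = (N (fst w) + s *\<^sub>R snd w, N (snd w) - s *\<^sub>R fst w)" for w
    define M' where "M' w = (N' (fst w) - s *\<^sub>R snd w, N' (snd w) + s *\<^sub>R fst w)" for w
    define R where "R w = (Q (fst w) + s *\<^sub>R snd w, Q (snd w) - s *\<^sub>R fst w)" for w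
    define r where "r = sqrt (c\<^sup>2 + s\<^sup>2)"
    have r: "r > 0" "r\<^sup>2 = c\<^sup>2 + s\<^sup>2" using c by (auto simp: r_def add_pos_nonneg)
    have RH: "R w \<in> H \<times> H" if "w \<in> H \<times> H" for w
      using that by (simp add: R_def mem_Times_iff QH subspace_add[OF H] subspace_diff[OF H] subspace_scale[OF H])
    have Rn: "norm (R w) \<le> r * norm w" if "w \<in> H \<times> H" for w
    proof (rule power2_le_imp_le)
      obtain x y where w: "w = (x, y)" "x \<in> H" "y \<in> H" using \<open>w \<in> H \<times> H\<close> by auto
      \<comment> \<open>This symmetry cancels the terms linear in \<open>s\<close>, which is why
        \<open>R\<close> is bounded by \<open>sqrt (c\<^sup>2 + s\<^sup>2)\<close> and not merely by
        the sum of \<open>c\<close> and the absolute value of \<open>s\<close>.\<close>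
      have 1: "Q x \<bullet> y = Q y \<bullet> x" using sa[OF w(2,3)] by (simp add: inner_commute)
      have "(norm (R w))\<^sup>2 = (norm (Q x))\<^sup>2 + (norm (Q y))\<^sup>2 + s\<^sup>2 * ((norm x)\<^sup>2 + (norm y)\<^sup>2)"
        unfolding R_def w power2_norm_eq_inner using 1
        by (simp add: inner_add_left inner_add_right inner_diff_left inner_diff_right inner_commute power2_eq_square algebra_simps)
      also have "\<dots> \<le> (norm x * c)\<^sup>2 + (norm y * c)\<^sup>2 + s\<^sup>2 * ((norm x)\<^sup>2 + (norm y)\<^sup>2)"
        using c by (intro add_mono power_mono) auto
      also have "\<dots> = (r * norm w)\<^sup>2"
        by (simp add: w norm_Pair power_mult_distrib r(2) algebra_simps)
      finally show "(norm (R w))\<^sup>2 \<le> (r * norm w)\<^sup>2" .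
    qed (use r in simp)
    have RnH: "(R ^^ n) w \<in> H \<times> H" if "w \<in> H \<times> H" for n w by (induction n) (use that RH in auto)
    have Rpow: "norm ((R ^^ n) w) \<le> r ^ n * norm w" if "w \<in> H \<times> H" for n w
    proof (induction n)
      case (Suc n)
      have "norm ((R ^^ Suc n) w) \<le> r * norm ((R ^^ n) w)" using Rn[OF RnH[OF that]] by simp
      also have "\<dots> \<le> r * (r ^ n * norm w)" using Suc r by (intro mult_left_mono) auto
      finally show ?case by (simp add: ac_simps)
    qed simp
    define LL where "LL w = (L (fst w), L (snd w))" for w
    have LLn: "norm (LL w) \<le> l * norm w" for w
    proof (rule power2_le_imp_le)
      have "(norm (LL w))\<^sup>2 \<le> (norm (fst w) * l)\<^sup>2 + (norm (snd w) * l)\<^sup>2"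
        using power_mono[OF l(1), of "fst w" 2] power_mono[OF l(1), of "snd w" 2] by (simp add: LL_def norm_Pair)
      also have "\<dots> = (l * norm w)\<^sup>2"
        by (cases w) (simp add: norm_Pair power_mult_distrib algebra_simps)
      finally show "(norm (LL w))\<^sup>2 \<le> (l * norm w)\<^sup>2" .
    qed (use l in simp)
    note linL = bounded_linear.linear[OF L]
    have M_LL: "M (LL w) = LL (R w)" if "w \<in> H \<times> H" for w
      using that by (simp add: M_def LL_def R_def inter linear_add[OF linL] linear_diff[OF linL] linear_scale[OF linL] mem_Times_iff)
    have M_pow: "(M ^^ n) (LL w) = LL ((R ^^ n) w)" if "w \<in> H \<times> H" for n w
    proof (induction n)
      case (Suc n)
      then show ?case using M_LL[OF RnH[OF that, of n]] by simp
    qed simp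
    \<comment> \<open>The similarity contributes only the constant factor
      \<open>l * norm (B u, B v)\<close>, to which the growth criterion is insensitive.\<close>
    have "norm (M (u, v)) \<le> r * norm (u, v)"
    proof (rule normal_norm_le_growth_rate[where H = "H \<times> H" and M' = M'])
      show "M w \<in> H \<times> H" "M' w \<in> H \<times> H" if "w \<in> H \<times> H" for w
        using that by (simp_all add: M_def M'_def mem_Times_iff NH N'H subspace_add[OF H] subspace_diff[OF H] subspace_scale[OF H])
      show "M w \<bullet> z = w \<bullet> M' z" if "w \<in> H \<times> H" "z \<in> H \<times> H" for w z
        using that by (auto simp: M_def M'_def inner_add_left inner_add_right inner_diff_left inner_diff_right adj)
      show "M (M' w) = M' (M w)" if "w \<in> H \<times> H" for w
        using that by (auto simp: M_def M'_def comm linear_add[OF N] linear_diff[OF N] linear_scale[OF N]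
            linear_add[OF N'] linear_diff[OF N'] linear_scale[OF N'] algebra_simps)
      show "(u, v) \<in> H \<times> H" using u v by simp
      show "norm ((M ^^ n) (u, v)) \<le> (l * norm (B u, B v)) * r ^ n" for n
      proof -
        have "(M ^^ n) (u, v) = LL ((R ^^ n) (B u, B v))"
          using M_pow[of "(B u, B v)" n] u v BH LB by (simp add: LL_def)
        then have "norm ((M ^^ n) (u, v)) \<le> l * norm ((R ^^ n) (B u, B v))" using LLn by simp
        also have "\<dots> \<le> l * (r ^ n * norm (B u, B v))"
          using Rpow[of "(B u, B v)" n] u v BH l by (intro mult_left_mono) auto
        finally show ?thesis by (simp add: ac_simps)
      qed
    qed (use r in simp)
    then have "(norm (M (u, v)))\<^sup>2 \<le> (r * norm (u, v))\<^sup>2" by (rule power_mono) simp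
    then show ?thesis by (simp add: M_def norm_Pair power_mult_distrib r(2))
  qed
  \<comment> \<open>Up to sign, \<open>d\<close> is the imaginary part of the quadratic form of
    \<open>N\<close> at \<open>u + i v\<close>. The terms with \<open>s\<^sup>2\<close> on the two
    sides of \<open>bound\<close> agree; what remains is an affine function of \<open>s\<close> that
    is bounded above, so its slope vanishes.\<close>
  define d where "d = N u \<bullet> v - N v \<bullet> u"
  define k where "k = c\<^sup>2 * ((norm u)\<^sup>2 + (norm v)\<^sup>2)"
  have lin: "2 * s * d \<le> k" for s
  proof -
    have "(norm (N u + s *\<^sub>R v))\<^sup>2 + (norm (N v - s *\<^sub>R u))\<^sup>2
       = (norm (N u))\<^sup>2 + (norm (N v))\<^sup>2 + 2 * s * d + s\<^sup>2 * ((norm u)\<^sup>2 + (norm v)\<^sup>2)"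
      unfolding power2_norm_eq_inner d_def
      by (simp add: inner_add_left inner_add_right inner_diff_left inner_diff_right inner_commute power2_eq_square algebra_simps)
    with bound[of s] zero_le_power2[of "norm (N u)"] zero_le_power2[of "norm (N v)"]
    show ?thesis unfolding k_def distrib_right by linarith
  qed
  have "d = 0"
  proof (rule ccontr)
    assume "d \<noteq> 0"
    then show False using lin[of "(k + 1) / (2 * d)"] by simp
  qed
  then show ?thesis by (simp add: d_def inner_commute)
qed

section \<open>The space of square-summable families\<close>

definition square_summable :: "(int \<Rightarrow> real) \<Rightarrow> bool" where
  "square_summable f \<longleftrightarrow> (\<lambda>x. (f x)\<^sup>2) summable_on UNIV"

lemma square_summable_bounded:
  assumes "\<And>F. finite F \<Longrightarrow> (\<Sum>x\<in>F. (f x)\<^sup>2) \<le> C"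
  shows "square_summable f"
  unfolding square_summable_def by (rule summable_on_real_bounded(1)[where C = C]) (use assms in auto)

lemma square_summable_add:
  assumes "square_summable f" "square_summable g"
  shows "square_summable (\<lambda>x. f x + g x)"
proof -
  have "(\<lambda>x. 2 * (f x)\<^sup>2 + 2 * (g x)\<^sup>2) summable_on UNIV"
    using assms unfolding square_summable_def by (intro summable_on_add summable_on_cmult_right)
  then show ?thesis unfolding square_summable_def
  proof (rule summable_on_comparison_test)
    fix x show "(f x + g x)\<^sup>2 \<le> 2 * (f x)\<^sup>2 + 2 * (g x)\<^sup>2"
      using zero_le_power2[of "f x - g x"] by (simp add: power2_sum power2_diff)
  qed simp
qed

lemma square_summable_scale: "square_summable f \<Longrightarrow> square_summable (\<lambda>x. c * f x)"
  unfolding square_summable_def power_mult_distrib by (rule summable_on_cmult_right)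

lemma square_summable_mult:
  assumes "square_summable f" "square_summable g"
  shows "(\<lambda>x. f x * g x) summable_on UNIV"
proof -
  have "(\<lambda>x. (f x)\<^sup>2 + (g x)\<^sup>2) summable_on UNIV"
    using assms unfolding square_summable_def by (rule summable_on_add)
  then have "(\<lambda>x. norm (f x * g x)) summable_on UNIV"
  proof (rule summable_on_comparison_test)
    fix x
    have "norm (f x * g x) * 2 \<le> (f x)\<^sup>2 + (g x)\<^sup>2"
      using sum_squares_bound[of "\<bar>f x\<bar>" "\<bar>g x\<bar>"] by (simp add: abs_mult)
    then show "norm (f x * g x) \<le> (f x)\<^sup>2 + (g x)\<^sup>2"
      using norm_ge_zero[of "f x * g x"] by linarith
  qed simp
  then show ?thesis by (rule abs_summable_summable)
qed

text \<open>One Hilbert space over all integers serves every state space and weight, because a type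
  cannot depend on them. The individual spaces become the subspaces
  \<open>supported_on E\<close>.\<close>

typedef ell2 = "{f. square_summable f}" morphisms coord Abs_ell2
  by (rule exI[of _ "\<lambda>x. 0"]) (simp add: square_summable_def)

setup_lifting type_definition_ell2

lemma square_summable_coord [simp]: "square_summable (coord f)"
  using coord by blast

lemma ell2_eqI: "(\<And>x. coord f x = coord g x) \<Longrightarrow> f = g"
  by (metis coord_inject ext)

lemma coord_Abs_ell2: "square_summable f \<Longrightarrow> coord (Abs_ell2 f) = f"
  by (simp add: Abs_ell2_inverse)

instantiation ell2 :: real_inner
begin

lift_definition zero_ell2 :: ell2 is "\<lambda>x. 0" by (simp add: square_summable_def)
lift_definition plus_ell2 :: "ell2 \<Rightarrow> ell2 \<Rightarrow> ell2" is "\<lambda>f g x. f x + g x"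
  by (rule square_summable_add)
lift_definition uminus_ell2 :: "ell2 \<Rightarrow> ell2" is "\<lambda>f x. - f x" by (simp add: square_summable_def)
lift_definition minus_ell2 :: "ell2 \<Rightarrow> ell2 \<Rightarrow> ell2" is "\<lambda>f g x. f x - g x"
  using square_summable_add[OF _ square_summable_scale[of _ "-1"]] by simp
lift_definition scaleR_ell2 :: "real \<Rightarrow> ell2 \<Rightarrow> ell2" is "\<lambda>c f x. c * f x"
  by (rule square_summable_scale)
lift_definition inner_ell2 :: "ell2 \<Rightarrow> ell2 \<Rightarrow> real" is "\<lambda>f g. \<Sum>\<^sub>\<infinity>x. f x * g x" .

definition norm_ell2 :: "ell2 \<Rightarrow> real" where "norm_ell2 f = sqrt (f \<bullet> f)"
definition dist_ell2 :: "ell2 \<Rightarrow> ell2 \<Rightarrow> real" where "dist_ell2 f g = norm (f - g)"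
definition sgn_ell2 :: "ell2 \<Rightarrow> ell2" where "sgn_ell2 f = inverse (norm f) *\<^sub>R f"
definition uniformity_ell2 :: "(ell2 \<times> ell2) filter" where
  "uniformity_ell2 = (INF e\<in>{0<..}. principal {(f, g). dist f g < e})"
definition open_ell2 :: "ell2 set \<Rightarrow> bool" where
  "open_ell2 U \<longleftrightarrow> (\<forall>x\<in>U. \<forall>\<^sub>F (x', y) in uniformity. x' = x \<longrightarrow> y \<in> U)"

instance
proof
  fix f g h :: ell2 and a b :: real
  show "f + g + h = f + (g + h)" "f + g = g + f" "0 + f = f" "- f + f = 0" "f - g = f + - g"
    "a *\<^sub>R (f + g) = a *\<^sub>R f + a *\<^sub>R g" "(a + b) *\<^sub>R f = a *\<^sub>R f + b *\<^sub>R f"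
    "a *\<^sub>R b *\<^sub>R f = (a * b) *\<^sub>R f" "1 *\<^sub>R f = f"
    by (transfer; simp add: algebra_simps)+
  show "sgn f = inverse (norm f) *\<^sub>R f" "dist f g = norm (f - g)" "norm f = sqrt (f \<bullet> f)"
    "uniformity = (INF e\<in>{0<..}. principal {(f, g::ell2). dist f g < e})"
    by (simp_all add: sgn_ell2_def dist_ell2_def norm_ell2_def uniformity_ell2_def)
  show "open U \<longleftrightarrow> (\<forall>x\<in>U. \<forall>\<^sub>F (x', y) in uniformity. x' = x \<longrightarrow> y \<in> U)" for U :: "ell2 set"
    by (simp add: open_ell2_def)
  show "f \<bullet> g = g \<bullet> f" by transfer (simp add: mult.commute)
  show "(f + g) \<bullet> h = f \<bullet> h + g \<bullet> h"
    by transfer (simp add: distrib_right infsum_add square_summable_mult)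
  show "(a *\<^sub>R f) \<bullet> g = a * (f \<bullet> g)"
    by transfer (simp add: mult.assoc infsum_cmult_right')
  show "0 \<le> f \<bullet> f" by transfer (simp add: infsum_nonneg)
  show "f \<bullet> f = 0 \<longleftrightarrow> f = 0"
  proof
    assume 0: "f \<bullet> f = 0"
    show "f = 0"
    proof (rule ell2_eqI)
      fix x
      have "coord f x * coord f x = 0"
        by (rule nonneg_infsum_le_0D[of "\<lambda>x. coord f x * coord f x" UNIV])
          (use 0 in \<open>auto simp: inner_ell2.rep_eq square_summable_mult\<close>)
      then show "coord f x = coord 0 x" by (simp add: zero_ell2.rep_eq)
    qed
  qed (transfer, simp)
qed

end

lemma coord_simps [simp]:
  "coord 0 x = 0" "coord (f + g) x = coord f x + coord g x" "coord (f - g) x = coord f x - coord g x"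
  "coord (- f) x = - coord f x" "coord (c *\<^sub>R f) x = c * coord f x"
  by (simp_all add: zero_ell2.rep_eq plus_ell2.rep_eq minus_ell2.rep_eq uminus_ell2.rep_eq scaleR_ell2.rep_eq)

lemma coord_sum [simp]: "coord (\<Sum>k\<in>F. f k) x = (\<Sum>k\<in>F. coord (f k) x)"
  by (induction F rule: infinite_finite_induct) auto

lemma inner_ell2_has_sum: "((\<lambda>x. coord f x * coord g x) has_sum f \<bullet> g) UNIV"
  unfolding inner_ell2.rep_eq by (rule has_sum_infsum) (simp add: square_summable_mult)

lemma norm_ell2_has_sum: "((\<lambda>x. (coord f x)\<^sup>2) has_sum (norm f)\<^sup>2) UNIV"
  using inner_ell2_has_sum[of f f] unfolding power2_norm_eq_inner by (simp add: power2_eq_square)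

lemma sum_coord_le_norm: "finite F \<Longrightarrow> (\<Sum>x\<in>F. (coord f x)\<^sup>2) \<le> (norm f)\<^sup>2"
  by (rule finite_sum_le_has_sum[OF norm_ell2_has_sum]) auto

lemma abs_coord_le_norm: "\<bar>coord f x\<bar> \<le> norm f"
  using sum_coord_le_norm[of "{x}" f] by (simp add: abs_le_square_iff[symmetric])

lemma norm_ell2_le:
  assumes "\<And>F. finite F \<Longrightarrow> (\<Sum>x\<in>F. (coord f x)\<^sup>2) \<le> C\<^sup>2" "0 \<le> C"
  shows "norm f \<le> C"
  by (rule power2_le_imp_le[OF has_sum_le_finite_sums[OF norm_ell2_has_sum]]) (use assms in auto)

instance ell2 :: banach
proof
  fix X :: "nat \<Rightarrow> ell2" assume X: "Cauchy X"
  have "Cauchy (\<lambda>n. coord (X n) x)" for x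
    using X unfolding Cauchy_def dist_norm
    by (metis abs_coord_le_norm coord_simps(3) le_less_trans real_norm_def)
  then have "\<forall>x. \<exists>l. (\<lambda>n. coord (X n) x) \<longlonglongrightarrow> l"
    using Cauchy_convergent convergent_def by blast
  then obtain l where l: "\<And>x. (\<lambda>n. coord (X n) x) \<longlonglongrightarrow> l x" by metis
  \<comment> \<open>The Cauchy estimate passes to the pointwise limit on every finite set of
    coordinates, with a threshold independent of that set.\<close>
  have close: "\<exists>M. \<forall>n\<ge>M. \<forall>F. finite F \<longrightarrow> (\<Sum>x\<in>F. (coord (X n) x - l x)\<^sup>2) \<le> e\<^sup>2" if "e > 0" for e
  proof -
    obtain M where M: "\<And>m n. m \<ge> M \<Longrightarrow> n \<ge> M \<Longrightarrow> norm (X m - X n) < e"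
      using X \<open>e > 0\<close> unfolding Cauchy_def dist_norm by blast
    have "(\<Sum>x\<in>F. (coord (X n) x - l x)\<^sup>2) \<le> e\<^sup>2" if "n \<ge> M" "finite F" for n F
    proof (rule tendsto_upperbound)
      show "(\<lambda>m. \<Sum>x\<in>F. (coord (X n) x - coord (X m) x)\<^sup>2) \<longlonglongrightarrow> (\<Sum>x\<in>F. (coord (X n) x - l x)\<^sup>2)"
        by (intro tendsto_intros l)
      have "(\<Sum>x\<in>F. (coord (X n) x - coord (X m) x)\<^sup>2) \<le> e\<^sup>2" if "m \<ge> M" for m
      proof -
        have "(\<Sum>x\<in>F. (coord (X n) x - coord (X m) x)\<^sup>2) \<le> (norm (X n - X m))\<^sup>2"
          using sum_coord_le_norm[OF \<open>finite F\<close>, of "X n - X m"] by simp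
        also have "\<dots> \<le> e\<^sup>2"
          by (rule power_mono) (use M[OF \<open>n \<ge> M\<close> \<open>m \<ge> M\<close>] in auto)
        finally show ?thesis .
      qed
      then show "\<forall>\<^sub>F m in sequentially. (\<Sum>x\<in>F. (coord (X n) x - coord (X m) x)\<^sup>2) \<le> e\<^sup>2"
        using eventually_sequentially by blast
    qed simp
    then show ?thesis by blast
  qed
  obtain M where M: "\<And>F. finite F \<Longrightarrow> (\<Sum>x\<in>F. (coord (X M) x - l x)\<^sup>2) \<le> 1\<^sup>2"
    using close[of 1] by auto
  have "square_summable (\<lambda>x. coord (X M) x - l x)"
    by (rule square_summable_bounded[OF M])
  then have "square_summable (\<lambda>x. coord (X M) x + (-1) * (coord (X M) x - l x))"
    by (intro square_summable_add square_summable_scale) simp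
  then have "square_summable l" by simp
  then have lc: "coord (Abs_ell2 l) = l" by (rule coord_Abs_ell2)
  have "X \<longlonglongrightarrow> Abs_ell2 l"
    unfolding LIMSEQ_iff
  proof (intro allI impI)
    fix r :: real assume r: "r > 0"
    then obtain M where "\<forall>n\<ge>M. \<forall>F. finite F \<longrightarrow> (\<Sum>x\<in>F. (coord (X n) x - l x)\<^sup>2) \<le> (r / 2)\<^sup>2"
      using close[of "r / 2"] by auto
    then have "norm (X n - Abs_ell2 l) \<le> r / 2" if "n \<ge> M" for n
      by (intro norm_ell2_le) (use that r in \<open>auto simp: lc\<close>)
    then show "\<exists>M. \<forall>n\<ge>M. norm (X n - Abs_ell2 l) < r"
      using r by (intro exI[of _ M]) fastforce
  qed
  then show "convergent X" by (auto simp: convergent_def)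
qed

section \<open>Coordinate vectors, dimension and adjoints in the sequence space\<close>

definition delta :: "int \<Rightarrow> ell2" where
  "delta x = Abs_ell2 (\<lambda>y. if y = x then 1 else 0)"

lemma coord_delta [simp]: "coord (delta x) y = (if y = x then 1 else 0)"
proof -
  have "square_summable (\<lambda>y. if y = x then 1 else 0)"
    unfolding square_summable_def
    by (rule finite_nonzero_values_imp_summable_on) (auto intro: finite_subset[of _ "{x}"])
  then show ?thesis by (simp add: delta_def coord_Abs_ell2)
qed

lemma inner_delta [simp]: "f \<bullet> delta x = coord f x" "delta x \<bullet> f = coord f x"
proof -
  have "((\<lambda>y. coord f y * coord (delta x) y) has_sum coord f x) UNIV"
    by (rule has_sum_finite_neutralI[of "{x}"]) auto
  with inner_ell2_has_sum[of f "delta x"] show "f \<bullet> delta x = coord f x"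
    by (metis has_sum_unique)
  then show "delta x \<bullet> f = coord f x" by (simp add: inner_commute)
qed

lemma bounded_linear_coord: "bounded_linear (\<lambda>f. coord f x)"
  using bounded_linear_inner_left[of "delta x"] by simp

definition supported_on :: "int set \<Rightarrow> ell2 set" where
  "supported_on E = {f. \<forall>x. x \<notin> E \<longrightarrow> coord f x = 0}"

lemma subspace_supported_on: "subspace (supported_on E)"
  by (auto simp: supported_on_def subspace_def)

lemma closed_supported_on: "closed (supported_on E)"
proof -
  have *: "supported_on E = (\<Inter>x\<in>-E. {f. f \<bullet> delta x = 0})" by (auto simp: supported_on_def)
  show ?thesis unfolding * by (intro closed_INT ballI closed_Collect_eq continuous_intros)
qed

lemma orthonormal_delta: "orthonormal_on E delta"
  by (simp add: orthonormal_on_def)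

lemma delta_supported_on: "x \<in> E \<Longrightarrow> delta x \<in> supported_on E"
  by (auto simp: supported_on_def)

lemma onb_delta: "onb (supported_on E) E delta"
  unfolding onb_def using orthonormal_delta delta_supported_on
  by (auto simp: supported_on_def intro!: ell2_eqI)

lemma delta_expansion: "((\<lambda>x. coord f x *\<^sub>R delta x) has_sum f) UNIV"
proof -
  interpret hilbert_subspace "supported_on UNIV"
    by unfold_locales (rule subspace_supported_on closed_supported_on)+
  show ?thesis using onb_expansion[OF onb_delta, of f] by (simp add: supported_on_def)
qed

lemma independent_orthonormal:
  assumes "orthonormal_on S (\<lambda>x. x)" shows "independent S"
proof (rule pairwise_orthogonal_independent)
  show "pairwise orthogonal S"
    using assms by (simp add: pairwise_def orthogonal_def orthonormal_on_def)
  show "0 \<notin> S" using orthonormal_onD[OF assms, of 0 0] by auto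
qed

lemma onb_finite_span:
  assumes "onb H S (\<lambda>x. x)" "finite S" "subspace H" "closed H"
  shows "H \<subseteq> span (S :: 'a::{real_inner,banach} set)"
proof
  interpret hilbert_subspace H by unfold_locales (rule assms)+
  fix f assume "f \<in> H"
  then have "((\<lambda>k. (f \<bullet> k) *\<^sub>R k) has_sum f) S" by (rule onb_expansion[OF assms(1)])
  then have "f = (\<Sum>k\<in>S. (f \<bullet> k) *\<^sub>R k)" using assms(2) by (simp add: has_sum_finite_iff)
  also have "\<dots> \<in> span S" by (intro span_sum span_scale span_base)
  finally show "f \<in> span S" .
qed

text \<open>For finite \<open>E\<close> the exchange lemma compares \<open>S\<close> with the
  \<open>delta\<close> basis in both directions. For infinite \<open>E\<close> the set
  \<open>S\<close> is countable: each of its vectors has a nonzero coordinate, and by Bessel only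
  countably many of them have a nonzero coordinate at a given point.\<close>

lemma onb_supported_on_index:
  assumes S: "onb (supported_on E) S (\<lambda>x. x)"
  shows "\<exists>b. bij_betw b (index_set E) S"
proof -
  have on: "orthonormal_on S (\<lambda>x. x)" and SH: "S \<subseteq> supported_on E" using S by (auto simp: onb_def)
  have inj: "inj delta" by (rule injI) (metis coord_delta zero_neq_one)
  have D: "orthonormal_on (delta ` A) (\<lambda>x. x)" for A
    by (auto simp: orthonormal_on_def inj_eq[OF inj])
  have ind: "independent S" "independent (delta ` A)" for A
    using independent_orthonormal[OF on] independent_orthonormal[OF D] by auto
  show ?thesis
  proof (cases "finite E")
    case True
    have "onb (supported_on E) (delta ` E) (\<lambda>x. x)"
      using onb_delta[of E] D[of E] by (simp add: onb_def)
    then have "supported_on E \<subseteq> span (delta ` E)"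
      by (rule onb_finite_span) (use True subspace_supported_on closed_supported_on in auto)
    then have fin: "finite S" "card S \<le> card (delta ` E)"
      using independent_span_bound[of "delta ` E" S] ind True SH by auto
    have "delta ` E \<subseteq> span S"
      using onb_finite_span[OF S fin(1) subspace_supported_on closed_supported_on] delta_supported_on by blast
    then have "card (delta ` E) \<le> card S"
      using independent_span_bound[OF fin(1) ind(2)] by blast
    with fin have "card S = card E" using card_image[OF inj_on_subset[OF inj]] by (simp add: le_antisym)
    moreover have "index_set E = {..<card E}" using True by (auto simp: index_set_def)
    ultimately show ?thesis using bij_betw_from_nat_into_finite[OF fin(1)] by auto
  next
    case False
    have "infinite S"
    proof
      assume fin: "finite S"
      have "delta ` E \<subseteq> span S"
        using onb_finite_span[OF S fin subspace_supported_on closed_supported_on] delta_supported_on by blast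
      then have "finite (delta ` E)" using independent_span_bound[OF fin ind(2)] by blast
      with False show False using finite_imageD[OF _ inj_on_subset[OF inj]] by blast
    qed
    moreover have "countable S"
    proof -
      have "S \<subseteq> (\<Union>x. {e\<in>S. (delta x \<bullet> e)\<^sup>2 \<noteq> 0})"
      proof
        fix e assume e: "e \<in> S"
        have "\<exists>x. coord e x \<noteq> 0"
        proof (rule ccontr)
          assume "\<not> ?thesis"
          then have "e = 0" by (auto intro: ell2_eqI)
          with orthonormal_onD[OF on e e] show False by simp
        qed
        with e show "e \<in> (\<Union>x. {e\<in>S. (delta x \<bullet> e)\<^sup>2 \<noteq> 0})" by auto
      qed
      moreover have "countable (\<Union>x. {e\<in>S. (delta x \<bullet> e)\<^sup>2 \<noteq> 0})"
        by (intro countable_UN summable_countable_real bessel_summable[OF on]) auto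
      ultimately show ?thesis by (rule countable_subset)
    qed
    moreover have "index_set E = UNIV" using False by (simp add: index_set_def)
    ultimately show ?thesis using bij_betw_from_nat_into by metis
  qed
qed

lemma indexed_supported_on: "indexed_hilbert_subspace (supported_on E) (index_set E)"
  by unfold_locales (auto intro: subspace_supported_on closed_supported_on onb_supported_on_index)

text \<open>The coordinate of \<open>A' g\<close> at \<open>x\<close> can only be
  \<open>A (delta x) \<bullet> g\<close>, so no representation theorem enters. The point to prove is
  that these numbers are square summable.\<close>

lemma ell2_adjoint:
  assumes A: "bounded_linear (A :: ell2 \<Rightarrow> ell2)"
  obtains A' where "bounded_linear A'" "\<And>f g. A f \<bullet> g = f \<bullet> A' g"
proof -
  note lin = bounded_linear.linear[OF A]
  obtain K where K: "\<And>x. norm (A x) \<le> norm x * K" "K > 0"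
    using bounded_linear.pos_bounded[OF A] by blast
  define c where "c g x = A (delta x) \<bullet> g" for g x
  have bound: "(\<Sum>x\<in>F. (c g x)\<^sup>2) \<le> (norm g * K)\<^sup>2" if F: "finite F" for F g
  proof -
    \<comment> \<open>\<open>A\<close> is tested on the truncation of the candidate itself:
      \<open>(norm v)\<^sup>2 = A v \<bullet> g \<le> norm v * K * norm g\<close>, and one factor
      cancels.\<close>
    define v where "v = (\<Sum>x\<in>F. c g x *\<^sub>R delta x)"
    have n: "(norm v)\<^sup>2 = (\<Sum>x\<in>F. (c g x)\<^sup>2)"
      unfolding v_def by (rule norm_sum_orthonormal[OF orthonormal_delta[of UNIV] F]) auto
    have "A v \<bullet> g = (\<Sum>x\<in>F. (c g x)\<^sup>2)"
      by (simp add: v_def linear_sum[OF lin] linear_scale[OF lin] inner_sum_left c_def power2_eq_square)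
    then have "(norm v)\<^sup>2 = A v \<bullet> g" using n by simp
    also have "\<dots> \<le> norm (A v) * norm g" by (rule norm_cauchy_schwarz)
    also have "\<dots> \<le> (norm v * K) * norm g" by (intro mult_right_mono K) auto
    finally have "norm v * norm v \<le> norm v * (norm g * K)" by (simp add: power2_eq_square mult_ac)
    then have "norm v \<le> norm g * K"
      using K(2) by (cases "norm v = 0") (auto simp: mult_le_cancel_left)
    then have "(norm v)\<^sup>2 \<le> (norm g * K)\<^sup>2" by (rule power_mono) simp
    then show ?thesis unfolding n .
  qed
  have c: "square_summable (c g)" for g by (rule square_summable_bounded[OF bound])
  define A' where "A' g = Abs_ell2 (c g)" for g
  have cA': "coord (A' g) = c g" for g unfolding A'_def by (rule coord_Abs_ell2[OF c])
  have adj: "A f \<bullet> g = f \<bullet> A' g" for f g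
  proof -
    have "((\<lambda>x. (coord f x *\<^sub>R A (delta x)) \<bullet> g) has_sum A f \<bullet> g) UNIV"
      using has_sum_bounded_linear[OF bounded_linear_inner_left has_sum_bounded_linear[OF A delta_expansion[of f]], of g]
      by (simp add: linear_scale[OF lin])
    moreover have "((\<lambda>x. coord f x * coord (A' g) x) has_sum f \<bullet> A' g) UNIV" by (rule inner_ell2_has_sum)
    ultimately show ?thesis by (simp add: cA' c_def has_sum_unique)
  qed
  have "bounded_linear A'"
  proof (rule bounded_linear_intro[where K = K])
    show "A' (x + y) = A' x + A' y" for x y by (rule ell2_eqI) (simp add: cA' c_def inner_add_right)
    show "A' (r *\<^sub>R x) = r *\<^sub>R A' x" for r x by (rule ell2_eqI) (simp add: cA' c_def)
    show "norm (A' x) \<le> norm x * K" for x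
      by (rule norm_ell2_le) (use bound K in \<open>auto simp: cA'\<close>)
  qed
  with adj that show ?thesis by blast
qed

section \<open>Weighted spaces\<close>

text \<open>Isometric from \<open>l2 E w\<close> onto \<open>supported_on E\<close>, with inverse
  \<open>dn\<close>. Off \<open>l2 E w\<close> the value is unspecified, since
  \<open>Abs_ell2\<close> is then applied to a family that need not be square summable; membership
  in \<open>l2\<close> must therefore be carried along.\<close>

definition up :: "int set \<Rightarrow> (int \<Rightarrow> real) \<Rightarrow> (int \<Rightarrow> real) \<Rightarrow> ell2" where
  "up E w f = Abs_ell2 (\<lambda>x. if x \<in> E then f x * sqrt (w x) else 0)"

definition dn :: "int set \<Rightarrow> (int \<Rightarrow> real) \<Rightarrow> ell2 \<Rightarrow> int \<Rightarrow> real" where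
  "dn E w g = (\<lambda>x. if x \<in> E then coord g x / sqrt (w x) else 0)"

text \<open>Since \<open>dn\<close> discards coordinates off \<open>E\<close>, the lift of a bounded
  operator is bounded and linear on the whole type, not only on
  \<open>supported_on E\<close>.\<close>

definition lift_op :: "int set \<Rightarrow> (int \<Rightarrow> real) \<Rightarrow> (int \<Rightarrow> real) \<Rightarrow> operator \<Rightarrow> ell2 \<Rightarrow> ell2" where
  "lift_op E v w A g = up E w (A (dn E v g))"

definition unlift_op :: "int set \<Rightarrow> (int \<Rightarrow> real) \<Rightarrow> (int \<Rightarrow> real) \<Rightarrow> (ell2 \<Rightarrow> ell2) \<Rightarrow> operator" where
  "unlift_op E v w B f = dn E w (B (up E v f))"

definition positive_on :: "int set \<Rightarrow> (int \<Rightarrow> real) \<Rightarrow> bool" where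
  "positive_on E w \<longleftrightarrow> (\<forall>x\<in>E. 0 < w x)"

lemma coord_up:
  assumes "positive_on E w" "f \<in> l2 E w"
  shows "coord (up E w f) = (\<lambda>x. if x \<in> E then f x * sqrt (w x) else 0)"
proof -
  have "(\<lambda>x. (f x)\<^sup>2 * w x) summable_on E" using assms by (simp add: l2_def)
  moreover have "(\<lambda>x. (f x)\<^sup>2 * w x) summable_on E \<longleftrightarrow>
      (\<lambda>x. (if x \<in> E then f x * sqrt (w x) else 0)\<^sup>2) summable_on UNIV"
    by (rule summable_on_cong_neutral)
      (use assms in \<open>auto simp: positive_on_def power_mult_distrib less_imp_le\<close>)
  ultimately show ?thesis
    unfolding up_def by (intro coord_Abs_ell2) (simp add: square_summable_def)
qed

lemma up_supported: "positive_on E w \<Longrightarrow> f \<in> l2 E w \<Longrightarrow> up E w f \<in> supported_on E"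
  by (simp add: supported_on_def coord_up)

lemma dn_l2:
  assumes "positive_on E w" shows "dn E w g \<in> l2 E w"
proof -
  have "(\<lambda>x. (coord g x)\<^sup>2) summable_on E"
    by (rule summable_on_subset_banach[of _ UNIV]) (use norm_ell2_has_sum[of g] in \<open>auto simp: summable_on_def\<close>)
  moreover have "(\<lambda>x. (coord g x)\<^sup>2) summable_on E \<longleftrightarrow> (\<lambda>x. (dn E w g x)\<^sup>2 * w x) summable_on E"
    by (rule summable_on_cong)
      (use assms in \<open>auto simp: positive_on_def dn_def power_divide less_imp_le less_imp_neq[symmetric]\<close>)
  ultimately show ?thesis by (simp add: l2_def dn_def)
qed

lemma dn_up:
  assumes "positive_on E w" "f \<in> l2 E w" shows "dn E w (up E w f) = f"
  using assms by (auto simp: dn_def coord_up l2_def positive_on_def fun_eq_iff less_imp_neq[symmetric])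

lemma coord_up_dn:
  assumes "positive_on E w" shows "coord (up E w (dn E w g)) = (\<lambda>x. if x \<in> E then coord g x else 0)"
  unfolding coord_up[OF assms dn_l2[OF assms]]
  using assms by (auto simp: dn_def positive_on_def fun_eq_iff less_imp_neq[symmetric])

lemma up_dn:
  assumes "positive_on E w" "g \<in> supported_on E" shows "up E w (dn E w g) = g"
  by (rule ell2_eqI) (use assms in \<open>simp add: coord_up_dn supported_on_def\<close>)

lemma inner_up:
  assumes "positive_on E w" "f \<in> l2 E w" "g \<in> l2 E w"
  shows "up E w f \<bullet> up E w g = l2_inner E w f g"
proof -
  have "((\<lambda>x. coord (up E w f) x * coord (up E w g) x) has_sum up E w f \<bullet> up E w g) UNIV"
    by (rule inner_ell2_has_sum)
  moreover have "((\<lambda>x. coord (up E w f) x * coord (up E w g) x) has_sum up E w f \<bullet> up E w g) UNIV \<longleftrightarrow>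
      ((\<lambda>x. f x * g x * w x) has_sum up E w f \<bullet> up E w g) E"
    by (rule has_sum_cong_neutral) (use assms in \<open>auto simp: coord_up positive_on_def less_imp_le mult_ac\<close>)
  ultimately show ?thesis by (simp add: l2_inner_def infsumI)
qed

lemma l2_norm_up:
  assumes "positive_on E w" "f \<in> l2 E w" shows "l2_norm E w f = norm (up E w f)"
  using inner_up[OF assms assms(2)] by (simp add: l2_norm_def norm_eq_sqrt_inner)

lemma l2_combination:
  assumes w: "positive_on E w" and f: "f \<in> l2 E w" and g: "g \<in> l2 E w"
  shows "(\<lambda>x. a * f x + b * g x) \<in> l2 E w"
    and "up E w (\<lambda>x. a * f x + b * g x) = a *\<^sub>R up E w f + b *\<^sub>R up E w g"
proof -
  have *: "(\<lambda>x. a * f x + b * g x) = dn E w (a *\<^sub>R up E w f + b *\<^sub>R up E w g)"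
    using w f g by (auto simp: dn_def coord_up fun_eq_iff l2_def positive_on_def less_imp_neq[symmetric] field_simps)
  show "(\<lambda>x. a * f x + b * g x) \<in> l2 E w" unfolding * by (rule dn_l2[OF w])
  show "up E w (\<lambda>x. a * f x + b * g x) = a *\<^sub>R up E w f + b *\<^sub>R up E w g"
    unfolding * by (rule up_dn[OF w])
      (intro subspace_add[OF subspace_supported_on] subspace_scale[OF subspace_supported_on] up_supported w f g)
qed

lemma dn_linear:
  "dn E w (a *\<^sub>R f + b *\<^sub>R g) = (\<lambda>x. a * dn E w f x + b * dn E w g x)"
  by (auto simp: dn_def fun_eq_iff add_divide_distrib)

lemma norm_up_dn_le: "positive_on E w \<Longrightarrow> norm (up E w (dn E w g)) \<le> norm g"
proof (rule norm_ell2_le)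
  fix F :: "int set" assume w: "positive_on E w" and F: "finite F"
  have "(\<Sum>x\<in>F. (coord (up E w (dn E w g)) x)\<^sup>2) \<le> (\<Sum>x\<in>F. (coord g x)\<^sup>2)"
    by (rule sum_mono) (use w in \<open>auto simp: coord_up_dn\<close>)
  also have "\<dots> \<le> (norm g)\<^sup>2" by (rule sum_coord_le_norm[OF F])
  finally show "(\<Sum>x\<in>F. (coord (up E w (dn E w g)) x)\<^sup>2) \<le> (norm g)\<^sup>2" .
qed simp

lemma lift_op_up: "positive_on E v \<Longrightarrow> f \<in> l2 E v \<Longrightarrow> lift_op E v w A (up E v f) = up E w (A f)"
  by (simp add: lift_op_def dn_up)

lemma dn_lift_op:
  assumes "positive_on E v" "positive_on E w" "bounded_operator E v w A"
  shows "dn E w (lift_op E v w A g) = A (dn E v g)"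
  unfolding lift_op_def by (rule dn_up) (use assms dn_l2 in \<open>auto simp: bounded_operator_def\<close>)

lemma lift_op_supported:
  assumes "positive_on E v" "positive_on E w" "bounded_operator E v w A"
  shows "lift_op E v w A g \<in> supported_on E"
  unfolding lift_op_def by (rule up_supported) (use assms dn_l2 in \<open>auto simp: bounded_operator_def\<close>)

lemma lift_op_bounded_linear:
  assumes v: "positive_on E v" and w: "positive_on E w" and A: "bounded_operator E v w A"
  shows "bounded_linear (lift_op E v w A)"
proof -
  obtain C where C: "\<And>f. f \<in> l2 E v \<Longrightarrow> l2_norm E w (A f) \<le> C * l2_norm E v f"
    using A unfolding bounded_operator_def by blast
  have Al2: "A f \<in> l2 E w" if "f \<in> l2 E v" for f using A that by (simp add: bounded_operator_def)
  have lin: "lift_op E v w A (a *\<^sub>R f + b *\<^sub>R g) = a *\<^sub>R lift_op E v w A f + b *\<^sub>R lift_op E v w A g" for a b f g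
  proof -
    have "A (dn E v (a *\<^sub>R f + b *\<^sub>R g)) = (\<lambda>x. a * A (dn E v f) x + b * A (dn E v g) x)"
      unfolding dn_linear using A dn_l2[OF v] unfolding bounded_operator_def by blast
    then show ?thesis
      unfolding lift_op_def using l2_combination(2)[OF w Al2 Al2] dn_l2[OF v] by simp
  qed
  show ?thesis
  proof (rule bounded_linear_intro[where K = "\<bar>C\<bar>"])
    show "lift_op E v w A (f + g) = lift_op E v w A f + lift_op E v w A g" for f g
      using lin[of 1 f 1 g] by simp
    show "lift_op E v w A (r *\<^sub>R f) = r *\<^sub>R lift_op E v w A f" for r f
      using lin[of r f 0 f] by simp
    show "norm (lift_op E v w A g) \<le> norm g * \<bar>C\<bar>" for g
    proof -
      have "norm (lift_op E v w A g) \<le> C * norm (up E v (dn E v g))"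
        using C[OF dn_l2[OF v, of g]] by (simp add: lift_op_def l2_norm_up v w Al2 dn_l2)
      also have "\<dots> \<le> \<bar>C\<bar> * norm g"
        using norm_up_dn_le[OF v, of g] by (intro mult_mono) auto
      finally show ?thesis by (simp add: mult.commute)
    qed
  qed
qed

lemma unlift_op_bounded:
  assumes v: "positive_on E v" and w: "positive_on E w" and B: "bounded_linear B"
  shows "bounded_operator E v w (unlift_op E v w B)"
proof -
  note lin = bounded_linear.linear[OF B]
  obtain K where K: "\<And>x. norm (B x) \<le> norm x * K" using bounded_linear.bounded[OF B] by blast
  show ?thesis
    unfolding bounded_operator_def
  proof (intro conjI ballI allI exI)
    show "unlift_op E v w B f \<in> l2 E w" for f unfolding unlift_op_def by (rule dn_l2[OF w])
    show "unlift_op E v w B (\<lambda>x. a * f x + b * g x) =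
        (\<lambda>x. a * unlift_op E v w B f x + b * unlift_op E v w B g x)"
      if "f \<in> l2 E v" "g \<in> l2 E v" for f g a b
      using that by (simp add: unlift_op_def l2_combination(2)[OF v] linear_add[OF lin] linear_scale[OF lin] dn_linear)
    show "l2_norm E w (unlift_op E v w B f) \<le> K * l2_norm E v f" if f: "f \<in> l2 E v" for f
    proof -
      have "l2_norm E w (unlift_op E v w B f) \<le> norm (B (up E v f))"
        unfolding unlift_op_def by (simp add: l2_norm_up w dn_l2 norm_up_dn_le)
      also have "\<dots> \<le> K * l2_norm E v f" using K[of "up E v f"] by (simp add: l2_norm_up v f mult.commute)
      finally show ?thesis .
    qed
  qed
qed

lemma up_unlift_op:
  assumes "positive_on E v" "positive_on E w" "f \<in> l2 E v" "B (up E v f) \<in> supported_on E"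
  shows "up E w (unlift_op E v w B f) = B (up E v f)"
  using assms by (simp add: unlift_op_def up_dn)

lemma up_inject:
  assumes "positive_on E w" "f \<in> l2 E w" "g \<in> l2 E w" "up E w f = up E w g" shows "f = g"
  using dn_up[OF assms(1,2)] dn_up[OF assms(1,3)] assms(4) by metis

section \<open>Operators on weighted spaces\<close>

lemma l2_zero: "(\<lambda>x. 0) \<in> l2 E w"
  by (simp add: l2_def)

lemma up_zero: "positive_on E w \<Longrightarrow> up E w (\<lambda>x. 0) = 0"
  by (rule ell2_eqI) (simp add: coord_up l2_zero)

lemma l2_sum:
  assumes w: "positive_on E w" and f: "\<And>k. k \<in> F \<Longrightarrow> f k \<in> l2 E w"
  shows "(\<lambda>x. \<Sum>k\<in>F. c k * f k x) \<in> l2 E w"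
    and "up E w (\<lambda>x. \<Sum>k\<in>F. c k * f k x) = (\<Sum>k\<in>F. c k *\<^sub>R up E w (f k))"
proof -
  have "(\<lambda>x. \<Sum>k\<in>F. c k * f k x) \<in> l2 E w \<and>
      up E w (\<lambda>x. \<Sum>k\<in>F. c k * f k x) = (\<Sum>k\<in>F. c k *\<^sub>R up E w (f k))"
    using f
  proof (induction F rule: infinite_finite_induct)
    case (insert k F)
    then show ?case
      using l2_combination[OF w, of "f k" "\<lambda>x. \<Sum>k\<in>F. c k * f k x" "c k" 1] by simp
  qed (simp_all add: l2_zero up_zero[OF w])
  then show "(\<lambda>x. \<Sum>k\<in>F. c k * f k x) \<in> l2 E w"
    "up E w (\<lambda>x. \<Sum>k\<in>F. c k * f k x) = (\<Sum>k\<in>F. c k *\<^sub>R up E w (f k))" by blast+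
qed

lemma l2_scale:
  assumes w: "positive_on E w" and f: "f \<in> l2 E w"
  shows "(\<lambda>x. c * f x) \<in> l2 E w" "up E w (\<lambda>x. c * f x) = c *\<^sub>R up E w f"
  using l2_combination[OF w f f, of c 0] by simp_all

lemma l2_diff:
  assumes w: "positive_on E w" and f: "f \<in> l2 E w" and g: "g \<in> l2 E w"
  shows "(\<lambda>x. f x - g x) \<in> l2 E w" "up E w (\<lambda>x. f x - g x) = up E w f - up E w g"
  using l2_combination[OF w f g, of 1 "-1"] by simp_all

lemma l2_inner_eqI:
  assumes w: "positive_on E w" and f: "f \<in> l2 E w" and g: "g \<in> l2 E w"
    and eq: "\<And>h. h \<in> l2 E w \<Longrightarrow> l2_inner E w f h = l2_inner E w g h"
  shows "f = g"
proof (rule up_inject[OF w f g])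
  have "up E w f \<bullet> (up E w f - up E w g) = up E w g \<bullet> (up E w f - up E w g)"
    using eq[OF l2_diff(1)[OF w f g]] inner_up[OF w _ l2_diff(1)[OF w f g]] f g
    by (simp add: l2_diff(2)[OF w f g])
  then have "(up E w f - up E w g) \<bullet> (up E w f - up E w g) = 0"
    by (simp add: inner_diff_left)
  then show "up E w f = up E w g" by simp
qed

lemma l2_inner_commute: "l2_inner E w f g = l2_inner E w g f"
  by (simp add: l2_inner_def mult.commute)

lemma bounded_operator_l2: "bounded_operator E v w A \<Longrightarrow> f \<in> l2 E v \<Longrightarrow> A f \<in> l2 E w"
  by (simp add: bounded_operator_def)

lemma bounded_operator_scale:
  assumes "bounded_operator E v w A" "f \<in> l2 E v"
  shows "A (\<lambda>x. c * f x) = (\<lambda>x. c * A f x)"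
proof -
  have "A (\<lambda>x. c * f x + 0 * f x) = (\<lambda>x. c * A f x + 0 * A f x)"
    using assms unfolding bounded_operator_def by blast
  then show ?thesis by simp
qed

lemma bounded_operator_lift_iff:
  assumes v: "positive_on E v" and w: "positive_on E w" and A: "\<And>f. f \<in> l2 E v \<Longrightarrow> A f \<in> l2 E w"
    and L: "bounded_linear L" "\<And>f. f \<in> l2 E v \<Longrightarrow> up E w (A f) = L (up E v f)"
  shows "bounded_operator E v w A"
proof -
  obtain K where K: "\<And>x. norm (L x) \<le> norm x * K" using bounded_linear.bounded[OF L(1)] by blast
  note lin = bounded_linear.linear[OF L(1)]
  show ?thesis
    unfolding bounded_operator_def
  proof (intro conjI ballI allI exI)
    fix f g a b assume fg: "f \<in> l2 E v" "g \<in> l2 E v"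
    note c = l2_combination[OF v fg, of a b] and c' = l2_combination[OF w A[OF fg(1)] A[OF fg(2)], of a b]
    show "A (\<lambda>x. a * f x + b * g x) = (\<lambda>x. a * A f x + b * A g x)"
      by (rule up_inject[OF w A[OF c(1)] c'(1)])
        (simp add: L(2) c c' fg linear_add[OF lin] linear_scale[OF lin])
  next
    fix f assume "f \<in> l2 E v"
    then show "l2_norm E w (A f) \<le> K * l2_norm E v f"
      using K[of "up E v f"] by (simp add: l2_norm_up v w A L(2) mult.commute)
  qed (rule A)
qed

lemma bounded_operator_compose:
  assumes u: "positive_on E u" and v: "positive_on E v" and w: "positive_on E w"
    and A: "bounded_operator E u v A" and B: "bounded_operator E v w B"
  shows "bounded_operator E u w (\<lambda>f. B (A f))"
  by (rule bounded_operator_lift_iff[OF u w _ bounded_linear_compose[OF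
          lift_op_bounded_linear[OF v w B] lift_op_bounded_linear[OF u v A]]])
    (use A B bounded_operator_l2 in \<open>auto simp: lift_op_up u v\<close>)

lemma bounded_invertible_compose:
  assumes u: "positive_on E u" and v: "positive_on E v" and w: "positive_on E w"
    and A: "bounded_invertible E u v A" and B: "bounded_invertible E v w B"
  shows "bounded_invertible E u w (\<lambda>f. B (A f))"
proof -
  obtain A' where A': "bounded_operator E v u A'" "\<forall>f\<in>l2 E u. A' (A f) = f" "\<forall>g\<in>l2 E v. A (A' g) = g"
    and bA: "bounded_operator E u v A" using A unfolding bounded_invertible_def by blast
  obtain B' where B': "bounded_operator E w v B'" "\<forall>f\<in>l2 E v. B' (B f) = f" "\<forall>g\<in>l2 E w. B (B' g) = g"
    and bB: "bounded_operator E v w B" using B unfolding bounded_invertible_def by blast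
  show ?thesis
    unfolding bounded_invertible_def
    by (intro conjI exI[of _ "\<lambda>f. A' (B' f)"] bounded_operator_compose[OF u v w bA bB]
        bounded_operator_compose[OF w v u B'(1) A'(1)])
      (use A' B' bA bB bounded_operator_l2 in auto)
qed

text \<open>On \<open>E\<close> the map is multiplication by \<open>sqrt (v x) / sqrt (w x)\<close>,
  a unitary between the two weighted spaces. It lets an orthonormal basis for one weight serve for
  the other.\<close>

lemma weight_change_invertible:
  assumes v: "positive_on E v" and w: "positive_on E w"
  shows "bounded_invertible E v w (\<lambda>f. dn E w (up E v f))"
proof -
  have b: "bounded_operator E v w (\<lambda>f. dn E w (up E v f))" if "positive_on E v" "positive_on E w" for v w
    using unlift_op_bounded[OF that bounded_linear_ident] by (simp add: unlift_op_def[abs_def])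
  show ?thesis
    unfolding bounded_invertible_def
    by (intro conjI exI[of _ "\<lambda>f. dn E v (up E w f)"] b v w)
      (auto simp: v w up_dn dn_up up_supported)
qed

text \<open>\<open>l2_adjoint\<close> is a choice, so it has the desired properties as soon as some
  operator has them. The adjoint of the lift, brought back by \<open>unlift_op\<close>, is such an
  operator.\<close>

lemma l2_adjoint:
  assumes v: "positive_on E v" and w: "positive_on E w" and A: "bounded_operator E v w A"
  shows l2_adjoint_bounded: "bounded_operator E w v (l2_adjoint E v w A)"
    and l2_inner_adjoint: "\<And>f g. f \<in> l2 E v \<Longrightarrow> g \<in> l2 E w \<Longrightarrow>
      l2_inner E w (A f) g = l2_inner E v f (l2_adjoint E v w A g)"
proof -
  obtain A' where A': "bounded_linear A'" "\<And>f g. lift_op E v w A f \<bullet> g = f \<bullet> A' g"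
    using ell2_adjoint[OF lift_op_bounded_linear[OF v w A]] by blast
  \<comment> \<open>The lift kills \<open>delta x\<close> for \<open>x\<close> off \<open>E\<close>,
    so its adjoint produces no coordinate there.\<close>
  have supp: "A' g \<in> supported_on E" for g
  proof -
    have "coord (A' g) x = 0" if "x \<notin> E" for x
    proof -
      have "dn E v (delta x) = dn E v 0" using that by (auto simp: dn_def fun_eq_iff)
      then have "lift_op E v w A (delta x) = 0"
        using linear_0[OF bounded_linear.linear[OF lift_op_bounded_linear[OF v w A]]] by (simp add: lift_op_def)
      then show ?thesis using A'(2)[of "delta x" g] by simp
    qed
    then show ?thesis by (simp add: supported_on_def)
  qed
  have "\<exists>B. bounded_operator E w v B \<and>
     (\<forall>f\<in>l2 E v. \<forall>g\<in>l2 E w. l2_inner E w (A f) g = l2_inner E v f (B g))"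
  proof (intro exI[of _ "unlift_op E w v A'"] conjI ballI)
    show b: "bounded_operator E w v (unlift_op E w v A')" by (rule unlift_op_bounded[OF w v A'(1)])
    fix f g assume fg: "f \<in> l2 E v" "g \<in> l2 E w"
    have "l2_inner E w (A f) g = lift_op E v w A (up E v f) \<bullet> up E w g"
      using fg A by (simp add: lift_op_up v inner_up w bounded_operator_l2)
    also have "\<dots> = up E v f \<bullet> up E v (unlift_op E w v A' g)"
      using fg by (simp add: A' up_unlift_op[OF w v _ supp])
    also have "\<dots> = l2_inner E v f (unlift_op E w v A' g)"
      using fg by (simp add: inner_up v bounded_operator_l2[OF b])
    finally show "l2_inner E w (A f) g = l2_inner E v f (unlift_op E w v A' g)" .
  qed
  from someI_ex[OF this]
  show "bounded_operator E w v (l2_adjoint E v w A)"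
    "\<And>f g. f \<in> l2 E v \<Longrightarrow> g \<in> l2 E w \<Longrightarrow> l2_inner E w (A f) g = l2_inner E v f (l2_adjoint E v w A g)"
    unfolding l2_adjoint_def by blast+
qed

lemma lift_op_adjoint:
  assumes v: "positive_on E v" and w: "positive_on E w"
    and A: "bounded_operator E v w A" and B: "bounded_operator E w v B"
    and adj: "\<And>f g. f \<in> l2 E v \<Longrightarrow> g \<in> l2 E w \<Longrightarrow> l2_inner E w (A f) g = l2_inner E v f (B g)"
    and f: "f \<in> supported_on E" and g: "g \<in> supported_on E"
  shows "lift_op E v w A f \<bullet> g = f \<bullet> lift_op E w v B g"
proof -
  have "lift_op E v w A f \<bullet> g = up E w (A (dn E v f)) \<bullet> up E w (dn E w g)"
    using g w by (simp add: lift_op_def up_dn)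
  also have "\<dots> = up E v (dn E v f) \<bullet> up E v (B (dn E w g))"
    using A B v w by (simp add: inner_up dn_l2 bounded_operator_l2 adj)
  finally show ?thesis using f v by (simp add: lift_op_def up_dn)
qed

text \<open>The inverse of the adjoint is the adjoint of the inverse; both identities are tested
  against arbitrary vectors.\<close>

lemma bounded_invertible_adjoint:
  assumes v: "positive_on E v" and w: "positive_on E w" and A: "bounded_operator E v w A"
    and A': "bounded_operator E w v A'"
    and adj: "\<And>f g. f \<in> l2 E v \<Longrightarrow> g \<in> l2 E w \<Longrightarrow> l2_inner E w (A f) g = l2_inner E v f (A' g)"
    and inv: "bounded_invertible E v w A"
  shows "bounded_invertible E w v A'"
proof -
  obtain B where B: "bounded_operator E w v B" and BA: "\<And>f. f \<in> l2 E v \<Longrightarrow> B (A f) = f"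
    and AB: "\<And>g. g \<in> l2 E w \<Longrightarrow> A (B g) = g" using inv unfolding bounded_invertible_def by blast
  let ?B = "l2_adjoint E w v B"
  note B' = l2_adjoint[OF w v B]
  note in_l2 = bounded_operator_l2[OF A] bounded_operator_l2[OF B] bounded_operator_l2[OF A']
    bounded_operator_l2[OF B'(1)]
  have "A' (?B f) = f" if f: "f \<in> l2 E v" for f
  proof (rule l2_inner_eqI[OF v])
    fix h assume h: "h \<in> l2 E v"
    have "l2_inner E v h (A' (?B f)) = l2_inner E w (A h) (?B f)" using adj h f in_l2 by simp
    also have "\<dots> = l2_inner E v (B (A h)) f" using B'(2) h f in_l2 by simp
    finally show "l2_inner E v (A' (?B f)) h = l2_inner E v f h"
      using BA[OF h] by (simp add: l2_inner_commute)
  qed (use f in_l2 in auto)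
  moreover have "?B (A' f) = f" if f: "f \<in> l2 E w" for f
  proof (rule l2_inner_eqI[OF w])
    fix h assume h: "h \<in> l2 E w"
    have "l2_inner E w h (?B (A' f)) = l2_inner E v (B h) (A' f)" using B'(2) h f in_l2 by simp
    also have "\<dots> = l2_inner E w (A (B h)) f" using adj h f in_l2 by simp
    finally show "l2_inner E w (?B (A' f)) h = l2_inner E w f h"
      using AB[OF h] by (simp add: l2_inner_commute)
  qed (use f in_l2 in auto)
  ultimately show ?thesis
    unfolding bounded_invertible_def using A' B'(1) by blast
qed

lemma compact_operator_lift:
  assumes w: "positive_on E w" and A: "bounded_operator E w w A"
  shows "compact_operator E w A \<longleftrightarrow> compact_on (supported_on E) (lift_op E w w A)"
proof
  assume c: "compact_operator E w A"
  show "compact_on (supported_on E) (lift_op E w w A)"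
    unfolding compact_on_def
  proof (intro allI impI)
    fix f :: "nat \<Rightarrow> ell2" assume f: "\<forall>n. f n \<in> supported_on E \<and> norm (f n) \<le> 1"
    define F where "F = (\<lambda>n. dn E w (f n))"
    have "\<forall>n. F n \<in> l2 E w \<and> l2_norm E w (F n) \<le> 1"
      using f w by (simp add: F_def dn_l2 l2_norm_up up_dn)
    then obtain g s where g: "g \<in> l2 E w" "strict_mono s"
      "(\<lambda>n. l2_norm E w (\<lambda>x. A (F (s n)) x - g x)) \<longlonglongrightarrow> 0"
      using c unfolding compact_operator_def by meson
    have "l2_norm E w (\<lambda>x. A (F (s n)) x - g x) = norm (lift_op E w w A (f (s n)) - up E w g)" for n
      using bounded_operator_l2[OF A dn_l2[OF w]] g
      by (simp add: F_def l2_norm_up[OF w] l2_diff[OF w] lift_op_def)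
    with g(3) have "(\<lambda>n. norm (lift_op E w w A (f (s n)) - up E w g)) \<longlonglongrightarrow> 0" by simp
    then have "(\<lambda>n. lift_op E w w A (f (s n))) \<longlonglongrightarrow> up E w g"
      by (rule LIM_zero_cancel[OF tendsto_norm_zero_cancel])
    then show "\<exists>g\<in>supported_on E. \<exists>s. strict_mono s \<and> (\<lambda>n. lift_op E w w A (f (s n))) \<longlonglongrightarrow> g"
      using g up_supported[OF w] by blast
  qed
next
  assume c: "compact_on (supported_on E) (lift_op E w w A)"
  show "compact_operator E w A"
    unfolding compact_operator_def
  proof (intro conjI allI impI A)
    fix f :: "nat \<Rightarrow> int \<Rightarrow> real" assume f: "\<forall>n. f n \<in> l2 E w \<and> l2_norm E w (f n) \<le> 1"
    define F where "F = (\<lambda>n. up E w (f n))"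
    have "\<forall>n. F n \<in> supported_on E \<and> norm (F n) \<le> 1"
      using f by (simp add: F_def up_supported[OF w] l2_norm_up[OF w, symmetric])
    then obtain g s where g: "g \<in> supported_on E" "strict_mono s" "(\<lambda>n. lift_op E w w A (F (s n))) \<longlonglongrightarrow> g"
      using c unfolding compact_on_def by meson
    have "norm (lift_op E w w A (F (s n)) - g) = l2_norm E w (\<lambda>x. A (f (s n)) x - dn E w g x)" for n
      using f bounded_operator_l2[OF A] g
      by (simp add: F_def l2_norm_up[OF w] l2_diff[OF w] lift_op_up[OF w] dn_l2[OF w] up_dn[OF w])
    moreover have "(\<lambda>n. norm (lift_op E w w A (F (s n)) - g)) \<longlonglongrightarrow> 0"
      using g(3) by (simp add: LIM_zero_iff tendsto_norm_zero_iff)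
    ultimately show "\<exists>g\<in>l2 E w. \<exists>s. strict_mono s \<and> (\<lambda>n. l2_norm E w (\<lambda>x. A (f (s n)) x - g x)) \<longlonglongrightarrow> 0"
      using g(2) dn_l2[OF w, of g] by (intro bexI[of _ "dn E w g"] exI[of _ s]) auto
  qed
qed

lemma orthonormal_basis_up:
  assumes w: "positive_on E w" and e: "\<And>k. k \<in> index_set E \<Longrightarrow> e k \<in> l2 E w"
  shows "orthonormal_basis E w e \<longleftrightarrow> onb (supported_on E) (index_set E) (\<lambda>k. up E w (e k))"
proof -
  have 1: "biorthogonal E w e e \<longleftrightarrow> orthonormal_on (index_set E) (\<lambda>k. up E w (e k))"
    by (simp add: biorthogonal_def orthonormal_on_def inner_up[OF w] e)
  have 2: "(\<forall>f\<in>l2 E w. (\<forall>k\<in>index_set E. l2_inner E w f (e k) = 0) \<longrightarrow> f = (\<lambda>x. 0)) \<longleftrightarrow>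
     (\<forall>f\<in>supported_on E. (\<forall>k\<in>index_set E. f \<bullet> up E w (e k) = 0) \<longrightarrow> f = 0)" (is "?L \<longleftrightarrow> ?R")
  proof
    assume L: ?L
    show ?R
    proof (intro ballI impI)
      fix f assume f: "f \<in> supported_on E" "\<forall>k\<in>index_set E. f \<bullet> up E w (e k) = 0"
      have "\<forall>k\<in>index_set E. l2_inner E w (dn E w f) (e k) = 0"
        using f by (simp add: inner_up[OF w, symmetric] dn_l2[OF w] up_dn[OF w] e)
      then have "dn E w f = (\<lambda>x. 0)" using L dn_l2[OF w] by blast
      then show "f = 0" using up_dn[OF w f(1)] up_zero[OF w] by simp
    qed
  next
    assume R: ?R
    show ?L
    proof (intro ballI impI)
      fix f assume f: "f \<in> l2 E w" "\<forall>k\<in>index_set E. l2_inner E w f (e k) = 0"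
      then have "\<forall>k\<in>index_set E. up E w f \<bullet> up E w (e k) = 0" by (simp add: inner_up[OF w] e)
      then have "up E w f = 0" using R up_supported[OF w f(1)] by blast
      then show "f = (\<lambda>x. 0)" using up_inject[OF w f(1) l2_zero] up_zero[OF w] by simp
    qed
  qed
  show ?thesis unfolding orthonormal_basis_def onb_def 1 2 using e up_supported[OF w] by auto
qed

lemma orthonormal_basis_dn:
  assumes w: "positive_on E w" and e: "onb (supported_on E) (index_set E) e"
  shows "orthonormal_basis E w (\<lambda>k. dn E w (e k))"
proof -
  have "onb (supported_on E) (index_set E) (\<lambda>k. up E w (dn E w (e k)))"
    using e unfolding onb_def orthonormal_on_def by (simp add: up_dn[OF w])
  then show ?thesis using orthonormal_basis_up[OF w, of "\<lambda>k. dn E w (e k)"] dn_l2[OF w] by simp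
qed

lemma trace_class_lift:
  assumes w: "positive_on E w" and A: "bounded_operator E w w A" and A': "bounded_operator E w w A'"
    and adj: "\<And>f g. f \<in> l2 E w \<Longrightarrow> g \<in> l2 E w \<Longrightarrow> l2_inner E w (A f) g = l2_inner E w f (A' g)"
  shows "trace_class E w A \<longleftrightarrow>
    trace_class_on (supported_on E) (index_set E) (lift_op E w w A) (lift_op E w w A')"
proof -
  let ?H = "supported_on E" and ?I = "index_set E"
  note adj' = l2_adjoint[OF w w A]
  \<comment> \<open>On the space the chosen adjoint coincides with any \<open>A'\<close> satisfying
    the adjoint relation, so the explicit \<open>A'\<close> may replace it.\<close>
  have eq: "l2_adjoint E w w A f = A' f" if f: "f \<in> l2 E w" for f
  proof (rule l2_inner_eqI[OF w])
    fix h assume h: "h \<in> l2 E w"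
    show "l2_inner E w (l2_adjoint E w w A f) h = l2_inner E w (A' f) h"
      using adj[OF h f] adj'(2)[OF h f] by (simp add: l2_inner_commute)
  qed (use f bounded_operator_l2[OF adj'(1)] bounded_operator_l2[OF A'] in auto)
  have lift2: "lift_op E w w S (lift_op E w w T g) = up E w (S (T (dn E w g)))"
    if "bounded_operator E w w T" for S T g
    by (simp add: lift_op_def dn_up[OF w] bounded_operator_l2[OF that] dn_l2[OF w])
  show ?thesis
  proof
    assume "trace_class E w A"
    then obtain S e where S: "bounded_operator E w w S"
      and sym: "\<And>f g. f \<in> l2 E w \<Longrightarrow> g \<in> l2 E w \<Longrightarrow> l2_inner E w (S f) g = l2_inner E w f (S g)"
      and pos: "\<And>f. f \<in> l2 E w \<Longrightarrow> 0 \<le> l2_inner E w (S f) f"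
      and SS: "\<And>f. f \<in> l2 E w \<Longrightarrow> S (S f) = l2_adjoint E w w A (A f)"
      and e: "orthonormal_basis E w e" and sum: "(\<lambda>k. l2_inner E w (S (e k)) (e k)) summable_on ?I"
      unfolding trace_class_def by blast
    have el2: "e k \<in> l2 E w" if "k \<in> ?I" for k using e that by (simp add: orthonormal_basis_def)
    show "trace_class_on ?H ?I (lift_op E w w A) (lift_op E w w A')"
      unfolding trace_class_on_def
    proof (intro exI[of _ "lift_op E w w S"] conjI ballI)
      show "bounded_linear (lift_op E w w S)" by (rule lift_op_bounded_linear[OF w w S])
      show "lift_op E w w S f \<in> ?H" for f by (rule lift_op_supported[OF w w S])
      show "lift_op E w w S f \<bullet> g = f \<bullet> lift_op E w w S g" if "f \<in> ?H" "g \<in> ?H" for f g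
        by (rule lift_op_adjoint[OF w w S S sym that])
      show "0 \<le> lift_op E w w S f \<bullet> f" if "f \<in> ?H" for f
      proof -
        have "lift_op E w w S f \<bullet> f = up E w (S (dn E w f)) \<bullet> up E w (dn E w f)"
          using that by (simp add: lift_op_def up_dn[OF w])
        also have "\<dots> = l2_inner E w (S (dn E w f)) (dn E w f)"
          by (rule inner_up[OF w bounded_operator_l2[OF S dn_l2[OF w]] dn_l2[OF w]])
        finally show ?thesis using pos[OF dn_l2[OF w]] by simp
      qed
      show "lift_op E w w S (lift_op E w w S f) = lift_op E w w A' (lift_op E w w A f)" for f
        unfolding lift2[OF S] lift2[OF A]
        by (simp add: SS dn_l2[OF w] eq bounded_operator_l2[OF A])
      have "(\<lambda>k. lift_op E w w S (up E w (e k)) \<bullet> up E w (e k)) summable_on ?I"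
        using sum by (rule summable_on_cong[THEN iffD1, rotated])
          (simp add: el2 lift_op_up[OF w] inner_up[OF w] bounded_operator_l2[OF S])
      then show "\<exists>e. onb ?H ?I e \<and> (\<lambda>k. lift_op E w w S (e k) \<bullet> e k) summable_on ?I"
        using e orthonormal_basis_up[OF w el2] by (intro exI[of _ "\<lambda>k. up E w (e k)"]) auto
    qed
  next
    assume "trace_class_on ?H ?I (lift_op E w w A) (lift_op E w w A')"
    then obtain S e where S: "bounded_linear S" and SH: "\<And>f. f \<in> ?H \<Longrightarrow> S f \<in> ?H"
      and sym: "\<And>f g. f \<in> ?H \<Longrightarrow> g \<in> ?H \<Longrightarrow> S f \<bullet> g = f \<bullet> S g"
      and pos: "\<And>f. f \<in> ?H \<Longrightarrow> 0 \<le> S f \<bullet> f"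
      and SS: "\<And>f. f \<in> ?H \<Longrightarrow> S (S f) = lift_op E w w A' (lift_op E w w A f)"
      and e: "onb ?H ?I e" and sum: "(\<lambda>k. S (e k) \<bullet> e k) summable_on ?I"
      unfolding trace_class_on_def by blast
    let ?S = "unlift_op E w w S"
    have b: "bounded_operator E w w ?S" by (rule unlift_op_bounded[OF w w S])
    have upS: "up E w (?S f) = S (up E w f)" if "f \<in> l2 E w" for f
      by (rule up_unlift_op[OF w w that]) (rule SH[OF up_supported[OF w that]])
    note in_l2 = bounded_operator_l2[OF b] bounded_operator_l2[OF A] bounded_operator_l2[OF A'] dn_l2[OF w]
    show "trace_class E w A"
      unfolding trace_class_def
    proof (intro exI[of _ ?S] conjI ballI A b)
      show "l2_inner E w (?S f) g = l2_inner E w f (?S g)" if "f \<in> l2 E w" "g \<in> l2 E w" for f g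
        using that sym up_supported[OF w] by (simp add: inner_up[OF w, symmetric] in_l2 upS)
      show "0 \<le> l2_inner E w (?S f) f" if "f \<in> l2 E w" for f
        using that pos up_supported[OF w] by (simp add: inner_up[OF w, symmetric] in_l2 upS)
      show "?S (?S f) = l2_adjoint E w w A (A f)" if f: "f \<in> l2 E w" for f
      proof (rule up_inject[OF w])
        show "up E w (?S (?S f)) = up E w (l2_adjoint E w w A (A f))"
          using f up_supported[OF w f] by (simp add: upS in_l2 SS eq lift2[OF A] dn_up[OF w])
      qed (use f in_l2 eq in auto)
      have eH: "e k \<in> ?H" if "k \<in> ?I" for k using e that by (simp add: onb_def)
      have "(\<lambda>k. l2_inner E w (?S (dn E w (e k))) (dn E w (e k))) summable_on ?I"
        using sum by (rule summable_on_cong[THEN iffD1, rotated])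
          (simp add: inner_up[OF w, symmetric] in_l2 upS up_dn[OF w] eH)
      then show "\<exists>e. orthonormal_basis E w e \<and> (\<lambda>k. l2_inner E w (?S (e k)) (e k)) summable_on ?I"
        using orthonormal_basis_dn[OF w e] by blast
    qed
  qed
qed

section \<open>Transition matrices as operators\<close>

lemma mat_op_cong:
  "(\<And>x y. x \<in> E \<Longrightarrow> y \<in> E \<Longrightarrow> p x y = p' x y) \<Longrightarrow> mat_op E p f = mat_op E p' f"
  by (auto simp: mat_op_def fun_eq_iff intro!: infsum_cong)

lemma reference_positive_on: "reference_measure E p \<pi> \<Longrightarrow> positive_on E \<pi>"
  by (simp add: reference_measure_def positive_on_def)

text \<open>Reversal exchanges the two hypotheses: excessiveness of \<open>\<pi>\<close> for
  \<open>p\<close> bounds the rows of the reversal, and the row sums of \<open>p\<close> make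
  \<open>\<pi>\<close> excessive for it.\<close>

lemma time_reversal_sub_markov:
  assumes p: "sub_markov E p" and \<pi>: "reference_measure E p \<pi>"
  shows "sub_markov E (time_reversal \<pi> p)" "reference_measure E (time_reversal \<pi> p) \<pi>"
proof -
  have pos: "0 < \<pi> x" if "x \<in> E" for x using \<pi> that by (simp add: reference_measure_def)
  have p0: "0 \<le> p x y" if "x \<in> E" "y \<in> E" for x y using p that by (simp add: sub_markov_def)
  have col: "(\<lambda>y. \<pi> y * p y x) summable_on E" "(\<Sum>\<^sub>\<infinity>y\<in>E. \<pi> y * p y x) \<le> \<pi> x" if "x \<in> E" for x
    using \<pi> that by (auto simp: reference_measure_def)
  have row: "p x summable_on E" "infsum (p x) E \<le> 1" if "x \<in> E" for x
    using p that by (auto simp: sub_markov_def)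
  have tr: "time_reversal \<pi> p x = (\<lambda>y. (1 / \<pi> x) * (\<pi> y * p y x))" for x
    by (simp add: time_reversal_def fun_eq_iff)
  show "sub_markov E (time_reversal \<pi> p)"
    unfolding sub_markov_def
  proof (intro conjI ballI)
    fix x assume x: "x \<in> E"
    show "0 \<le> time_reversal \<pi> p x y" if "y \<in> E" for y
      using pos p0 x that by (simp add: time_reversal_def less_imp_le)
    show "time_reversal \<pi> p x summable_on E" unfolding tr by (rule summable_on_cmult_right[OF col(1)[OF x]])
    have "infsum (time_reversal \<pi> p x) E = (1 / \<pi> x) * (\<Sum>\<^sub>\<infinity>y\<in>E. \<pi> y * p y x)"
      unfolding tr by (rule infsum_cmult_right')
    also have "\<dots> \<le> (1 / \<pi> x) * \<pi> x" using pos[OF x] by (intro mult_left_mono col x) auto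
    finally show "infsum (time_reversal \<pi> p x) E \<le> 1" using pos[OF x] by simp
  qed
  show "reference_measure E (time_reversal \<pi> p) \<pi>"
    unfolding reference_measure_def
  proof (intro conjI ballI)
    fix y assume y: "y \<in> E"
    have 1: "(\<lambda>x. \<pi> x * time_reversal \<pi> p x y) summable_on E \<longleftrightarrow> (\<lambda>x. \<pi> y * p y x) summable_on E"
      by (rule summable_on_cong) (simp add: time_reversal_def pos less_imp_neq[OF pos, symmetric])
    have 2: "(\<Sum>\<^sub>\<infinity>x\<in>E. \<pi> x * time_reversal \<pi> p x y) = (\<Sum>\<^sub>\<infinity>x\<in>E. \<pi> y * p y x)"
      by (rule infsum_cong) (simp add: time_reversal_def less_imp_neq[OF pos, symmetric])
    show "(\<lambda>x. \<pi> x * time_reversal \<pi> p x y) summable_on E"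
      unfolding 1 using row(1)[OF y] by (rule summable_on_cmult_right)
    have "\<pi> y * infsum (p y) E \<le> \<pi> y * 1" using pos[OF y] by (intro mult_left_mono row y) auto
    then show "(\<Sum>\<^sub>\<infinity>x\<in>E. \<pi> x * time_reversal \<pi> p x y) \<le> \<pi> y"
      unfolding 2 by (simp add: infsum_cmult_right')
  qed (rule pos)
qed

context
  fixes E :: "int set" and p :: matrix and \<pi> :: "int \<Rightarrow> real"
  assumes p: "sub_markov E p" and \<pi>: "reference_measure E p \<pi>"
begin

private lemma pos: "x \<in> E \<Longrightarrow> 0 < \<pi> x" using \<pi> by (simp add: reference_measure_def)
private lemma p0: "x \<in> E \<Longrightarrow> y \<in> E \<Longrightarrow> 0 \<le> p x y" using p by (simp add: sub_markov_def)
private lemma w: "positive_on E \<pi>" by (rule reference_positive_on[OF \<pi>])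

private lemma sum_l2_le: "f \<in> l2 E \<pi> \<Longrightarrow> finite F \<Longrightarrow> F \<subseteq> E \<Longrightarrow> (\<Sum>x\<in>F. (f x)\<^sup>2 * \<pi> x) \<le> l2_inner E \<pi> f f"
  unfolding l2_inner_def power2_eq_square
  by (rule finite_sum_le_infsum) (use pos in \<open>auto simp: l2_def power2_eq_square less_imp_le\<close>)

text \<open>Schur's test: the product \<open>f y * g x\<close> is bounded by half the sum of the
  squares. Column sums weighted by \<open>\<pi>\<close> control the part with \<open>f\<close>, and
  row sums control the part with \<open>g\<close>. The estimate holds for absolute values and so
  permits exchanging the sums later.\<close>

lemma kernel_bound:
  assumes f: "f \<in> l2 E \<pi>" and g: "g \<in> l2 E \<pi>"
  shows kernel_summable: "(\<lambda>(x, y). \<pi> x * p x y * f y * g x) summable_on E \<times> E"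
    and kernel_le: "(\<Sum>\<^sub>\<infinity>(x, y)\<in>E \<times> E. \<pi> x * p x y * f y * g x) \<le> (l2_inner E \<pi> f f + l2_inner E \<pi> g g) / 2"
proof -
  let ?k = "\<lambda>(x, y). \<pi> x * p x y * f y * g x"
  have col: "(\<Sum>x\<in>F. \<pi> x * p x y) \<le> \<pi> y" if "finite F" "F \<subseteq> E" "y \<in> E" for F y
    using \<pi> that pos p0 unfolding reference_measure_def
    by (intro order_trans[OF finite_sum_le_infsum[of _ E F]]) (auto simp: subset_iff less_imp_le)
  have row: "(\<Sum>y\<in>G. p x y) \<le> 1" if "finite G" "G \<subseteq> E" "x \<in> E" for G x
    using p that p0 unfolding sub_markov_def
    by (intro order_trans[OF finite_sum_le_infsum[of _ E G]]) (auto simp: subset_iff)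
  have bound: "(\<Sum>z\<in>S. norm (?k z)) \<le> (l2_inner E \<pi> f f + l2_inner E \<pi> g g) / 2"
    if S: "finite S" "S \<subseteq> E \<times> E" for S
  proof -
    let ?F = "fst ` S" and ?G = "snd ` S"
    have FG: "finite ?F" "finite ?G" "?F \<subseteq> E" "?G \<subseteq> E" using S by auto
    \<comment> \<open>The finite set of pairs is enlarged to a rectangle, where row and column sums
      separate.\<close>
    have "(\<Sum>z\<in>S. norm (?k z)) \<le> (\<Sum>z\<in>?F \<times> ?G. norm (?k z))"
      by (rule sum_mono2[OF _ subset_fst_snd]) (use FG in auto)
    also have "\<dots> \<le> (\<Sum>(x, y)\<in>?F \<times> ?G. \<pi> x * p x y * ((f y)\<^sup>2 + (g x)\<^sup>2) / 2)"
    proof (rule sum_mono)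
      fix z assume "z \<in> ?F \<times> ?G"
      then obtain x y where z: "z = (x, y)" "x \<in> E" "y \<in> E" by (metis FG(3,4) SigmaE subsetD)
      have "\<bar>f y * g x\<bar> \<le> ((f y)\<^sup>2 + (g x)\<^sup>2) / 2"
        using sum_squares_bound[of "\<bar>f y\<bar>" "\<bar>g x\<bar>"] by (simp add: abs_mult)
      then have "\<pi> x * p x y * \<bar>f y * g x\<bar> \<le> \<pi> x * p x y * (((f y)\<^sup>2 + (g x)\<^sup>2) / 2)"
        using z pos p0 by (intro mult_left_mono) (auto simp: less_imp_le)
      then show "norm (?k z) \<le> (case z of (x, y) \<Rightarrow> \<pi> x * p x y * ((f y)\<^sup>2 + (g x)\<^sup>2) / 2)"
        using z pos p0 by (simp add: abs_mult mult.assoc less_imp_le)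
    qed
    also have "\<dots> = ((\<Sum>y\<in>?G. (\<Sum>x\<in>?F. \<pi> x * p x y) * (f y)\<^sup>2) + (\<Sum>x\<in>?F. \<pi> x * (g x)\<^sup>2 * (\<Sum>y\<in>?G. p x y))) / 2"
    proof -
      have "(\<Sum>(x, y)\<in>?F \<times> ?G. \<pi> x * p x y * ((f y)\<^sup>2 + (g x)\<^sup>2) / 2) =
        (\<Sum>x\<in>?F. \<Sum>y\<in>?G. \<pi> x * p x y * (f y)\<^sup>2) / 2 + (\<Sum>x\<in>?F. \<Sum>y\<in>?G. \<pi> x * (g x)\<^sup>2 * p x y) / 2"
        by (simp add: sum.cartesian_product[symmetric] sum_divide_distrib sum.distrib[symmetric] algebra_simps add_divide_distrib)
      also have "(\<Sum>x\<in>?F. \<Sum>y\<in>?G. \<pi> x * p x y * (f y)\<^sup>2) = (\<Sum>y\<in>?G. (\<Sum>x\<in>?F. \<pi> x * p x y) * (f y)\<^sup>2)"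
        by (subst sum.swap) (simp add: sum_distrib_right)
      finally show ?thesis by (simp add: sum_distrib_left add_divide_distrib)
    qed
    also have "\<dots> \<le> ((\<Sum>y\<in>?G. \<pi> y * (f y)\<^sup>2) + (\<Sum>x\<in>?F. \<pi> x * (g x)\<^sup>2 * 1)) / 2"
      using FG col row pos by (intro divide_right_mono add_mono sum_mono mult_right_mono mult_left_mono)
        (auto simp: subset_iff less_imp_le)
    also have "\<dots> \<le> (l2_inner E \<pi> f f + l2_inner E \<pi> g g) / 2"
      using sum_l2_le[OF f FG(2,4)] sum_l2_le[OF g FG(1,3)] by (simp add: mult.commute)
    finally show ?thesis .
  qed
  have "(\<lambda>z. norm (?k z)) summable_on E \<times> E"
    by (rule summable_on_real_bounded(1)[OF _ bound]) auto
  then show 1: "?k summable_on E \<times> E" by (rule abs_summable_summable)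
  show "infsum ?k (E \<times> E) \<le> (l2_inner E \<pi> f f + l2_inner E \<pi> g g) / 2"
  proof (rule infsum_le_finite_sums[OF 1])
    fix S assume S: "finite S" "S \<subseteq> E \<times> E"
    have "sum ?k S \<le> (\<Sum>z\<in>S. norm (?k z))" by (rule sum_mono) auto
    with bound[OF S] show "sum ?k S \<le> (l2_inner E \<pi> f f + l2_inner E \<pi> g g) / 2" by linarith
  qed
qed

lemma finite_support_l2:
  assumes "finite F" "F \<subseteq> E" "\<And>x. x \<notin> F \<Longrightarrow> g x = 0"
  shows "g \<in> l2 E \<pi>" "l2_inner E \<pi> f g = (\<Sum>x\<in>F. f x * g x * \<pi> x)"
proof -
  show "g \<in> l2 E \<pi>"
    unfolding l2_def
    using assms(2,3)
    by (auto intro!: finite_nonzero_values_imp_summable_on finite_subset[OF _ assms(1)]) (metis assms(3))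
  show "l2_inner E \<pi> f g = (\<Sum>x\<in>F. f x * g x * \<pi> x)"
    unfolding l2_inner_def
    by (rule infsumI, rule has_sum_finite_neutralI[of F]) (use assms in auto)
qed

lemma mat_op_row_summable:
  assumes f: "f \<in> l2 E \<pi>" and x: "x \<in> E"
  shows "(\<lambda>y. p x y * f y) summable_on E"
proof -
  define g where "g = (\<lambda>z. if z = x then 1 else (0::real))"
  have g: "g \<in> l2 E \<pi>" by (rule finite_support_l2(1)[of "{x}"]) (use x in \<open>auto simp: g_def\<close>)
  have "(\<lambda>y. \<pi> x * p x y * f y * g x) summable_on E"
    using summable_on_SigmaD1[OF kernel_summable[OF f g] x] .
  then have "(\<lambda>y. (1 / \<pi> x) * (\<pi> x * p x y * f y * g x)) summable_on E" by (rule summable_on_cmult_right)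
  then show ?thesis using pos[OF x] by (simp add: g_def)
qed

lemma mat_op_inner_kernel:
  assumes f: "f \<in> l2 E \<pi>" and g: "g \<in> l2 E \<pi>"
  shows "l2_inner E \<pi> (mat_op E p f) g = (\<Sum>\<^sub>\<infinity>(x, y)\<in>E \<times> E. \<pi> x * p x y * f y * g x)"
proof -
  have "l2_inner E \<pi> (mat_op E p f) g = (\<Sum>\<^sub>\<infinity>x\<in>E. \<Sum>\<^sub>\<infinity>y\<in>E. \<pi> x * p x y * f y * g x)"
    unfolding l2_inner_def
  proof (rule infsum_cong)
    fix x assume x: "x \<in> E"
    have "(\<Sum>\<^sub>\<infinity>y\<in>E. \<pi> x * p x y * f y * g x) = (\<Sum>\<^sub>\<infinity>y\<in>E. (\<pi> x * g x) * (p x y * f y))"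
      by (rule infsum_cong) simp
    also have "\<dots> = (\<pi> x * g x) * (\<Sum>\<^sub>\<infinity>y\<in>E. p x y * f y)" by (rule infsum_cmult_right')
    finally show "mat_op E p f x * g x * \<pi> x = (\<Sum>\<^sub>\<infinity>y\<in>E. \<pi> x * p x y * f y * g x)"
      using x by (simp add: mat_op_def)
  qed
  then show ?thesis using infsum_Sigma'_banach[OF kernel_summable[OF f g]] by simp
qed

lemma mat_op_adjoint:
  assumes f: "f \<in> l2 E \<pi>" and g: "g \<in> l2 E \<pi>"
  shows "l2_inner E \<pi> (mat_op E p f) g = l2_inner E \<pi> f (mat_op E (time_reversal \<pi> p) g)"
proof -
  have "l2_inner E \<pi> (mat_op E p f) g = (\<Sum>\<^sub>\<infinity>x\<in>E. \<Sum>\<^sub>\<infinity>y\<in>E. \<pi> x * p x y * f y * g x)"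
    unfolding mat_op_inner_kernel[OF f g] using infsum_Sigma'_banach[OF kernel_summable[OF f g]] by simp
  also have "\<dots> = (\<Sum>\<^sub>\<infinity>y\<in>E. \<Sum>\<^sub>\<infinity>x\<in>E. \<pi> x * p x y * f y * g x)"
    by (rule infsum_swap_banach[OF kernel_summable[OF f g]])
  also have "\<dots> = l2_inner E \<pi> f (mat_op E (time_reversal \<pi> p) g)"
    unfolding l2_inner_def
  proof (rule infsum_cong)
    fix y assume y: "y \<in> E"
    have "(\<Sum>\<^sub>\<infinity>x\<in>E. \<pi> x * p x y * f y * g x) = (\<Sum>\<^sub>\<infinity>x\<in>E. (f y * \<pi> y) * (time_reversal \<pi> p y x * g x))"
      by (rule infsum_cong) (use pos[OF y] in \<open>simp add: time_reversal_def\<close>)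
    also have "\<dots> = (f y * \<pi> y) * (\<Sum>\<^sub>\<infinity>x\<in>E. time_reversal \<pi> p y x * g x)" by (rule infsum_cmult_right')
    finally show "(\<Sum>\<^sub>\<infinity>x\<in>E. \<pi> x * p x y * f y * g x) = f y * mat_op E (time_reversal \<pi> p) g y * \<pi> y"
      using y by (simp add: mat_op_def)
  qed
  finally show ?thesis .
qed

lemma mat_op_bounded: "bounded_operator E \<pi> \<pi> (mat_op E p)"
proof -
  have contr: "(\<Sum>x\<in>F. (mat_op E p f x)\<^sup>2 * \<pi> x) \<le> l2_inner E \<pi> f f"
    if f: "f \<in> l2 E \<pi>" and F: "finite F" "F \<subseteq> E" for f F
  proof -
    \<comment> \<open>Testing against the truncation of the image gives \<open>(norm g)\<^sup>2
      \<le> ((norm f)\<^sup>2 + (norm g)\<^sup>2) / 2\<close> in the weighted norms. This yields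
      contractivity before the image is known to lie in the space.\<close>
    define g where "g = (\<lambda>x. if x \<in> F then mat_op E p f x else 0)"
    have g: "g \<in> l2 E \<pi>" and ig: "\<And>h. l2_inner E \<pi> h g = (\<Sum>x\<in>F. h x * g x * \<pi> x)"
      using finite_support_l2[OF F, of g] by (auto simp: g_def)
    have "(\<Sum>x\<in>F. (mat_op E p f x)\<^sup>2 * \<pi> x) = l2_inner E \<pi> (mat_op E p f) g"
      unfolding ig by (rule sum.cong) (auto simp: g_def power2_eq_square)
    also have "\<dots> \<le> (l2_inner E \<pi> f f + l2_inner E \<pi> g g) / 2"
      unfolding mat_op_inner_kernel[OF f g] by (rule kernel_le[OF f g])
    also have "l2_inner E \<pi> g g = (\<Sum>x\<in>F. (mat_op E p f x)\<^sup>2 * \<pi> x)"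
      unfolding ig by (rule sum.cong) (auto simp: g_def power2_eq_square)
    finally show ?thesis by simp
  qed
  have sq: "(\<lambda>x. (mat_op E p f x)\<^sup>2 * \<pi> x) summable_on E"
    "(\<Sum>\<^sub>\<infinity>x\<in>E. (mat_op E p f x)\<^sup>2 * \<pi> x) \<le> l2_inner E \<pi> f f" if "f \<in> l2 E \<pi>" for f
    by (rule summable_on_real_bounded[OF _ contr[OF that]], use pos in \<open>auto simp: less_imp_le\<close>)+
  show ?thesis
    unfolding bounded_operator_def
  proof (intro conjI ballI allI exI[of _ 1])
    show "mat_op E p f \<in> l2 E \<pi>" if "f \<in> l2 E \<pi>" for f
      using sq(1)[OF that] by (simp add: l2_def mat_op_def)
    show "mat_op E p (\<lambda>x. a * f x + b * g x) = (\<lambda>x. a * mat_op E p f x + b * mat_op E p g x)"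
      if fg: "f \<in> l2 E \<pi>" "g \<in> l2 E \<pi>" for f g a b
    proof
      fix x
      show "mat_op E p (\<lambda>x. a * f x + b * g x) x = a * mat_op E p f x + b * mat_op E p g x"
      proof (cases "x \<in> E")
        case True
        have "(\<Sum>\<^sub>\<infinity>y\<in>E. p x y * (a * f y + b * g y)) = (\<Sum>\<^sub>\<infinity>y\<in>E. a * (p x y * f y) + b * (p x y * g y))"
          by (rule infsum_cong) (simp add: algebra_simps)
        also have "\<dots> = (\<Sum>\<^sub>\<infinity>y\<in>E. a * (p x y * f y)) + (\<Sum>\<^sub>\<infinity>y\<in>E. b * (p x y * g y))"
          by (intro infsum_add summable_on_cmult_right mat_op_row_summable fg True)
        finally show ?thesis using True by (simp add: mat_op_def infsum_cmult_right')
      qed (simp add: mat_op_def)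
    qed
    show "l2_norm E \<pi> (mat_op E p f) \<le> 1 * l2_norm E \<pi> f" if "f \<in> l2 E \<pi>" for f
      using sq(2)[OF that] by (simp add: l2_norm_def l2_inner_def power2_eq_square)
  qed
qed

end

lemma reversible_reference:
  assumes q: "sub_markov E q" and \<kappa>: "reversible_measure E q \<kappa>"
  shows "reference_measure E q \<kappa>"
  unfolding reference_measure_def
proof (intro conjI ballI)
  have pos: "0 < \<kappa> x" if "x \<in> E" for x using \<kappa> that by (simp add: reversible_measure_def)
  then show "0 < \<kappa> x" if "x \<in> E" for x using that .
  fix y assume y: "y \<in> E"
  have row: "q y summable_on E" "infsum (q y) E \<le> 1" using q y by (auto simp: sub_markov_def)
  have 1: "(\<lambda>x. \<kappa> x * q x y) summable_on E \<longleftrightarrow> (\<lambda>x. \<kappa> y * q y x) summable_on E"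
    by (rule summable_on_cong) (use \<kappa> y in \<open>simp add: reversible_measure_def\<close>)
  have 2: "(\<Sum>\<^sub>\<infinity>x\<in>E. \<kappa> x * q x y) = (\<Sum>\<^sub>\<infinity>x\<in>E. \<kappa> y * q y x)"
    by (rule infsum_cong) (use \<kappa> y in \<open>simp add: reversible_measure_def\<close>)
  show "(\<lambda>x. \<kappa> x * q x y) summable_on E" unfolding 1 by (rule summable_on_cmult_right[OF row(1)])
  have "\<kappa> y * infsum (q y) E \<le> \<kappa> y * 1" using pos[OF y] by (intro mult_left_mono row) auto
  then show "(\<Sum>\<^sub>\<infinity>x\<in>E. \<kappa> x * q x y) \<le> \<kappa> y" unfolding 2 by (simp add: infsum_cmult_right')
qed

lemma reversible_self_adjoint:
  assumes q: "sub_markov E q" and \<kappa>: "reversible_measure E q \<kappa>" and f: "f \<in> l2 E \<kappa>" and g: "g \<in> l2 E \<kappa>"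
  shows "l2_inner E \<kappa> (mat_op E q f) g = l2_inner E \<kappa> f (mat_op E q g)"
proof -
  have "mat_op E (time_reversal \<kappa> q) g = mat_op E q g"
    by (rule mat_op_cong) (use \<kappa> in \<open>auto simp: time_reversal_def reversible_measure_def field_simps\<close>)
  then show ?thesis using mat_op_adjoint[OF q reversible_reference[OF q \<kappa>] f g] by simp
qed

section \<open>Similarity\<close>

lemma similar_via_inverse:
  assumes v: "positive_on E v" and w: "positive_on E w"
    and a: "bounded_operator E v v (mat_op E a)" and b: "bounded_operator E w w (mat_op E b)"
    and sim: "similar_via E a v b w A"
  obtains B where "bounded_operator E w v A" "bounded_operator E v w B" "similar_via E b w a v B"
    "\<And>f. f \<in> l2 E w \<Longrightarrow> B (A f) = f" "\<And>g. g \<in> l2 E v \<Longrightarrow> A (B g) = g"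
proof -
  have A: "bounded_operator E w v A" and inter: "\<And>f. f \<in> l2 E w \<Longrightarrow> mat_op E a (A f) = A (mat_op E b f)"
    using sim by (auto simp: similar_via_def bounded_invertible_def)
  obtain B where B: "bounded_operator E v w B" and BA: "\<And>f. f \<in> l2 E w \<Longrightarrow> B (A f) = f"
    and AB: "\<And>g. g \<in> l2 E v \<Longrightarrow> A (B g) = g"
    using sim unfolding similar_via_def bounded_invertible_def by blast
  have "mat_op E b (B f) = B (mat_op E a f)" if f: "f \<in> l2 E v" for f
  proof -
    have "mat_op E a f = A (mat_op E b (B f))"
      using inter[OF bounded_operator_l2[OF B f]] AB[OF f] by simp
    then show ?thesis using BA[OF bounded_operator_l2[OF b bounded_operator_l2[OF B f]]] by simp
  qed
  moreover have "bounded_invertible E v w B"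
    unfolding bounded_invertible_def using A B AB BA by blast
  ultimately have "similar_via E b w a v B" by (simp add: similar_via_def)
  with that A B BA AB show ?thesis by blast
qed

text \<open>Adjoints are taken on both sides of \<open>a A = A b\<close>. With separate adjoint
  matrices \<open>a'\<close> and \<open>b'\<close> the same lemma serves both directions of the
  duality, the reversal standing on either side.\<close>

lemma similar_via_adjoint:
  assumes v: "positive_on E v" and w: "positive_on E w"
    and A: "bounded_operator E w v A" and A': "bounded_operator E v w A'"
    and adjA: "\<And>f g. f \<in> l2 E w \<Longrightarrow> g \<in> l2 E v \<Longrightarrow> l2_inner E v (A f) g = l2_inner E w f (A' g)"
    and a: "bounded_operator E v v (mat_op E a)" and a': "bounded_operator E v v (mat_op E a')"
    and adja: "\<And>f g. f \<in> l2 E v \<Longrightarrow> g \<in> l2 E v \<Longrightarrow> l2_inner E v (mat_op E a f) g = l2_inner E v f (mat_op E a' g)"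
    and b: "bounded_operator E w w (mat_op E b)" and b': "bounded_operator E w w (mat_op E b')"
    and adjb: "\<And>f g. f \<in> l2 E w \<Longrightarrow> g \<in> l2 E w \<Longrightarrow> l2_inner E w (mat_op E b f) g = l2_inner E w f (mat_op E b' g)"
    and sim: "similar_via E a v b w A"
  shows "similar_via E b' w a' v A'"
  unfolding similar_via_def
proof (intro conjI ballI)
  note in_l2 = bounded_operator_l2[OF A] bounded_operator_l2[OF A'] bounded_operator_l2[OF a]
    bounded_operator_l2[OF a'] bounded_operator_l2[OF b] bounded_operator_l2[OF b']
  have inter: "mat_op E a (A f) = A (mat_op E b f)" if "f \<in> l2 E w" for f
    using sim that by (simp add: similar_via_def)
  show "bounded_invertible E v w A'"
    using sim by (intro bounded_invertible_adjoint[OF w v A A' adjA]) (auto simp: similar_via_def)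
  fix f assume f: "f \<in> l2 E v"
  show "mat_op E b' (A' f) = A' (mat_op E a' f)"
  proof (rule l2_inner_eqI[OF w])
    fix h assume h: "h \<in> l2 E w"
    have "l2_inner E w h (mat_op E b' (A' f)) = l2_inner E v (A (mat_op E b h)) f"
      using h f by (simp add: adjb[symmetric] adjA in_l2)
    also have "\<dots> = l2_inner E w h (A' (mat_op E a' f))"
      using h f by (simp add: inter[symmetric] adja adjA in_l2)
    finally show "l2_inner E w (mat_op E b' (A' f)) h = l2_inner E w (A' (mat_op E a' f)) h"
      by (simp add: l2_inner_commute)
  qed (use f in_l2 in auto)
qed

lemma lift_similar:
  assumes v: "positive_on E v" and w: "positive_on E w"
    and b: "bounded_operator E w w (mat_op E b)" and B: "bounded_operator E v w B"
    and AB: "\<And>g. g \<in> l2 E v \<Longrightarrow> A (B g) = g" and sim: "similar_via E a v b w A"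
  shows "lift_op E v v (mat_op E a) f = lift_op E w v A (lift_op E w w (mat_op E b) (lift_op E v w B f))"
proof -
  let ?g = "dn E v f"
  have g: "B ?g \<in> l2 E w" by (rule bounded_operator_l2[OF B dn_l2[OF v]])
  have "mat_op E a ?g = mat_op E a (A (B ?g))" using AB[OF dn_l2[OF v]] by simp
  also have "\<dots> = A (mat_op E b (B ?g))" using sim g by (simp add: similar_via_def)
  finally show ?thesis
    by (simp add: lift_op_def dn_up[OF w g] dn_up[OF w bounded_operator_l2[OF b g]])
qed

lemma compact_similar:
  assumes v: "positive_on E v" and w: "positive_on E w"
    and a: "bounded_operator E v v (mat_op E a)" and b: "bounded_operator E w w (mat_op E b)"
    and sim: "similar_via E a v b w A" and c: "compact_operator E w (mat_op E b)"
  shows "compact_operator E v (mat_op E a)"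
proof -
  obtain B where A: "bounded_operator E w v A" and B: "bounded_operator E v w B" and "similar_via E b w a v B"
    and "\<And>f. f \<in> l2 E w \<Longrightarrow> B (A f) = f" and AB: "\<And>g. g \<in> l2 E v \<Longrightarrow> A (B g) = g"
    by (rule similar_via_inverse[OF v w a b sim]) (rule that)
  have "compact_on (supported_on E) (lift_op E v v (mat_op E a))"
  proof (rule compact_on_compose[where A = "lift_op E w w (mat_op E b)" and B = "lift_op E w v A" and C = "lift_op E v w B"])
    show "compact_on (supported_on E) (lift_op E w w (mat_op E b))"
      using c by (simp add: compact_operator_lift[OF w b])
  qed (rule subspace_supported_on lift_op_bounded_linear[OF w w b] lift_op_bounded_linear[OF w v A]
      lift_op_supported[OF w v A] lift_op_bounded_linear[OF v w B] lift_op_supported[OF v w B]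
      lift_similar[OF v w b B _ sim] AB | assumption)+
  then show ?thesis by (simp add: compact_operator_lift[OF v a])
qed

lemma trace_class_similar:
  assumes v: "positive_on E v" and w: "positive_on E w"
    and a: "bounded_operator E v v (mat_op E a)" and a': "bounded_operator E v v (mat_op E a')"
    and adja: "\<And>f g. f \<in> l2 E v \<Longrightarrow> g \<in> l2 E v \<Longrightarrow> l2_inner E v (mat_op E a f) g = l2_inner E v f (mat_op E a' g)"
    and b: "bounded_operator E w w (mat_op E b)" and b': "bounded_operator E w w (mat_op E b')"
    and adjb: "\<And>f g. f \<in> l2 E w \<Longrightarrow> g \<in> l2 E w \<Longrightarrow> l2_inner E w (mat_op E b f) g = l2_inner E w f (mat_op E b' g)"
    and sim: "similar_via E a v b w A" and tr: "trace_class E w (mat_op E b)"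
  shows "trace_class E v (mat_op E a)"
proof -
  interpret indexed_hilbert_subspace "supported_on E" "index_set E" by (rule indexed_supported_on)
  obtain B where A: "bounded_operator E w v A" and B: "bounded_operator E v w B" and "similar_via E b w a v B"
    and "\<And>f. f \<in> l2 E w \<Longrightarrow> B (A f) = f" and AB: "\<And>g. g \<in> l2 E v \<Longrightarrow> A (B g) = g"
    by (rule similar_via_inverse[OF v w a b sim]) (rule that)
  note A' = l2_adjoint[OF w v A] and B' = l2_adjoint[OF v w B]
  have 1: "lift_op E v v (mat_op E a) f \<bullet> g = f \<bullet> lift_op E v v (mat_op E a') g"
    if "f \<in> supported_on E" "g \<in> supported_on E" for f g
    using lift_op_adjoint[OF v v a a' adja that] .
  have 2: "lift_op E w w (mat_op E b) f \<bullet> g = f \<bullet> lift_op E w w (mat_op E b') g"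
    if "f \<in> supported_on E" "g \<in> supported_on E" for f g
    using lift_op_adjoint[OF w w b b' adjb that] .
  have 3: "lift_op E w v A f \<bullet> g = f \<bullet> lift_op E v w (l2_adjoint E w v A) g"
    if "f \<in> supported_on E" "g \<in> supported_on E" for f g
    using lift_op_adjoint[OF w v A A' that] .
  have 4: "lift_op E v w B f \<bullet> g = f \<bullet> lift_op E w v (l2_adjoint E v w B) g"
    if "f \<in> supported_on E" "g \<in> supported_on E" for f g
    using lift_op_adjoint[OF v w B B' that] .
  have "trace_class_on (supported_on E) (index_set E) (lift_op E v v (mat_op E a)) (lift_op E v v (mat_op E a'))"
  proof (rule trace_class_on_compose[where A = "lift_op E w w (mat_op E b)" and A' = "lift_op E w w (mat_op E b')"
        and B = "lift_op E w v A" and B' = "lift_op E v w (l2_adjoint E w v A)"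
        and C = "lift_op E v w B" and C' = "lift_op E w v (l2_adjoint E v w B)"])
    show "trace_class_on (supported_on E) (index_set E) (lift_op E w w (mat_op E b)) (lift_op E w w (mat_op E b'))"
      using tr trace_class_lift[OF w b b' adjb] by simp
  qed (rule 1 2 3 4 lift_op_bounded_linear[OF w w b] lift_op_supported[OF w w b]
      lift_op_bounded_linear[OF w v A] lift_op_supported[OF w v A] lift_op_supported[OF v w A'(1)]
      lift_op_bounded_linear[OF v w B] lift_op_supported[OF v w B] lift_op_supported[OF w v B'(1)]
      lift_op_bounded_linear[OF w v B'(1)] lift_op_bounded_linear[OF v v a] lift_op_supported[OF v v a]
      lift_op_bounded_linear[OF v v a'] lift_op_supported[OF v v a'] lift_similar[OF v w b B _ sim] AB | assumption)+
  then show ?thesis using trace_class_lift[OF v a a' adja] by simp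
qed

subsection \<open>Normal transition operators\<close>

lemma l2_indicator:
  assumes "x \<in> E" "positive_on E w"
  shows "(\<lambda>z. if z = x then 1 else 0) \<in> l2 E w"
    "up E w (\<lambda>z. if z = x then 1 else 0) = sqrt (w x) *\<^sub>R delta x"
proof -
  show 1: "(\<lambda>z. if z = x then 1 else 0) \<in> l2 E w"
    using assms(1) unfolding l2_def
    by (auto intro!: finite_nonzero_values_imp_summable_on intro: finite_subset[of _ "{x}"])
  show "up E w (\<lambda>z. if z = x then 1 else 0) = sqrt (w x) *\<^sub>R delta x"
    by (rule ell2_eqI) (use assms in \<open>auto simp: coord_up[OF assms(2) 1]\<close>)
qed

lemma mat_op_indicator:
  assumes "y \<in> E"
  shows "mat_op E p (\<lambda>z. if z = y then 1 else 0) = (\<lambda>x. if x \<in> E then p x y else 0)"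
proof -
  have "(\<Sum>\<^sub>\<infinity>z\<in>E. p x z * (if z = y then 1 else 0)) = p x y" for x
    by (rule infsumI, rule has_sum_finite_neutralI[of "{y}"]) (use assms in auto)
  then show ?thesis unfolding mat_op_def by (simp only:)
qed

text \<open>Normality is given entrywise. It is transferred to the operators on coordinate vectors
  and by continuity to the whole subspace, and the resulting self-adjointness is read back
  entrywise.\<close>

lemma normal_similar_symmetric:
  assumes p: "sub_markov E p" and \<pi>: "reference_measure E p \<pi>"
    and q: "sub_markov E q" and \<kappa>: "reversible_measure E q \<kappa>"
    and sim: "similar_via E p \<pi> q \<kappa> \<Lambda>"
    and normal: "\<And>x y. x \<in> E \<Longrightarrow> y \<in> E \<Longrightarrow>
      mat_mult E p (time_reversal \<pi> p) x y = mat_mult E (time_reversal \<pi> p) p x y"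
    and x: "x \<in> E" and y: "y \<in> E"
  shows "p x y = time_reversal \<pi> p x y"
proof -
  let ?H = "supported_on E" and ?p' = "time_reversal \<pi> p"
  interpret hilbert_subspace ?H
    by unfold_locales (rule subspace_supported_on closed_supported_on)+
  note p' = time_reversal_sub_markov[OF p \<pi>]
  note w = reference_positive_on[OF \<pi>] and v = reference_positive_on[OF reversible_reference[OF q \<kappa>]]
  note bp = mat_op_bounded[OF p \<pi>] and bp' = mat_op_bounded[OF p']
    and bq = mat_op_bounded[OF q reversible_reference[OF q \<kappa>]]
  obtain B where A: "bounded_operator E \<kappa> \<pi> \<Lambda>" and B: "bounded_operator E \<pi> \<kappa> B"
    and "similar_via E q \<kappa> p \<pi> B" and "\<And>f. f \<in> l2 E \<kappa> \<Longrightarrow> B (\<Lambda> f) = f"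
    and AB: "\<And>g. g \<in> l2 E \<pi> \<Longrightarrow> \<Lambda> (B g) = g"
    by (rule similar_via_inverse[OF w v bp bq sim]) (rule that)
  let ?N = "lift_op E \<pi> \<pi> (mat_op E p)" and ?N' = "lift_op E \<pi> \<pi> (mat_op E ?p')"
    and ?Q = "lift_op E \<kappa> \<kappa> (mat_op E q)" and ?L = "lift_op E \<kappa> \<pi> \<Lambda>" and ?B = "lift_op E \<pi> \<kappa> B"
  note bl = lift_op_bounded_linear[OF w w bp] lift_op_bounded_linear[OF w w bp'] lift_op_bounded_linear[OF v v bq]
    lift_op_bounded_linear[OF v w A]
  have dl: "dn E \<pi> (delta z) = (\<lambda>y. (1 / sqrt (\<pi> z)) * (if y = z then 1 else 0))" if "z \<in> E" for z
    using that by (auto simp: dn_def fun_eq_iff)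
  have prod: "mat_op E a (mat_op E b (dn E \<pi> (delta z))) =
      (\<lambda>x. (1 / sqrt (\<pi> z)) * (if x \<in> E then mat_mult E a b x z else 0))"
    if "z \<in> E" "bounded_operator E \<pi> \<pi> (mat_op E a)" "bounded_operator E \<pi> \<pi> (mat_op E b)" for a b z
  proof -
    note i = l2_indicator(1)[OF \<open>z \<in> E\<close> w]
    have "mat_op E a (mat_op E b (\<lambda>y. if y = z then 1 else 0)) =
       (\<lambda>x. if x \<in> E then mat_mult E a b x z else 0)"
      unfolding mat_op_indicator[OF \<open>z \<in> E\<close>] by (rule ext) (simp add: mat_op_def mat_mult_def cong: infsum_cong)
    then show ?thesis
      unfolding dl[OF \<open>z \<in> E\<close>] bounded_operator_scale[OF that(3) i]
        bounded_operator_scale[OF that(2) bounded_operator_l2[OF that(3) i]] by simp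
  qed
  have comm_delta: "?N (?N' (delta z)) = ?N' (?N (delta z))" if z: "z \<in> E" for z
  proof -
    have "mat_op E p (mat_op E ?p' (dn E \<pi> (delta z))) = mat_op E ?p' (mat_op E p (dn E \<pi> (delta z)))"
      unfolding prod[OF z bp bp'] prod[OF z bp' bp] using normal z by auto
    then show ?thesis
      by (simp add: lift_op_def dn_up[OF w] bounded_operator_l2[OF bp] bounded_operator_l2[OF bp'] dn_l2[OF w])
  qed
  have comm: "?N (?N' f) = ?N' (?N f)" if f: "f \<in> ?H" for f
  proof -
    have 1: "((\<lambda>z. (f \<bullet> delta z) *\<^sub>R ?N (?N' (delta z))) has_sum ?N (?N' f)) E"
      by (rule onb_operator_expansion[OF onb_delta f bounded_linear_compose[OF bl(1,2)]])
    have 2: "((\<lambda>z. (f \<bullet> delta z) *\<^sub>R ?N' (?N (delta z))) has_sum ?N' (?N f)) E"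
      by (rule onb_operator_expansion[OF onb_delta f bounded_linear_compose[OF bl(2,1)]])
    have "((\<lambda>z. (f \<bullet> delta z) *\<^sub>R ?N (?N' (delta z))) has_sum ?N (?N' f)) E \<longleftrightarrow>
      ((\<lambda>z. (f \<bullet> delta z) *\<^sub>R ?N' (?N (delta z))) has_sum ?N (?N' f)) E"
      by (rule has_sum_cong) (simp add: comm_delta)
    with 1 2 show ?thesis using has_sum_unique by blast
  qed
  have inter: "?N (?L f) = ?L (?Q f)" if "f \<in> ?H" for f
    using sim bounded_operator_l2[OF A] bounded_operator_l2[OF bq]
    by (simp add: lift_op_def dn_up[OF w] dn_up[OF v] dn_l2[OF v] similar_via_def)
  have LB: "?L (?B f) = f" if "f \<in> ?H" for f
    using that by (simp add: lift_op_def dn_up[OF v] bounded_operator_l2[OF B] dn_l2[OF w] AB up_dn[OF w])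
  have adjN: "?N f \<bullet> g = f \<bullet> ?N' g" if "f \<in> ?H" "g \<in> ?H" for f g
    by (rule lift_op_adjoint[OF w w bp bp' mat_op_adjoint[OF p \<pi>] that])
  have adjQ: "?Q f \<bullet> g = f \<bullet> ?Q g" if "f \<in> ?H" "g \<in> ?H" for f g
    by (rule lift_op_adjoint[OF v v bq bq reversible_self_adjoint[OF q \<kappa>] that])
  have "?N (delta y) \<bullet> delta x = delta y \<bullet> ?N (delta x)"
    by (rule normal_similar_self_adjoint[where N = ?N and N' = ?N' and H = ?H and Q = ?Q and L = ?L and B = ?B])
      (rule subspace_supported_on bl bl(1,2)[THEN bounded_linear.linear] delta_supported_on[OF x] delta_supported_on[OF y]
        lift_op_supported[OF w w bp] lift_op_supported[OF w w bp'] lift_op_supported[OF v v bq] lift_op_supported[OF w v B]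
        adjN adjQ comm inter LB | assumption)+
  \<comment> \<open>In the unweighted space the matrix entries are
    \<open>p u z * sqrt (\<pi> u) / sqrt (\<pi> z)\<close>, so symmetry there is detailed balance
    for \<open>p\<close>.\<close>
  moreover have "coord (?N (delta z)) u = p u z * sqrt (\<pi> u) / sqrt (\<pi> z)" if "u \<in> E" "z \<in> E" for u z
  proof -
    have "mat_op E p (dn E \<pi> (delta z)) = (\<lambda>x. (1 / sqrt (\<pi> z)) * (if x \<in> E then p x z else 0))"
      unfolding dl[OF that(2)] bounded_operator_scale[OF bp l2_indicator(1)[OF that(2) w]] mat_op_indicator[OF that(2)] ..
    moreover have "coord (?N (delta z)) u =
        (if u \<in> E then mat_op E p (dn E \<pi> (delta z)) u * sqrt (\<pi> u) else 0)"
      unfolding lift_op_def coord_up[OF w bounded_operator_l2[OF bp dn_l2[OF w]]] ..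
    ultimately show ?thesis using that by simp
  qed
  ultimately have "p x y * sqrt (\<pi> x) / sqrt (\<pi> y) = p y x * sqrt (\<pi> y) / sqrt (\<pi> x)"
    using x y by simp
  moreover have "\<pi> x > 0" "\<pi> y > 0" using w x y by (auto simp: positive_on_def)
  ultimately have "(sqrt (\<pi> x) * sqrt (\<pi> x)) * p x y = (sqrt (\<pi> y) * sqrt (\<pi> y)) * p y x"
    by (simp add: field_simps del: real_sqrt_mult_self)
  then have "p x y * \<pi> x = p y x * \<pi> y" using \<open>\<pi> x > 0\<close> \<open>\<pi> y > 0\<close> by (simp add: mult.commute)
  with \<open>\<pi> x > 0\<close> show ?thesis by (simp add: time_reversal_def field_simps)
qed

subsection \<open>Doob transforms\<close>

lemma mult_bounded_operator:
  assumes v: "positive_on E v" and w: "positive_on E w" and m: "\<And>x. x \<in> E \<Longrightarrow> (m x)\<^sup>2 * w x \<le> C * v x"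
  shows "bounded_operator E v w (\<lambda>f x. m x * f x)"
proof -
  have le: "(m x * f x)\<^sup>2 * w x \<le> C * ((f x)\<^sup>2 * v x)" if "x \<in> E" for f x
    using mult_right_mono[OF m[OF that], of "(f x)\<^sup>2"] by (simp add: power_mult_distrib mult_ac)
  have s: "(\<lambda>x. (m x * f x)\<^sup>2 * w x) summable_on E" if "f \<in> l2 E v" for f
  proof (rule summable_on_comparison_test[of "\<lambda>x. C * ((f x)\<^sup>2 * v x)"])
    show "(\<lambda>x. C * ((f x)\<^sup>2 * v x)) summable_on E"
      using that by (intro summable_on_cmult_right) (simp add: l2_def)
  qed (use le w in \<open>auto simp: positive_on_def less_imp_le\<close>)
  show ?thesis
    unfolding bounded_operator_def
  proof (intro conjI ballI allI exI[of _ "sqrt C"])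
    fix f assume f: "f \<in> l2 E v"
    show "(\<lambda>x. m x * f x) \<in> l2 E w" using s[OF f] f by (simp add: l2_def)
    have "l2_inner E w (\<lambda>x. m x * f x) (\<lambda>x. m x * f x) \<le> (\<Sum>\<^sub>\<infinity>x\<in>E. C * ((f x)\<^sup>2 * v x))"
      unfolding l2_inner_def power2_eq_square[symmetric]
      by (rule infsum_mono) (use s[OF f] f le in \<open>auto simp: l2_def intro!: summable_on_cmult_right\<close>)
    also have "\<dots> = C * l2_inner E v f f"
      by (simp add: infsum_cmult_right' l2_inner_def power2_eq_square)
    finally show "l2_norm E w (\<lambda>x. m x * f x) \<le> sqrt C * l2_norm E v f"
      by (simp add: l2_norm_def real_sqrt_mult[symmetric])
  qed (simp add: algebra_simps fun_eq_iff)
qed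

lemma mat_pow_doob:
  assumes h: "\<And>x. x \<in> E \<Longrightarrow> 0 < h x" and "x \<in> E" "y \<in> E"
  shows "mat_pow E (doob_transform h p) n x y = mat_pow E p n x y * h y / h x"
  using assms(2)
proof (induction n arbitrary: x)
  case 0 then show ?case using h[OF 0] by auto
next
  case (Suc n)
  have "mat_pow E (doob_transform h p) (Suc n) x y = (\<Sum>\<^sub>\<infinity>z\<in>E. (p x z * mat_pow E p n z y) * (h y / h x))"
    unfolding mat_pow.simps mat_mult_def
    by (rule infsum_cong) (use Suc h in \<open>simp add: doob_transform_def less_imp_neq[OF h, symmetric]\<close>)
  also have "\<dots> = mat_pow E p (Suc n) x y * (h y / h x)"
    unfolding mat_pow.simps mat_mult_def by (rule infsum_cmult_left')
  finally show ?case by (simp only: times_divide_eq_right)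
qed

lemma strictly_between_state_space: "strictly_between lb rb \<subseteq> state_space lb rb"
  by (auto simp: strictly_between_def state_space_def split: endpoint.splits)

lemma class_M_sub_markov: "p \<in> class_M lb rb \<Longrightarrow> sub_markov (state_space lb rb) p"
  by (simp add: class_M_def Let_def)

lemma doob_class_M:
  assumes p: "p \<in> class_M lb rb" and h: "h \<in> excessive (state_space lb rb) p"
  shows "doob_transform h p \<in> class_M lb rb"
proof -
  let ?E = "state_space lb rb"
  have pos: "0 < h x" if "x \<in> ?E" for x using h that by (simp add: excessive_def)
  have sm: "sub_markov ?E p" by (rule class_M_sub_markov[OF p])
  have row: "doob_transform h p x = (\<lambda>y. (1 / h x) * (p x y * h y))" for x
    by (simp add: doob_transform_def fun_eq_iff)
  have "sub_markov ?E (doob_transform h p)"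
    unfolding sub_markov_def
  proof (intro conjI ballI)
    fix x assume x: "x \<in> ?E"
    show "0 \<le> doob_transform h p x y" if "y \<in> ?E" for y
      using sm x that pos by (simp add: sub_markov_def doob_transform_def less_imp_le)
    show "doob_transform h p x summable_on ?E"
      unfolding row using h x by (intro summable_on_cmult_right) (simp add: excessive_def)
    have "infsum (doob_transform h p x) ?E = (1 / h x) * (\<Sum>\<^sub>\<infinity>y\<in>?E. p x y * h y)"
      unfolding row by (rule infsum_cmult_right')
    also have "\<dots> \<le> (1 / h x) * h x"
      using h x pos[OF x] by (intro mult_left_mono) (auto simp: excessive_def)
    finally show "infsum (doob_transform h p x) ?E \<le> 1" using pos[OF x] by simp
  qed
  moreover have "\<exists>n. 0 < mat_pow ?E (doob_transform h p) n x y"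
    if "x \<in> strictly_between lb rb" "y \<in> strictly_between lb rb" for x y
  proof -
    have xy: "x \<in> ?E" "y \<in> ?E" using that strictly_between_state_space by auto
    have "\<forall>x\<in>strictly_between lb rb. \<forall>y\<in>strictly_between lb rb. \<exists>n. 0 < mat_pow ?E p n x y"
      using p unfolding class_M_def Let_def by blast
    from this[rule_format, OF that] obtain n where "0 < mat_pow ?E p n x y" ..
    then have "0 < mat_pow ?E (doob_transform h p) n x y"
      using pos xy by (simp add: mat_pow_doob)
    then show ?thesis ..
  qed
  moreover have ne: "?E \<noteq> {}" using p by (simp add: class_M_def Let_def)
  have diag: "doob_transform h p l l = p l l" if "l \<in> ?E" for l
    using that pos[of l] by (simp add: doob_transform_def)
  have "l \<in> ?E" if "lb = Regular l" for l
    using ne that by (auto simp: state_space_def split: endpoint.splits)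
  then have "\<forall>l. lb = Regular l \<longrightarrow> doob_transform h p l l \<noteq> 1"
    using p diag by (simp add: class_M_def Let_def)
  moreover have "r \<in> ?E" if "rb = Regular r" for r
    using ne that by (auto simp: state_space_def split: endpoint.splits)
  then have "\<forall>r. rb = Regular r \<longrightarrow> doob_transform h p r r \<noteq> 1"
    using p diag by (simp add: class_M_def Let_def)
  moreover have "0 < doob_transform h p x (x + 1)" if "x \<in> ?E" "x + 1 \<in> ?E" for x
    using that pos p by (simp add: doob_transform_def class_M_def Let_def)
  moreover have "doob_transform h p x y = 0" if "x \<in> ?E" "y \<in> ?E" "x + 2 \<le> y" for x y
    using that p by (simp add: doob_transform_def class_M_def Let_def)
  ultimately show ?thesis using ne by (simp add: class_M_def Let_def)
qed

text \<open>For the weight \<open>(h x)\<^sup>2 * \<pi> x\<close> division by \<open>h\<close> is an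
  isometry that conjugates \<open>p\<close> into its transform. A comparable weight \<open>w\<close>
  changes only the constants of boundedness.\<close>

lemma doob_similar:
  assumes p: "p \<in> class_M lb rb" and E: "E = state_space lb rb" and \<pi>: "positive_on E \<pi>" and \<kappa>: "positive_on E \<kappa>"
    and h: "h \<in> excessive E p" and c: "c > 0" and C: "C > 0"
    and w: "\<And>x. x \<in> E \<Longrightarrow> c * ((h x)\<^sup>2 * \<pi> x) \<le> w x \<and> w x \<le> C * ((h x)\<^sup>2 * \<pi> x)"
    and sim: "similar_via E p \<pi> q \<kappa> \<Lambda>"
  shows "positive_on E w" "similar_via E (doob_transform h p) w q \<kappa> (\<lambda>f x. \<Lambda> f x / h x)"
proof -
  have pos: "0 < h x" if "x \<in> E" for x using h that by (simp add: excessive_def)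
  have pi0: "0 < \<pi> x" if "x \<in> E" for x using \<pi> that by (simp add: positive_on_def)
  show w0: "positive_on E w"
    unfolding positive_on_def
  proof
    fix x assume x: "x \<in> E"
    have "0 < c * ((h x)\<^sup>2 * \<pi> x)" using c pos[OF x] pi0[OF x] by simp
    then show "0 < w x" using w[OF x] by linarith
  qed
  have 1: "bounded_operator E \<pi> w (\<lambda>f x. (1 / h x) * f x)"
  proof (rule mult_bounded_operator[OF \<pi> w0])
    fix x assume x: "x \<in> E"
    have "(1 / h x)\<^sup>2 * w x \<le> (1 / h x)\<^sup>2 * (C * ((h x)\<^sup>2 * \<pi> x))" using w[OF x] by (intro mult_left_mono) auto
    then show "(1 / h x)\<^sup>2 * w x \<le> C * \<pi> x" using pos[OF x] by (simp add: power_divide)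
  qed
  have 2: "bounded_operator E w \<pi> (\<lambda>f x. h x * f x)"
  proof (rule mult_bounded_operator[OF w0 \<pi>])
    show "(h x)\<^sup>2 * \<pi> x \<le> (1 / c) * w x" if "x \<in> E" for x
      using w[OF that] c by (simp add: field_simps)
  qed
  have "bounded_invertible E \<pi> w (\<lambda>f x. (1 / h x) * f x)"
    unfolding bounded_invertible_def
    by (intro conjI exI[of _ "\<lambda>f x. h x * f x"] 1 2)
      (auto simp: l2_def fun_eq_iff, (metis less_irrefl pos)+)
  then have "bounded_invertible E \<kappa> w (\<lambda>f x. (1 / h x) * \<Lambda> f x)"
    using bounded_invertible_compose[OF \<kappa> \<pi> w0, of \<Lambda> "\<lambda>f x. (1 / h x) * f x"] sim by (simp add: similar_via_def)
  moreover have "mat_op E (doob_transform h p) (\<lambda>x. \<Lambda> f x / h x) = (\<lambda>x. \<Lambda> (mat_op E q f) x / h x)"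
    if f: "f \<in> l2 E \<kappa>" for f
  proof
    fix x
    have "mat_op E p (\<Lambda> f) x = \<Lambda> (mat_op E q f) x" using sim f by (simp add: similar_via_def)
    moreover have "mat_op E (doob_transform h p) (\<lambda>x. \<Lambda> f x / h x) x = mat_op E p (\<Lambda> f) x / h x"
    proof (cases "x \<in> E")
      case True
      have "(\<Sum>\<^sub>\<infinity>y\<in>E. doob_transform h p x y * (\<Lambda> f y / h y)) = (\<Sum>\<^sub>\<infinity>y\<in>E. (p x y * \<Lambda> f y) * (1 / h x))"
        by (rule infsum_cong) (simp add: doob_transform_def less_imp_neq[OF pos, symmetric])
      also have "\<dots> = (\<Sum>\<^sub>\<infinity>y\<in>E. p x y * \<Lambda> f y) * (1 / h x)" by (rule infsum_cmult_left')
      finally show ?thesis using True by (simp add: mat_op_def)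
    qed (simp add: mat_op_def)
    ultimately show "mat_op E (doob_transform h p) (\<lambda>x. \<Lambda> f x / h x) x = \<Lambda> (mat_op E q f) x / h x" by simp
  qed
  ultimately show "similar_via E (doob_transform h p) w q \<kappa> (\<lambda>f x. \<Lambda> f x / h x)"
    by (simp add: similar_via_def)
qed

section \<open>Riesz bases of eigenfunctions\<close>

lemma compact_reversible_eigenbasis:
  assumes q: "sub_markov E q" and \<kappa>: "reversible_measure E q \<kappa>" and c: "compact_operator E \<kappa> (mat_op E q)"
  obtains e t where "orthonormal_basis E \<kappa> e" "\<And>k. k \<in> index_set E \<Longrightarrow> mat_op E q (e k) = (\<lambda>x. t k * e k x)"
proof -
  interpret indexed_hilbert_subspace "supported_on E" "index_set E" by (rule indexed_supported_on)
  let ?Q = "lift_op E \<kappa> \<kappa> (mat_op E q)"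
  note v = reference_positive_on[OF reversible_reference[OF q \<kappa>]]
  note bq = mat_op_bounded[OF q reversible_reference[OF q \<kappa>]]
  have sa: "?Q f \<bullet> g = f \<bullet> ?Q g" if "f \<in> supported_on E" "g \<in> supported_on E" for f g
    by (rule lift_op_adjoint[OF v v bq bq reversible_self_adjoint[OF q \<kappa>] that])
  obtain e t where e: "onb (supported_on E) (index_set E) e" and t: "\<And>k. k \<in> index_set E \<Longrightarrow> ?Q (e k) = t k *\<^sub>R e k"
    using spectral_onb[OF lift_op_bounded_linear[OF v v bq] _ sa c[unfolded compact_operator_lift[OF v bq]]]
      lift_op_supported[OF v v bq] by metis
  have "mat_op E q (dn E \<kappa> (e k)) = (\<lambda>x. t k * dn E \<kappa> (e k) x)" if "k \<in> index_set E" for k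
  proof -
    have "mat_op E q (dn E \<kappa> (e k)) = dn E \<kappa> (?Q (e k))" by (simp add: dn_lift_op[OF v v bq])
    also have "\<dots> = dn E \<kappa> (t k *\<^sub>R e k + 0 *\<^sub>R e k)" by (simp add: t[OF that])
    also have "\<dots> = (\<lambda>x. t k * dn E \<kappa> (e k) x)" unfolding dn_linear by simp
    finally show ?thesis .
  qed
  with orthonormal_basis_dn[OF v e] that show ?thesis by blast
qed

lemma compact_similar_eigen_riesz_basis:
  assumes w: "positive_on E \<pi>"
    and q: "sub_markov E q" and \<kappa>: "reversible_measure E q \<kappa>" and sim: "similar_via E p \<pi> q \<kappa> \<Lambda>"
    and c: "compact_operator E \<kappa> (mat_op E q)"
  shows "\<exists>\<mu> f. eigen_riesz_basis E \<pi> p \<mu> f"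
proof -
  note v = reference_positive_on[OF reversible_reference[OF q \<kappa>]]
  obtain e t where e: "orthonormal_basis E \<kappa> e"
    and t: "\<And>k. k \<in> index_set E \<Longrightarrow> mat_op E q (e k) = (\<lambda>x. t k * e k x)"
    by (rule compact_reversible_eigenbasis[OF q \<kappa> c]) blast
  have el2: "e k \<in> l2 E \<kappa>" if "k \<in> index_set E" for k using e that by (simp add: orthonormal_basis_def)
  have inv: "bounded_invertible E \<kappa> \<pi> \<Lambda>" and inter: "\<And>f. f \<in> l2 E \<kappa> \<Longrightarrow> mat_op E p (\<Lambda> f) = \<Lambda> (mat_op E q f)"
    using sim by (auto simp: similar_via_def)
  have b: "bounded_operator E \<kappa> \<pi> \<Lambda>" using inv by (simp add: bounded_invertible_def)
  \<comment> \<open>\<open>riesz_basis\<close> asks for an operator within one space. So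
    \<open>e\<close> is moved to the weight \<open>\<pi>\<close>, and the move is undone inside
    \<open>T\<close>.\<close>
  define e' where "e' k = dn E \<pi> (up E \<kappa> (e k))" for k
  have e': "orthonormal_basis E \<pi> e'"
    unfolding e'_def by (rule orthonormal_basis_dn[OF w]) (use e orthonormal_basis_up[OF v el2] in simp)
  define T where "T f = \<Lambda> (dn E \<kappa> (up E \<pi> f))" for f
  have T: "bounded_invertible E \<pi> \<pi> T"
    unfolding T_def[abs_def] by (rule bounded_invertible_compose[OF w v w weight_change_invertible[OF w v] inv])
  have Te: "\<Lambda> (e k) = T (e' k)" if "k \<in> index_set E" for k
    by (simp add: T_def e'_def up_dn[OF w up_supported[OF v el2[OF that]]] dn_up[OF v el2[OF that]])
  have "riesz_basis E \<pi> (\<lambda>k. \<Lambda> (e k))"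
    unfolding riesz_basis_def using e' T Te by blast
  moreover have "\<Lambda> (e k) \<noteq> (\<lambda>x. 0)" if k: "k \<in> index_set E" for k
  proof
    assume 0: "\<Lambda> (e k) = (\<lambda>x. 0)"
    obtain B where B: "\<And>f. f \<in> l2 E \<kappa> \<Longrightarrow> B (\<Lambda> f) = f" using inv unfolding bounded_invertible_def by blast
    have z: "\<Lambda> (\<lambda>x. 0) = (\<lambda>x. 0)" using bounded_operator_scale[OF b l2_zero, of 0] by simp
    have "e k = (\<lambda>x. 0)" using B[OF el2[OF k]] B[OF l2_zero] 0 z by simp
    moreover have "l2_inner E \<kappa> (e k) (e k) = 1" using e k by (simp add: orthonormal_basis_def biorthogonal_def)
    ultimately show False by (simp add: l2_inner_def)
  qed
  moreover have "mat_op E p (\<Lambda> (e k)) = (\<lambda>x. t k * \<Lambda> (e k) x)" if "k \<in> index_set E" for k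
    using inter[OF el2[OF that]] bounded_operator_scale[OF b el2[OF that]] t[OF that] by simp
  ultimately have "eigen_riesz_basis E \<pi> p t (\<lambda>k. \<Lambda> (e k))" by (simp add: eigen_riesz_basis_def)
  then show ?thesis by blast
qed

lemma riesz_basis_l2: "riesz_basis E w f \<Longrightarrow> k \<in> index_set E \<Longrightarrow> f k \<in> l2 E w"
  by (auto simp: riesz_basis_def orthonormal_basis_def bounded_invertible_def bounded_operator_def)

text \<open>With \<open>f k = T (e k)\<close>, the adjoint of \<open>T\<close> maps
  \<open>g - h\<close> to a vector orthogonal to every \<open>e k\<close>, hence to 0, and
  surjectivity of \<open>T\<close> makes \<open>g - h\<close> vanish. Uniqueness of the biorthogonal
  family follows.\<close>

lemma riesz_basis_complete:
  assumes w: "positive_on E w" and f: "riesz_basis E w f" and g: "g \<in> l2 E w" and h: "h \<in> l2 E w"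
    and eq: "\<And>k. k \<in> index_set E \<Longrightarrow> l2_inner E w (f k) g = l2_inner E w (f k) h"
  shows "g = h"
proof -
  obtain e T where e: "orthonormal_basis E w e" and inv: "bounded_invertible E w w T"
    and fT: "\<And>k. k \<in> index_set E \<Longrightarrow> f k = T (e k)" using f unfolding riesz_basis_def by blast
  obtain B where T: "bounded_operator E w w T" and B: "bounded_operator E w w B"
    and TB: "\<And>g. g \<in> l2 E w \<Longrightarrow> T (B g) = g" using inv unfolding bounded_invertible_def by blast
  note T' = l2_adjoint[OF w w T]
  let ?T = "l2_adjoint E w w T" and ?d = "\<lambda>x. g x - h x"
  have d: "?d \<in> l2 E w" by (rule l2_diff(1)[OF w g h])
  have Td: "?T ?d \<in> l2 E w" by (rule bounded_operator_l2[OF T'(1) d])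
  have "l2_inner E w (?T ?d) (e k) = 0" if k: "k \<in> index_set E" for k
  proof -
    have ek: "e k \<in> l2 E w" using e k by (simp add: orthonormal_basis_def)
    have fk: "f k \<in> l2 E w" by (rule riesz_basis_l2[OF f k])
    have "l2_inner E w (e k) (?T ?d) = l2_inner E w (f k) ?d" using T'(2)[OF ek d] fT[OF k] by simp
    also have "\<dots> = l2_inner E w (f k) g - l2_inner E w (f k) h"
      by (simp add: inner_up[OF w, symmetric] fk d g h l2_diff(2)[OF w] inner_diff_right)
    finally show ?thesis using eq[OF k] by (simp add: l2_inner_commute)
  qed
  then have 0: "?T ?d = (\<lambda>x. 0)" using e Td unfolding orthonormal_basis_def by blast
  have "?d = (\<lambda>x. 0)"
  proof (rule l2_inner_eqI[OF w d l2_zero])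
    fix k assume k: "k \<in> l2 E w"
    have "l2_inner E w k ?d = l2_inner E w (T (B k)) ?d" using TB[OF k] by simp
    also have "\<dots> = l2_inner E w (B k) (?T ?d)" by (rule T'(2)[OF bounded_operator_l2[OF B k] d])
    also have "\<dots> = 0" unfolding 0 by (simp add: l2_inner_def)
    finally show "l2_inner E w ?d k = l2_inner E w (\<lambda>x. 0) k"
      by (subst l2_inner_commute) (simp add: l2_inner_def)
  qed
  then show ?thesis by (auto simp: fun_eq_iff)
qed

text \<open>The dual basis of \<open>T e\<^sub>k\<close> is \<open>(T\<^sup>-\<^sup>1)\<^sup>* e\<^sub>k\<close>.\<close>

lemma riesz_basis_dual:
  assumes w: "positive_on E w" and f: "riesz_basis E w f"
  obtains f' where "riesz_basis E w f'" "biorthogonal E w f f'"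
    "\<And>g. g \<in> l2 E w \<Longrightarrow> ((\<lambda>k. l2_inner E w g (f' k) *\<^sub>R up E w (f k)) has_sum up E w g) (index_set E)"
proof -
  interpret indexed_hilbert_subspace "supported_on E" "index_set E" by (rule indexed_supported_on)
  obtain e T where e: "orthonormal_basis E w e" and inv: "bounded_invertible E w w T"
    and fT: "\<And>k. k \<in> index_set E \<Longrightarrow> f k = T (e k)" using f unfolding riesz_basis_def by blast
  obtain B where T: "bounded_operator E w w T" and B: "bounded_operator E w w B"
    and BT: "\<And>g. g \<in> l2 E w \<Longrightarrow> B (T g) = g" and TB: "\<And>g. g \<in> l2 E w \<Longrightarrow> T (B g) = g"
    using inv unfolding bounded_invertible_def by blast
  have invB: "bounded_invertible E w w B" unfolding bounded_invertible_def using T B BT TB by blast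
  have el2: "e k \<in> l2 E w" if "k \<in> index_set E" for k using e that by (simp add: orthonormal_basis_def)
  note B' = l2_adjoint[OF w w B]
  define f' where "f' k = l2_adjoint E w w B (e k)" for k
  have "riesz_basis E w f'"
    unfolding riesz_basis_def f'_def using e bounded_invertible_adjoint[OF w w B B' invB] by blast
  moreover have "biorthogonal E w f f'"
    unfolding biorthogonal_def
  proof (intro ballI)
    fix j k assume jk: "j \<in> index_set E" "k \<in> index_set E"
    have "l2_inner E w (f j) (f' k) = l2_inner E w (B (T (e j))) (e k)"
      using B'(2)[OF bounded_operator_l2[OF T el2[OF jk(1)]] el2[OF jk(2)]] by (simp add: fT[OF jk(1)] f'_def)
    also have "\<dots> = (if j = k then 1 else 0)"
      using e jk by (simp add: BT el2 orthonormal_basis_def biorthogonal_def)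
    finally show "l2_inner E w (f j) (f' k) = (if j = k then 1 else 0)" .
  qed
  moreover have "((\<lambda>k. l2_inner E w g (f' k) *\<^sub>R up E w (f k)) has_sum up E w g) (index_set E)"
    if g: "g \<in> l2 E w" for g
  proof -
    have Bg: "B g \<in> l2 E w" by (rule bounded_operator_l2[OF B g])
    have "((\<lambda>k. (up E w (B g) \<bullet> up E w (e k)) *\<^sub>R lift_op E w w T (up E w (e k))) has_sum lift_op E w w T (up E w (B g))) (index_set E)"
      by (rule onb_operator_expansion[OF _ up_supported[OF w Bg] lift_op_bounded_linear[OF w w T]])
        (use e orthonormal_basis_up[OF w el2] in simp)
    moreover have "(up E w (B g) \<bullet> up E w (e k)) *\<^sub>R lift_op E w w T (up E w (e k))
       = l2_inner E w g (f' k) *\<^sub>R up E w (f k)" if k: "k \<in> index_set E" for k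
      using B'(2)[OF g el2[OF k]] by (simp add: inner_up[OF w Bg el2[OF k]] lift_op_up[OF w el2[OF k]] fT[OF k] f'_def)
    ultimately have "((\<lambda>k. l2_inner E w g (f' k) *\<^sub>R up E w (f k)) has_sum lift_op E w w T (up E w (B g))) (index_set E)"
      by (simp cong: has_sum_cong)
    then show ?thesis by (simp add: lift_op_up[OF w Bg] TB[OF g])
  qed
  ultimately show ?thesis using that by blast
qed

section \<open>Spectral expansion along a Riesz basis of eigenfunctions\<close>

context
  fixes E :: "int set" and w :: "int \<Rightarrow> real" and p :: matrix and \<mu> :: "nat \<Rightarrow> real" and f :: "nat \<Rightarrow> int \<Rightarrow> real"
  assumes w: "positive_on E w" and bp: "bounded_operator E w w (mat_op E p)"
    and eig: "eigen_riesz_basis E w p \<mu> f"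
begin

private lemma rf: "riesz_basis E w f" using eig by (simp add: eigen_riesz_basis_def)

lemma mat_op_pow_bounded: "bounded_operator E w w (mat_op E p ^^ n)"
proof (induction n)
  case 0
  have "bounded_operator E w w (\<lambda>f. f)"
    by (rule bounded_operator_lift_iff[OF w w _ bounded_linear_ident]) auto
  then show ?case by (simp add: id_def)
next
  case (Suc n)
  show ?case using bounded_operator_compose[OF w w w Suc bp] by (simp add: o_def)
qed

lemma mat_op_pow_eigen: "k \<in> index_set E \<Longrightarrow> (mat_op E p ^^ n) (f k) = (\<lambda>x. \<mu> k ^ n * f k x)"
proof (induction n)
  case (Suc n)
  have "mat_op E p (\<lambda>x. \<mu> k ^ n * f k x) = (\<lambda>x. \<mu> k ^ n * mat_op E p (f k) x)"
    by (rule bounded_operator_scale[OF bp riesz_basis_l2[OF rf Suc.prems]])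
  moreover have "mat_op E p (f k) = (\<lambda>x. \<mu> k * f k x)" using eig Suc.prems by (simp add: eigen_riesz_basis_def)
  ultimately show ?case using Suc by (simp add: mult_ac)
qed simp

lemma riesz_power_expansion:
  assumes f': "\<And>g. g \<in> l2 E w \<Longrightarrow> ((\<lambda>k. l2_inner E w g (f' k) *\<^sub>R up E w (f k)) has_sum up E w g) (index_set E)"
    and g: "g \<in> l2 E w"
  shows "((\<lambda>k. (\<mu> k ^ n * l2_inner E w g (f' k)) *\<^sub>R up E w (f k)) has_sum up E w ((mat_op E p ^^ n) g)) (index_set E)"
proof -
  note b = mat_op_pow_bounded[of n]
  note bl = lift_op_bounded_linear[OF w w b]
  have "((\<lambda>k. lift_op E w w (mat_op E p ^^ n) (l2_inner E w g (f' k) *\<^sub>R up E w (f k))) has_sum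
      lift_op E w w (mat_op E p ^^ n) (up E w g)) (index_set E)"
    by (rule has_sum_bounded_linear[OF bl f'[OF g]])
  moreover have "lift_op E w w (mat_op E p ^^ n) (l2_inner E w g (f' k) *\<^sub>R up E w (f k)) =
      (\<mu> k ^ n * l2_inner E w g (f' k)) *\<^sub>R up E w (f k)" if k: "k \<in> index_set E" for k
  proof -
    have fk: "f k \<in> l2 E w" by (rule riesz_basis_l2[OF rf k])
    have "lift_op E w w (mat_op E p ^^ n) (up E w (f k)) = \<mu> k ^ n *\<^sub>R up E w (f k)"
      by (simp add: lift_op_up[OF w fk] mat_op_pow_eigen[OF k] l2_scale(2)[OF w fk])
    then show ?thesis by (simp add: linear_scale[OF bounded_linear.linear[OF bl]])
  qed
  ultimately have "((\<lambda>k. (\<mu> k ^ n * l2_inner E w g (f' k)) *\<^sub>R up E w (f k)) has_sum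
      lift_op E w w (mat_op E p ^^ n) (up E w g)) (index_set E)"
    by (simp cong: has_sum_cong)
  then show ?thesis by (simp add: lift_op_up[OF w g])
qed

text \<open>For an eigenfunction \<open>g\<close>, pairing with \<open>f' j\<close> gives
  \<open>l * c = \<mu> j * c\<close> for its coefficient \<open>c\<close> at \<open>j\<close>. As
  \<open>g\<close> is nonzero, some coefficient is nonzero, and then
  \<open>l = \<mu> j\<close>.\<close>

lemma eigenvalues_riesz: "\<mu> ` index_set E = l2_eigenvalues E w p"
proof
  show "\<mu> ` index_set E \<subseteq> l2_eigenvalues E w p"
    using eig riesz_basis_l2[OF rf] by (auto simp: l2_eigenvalues_def eigen_riesz_basis_def)
  show "l2_eigenvalues E w p \<subseteq> \<mu> ` index_set E"
  proof
    fix l assume "l \<in> l2_eigenvalues E w p"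
    then obtain g where g: "g \<in> l2 E w" "g \<noteq> (\<lambda>x. 0)" "mat_op E p g = (\<lambda>x. l * g x)"
      by (auto simp: l2_eigenvalues_def)
    obtain f' where f': "riesz_basis E w f'" "biorthogonal E w f f'"
      and ex: "\<And>g. g \<in> l2 E w \<Longrightarrow> ((\<lambda>k. l2_inner E w g (f' k) *\<^sub>R up E w (f k)) has_sum up E w g) (index_set E)"
      using riesz_basis_dual[OF w rf] by metis
    have coeff: "l * l2_inner E w g (f' j) = \<mu> j * l2_inner E w g (f' j)" if j: "j \<in> index_set E" for j
    proof -
      have f'j: "f' j \<in> l2 E w" by (rule riesz_basis_l2[OF f'(1) j])
      have "((\<lambda>k. ((\<mu> k ^ 1 * l2_inner E w g (f' k)) *\<^sub>R up E w (f k)) \<bullet> up E w (f' j)) has_sum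
          up E w ((mat_op E p ^^ 1) g) \<bullet> up E w (f' j)) (index_set E)"
        by (rule has_sum_bounded_linear[OF bounded_linear_inner_left riesz_power_expansion[OF ex g(1)]])
      moreover have "((\<lambda>k. ((\<mu> k ^ 1 * l2_inner E w g (f' k)) *\<^sub>R up E w (f k)) \<bullet> up E w (f' j)) has_sum
          \<mu> j * l2_inner E w g (f' j)) (index_set E)"
      proof (rule has_sum_finite_neutralI[of "{j}"])
        have *: "up E w (f k) \<bullet> up E w (f' j) = (if k = j then 1 else 0)" if "k \<in> index_set E" for k
          using f'(2) that j by (simp add: inner_up[OF w riesz_basis_l2[OF rf that] f'j] biorthogonal_def)
        show "((\<mu> k ^ 1 * l2_inner E w g (f' k)) *\<^sub>R up E w (f k)) \<bullet> up E w (f' j) = 0"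
          if "k \<in> index_set E - {j}" for k using that * by simp
        show "\<mu> j * l2_inner E w g (f' j) =
            (\<Sum>k\<in>{j}. ((\<mu> k ^ 1 * l2_inner E w g (f' k)) *\<^sub>R up E w (f k)) \<bullet> up E w (f' j))"
          using *[OF j] by simp
      qed (use j in auto)
      ultimately have "up E w ((mat_op E p ^^ 1) g) \<bullet> up E w (f' j) = \<mu> j * l2_inner E w g (f' j)"
        by (rule has_sum_unique)
      moreover have "up E w ((mat_op E p ^^ 1) g) \<bullet> up E w (f' j) = l * l2_inner E w g (f' j)"
        by (simp add: g(3) l2_scale(2)[OF w g(1)] inner_up[OF w g(1) f'j])
      ultimately show ?thesis by argo
    qed
    show "l \<in> \<mu> ` index_set E"
    proof (rule ccontr)
      assume "l \<notin> \<mu> ` index_set E"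
      then have "l2_inner E w g (f' j) = 0" if "j \<in> index_set E" for j using coeff[OF that] that by auto
      then have "((\<lambda>k. 0) has_sum up E w g) (index_set E)"
        using ex[OF g(1)] by (simp cong: has_sum_cong)
      then have "up E w g = 0" using has_sum_unique has_sum_0_simp by blast
      then show False using up_inject[OF w g(1) l2_zero] up_zero[OF w] g(2) by simp
    qed
  qed
qed

lemma mat_op_pow_indicator:
  assumes "y \<in> E" "x \<in> E"
  shows "(mat_op E p ^^ n) (\<lambda>z. if z = y then 1 else 0) x = mat_pow E p n x y"
  using assms(2)
proof (induction n arbitrary: x)
  case (Suc n)
  have "(\<Sum>\<^sub>\<infinity>z\<in>E. p x z * (mat_op E p ^^ n) (\<lambda>z. if z = y then 1 else 0) z) = (\<Sum>\<^sub>\<infinity>z\<in>E. p x z * mat_pow E p n z y)"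
    by (rule infsum_cong) (simp add: Suc.IH)
  then show ?case using Suc.prems by (simp add: mat_op_def[of E p "(mat_op E p ^^ n) _"] mat_mult_def)
qed simp

text \<open>By \<open>riesz_basis_complete\<close> the given \<open>f'\<close> is the dual basis for
  which the expansion is known. Continuity of the coordinates turns norm convergence into pointwise
  sums, and the kernel is the case of an indicator, whose coefficient is
  \<open>f' k y * w y\<close>.\<close>

theorem riesz_spectral_expansion:
  assumes rf': "riesz_basis E w f'" and bi: "biorthogonal E w f f'"
  shows riesz_expansion_norm: "g \<in> l2 E w \<Longrightarrow>
      ((\<lambda>F. l2_norm E w (\<lambda>x. (mat_op E p ^^ n) g x - (\<Sum>k\<in>F. \<mu> k ^ n * l2_inner E w g (f' k) * f k x))) \<longlongrightarrow> 0)
        (finite_subsets_at_top (index_set E))"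
    and riesz_expansion_pointwise: "g \<in> l2 E w \<Longrightarrow> x \<in> E \<Longrightarrow>
      ((\<lambda>k. \<mu> k ^ n * l2_inner E w g (f' k) * f k x) has_sum (mat_op E p ^^ n) g x) (index_set E)"
    and riesz_expansion_kernel: "x \<in> E \<Longrightarrow> y \<in> E \<Longrightarrow>
      ((\<lambda>k. \<mu> k ^ n * f k x * f' k y * w y) has_sum mat_pow E p n x y) (index_set E)"
proof -
  obtain h where h: "riesz_basis E w h" "biorthogonal E w f h"
    and exh: "\<And>g. g \<in> l2 E w \<Longrightarrow> ((\<lambda>k. l2_inner E w g (h k) *\<^sub>R up E w (f k)) has_sum up E w g) (index_set E)"
    using riesz_basis_dual[OF w rf] by metis
  have "h k = f' k" if k: "k \<in> index_set E" for k
    by (rule riesz_basis_complete[OF w rf riesz_basis_l2[OF h(1) k] riesz_basis_l2[OF rf' k]])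
      (use h(2) bi k in \<open>simp add: biorthogonal_def\<close>)
  then have ex: "((\<lambda>k. l2_inner E w g (f' k) *\<^sub>R up E w (f k)) has_sum up E w g) (index_set E)"
    if "g \<in> l2 E w" for g using exh[OF that] by (simp cong: has_sum_cong)
  note fl2 = riesz_basis_l2[OF rf]
  have wx: "0 < w x" if "x \<in> E" for x using w that by (simp add: positive_on_def)
  show "((\<lambda>F. l2_norm E w (\<lambda>x. (mat_op E p ^^ n) g x - (\<Sum>k\<in>F. \<mu> k ^ n * l2_inner E w g (f' k) * f k x))) \<longlongrightarrow> 0)
        (finite_subsets_at_top (index_set E))" if g: "g \<in> l2 E w" for g
  proof -
    let ?S = "\<lambda>F. \<Sum>k\<in>F. (\<mu> k ^ n * l2_inner E w g (f' k)) *\<^sub>R up E w (f k)"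
    have Pg: "(mat_op E p ^^ n) g \<in> l2 E w" by (rule bounded_operator_l2[OF mat_op_pow_bounded g])
    have "(?S \<longlongrightarrow> up E w ((mat_op E p ^^ n) g)) (finite_subsets_at_top (index_set E))"
      using riesz_power_expansion[OF ex g, of n] by (simp add: has_sum_def)
    then have "((\<lambda>F. norm (up E w ((mat_op E p ^^ n) g) - ?S F)) \<longlongrightarrow> norm (up E w ((mat_op E p ^^ n) g) - up E w ((mat_op E p ^^ n) g)))
        (finite_subsets_at_top (index_set E))"
      by (intro tendsto_intros)
    then have lim: "((\<lambda>F. norm (up E w ((mat_op E p ^^ n) g) - ?S F)) \<longlongrightarrow> 0) (finite_subsets_at_top (index_set E))"
      by simp
    have "\<forall>\<^sub>F F in finite_subsets_at_top (index_set E). norm (up E w ((mat_op E p ^^ n) g) - ?S F) =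
       l2_norm E w (\<lambda>x. (mat_op E p ^^ n) g x - (\<Sum>k\<in>F. \<mu> k ^ n * l2_inner E w g (f' k) * f k x))"
    proof (rule eventually_finite_subsets_at_top_weakI)
      fix F assume F: "finite F" "F \<subseteq> index_set E"
      have fF: "f k \<in> l2 E w" if "k \<in> F" for k using fl2 F that by blast
      note s = l2_sum[OF w fF, where c = "\<lambda>k. \<mu> k ^ n * l2_inner E w g (f' k)"]
      show "norm (up E w ((mat_op E p ^^ n) g) - ?S F) =
        l2_norm E w (\<lambda>x. (mat_op E p ^^ n) g x - (\<Sum>k\<in>F. \<mu> k ^ n * l2_inner E w g (f' k) * f k x))"
        by (simp add: l2_norm_up[OF w l2_diff(1)[OF w Pg s(1)]] l2_diff(2)[OF w Pg s(1)] s(2))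
    qed
    then show ?thesis by (rule Lim_transform_eventually[OF lim])
  qed
  show pw: "((\<lambda>k. \<mu> k ^ n * l2_inner E w g (f' k) * f k x) has_sum (mat_op E p ^^ n) g x) (index_set E)"
    if g: "g \<in> l2 E w" and x: "x \<in> E" for g x
  proof -
    have Pg: "(mat_op E p ^^ n) g \<in> l2 E w" by (rule bounded_operator_l2[OF mat_op_pow_bounded g])
    have "((\<lambda>k. coord ((\<mu> k ^ n * l2_inner E w g (f' k)) *\<^sub>R up E w (f k)) x) has_sum
        coord (up E w ((mat_op E p ^^ n) g)) x) (index_set E)"
      by (rule has_sum_bounded_linear[OF bounded_linear_coord riesz_power_expansion[OF ex g]])
    then have "((\<lambda>k. (1 / sqrt (w x)) * coord ((\<mu> k ^ n * l2_inner E w g (f' k)) *\<^sub>R up E w (f k)) x) has_sum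
        (1 / sqrt (w x)) * coord (up E w ((mat_op E p ^^ n) g)) x) (index_set E)"
      by (rule has_sum_cmult_right)
    then have "((\<lambda>k. \<mu> k ^ n * l2_inner E w g (f' k) * f k x) has_sum
        (1 / sqrt (w x)) * coord (up E w ((mat_op E p ^^ n) g)) x) (index_set E)"
      using wx[OF x] x by (simp add: coord_up[OF w fl2] mult.assoc cong: has_sum_cong)
    then show ?thesis using wx[OF x] x by (simp add: coord_up[OF w Pg])
  qed
  show "((\<lambda>k. \<mu> k ^ n * f k x * f' k y * w y) has_sum mat_pow E p n x y) (index_set E)"
    if x: "x \<in> E" and y: "y \<in> E" for x y
  proof -
    let ?d = "\<lambda>z. if z = y then 1 else (0::real)"
    have "l2_inner E w ?d (f' k) = f' k y * w y" for k
      unfolding l2_inner_def by (rule infsumI, rule has_sum_finite_neutralI[of "{y}"]) (use y in auto)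
    then show ?thesis
      using pw[OF l2_indicator(1)[OF y w] x] by (simp add: mat_op_pow_indicator[OF y x] mult_ac)
  qed
qed

end

section \<open>Finite state spaces\<close>

lemma l2_finite: "finite E \<Longrightarrow> f \<in> l2 E w \<longleftrightarrow> (\<forall>x. x \<notin> E \<longrightarrow> f x = 0)"
  by (simp add: l2_def)

lemma mat_op_finite: "finite E \<Longrightarrow> mat_op E p f x = (if x \<in> E then \<Sum>y\<in>E. p x y * f y else 0)"
  by (simp add: mat_op_def)

text \<open>A linear map on the whole type may be unbounded. It is replaced by one that agrees with
  it on the finite-dimensional subspace and ignores all other coordinates.\<close>

lemma finite_linear_bounded:
  assumes E: "finite E" and A: "linear (A :: ell2 \<Rightarrow> ell2)"
  obtains A' where "bounded_linear A'" "\<And>f. f \<in> supported_on E \<Longrightarrow> A' f = A f"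
proof
  show "bounded_linear (\<lambda>f. \<Sum>x\<in>E. coord f x *\<^sub>R A (delta x))"
    by (intro bounded_linear_sum bounded_linear_compose[OF bounded_linear_scaleR_left bounded_linear_coord])
  fix f assume f: "f \<in> supported_on E"
  have "f = (\<Sum>x\<in>E. coord f x *\<^sub>R delta x)"
  proof (rule ell2_eqI)
    fix y
    have "coord (\<Sum>x\<in>E. coord f x *\<^sub>R delta x) y = (\<Sum>x\<in>E. if y = x then coord f x else 0)"
      by (simp cong: sum.cong) (rule sum.cong, auto)
    then show "coord f y = coord (\<Sum>x\<in>E. coord f x *\<^sub>R delta x) y"
      using E f by (auto simp: supported_on_def)
  qed
  then show "(\<Sum>x\<in>E. coord f x *\<^sub>R A (delta x)) = A f"
    by (metis (no_types, lifting) A linear_scale linear_sum sum.cong)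
qed

lemma finite_bounded_operator:
  assumes E: "finite E" and v: "positive_on E v" and w: "positive_on E w" and A: "linear A"
    and AE: "\<And>f. f \<in> supported_on E \<Longrightarrow> A f \<in> supported_on E"
  shows "bounded_operator E v w (unlift_op E v w A)"
    and "\<And>f. f \<in> l2 E v \<Longrightarrow> up E w (unlift_op E v w A f) = A (up E v f)"
proof -
  obtain A' where A': "bounded_linear A'" "\<And>f. f \<in> supported_on E \<Longrightarrow> A' f = A f"
    by (rule finite_linear_bounded[OF E A]) (rule that)
  show 1: "up E w (unlift_op E v w A f) = A (up E v f)" if "f \<in> l2 E v" for f
    by (rule up_unlift_op[where B = A, OF v w that]) (rule AE[OF up_supported[OF v that]])
  show "bounded_operator E v w (unlift_op E v w A)"
    by (rule bounded_operator_lift_iff[OF v w _ A'(1)])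
      (use 1 A'(2) up_supported[OF v] dn_l2[OF w] in \<open>auto simp: unlift_op_def[of _ _ _ A]\<close>)
qed

lemma mat_op_finite_bounded:
  assumes E: "finite E" and w: "positive_on E w"
  shows "bounded_operator E w w (mat_op E p)"
proof -
  define A where "A g = up E w (mat_op E p (dn E w g))" for g
  have l: "mat_op E p f \<in> l2 E w" for f by (simp add: l2_finite[OF E] mat_op_finite[OF E])
  have "linear A"
  proof (rule linearI)
    fix f g and r :: real
    have "mat_op E p (dn E w (f + g)) = (\<lambda>x. 1 * mat_op E p (dn E w f) x + 1 * mat_op E p (dn E w g) x)"
      using dn_linear[of E w 1 f 1 g] by (auto simp: mat_op_finite[OF E] fun_eq_iff algebra_simps sum.distrib)
    then show "A (f + g) = A f + A g" unfolding A_def by (simp only: l2_combination(2)[OF w l l] scaleR_one)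
    have "mat_op E p (dn E w (r *\<^sub>R f)) = (\<lambda>x. r * mat_op E p (dn E w f) x)"
      using dn_linear[of E w r f 0 f] by (auto simp: mat_op_finite[OF E] fun_eq_iff sum_distrib_left mult_ac)
    then show "A (r *\<^sub>R f) = r *\<^sub>R A f" unfolding A_def by (simp only: l2_scale(2)[OF w l])
  qed
  then obtain A' where A': "bounded_linear A'" "\<And>f. f \<in> supported_on E \<Longrightarrow> A' f = A f"
    by (rule finite_linear_bounded[OF E]) (rule that)
  show ?thesis
    by (rule bounded_operator_lift_iff[OF w w l A'(1)]) (simp add: A'(2) up_supported[OF w] A_def dn_up[OF w])
qed

lemma finite_compact_operator:
  assumes E: "finite E" and w: "positive_on E w" and A: "bounded_operator E w w A"
  shows "compact_operator E w A"
proof -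
  interpret hilbert_subspace "supported_on E"
    by unfold_locales (rule subspace_supported_on closed_supported_on)+
  have "compact_on (supported_on E) (lift_op E w w A)"
    by (rule hilbert_schmidt_compact[OF onb_delta countable_finite[OF E] lift_op_bounded_linear[OF w w A]])
      (use lift_op_supported[OF w w A] E in auto)
  then show ?thesis by (simp add: compact_operator_lift[OF w A])
qed

lemma independent_eigenvectors:
  assumes A: "linear (A :: 'a::real_vector \<Rightarrow> 'a)" and S: "finite S"
    and eig: "\<And>x. x \<in> S \<Longrightarrow> A x = \<tau> x *\<^sub>R x" "\<And>x. x \<in> S \<Longrightarrow> x \<noteq> 0" and inj: "inj_on \<tau> S"
  shows "independent S"
proof -
  have "\<forall>x\<in>S. c x = 0" if "(\<Sum>x\<in>S. c x *\<^sub>R x) = 0" for c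
    using S eig inj that
  proof (induction S arbitrary: c rule: finite_induct)
    case (insert a S)
    let ?s = "\<Sum>x\<in>S. c x *\<^sub>R x"
    have 0: "c a *\<^sub>R a + ?s = 0" using insert by simp
    have eq1: "A (c a *\<^sub>R a + ?s) = c a *\<^sub>R (\<tau> a *\<^sub>R a) + (\<Sum>x\<in>S. c x *\<^sub>R (\<tau> x *\<^sub>R x))"
      using insert.prems(1) by (simp add: linear_add[OF A] linear_sum[OF A] linear_scale[OF A])
    have eq2: "\<tau> a *\<^sub>R (c a *\<^sub>R a + ?s) = c a *\<^sub>R (\<tau> a *\<^sub>R a) + (\<Sum>x\<in>S. \<tau> a *\<^sub>R (c x *\<^sub>R x))"
      by (simp add: scaleR_add_right scaleR_sum_right mult.commute)
    have "c a *\<^sub>R (\<tau> a *\<^sub>R a) + (\<Sum>x\<in>S. c x *\<^sub>R (\<tau> x *\<^sub>R x)) = 0"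
      unfolding eq1[symmetric] 0 by (rule linear_0[OF A])
    moreover have "c a *\<^sub>R (\<tau> a *\<^sub>R a) + (\<Sum>x\<in>S. \<tau> a *\<^sub>R (c x *\<^sub>R x)) = 0"
      unfolding eq2[symmetric] 0 by (rule scaleR_zero_right)
    ultimately have "(\<Sum>x\<in>S. c x *\<^sub>R (\<tau> x *\<^sub>R x)) = (\<Sum>x\<in>S. \<tau> a *\<^sub>R (c x *\<^sub>R x))"
      by (metis add_left_cancel)
    then have "(\<Sum>x\<in>S. c x *\<^sub>R (\<tau> x *\<^sub>R x)) - (\<Sum>x\<in>S. \<tau> a *\<^sub>R (c x *\<^sub>R x)) = 0"
      by (rule eq_iff_diff_eq_0[THEN iffD1])
    then have "(\<Sum>x\<in>S. (c x * (\<tau> x - \<tau> a)) *\<^sub>R x) = 0"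
      by (simp add: sum_subtractf[symmetric] algebra_simps)
    then have "\<forall>x\<in>S. c x * (\<tau> x - \<tau> a) = 0"
      by (rule insert.IH[rotated 3]) (use insert.prems in \<open>auto intro: inj_on_subset\<close>)
    moreover have "\<tau> x \<noteq> \<tau> a" if "x \<in> S" for x
      using insert.prems(3) insert.hyps(2) that by (auto simp: inj_on_def)
    ultimately have c0: "\<forall>x\<in>S. c x = 0" by simp
    then have "c a *\<^sub>R a = 0" using 0 by simp
    then show ?case using c0 insert.prems(2)[of a] by simp
  qed simp
  then show ?thesis by (intro independent_if_scalars_zero[OF S]) blast
qed

lemma eigenfunctions_basis:
  assumes E: "finite E" and w: "positive_on E w" and t: "inj_on t {..<card E}"
    and f: "\<And>k. k < card E \<Longrightarrow> f k \<in> l2 E w" "\<And>k. k < card E \<Longrightarrow> f k \<noteq> (\<lambda>x. 0)"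
    and eig: "\<And>k. k < card E \<Longrightarrow> mat_op E p (f k) = (\<lambda>x. t k * f k x)"
  shows "inj_on (\<lambda>k. up E w (f k)) {..<card E}" "independent ((\<lambda>k. up E w (f k)) ` {..<card E})"
    "span ((\<lambda>k. up E w (f k)) ` {..<card E}) = supported_on E"
proof -
  let ?F = "\<lambda>k. up E w (f k)" and ?n = "card E"
  let ?P = "lift_op E w w (mat_op E p)"
  note b = mat_op_finite_bounded[OF E w, of p]
  note lin = bounded_linear.linear[OF lift_op_bounded_linear[OF w w b]]
  have PF: "?P (?F k) = t k *\<^sub>R ?F k" if "k < ?n" for k
    using that by (simp add: lift_op_up[OF w] f eig l2_scale(2)[OF w])
  have F0: "?F k \<noteq> 0" if "k < ?n" for k
  proof
    assume "?F k = 0"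
    then have "f k = (\<lambda>x. 0)" using up_inject[OF w f(1)[OF that] l2_zero] up_zero[OF w] by simp
    with f(2)[OF that] show False ..
  qed
  show inj: "inj_on ?F {..<?n}"
  proof (rule inj_onI)
    fix j k assume jk: "j \<in> {..<?n}" "k \<in> {..<?n}" "?F j = ?F k"
    then have "t j *\<^sub>R ?F j = t k *\<^sub>R ?F j" using PF[of j] PF[of k] by (metis lessThan_iff)
    then have "t j = t k" using F0[of k] jk by auto
    with t jk show "j = k" by (simp add: inj_on_def)
  qed
  define \<tau> where "\<tau> x = t (inv_into {..<?n} ?F x)" for x
  have \<tau>: "\<tau> (?F k) = t k" if "k < ?n" for k using inv_into_f_f[OF inj, of k] that by (simp add: \<tau>_def)
  show ind: "independent (?F ` {..<?n})"
  proof (rule independent_eigenvectors[OF lin, where \<tau> = \<tau>])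
    show "inj_on \<tau> (?F ` {..<?n})" using t by (auto simp: inj_on_def \<tau>)
  qed (use PF F0 \<tau> in auto)
  have sub: "?F ` {..<?n} \<subseteq> supported_on E" using f(1) up_supported[OF w] by blast
  have on: "orthonormal_on (delta ` E) (\<lambda>x. x)"
    by (auto simp: orthonormal_on_def) (metis coord_delta zero_neq_one)
  have "onb (supported_on E) (delta ` E) (\<lambda>x. x)"
    using onb_delta[of E] on by (simp add: onb_def)
  then have D: "supported_on E \<subseteq> span (delta ` E)"
    by (rule onb_finite_span) (use E subspace_supported_on closed_supported_on in auto)
  show "span (?F ` {..<?n}) = supported_on E"
  proof
    show "span (?F ` {..<?n}) \<subseteq> supported_on E" by (rule span_minimal[OF sub subspace_supported_on])
    show "supported_on E \<subseteq> span (?F ` {..<?n})"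
    proof
      fix x assume x: "x \<in> supported_on E"
      show "x \<in> span (?F ` {..<?n})"
      proof (rule ccontr)
        assume nx: "x \<notin> span (?F ` {..<?n})"
        then have "independent (insert x (?F ` {..<?n}))" using ind by (rule independent_insertI)
        moreover have "insert x (?F ` {..<?n}) \<subseteq> span (delta ` E)" using D x sub by auto
        ultimately have "card (insert x (?F ` {..<?n})) \<le> card (delta ` E)"
          by (rule independent_span_bound[OF finite_imageI[OF E], THEN conjunct2])
        also have "\<dots> \<le> ?n" by (rule card_image_le[OF E])
        also have "card (insert x (?F ` {..<?n})) = Suc ?n"
        proof -
          have nx': "x \<notin> ?F ` {..<?n}"
          proof
            assume "x \<in> ?F ` {..<?n}"
            with nx show False using span_base by metis
          qed
          have "card (insert x (?F ` {..<?n})) = Suc (card (?F ` {..<?n}))"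
            by (rule card_insert_disjoint[OF _ nx']) simp
          then show ?thesis unfolding card_image[OF inj] by simp
        qed
        finally show False by simp
      qed
    qed
  qed
qed

lemma same_simple_spectrum_similar:
  assumes E: "finite E" and v: "positive_on E v" and w: "positive_on E w" and t: "inj_on t {..<card E}"
    and f: "\<And>k. k < card E \<Longrightarrow> f k \<in> l2 E v" "\<And>k. k < card E \<Longrightarrow> f k \<noteq> (\<lambda>x. 0)"
      "\<And>k. k < card E \<Longrightarrow> mat_op E p (f k) = (\<lambda>x. t k * f k x)"
    and g: "\<And>k. k < card E \<Longrightarrow> g k \<in> l2 E w" "\<And>k. k < card E \<Longrightarrow> g k \<noteq> (\<lambda>x. 0)"
      "\<And>k. k < card E \<Longrightarrow> mat_op E q (g k) = (\<lambda>x. t k * g k x)"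
  shows "\<exists>\<Lambda>. similar_via E p v q w \<Lambda>"
proof -
  let ?n = "card E" and ?F = "\<lambda>k. up E v (f k)" and ?G = "\<lambda>k. up E w (g k)" and ?H = "supported_on E"
  note Fb = eigenfunctions_basis[OF E v t f] and Gb = eigenfunctions_basis[OF E w t g]
  have map: "\<exists>L. linear L \<and> (\<forall>k<?n. L (X k) = Y k)"
    if inj: "inj_on X {..<?n}" and ind: "independent (X ` {..<?n})" for X Y :: "nat \<Rightarrow> ell2"
  proof -
    obtain L where "linear L" "\<forall>x\<in>X ` {..<?n}. L x = Y (inv_into {..<?n} X x)"
      using linear_independent_extend[OF ind, of "\<lambda>x. Y (inv_into {..<?n} X x)"] by blast
    then show ?thesis using inj by (intro exI[of _ L]) (auto simp: inv_into_f_f)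
  qed
  obtain L where L: "linear L" "\<And>k. k < ?n \<Longrightarrow> L (?G k) = ?F k" using map[OF Gb(1,2), of ?F] by blast
  obtain M where M: "linear M" "\<And>k. k < ?n \<Longrightarrow> M (?F k) = ?G k" using map[OF Fb(1,2), of ?G] by blast
  \<comment> \<open>Outside the span of the eigenfunctions \<open>L\<close> is an arbitrary linear
    extension, so invariance of the subspace has to be read off from the images of the spanning
    set.\<close>
  have LH: "L x \<in> ?H" if "x \<in> ?H" for x
  proof -
    have "L x \<in> L ` span (?G ` {..<?n})" using that Gb(3) by simp
    also have "\<dots> = span (L ` ?G ` {..<?n})" by (rule linear_span_image[OF L(1), symmetric])
    also have "L ` ?G ` {..<?n} = ?F ` {..<?n}" using L(2) by (force simp: image_iff)
    finally show ?thesis using Fb(3) by simp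
  qed
  have MH: "M x \<in> ?H" if "x \<in> ?H" for x
  proof -
    have "M x \<in> M ` span (?F ` {..<?n})" using that Fb(3) by simp
    also have "\<dots> = span (M ` ?F ` {..<?n})" by (rule linear_span_image[OF M(1), symmetric])
    also have "M ` ?F ` {..<?n} = ?G ` {..<?n}" using M(2) by (force simp: image_iff)
    finally show ?thesis using Gb(3) by simp
  qed
  have M_L: "M (L x) = x" if "x \<in> ?H" for x
  proof -
    have "(M \<circ> L) x = id x"
      by (rule linear_eq_on[OF linear_compose[OF L(1) M(1)] linear_id, of _ "?G ` {..<?n}"])
        (use that Gb(3) L M in auto)
    then show ?thesis by simp
  qed
  have LM: "L (M x) = x" if "x \<in> ?H" for x
  proof -
    have "(L \<circ> M) x = id x"
      by (rule linear_eq_on[OF linear_compose[OF M(1) L(1)] linear_id, of _ "?F ` {..<?n}"])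
        (use that Fb(3) L M in auto)
    then show ?thesis by simp
  qed
  let ?\<Lambda> = "unlift_op E w v L" and ?B = "unlift_op E v w M"
  note \<Lambda> = finite_bounded_operator[OF E w v L(1) LH] and B = finite_bounded_operator[OF E v w M(1) MH]
  note bp = mat_op_finite_bounded[OF E v, of p] and bq = mat_op_finite_bounded[OF E w, of q]
  note in_l2 = bounded_operator_l2[OF \<Lambda>(1)] bounded_operator_l2[OF B(1)] bounded_operator_l2[OF bp] bounded_operator_l2[OF bq]
  have "?B (?\<Lambda> x) = x" if x: "x \<in> l2 E w" for x
    by (rule up_inject[OF w]) (use x in \<open>auto simp: in_l2 \<Lambda>(2) B(2) M_L up_supported[OF w]\<close>)
  moreover have "?\<Lambda> (?B x) = x" if x: "x \<in> l2 E v" for x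
    by (rule up_inject[OF v]) (use x in \<open>auto simp: in_l2 \<Lambda>(2) B(2) LM up_supported[OF v]\<close>)
  moreover have "mat_op E p (?\<Lambda> x) = ?\<Lambda> (mat_op E q x)" if x: "x \<in> l2 E w" for x
  proof (rule up_inject[OF v])
    let ?P = "lift_op E v v (mat_op E p)" and ?Q = "lift_op E w w (mat_op E q)"
    note lP = bounded_linear.linear[OF lift_op_bounded_linear[OF v v bp]]
      and lQ = bounded_linear.linear[OF lift_op_bounded_linear[OF w w bq]]
    have "(?P \<circ> L) (up E w x) = (L \<circ> ?Q) (up E w x)"
    proof (rule linear_eq_on[OF linear_compose[OF L(1) lP] linear_compose[OF lQ L(1)], of _ "?G ` {..<?n}"])
      show "up E w x \<in> span (?G ` {..<?n})" using Gb(3) up_supported[OF w x] by simp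
      show "(?P \<circ> L) y = (L \<circ> ?Q) y" if "y \<in> ?G ` {..<?n}" for y
        using that f g L by (auto simp: lift_op_up[OF v] lift_op_up[OF w] l2_scale(2)[OF v] l2_scale(2)[OF w] linear_scale[OF L(1)])
    qed
    then show "up E v (mat_op E p (?\<Lambda> x)) = up E v (?\<Lambda> (mat_op E q x))"
      using x by (simp add: \<Lambda>(2) in_l2 lift_op_up[OF w x]) (simp add: in_l2 \<Lambda>(2)[symmetric] lift_op_up[OF v])
  qed (use x in_l2 in auto)
  ultimately have "similar_via E p v q w ?\<Lambda>"
    unfolding similar_via_def bounded_invertible_def using \<Lambda>(1) B(1) by blast
  then show ?thesis by blast
qed

text \<open>Row \<open>x\<close> of the eigenvalue equation expresses \<open>g (x + 1)\<close>
  through the values at states up to \<open>x\<close>, because \<open>p x (x + 1)\<close> is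
  nonzero. An eigenfunction is thus determined by its value at \<open>a\<close>, which is the reason
  for simple eigenvalues.\<close>

lemma skip_free_eigenfunction_zero:
  assumes E: "E = {a..b :: int}" and pos: "\<And>x. x \<in> E \<Longrightarrow> x + 1 \<in> E \<Longrightarrow> 0 < p x (x + 1)"
    and sf: "\<And>x y. x \<in> E \<Longrightarrow> y \<in> E \<Longrightarrow> x + 2 \<le> y \<Longrightarrow> p x y = 0"
    and g: "mat_op E p g = (\<lambda>x. l * g x)" and ga: "g a = 0" and off: "\<And>x. x \<notin> E \<Longrightarrow> g x = 0"
  shows "g = (\<lambda>x. 0)"
proof -
  have fin: "finite E" by (simp add: E)
  have step: "g y = 0" if "y \<le> a + int n" for n y
    using that
  proof (induction n arbitrary: y)
    case 0
    then show ?case using ga off[of y] by (cases "y = a") (auto simp: E)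
  next
    case (Suc n)
    show ?case
    proof (cases "y \<le> a + int n \<or> y \<notin> E")
      case True then show ?thesis using Suc off by blast
    next
      case False
      define x where "x = a + int n"
      have y: "y = x + 1" "x + 1 \<in> E" "x \<in> E" using False Suc.prems by (auto simp: x_def E)
      have "0 = mat_op E p g x" using g Suc.IH[of x] by (simp add: x_def)
      also have "\<dots> = (\<Sum>y\<in>E. p x y * g y)" using y by (simp add: mat_op_finite[OF fin])
      also have "\<dots> = (\<Sum>y\<in>{x + 1}. p x y * g y)"
      proof (rule sum.mono_neutral_right[OF fin])
        show "\<forall>i\<in>E - {x + 1}. p x i * g i = 0"
        proof
          fix i assume i: "i \<in> E - {x + 1}"
          show "p x i * g i = 0"
          proof (cases "i \<le> x")
            case True then show ?thesis using Suc.IH[of i] by (simp add: x_def)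
          next
            case False then show ?thesis using sf[of x i] i y by simp
          qed
        qed
      qed (use y in auto)
      finally show ?thesis using pos[OF y(3,2)] y by simp
    qed
  qed
  show ?thesis
  proof
    fix y show "g y = 0" using step[of y "nat (y - a)"] by (cases "y \<le> a") (auto intro: step[of y 0])
  qed
qed

lemma reversible_simple_spectrum:
  assumes E: "E = {a..b :: int}" and q: "sub_markov E q" and \<kappa>: "reversible_measure E q \<kappa>"
    and pos: "\<And>x. x \<in> E \<Longrightarrow> x + 1 \<in> E \<Longrightarrow> 0 < q x (x + 1)"
    and sf: "\<And>x y. x \<in> E \<Longrightarrow> y \<in> E \<Longrightarrow> x + 2 \<le> y \<Longrightarrow> q x y = 0"
  obtains e t where "orthonormal_basis E \<kappa> e" "\<And>k. k < card E \<Longrightarrow> mat_op E q (e k) = (\<lambda>x. t k * e k x)"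
    "inj_on t {..<card E}"
proof -
  have fin: "finite E" by (simp add: E)
  have I: "index_set E = {..<card E}" using fin by (auto simp: index_set_def)
  note v = reference_positive_on[OF reversible_reference[OF q \<kappa>]]
  obtain e t where e: "orthonormal_basis E \<kappa> e"
    and t: "\<And>k. k \<in> index_set E \<Longrightarrow> mat_op E q (e k) = (\<lambda>x. t k * e k x)"
    by (rule compact_reversible_eigenbasis[OF q \<kappa> finite_compact_operator[OF fin v mat_op_finite_bounded[OF fin v]]]) blast
  have el2: "e k \<in> l2 E \<kappa>" if "k < card E" for k using e that I by (simp add: orthonormal_basis_def)
  have ip: "l2_inner E \<kappa> (e j) (e k) = (if j = k then 1 else 0)" if "j < card E" "k < card E" for j k
    using e that I by (simp add: orthonormal_basis_def biorthogonal_def)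
  have zero: "g = (\<lambda>x. 0)"
    if "mat_op E q g = (\<lambda>x. l * g x)" "g a = 0" "\<And>x. x \<notin> E \<Longrightarrow> g x = 0" for g l
    by (rule skip_free_eigenfunction_zero[OF E, of q g l]) (use pos sf that in auto)
  have "inj_on t {..<card E}"
  proof (rule inj_onI, rule ccontr)
    fix j k assume jk: "j \<in> {..<card E}" "k \<in> {..<card E}" "t j = t k" "j \<noteq> k"
    then have jk': "j < card E" "k < card E" by auto
    \<comment> \<open>Two orthonormal eigenfunctions for one eigenvalue are combined so as to vanish
      at \<open>a\<close>. The combination must be 0, which gives \<open>e k a = 0\<close>, and then
      \<open>e k\<close> itself would vanish.\<close>
    define g where "g = (\<lambda>x. e k a * e j x + (- e j a) * e k x)"
    note c = l2_combination[OF v el2[OF jk'(1)] el2[OF jk'(2)], of "e k a" "- e j a"]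
    have "mat_op E q g = (\<lambda>x. e k a * mat_op E q (e j) x + (- e j a) * mat_op E q (e k) x)"
      using mat_op_finite_bounded[OF fin v, of q] el2[OF jk'(1)] el2[OF jk'(2)]
      unfolding g_def bounded_operator_def by blast
    then have "mat_op E q g = (\<lambda>x. t k * g x)"
      using jk t[of j] t[of k] I by (simp add: g_def algebra_simps fun_eq_iff)
    then have g0: "g = (\<lambda>x. 0)"
      by (rule zero) (use c(1) in \<open>auto simp: g_def l2_def\<close>)
    have "up E \<kappa> g = e k a *\<^sub>R up E \<kappa> (e j) + (- e j a) *\<^sub>R up E \<kappa> (e k)"
      unfolding g_def by (rule c(2))
    then have "(e k a *\<^sub>R up E \<kappa> (e j) + (- e j a) *\<^sub>R up E \<kappa> (e k)) \<bullet> up E \<kappa> (e j) = 0"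
      using g0 up_zero[OF v] by simp
    then have "e k a = 0"
      using jk by (simp add: inner_diff_left inner_up[OF v el2 el2] ip)
    then have "e k = (\<lambda>x. 0)"
      by (intro zero[of "e k" "t k"]) (use t[of k] I jk el2[of k] in \<open>auto simp: l2_def\<close>)
    then show False using ip[of k k] jk by (simp add: l2_inner_def)
  qed
  with e t I that show ?thesis by auto
qed

subsection \<open>Complex eigenvalues\<close>

text \<open>A complex eigenvector is split into a pair of real functions, so that complex
  eigenvalues can be followed through operators on real spaces.\<close>

lemma eigenvalues_real_imag:
  assumes E: "finite E"
  shows "z \<in> eigenvalues E p \<longleftrightarrow> (\<exists>f g. (\<forall>x. x \<notin> E \<longrightarrow> f x = 0 \<and> g x = 0) \<and> (f \<noteq> (\<lambda>x. 0) \<or> g \<noteq> (\<lambda>x. 0)) \<and>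
    mat_op E p f = (\<lambda>x. Re z * f x + (- Im z) * g x) \<and> mat_op E p g = (\<lambda>x. Im z * f x + Re z * g x))"
proof
  assume "z \<in> eigenvalues E p"
  then obtain h where h: "\<exists>x\<in>E. h x \<noteq> 0" "\<And>x. x \<in> E \<Longrightarrow> (\<Sum>y\<in>E. complex_of_real (p x y) * h y) = z * h x"
    unfolding eigenvalues_def by blast
  have re: "(\<Sum>y\<in>E. p x y * Re (h y)) = Re z * Re (h x) - Im z * Im (h x)"
    and im: "(\<Sum>y\<in>E. p x y * Im (h y)) = Im z * Re (h x) + Re z * Im (h x)" if "x \<in> E" for x
    using arg_cong[OF h(2)[OF that], of Re] arg_cong[OF h(2)[OF that], of Im] by simp_all
  obtain x0 where x0: "x0 \<in> E" "h x0 \<noteq> 0" using h(1) by blast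
  then have "Re (h x0) \<noteq> 0 \<or> Im (h x0) \<noteq> 0" by (auto simp: complex_eq_iff)
  then show "\<exists>f g. (\<forall>x. x \<notin> E \<longrightarrow> f x = 0 \<and> g x = 0) \<and> (f \<noteq> (\<lambda>x. 0) \<or> g \<noteq> (\<lambda>x. 0)) \<and>
    mat_op E p f = (\<lambda>x. Re z * f x + (- Im z) * g x) \<and> mat_op E p g = (\<lambda>x. Im z * f x + Re z * g x)"
    using x0
    by (intro exI[of _ "\<lambda>x. if x \<in> E then Re (h x) else 0"] exI[of _ "\<lambda>x. if x \<in> E then Im (h x) else 0"])
      (auto simp: mat_op_finite[OF E] fun_eq_iff re im cong: sum.cong)
next
  assume "\<exists>f g. (\<forall>x. x \<notin> E \<longrightarrow> f x = 0 \<and> g x = 0) \<and> (f \<noteq> (\<lambda>x. 0) \<or> g \<noteq> (\<lambda>x. 0)) \<and>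
    mat_op E p f = (\<lambda>x. Re z * f x + (- Im z) * g x) \<and> mat_op E p g = (\<lambda>x. Im z * f x + Re z * g x)"
  then obtain f g where off: "\<And>x. x \<notin> E \<Longrightarrow> f x = 0 \<and> g x = 0" and ne: "f \<noteq> (\<lambda>x. 0) \<or> g \<noteq> (\<lambda>x. 0)"
    and f: "mat_op E p f = (\<lambda>x. Re z * f x + (- Im z) * g x)" and g: "mat_op E p g = (\<lambda>x. Im z * f x + Re z * g x)"
    by blast
  obtain x0 where x0: "f x0 \<noteq> 0 \<or> g x0 \<noteq> 0" using ne by (auto simp: fun_eq_iff)
  then have "x0 \<in> E" using off by blast
  moreover have "Complex (f x0) (g x0) \<noteq> 0" using x0 by (simp add: complex_eq_iff)
  moreover have "(\<Sum>y\<in>E. complex_of_real (p x y) * Complex (f y) (g y)) = z * Complex (f x) (g x)" if "x \<in> E" for x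
    using fun_cong[OF f, of x] fun_cong[OF g, of x] that
    by (simp add: complex_eq_iff mat_op_finite[OF E])
  ultimately show "z \<in> eigenvalues E p"
    unfolding eigenvalues_def by (intro CollectI exI[of _ "\<lambda>y. Complex (f y) (g y)"]) blast
qed

lemma of_real_eigenvalue:
  assumes E: "finite E" and l: "complex_of_real l \<in> eigenvalues E p"
  shows "\<exists>f. (\<forall>x. x \<notin> E \<longrightarrow> f x = 0) \<and> f \<noteq> (\<lambda>x. 0) \<and> mat_op E p f = (\<lambda>x. l * f x)"
  using l unfolding eigenvalues_real_imag[OF E] by auto

lemma eigenvalues_similar_subset:
  assumes E: "finite E" and v: "positive_on E v" and w: "positive_on E w" and sim: "similar_via E a v b w A"
  shows "eigenvalues E b \<subseteq> eigenvalues E a"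
proof
  fix z assume "z \<in> eigenvalues E b"
  then obtain f g where off: "\<And>x. x \<notin> E \<Longrightarrow> f x = 0" "\<And>x. x \<notin> E \<Longrightarrow> g x = 0" and ne: "f \<noteq> (\<lambda>x. 0) \<or> g \<noteq> (\<lambda>x. 0)"
    and f: "mat_op E b f = (\<lambda>x. Re z * f x + (- Im z) * g x)" and g: "mat_op E b g = (\<lambda>x. Im z * f x + Re z * g x)"
    unfolding eigenvalues_real_imag[OF E] by blast
  obtain B where A: "bounded_operator E w v A" and "bounded_operator E v w B" and "similar_via E b w a v B"
    and BA: "\<And>f. f \<in> l2 E w \<Longrightarrow> B (A f) = f" and "\<And>g. g \<in> l2 E v \<Longrightarrow> A (B g) = g"
    by (rule similar_via_inverse[OF v w mat_op_finite_bounded[OF E v] mat_op_finite_bounded[OF E w] sim]) (rule that)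
  have fg: "f \<in> l2 E w" "g \<in> l2 E w" using off by (simp_all add: l2_finite[OF E])
  have lin: "A (\<lambda>x. c * f x + d * g x) = (\<lambda>x. c * A f x + d * A g x)" for c d
    using A fg unfolding bounded_operator_def by blast
  have inter: "mat_op E a (A h) = A (mat_op E b h)" if "h \<in> l2 E w" for h
    using sim that by (simp add: similar_via_def)
  have A0: "A (\<lambda>x. 0) = (\<lambda>x. 0)" using lin[of 0 0] by simp
  have "A f \<noteq> (\<lambda>x. 0) \<or> A g \<noteq> (\<lambda>x. 0)"
    using ne BA[OF fg(1)] BA[OF fg(2)] BA[OF l2_zero] A0 by metis
  moreover have "mat_op E a (A f) = (\<lambda>x. Re z * A f x + (- Im z) * A g x)"
    unfolding inter[OF fg(1)] f by (rule lin)
  moreover have "mat_op E a (A g) = (\<lambda>x. Im z * A f x + Re z * A g x)"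
    unfolding inter[OF fg(2)] g by (rule lin)
  moreover have "\<forall>x. x \<notin> E \<longrightarrow> A f x = 0 \<and> A g x = 0"
    using bounded_operator_l2[OF A fg(1)] bounded_operator_l2[OF A fg(2)] by (simp add: l2_finite[OF E])
  ultimately show "z \<in> eigenvalues E a" unfolding eigenvalues_real_imag[OF E] by blast
qed

lemma orthonormal_basis_nonzero:
  assumes "orthonormal_basis E w e" "k \<in> index_set E" shows "e k \<noteq> (\<lambda>x. 0)"
proof
  assume "e k = (\<lambda>x. 0)"
  moreover have "l2_inner E w (e k) (e k) = 1" using assms by (simp add: orthonormal_basis_def biorthogonal_def)
  ultimately show False by (simp add: l2_inner_def)
qed

text \<open>An eigenvector for \<open>z\<close> has a nonzero coefficient at some
  \<open>e k\<close>, and self-adjointness shows that this coefficient is multiplied both by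
  \<open>t k\<close> and by \<open>z\<close>.\<close>

lemma eigenvalues_reversible:
  assumes E: "finite E" and v: "positive_on E \<kappa>" and e: "orthonormal_basis E \<kappa> e"
    and sa: "\<And>f g. f \<in> l2 E \<kappa> \<Longrightarrow> g \<in> l2 E \<kappa> \<Longrightarrow> l2_inner E \<kappa> (mat_op E q f) g = l2_inner E \<kappa> f (mat_op E q g)"
    and t: "\<And>k. k < card E \<Longrightarrow> mat_op E q (e k) = (\<lambda>x. t k * e k x)"
  shows "eigenvalues E q = (\<lambda>k. complex_of_real (t k)) ` {..<card E}"
proof
  have I: "index_set E = {..<card E}" using E by (auto simp: index_set_def)
  have el2: "e k \<in> l2 E \<kappa>" if "k < card E" for k using e that I by (simp add: orthonormal_basis_def)
  have e0: "e k \<noteq> (\<lambda>x. 0)" if "k < card E" for k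
    using orthonormal_basis_nonzero[OF e] that I by simp
  have "complex_of_real (t k) \<in> eigenvalues E q" if k: "k < card E" for k
    unfolding eigenvalues_real_imag[OF E]
    by (intro exI[of _ "e k"] exI[of _ "\<lambda>x. 0"])
      (use e0[OF k] t[OF k] el2[OF k] in \<open>auto simp: l2_finite[OF E] mat_op_finite[OF E] fun_eq_iff\<close>)
  then show "(\<lambda>k. complex_of_real (t k)) ` {..<card E} \<subseteq> eigenvalues E q" by auto
  show "eigenvalues E q \<subseteq> (\<lambda>k. complex_of_real (t k)) ` {..<card E}"
  proof
    fix z assume "z \<in> eigenvalues E q"
    then obtain f g where off: "\<And>x. x \<notin> E \<Longrightarrow> f x = 0" "\<And>x. x \<notin> E \<Longrightarrow> g x = 0" and ne: "f \<noteq> (\<lambda>x. 0) \<or> g \<noteq> (\<lambda>x. 0)"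
      and f: "mat_op E q f = (\<lambda>x. Re z * f x + (- Im z) * g x)" and g: "mat_op E q g = (\<lambda>x. Im z * f x + Re z * g x)"
      unfolding eigenvalues_real_imag[OF E] by blast
    have fg: "f \<in> l2 E \<kappa>" "g \<in> l2 E \<kappa>" using off by (simp_all add: l2_finite[OF E])
    have "\<exists>k<card E. l2_inner E \<kappa> f (e k) \<noteq> 0 \<or> l2_inner E \<kappa> g (e k) \<noteq> 0"
      using e fg ne I unfolding orthonormal_basis_def by blast
    then obtain k where k: "k < card E" "l2_inner E \<kappa> f (e k) \<noteq> 0 \<or> l2_inner E \<kappa> g (e k) \<noteq> 0" by blast
    define x y where "x = l2_inner E \<kappa> f (e k)" and "y = l2_inner E \<kappa> g (e k)"
    have comb: "l2_inner E \<kappa> (\<lambda>x. c * f x + d * g x) (e k) = c * x + d * y" for c d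
      using l2_combination[OF v fg, of c d] el2[OF k(1)] fg
      by (simp add: x_def y_def inner_up[OF v, symmetric] inner_add_left)
    have sc: "l2_inner E \<kappa> h (\<lambda>x. t k * e k x) = t k * l2_inner E \<kappa> h (e k)" for h
      unfolding l2_inner_def using E by (simp add: sum_distrib_left mult_ac)
    have 1: "t k * x = Re z * x + (- Im z) * y"
      using sa[OF fg(1) el2[OF k(1)]] unfolding f comb t[OF k(1)] sc x_def[symmetric] by simp
    have 2: "t k * y = Im z * x + Re z * y"
      using sa[OF fg(2) el2[OF k(1)]] unfolding g comb t[OF k(1)] sc y_def[symmetric] by simp
    \<comment> \<open>In complex form the two equations read
      \<open>(t k - z) * (x + i y) = 0\<close>; multiplication by the conjugate of the first factor
      separates \<open>x\<close> from \<open>y\<close>.\<close>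
    define s where "s = t k - Re z"
    have sx: "s * x = - (Im z * y)" and sy: "s * y = Im z * x" using 1 2 by (simp_all add: s_def algebra_simps)
    have "(s\<^sup>2 + (Im z)\<^sup>2) * x = s * (s * x) + Im z * (Im z * x)" by (simp add: power2_eq_square algebra_simps)
    also have "\<dots> = 0" unfolding sx sy[symmetric] by simp
    finally have x: "(s\<^sup>2 + (Im z)\<^sup>2) * x = 0" .
    have "(s\<^sup>2 + (Im z)\<^sup>2) * y = s * (s * y) - Im z * (- (Im z * y))" by (simp add: power2_eq_square algebra_simps)
    also have "\<dots> = 0" unfolding sx[symmetric] sy by simp
    finally have "(s\<^sup>2 + (Im z)\<^sup>2) * y = 0" .
    with x k(2) have "s\<^sup>2 + (Im z)\<^sup>2 = 0" by (auto simp: x_def y_def)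
    then have "s = 0" "Im z = 0" by (simp_all add: sum_power2_eq_zero_iff)
    then have "z = complex_of_real (t k)" by (simp add: complex_eq_iff s_def)
    then show "z \<in> (\<lambda>k. complex_of_real (t k)) ` {..<card E}" using k(1) by blast
  qed
qed

lemma finite_state_space_interval:
  assumes "finite (state_space lb rb)"
  shows "\<exists>a b. state_space lb rb = {a..b}"
proof (cases "state_space lb rb = {}")
  case True
  then show ?thesis by (intro exI[of _ 1] exI[of _ 0]) simp
next
  case False
  let ?E = "state_space lb rb"
  have conv: "z \<in> ?E" if "x \<in> ?E" "y \<in> ?E" "x \<le> z" "z \<le> y" for x y z
    using that by (auto simp: state_space_def split: endpoint.splits)
  have "?E = {Min ?E..Max ?E}"
  proof (intro set_eqI iffI)
    fix z assume "z \<in> ?E"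
    then show "z \<in> {Min ?E..Max ?E}" using Min_le[OF assms] Max_ge[OF assms] by simp
  next
    fix z assume "z \<in> {Min ?E..Max ?E}"
    then show "z \<in> ?E" using conv[OF Min_in[OF assms False] Max_in[OF assms False]] by simp
  qed
  then show ?thesis by blast
qed

text \<open>Forward, the inclusion of spectra is applied to \<open>\<Lambda>\<close> and to its
  inverse, and simplicity comes from \<open>q\<close>. Backward, an eigenfunction of
  \<open>p\<close> is picked for each eigenvalue of \<open>q\<close> and matched with that of
  \<open>q\<close>.\<close>

theorem finite_similar_iff:
  assumes E: "E = state_space lb rb" and fin: "finite E" and \<pi>: "positive_on E \<pi>"
    and q: "q \<in> birth_death lb rb" and \<kappa>: "reversible_measure E q \<kappa>"
  shows "(\<exists>\<Lambda>. similar_via E p \<pi> q \<kappa> \<Lambda>) \<longleftrightarrow>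
    real_distinct_eigenvalues E p \<and> eigenvalues E p = eigenvalues E q"
proof -
  have qM: "q \<in> class_M lb rb" using q by (simp add: birth_death_def Let_def)
  have sq: "sub_markov E q" using class_M_sub_markov[OF qM] by (simp add: E)
  note v = reference_positive_on[OF reversible_reference[OF sq \<kappa>]]
  obtain a b where ab: "E = {a..b}" using finite_state_space_interval fin E by metis
  have pos: "0 < q x (x + 1)" if "x \<in> E" "x + 1 \<in> E" for x
    using qM that by (simp add: class_M_def Let_def E)
  have sf: "q x y = 0" if "x \<in> E" "y \<in> E" "x + 2 \<le> y" for x y
    using qM that by (simp add: class_M_def Let_def E)
  obtain e t where e: "orthonormal_basis E \<kappa> e" and t: "\<And>k. k < card E \<Longrightarrow> mat_op E q (e k) = (\<lambda>x. t k * e k x)"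
    and inj: "inj_on t {..<card E}"
    by (rule reversible_simple_spectrum[OF ab sq \<kappa>]) (rule that pos sf | assumption)+
  have eq: "eigenvalues E q = (\<lambda>k. complex_of_real (t k)) ` {..<card E}"
    by (rule eigenvalues_reversible[OF fin v e reversible_self_adjoint[OF sq \<kappa>] t])
  have "inj_on (\<lambda>k. complex_of_real (t k)) {..<card E}" using inj by (auto simp: inj_on_def)
  then have rq: "real_distinct_eigenvalues E q"
    unfolding real_distinct_eigenvalues_def eq by (auto simp: card_image)
  show ?thesis
  proof
    assume "\<exists>\<Lambda>. similar_via E p \<pi> q \<kappa> \<Lambda>"
    then obtain \<Lambda> where sim: "similar_via E p \<pi> q \<kappa> \<Lambda>" by blast
    obtain B where "bounded_operator E \<kappa> \<pi> \<Lambda>" and "bounded_operator E \<pi> \<kappa> B" and sim': "similar_via E q \<kappa> p \<pi> B"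
      and "\<And>f. f \<in> l2 E \<kappa> \<Longrightarrow> B (\<Lambda> f) = f" and "\<And>g. g \<in> l2 E \<pi> \<Longrightarrow> \<Lambda> (B g) = g"
      by (rule similar_via_inverse[OF \<pi> v mat_op_finite_bounded[OF fin \<pi>] mat_op_finite_bounded[OF fin v] sim]) (rule that)
    have "eigenvalues E p = eigenvalues E q"
      using eigenvalues_similar_subset[OF fin \<pi> v sim] eigenvalues_similar_subset[OF fin v \<pi> sim'] by blast
    then show "real_distinct_eigenvalues E p \<and> eigenvalues E p = eigenvalues E q"
      using rq by (simp add: real_distinct_eigenvalues_def)
  next
    assume "real_distinct_eigenvalues E p \<and> eigenvalues E p = eigenvalues E q"
    then have "complex_of_real (t k) \<in> eigenvalues E p" if "k < card E" for k using eq that by auto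
    then have "\<forall>k. \<exists>f. k < card E \<longrightarrow> (\<forall>x. x \<notin> E \<longrightarrow> f x = 0) \<and> f \<noteq> (\<lambda>x. 0) \<and> mat_op E p f = (\<lambda>x. t k * f x)"
      using of_real_eigenvalue[OF fin] by blast
    then obtain f where f: "\<And>k. k < card E \<Longrightarrow> (\<forall>x. x \<notin> E \<longrightarrow> f k x = 0) \<and> f k \<noteq> (\<lambda>x. 0) \<and> mat_op E p (f k) = (\<lambda>x. t k * f k x)"
      by metis
    have I: "index_set E = {..<card E}" using fin by (auto simp: index_set_def)
    show "\<exists>\<Lambda>. similar_via E p \<pi> q \<kappa> \<Lambda>"
      by (rule same_simple_spectrum_similar[OF fin \<pi> v inj, of f p e q])
        (use f t e I orthonormal_basis_nonzero[OF e] in \<open>auto simp: l2_finite[OF fin] orthonormal_basis_def\<close>)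
  qed
qed

subsection \<open>Absorption times\<close>

lemma sum_PiE_Suc:
  assumes "finite (E :: 'a set)"
  shows "(\<Sum>s\<in>PiE {..Suc n} (\<lambda>_. E). F s) = (\<Sum>s\<in>PiE {..n} (\<lambda>_. E). \<Sum>y\<in>E. F (s(Suc n := y)))"
proof -
  have ni: "Suc n \<notin> {..n}" by simp
  have "(\<Sum>s\<in>PiE {..Suc n} (\<lambda>_. E). F s) = (\<Sum>(y, s)\<in>E \<times> PiE {..n} (\<lambda>_. E). F (s(Suc n := y)))"
    unfolding atMost_Suc PiE_insert_eq
    by (subst sum.reindex[OF inj_combinator[OF ni, of "\<lambda>_. E"]]) (simp add: o_def case_prod_unfold)
  also have "\<dots> = (\<Sum>y\<in>E. \<Sum>s\<in>PiE {..n} (\<lambda>_. E). F (s(Suc n := y)))"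
    by (simp add: sum.cartesian_product)
  finally show ?thesis by (simp add: sum.swap[of _ E])
qed

lemma path_sum_mat_op:
  assumes E: "finite E" and x: "x \<in> E" and off: "\<And>y. y \<notin> E \<Longrightarrow> g y = 0"
  shows "(\<Sum>s\<in>PiE {..n} (\<lambda>_. E). (if s 0 = x then 1 else 0) * (\<Prod>i<n. p (s i) (s (Suc i))) * g (s n))
    = (mat_op E p ^^ n) g x"
  using off
proof (induction n arbitrary: g)
  case 0
  have *: "PiE {..0::nat} (\<lambda>_. E) = (\<lambda>y. (\<lambda>_. undefined)(0 := y)) ` E"
  proof -
    have "{..0::nat} = insert 0 {}" by auto
    then show ?thesis by (simp only: PiE_insert_eq PiE_empty_domain) auto
  qed
  have inj: "inj_on (\<lambda>y. (\<lambda>_. undefined)(0 := y)) E" by (auto simp: inj_on_def fun_eq_iff split: if_splits)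
  show ?case unfolding * using E x by (subst sum.reindex[OF inj]) (simp add: if_distrib[of "\<lambda>c. c * _"] cong: if_cong)
next
  case (Suc n)
  have "(\<Sum>s\<in>PiE {..Suc n} (\<lambda>_. E). (if s 0 = x then 1 else 0) * (\<Prod>i<Suc n. p (s i) (s (Suc i))) * g (s (Suc n)))
    = (\<Sum>s\<in>PiE {..n} (\<lambda>_. E). \<Sum>y\<in>E. (if s 0 = x then 1 else 0) * (\<Prod>i<n. p (s i) (s (Suc i))) * (p (s n) y * g y))"
    unfolding sum_PiE_Suc[OF E] by (intro sum.cong refl) (simp add: mult_ac)
  also have "\<dots> = (\<Sum>s\<in>PiE {..n} (\<lambda>_. E). (if s 0 = x then 1 else 0) * (\<Prod>i<n. p (s i) (s (Suc i))) * mat_op E p g (s n))"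
    by (intro sum.cong refl) (auto simp: mat_op_finite[OF E] sum_distrib_left PiE_iff)
  also have "\<dots> = (mat_op E p ^^ n) (mat_op E p g) x"
    by (rule Suc.IH) (simp add: mat_op_finite[OF E])
  finally show ?case by (simp add: funpow_swap1)
qed

text \<open>The start lies in \<open>E\<close>, so absorption at time \<open>n + 1\<close> is the
  disjoint union, over all paths of \<open>n + 1\<close> states in \<open>E\<close>, of following
  the path and then jumping to \<open>a\<close>. The jump has the probability missing from the row
  of the last state.\<close>

lemma hitting_probability:
  assumes E: "finite E" and a: "a \<notin> E" and x: "x \<in> E"
    and mc: "markov_chain (insert a E) (absorbed_kernel E a p) x \<Omega> X"
  shows "measure \<Omega> (hitting_event \<Omega> X a (n + 1)) =
    (mat_op E p ^^ n) (\<lambda>y. if y \<in> E then 1 - (\<Sum>z\<in>E. p y z) else 0) x"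
proof -
  let ?S = "insert a E" and ?k = "absorbed_kernel E a p"
  interpret prob_space \<Omega> using mc by (simp add: markov_chain_def)
  have meas: "X i \<in> measurable \<Omega> (count_space ?S)" for i using mc by (simp add: markov_chain_def)
  have path: "measure \<Omega> {\<omega>\<in>space \<Omega>. \<forall>i\<le>m. X i \<omega> = s i} =
      (if s 0 = x then 1 else 0) * (\<Prod>i<m. ?k (s i) (s (Suc i)))" if "\<forall>i\<le>m. s i \<in> ?S" for m s
    using mc that unfolding markov_chain_def by blast
  define C where "C s = {\<omega>\<in>space \<Omega>. \<forall>i\<le>Suc n. X i \<omega> = (s(Suc n := a)) i}" for s
  let ?P = "PiE {..n} (\<lambda>_. E)"
  have "hitting_event \<Omega> X a (n + 1) = (\<Union>s\<in>?P. C s)"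
  proof (intro set_eqI iffI)
    fix \<omega> assume "\<omega> \<in> hitting_event \<Omega> X a (n + 1)"
    then have w': "\<omega> \<in> space \<Omega>" "X (Suc n) \<omega> = a" "\<And>i. i \<le> n \<Longrightarrow> X i \<omega> \<noteq> a"
      by (auto simp: hitting_event_def)
    have "X i \<omega> \<in> E" if "i \<le> n" for i
      using measurable_space[OF meas w'(1), of i] w'(3)[OF that] by simp
    then have "restrict (\<lambda>i. X i \<omega>) {..n} \<in> ?P" by auto
    moreover have "\<omega> \<in> C (restrict (\<lambda>i. X i \<omega>) {..n})"
      using w' by (auto simp: C_def le_Suc_eq)
    ultimately show "\<omega> \<in> (\<Union>s\<in>?P. C s)" by blast
  next
    fix \<omega> assume "\<omega> \<in> (\<Union>s\<in>?P. C s)"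
    then obtain s where s: "s \<in> ?P" "\<omega> \<in> C s" by blast
    then have "X (Suc n) \<omega> = a" by (auto simp: C_def)
    moreover have "X m \<omega> \<noteq> a" if "m < n + 1" for m
    proof -
      have "X m \<omega> = s m" using s(2) that by (auto simp: C_def)
      moreover have "s m \<in> E" using s(1) that by (auto simp: PiE_iff)
      ultimately show ?thesis using a by auto
    qed
    ultimately show "\<omega> \<in> hitting_event \<Omega> X a (n + 1)"
      using s(2) by (auto simp: hitting_event_def C_def)
  qed
  moreover have "measure \<Omega> (\<Union>s\<in>?P. C s) = (\<Sum>s\<in>?P. measure \<Omega> (C s))"
  proof (rule finite_measure_finite_Union)
    show "finite ?P" using E by (intro finite_PiE) auto
    show "C ` ?P \<subseteq> sets \<Omega>"
    proof
      fix D assume "D \<in> C ` ?P"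
      then obtain s where s: "s \<in> ?P" "D = C s" by blast
      have "D = (\<Inter>i\<in>{..Suc n}. X i -` {(s(Suc n := a)) i} \<inter> space \<Omega>)" by (auto simp: s(2) C_def)
      also have "\<dots> \<in> sets \<Omega>"
      proof (rule sets.finite_INT)
        fix i assume "i \<in> {..Suc n}"
        then have "{(s(Suc n := a)) i} \<in> sets (count_space ?S)" using s(1) by (auto simp: PiE_iff)
        then show "X i -` {(s(Suc n := a)) i} \<inter> space \<Omega> \<in> sets \<Omega>" by (rule measurable_sets[OF meas])
      qed auto
      finally show "D \<in> sets \<Omega>" .
    qed
    show "disjoint_family_on C ?P"
      unfolding disjoint_family_on_def
    proof (intro ballI impI)
      fix s s' assume s: "s \<in> ?P" "s' \<in> ?P" "s \<noteq> s'"
      then obtain i where i: "i \<in> {..n}" "s i \<noteq> s' i" by (meson PiE_ext)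
      then show "C s \<inter> C s' = {}" by (auto simp: C_def)
    qed
  qed
  moreover have "measure \<Omega> (C s) = (if s 0 = x then 1 else 0) * (\<Prod>i<n. p (s i) (s (Suc i))) *
      (if s n \<in> E then 1 - (\<Sum>z\<in>E. p (s n) z) else 0)" if s: "s \<in> ?P" for s
  proof -
    have sE: "s i \<in> E" if "i \<le> n" for i using s that by (auto simp: PiE_iff)
    have "measure \<Omega> (C s) = (if s 0 = x then 1 else 0) * (\<Prod>i<Suc n. ?k ((s(Suc n := a)) i) ((s(Suc n := a)) (Suc i)))"
      unfolding C_def by (subst path) (use sE in \<open>auto simp: le_Suc_eq\<close>)
    also have "(\<Prod>i<Suc n. ?k ((s(Suc n := a)) i) ((s(Suc n := a)) (Suc i))) =
        (\<Prod>i<n. p (s i) (s (Suc i))) * (1 - (\<Sum>z\<in>E. p (s n) z))"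
    proof -
      have first: "(\<Prod>i<n. ?k ((s(Suc n := a)) i) ((s(Suc n := a)) (Suc i))) = (\<Prod>i<n. p (s i) (s (Suc i)))"
      proof (rule prod.cong)
        fix i assume "i \<in> {..<n}"
        then have "s i \<in> E" "s (Suc i) \<in> E" using sE[of i] sE[of "Suc i"] by auto
        then have "s i \<noteq> a" "s (Suc i) \<noteq> a" using a by auto
        then show "?k ((s(Suc n := a)) i) ((s(Suc n := a)) (Suc i)) = p (s i) (s (Suc i))"
          using \<open>i \<in> {..<n}\<close> by (simp add: absorbed_kernel_def)
      qed simp
      have "s n \<noteq> a" using sE[of n] a by auto
      then have "?k ((s(Suc n := a)) n) ((s(Suc n := a)) (Suc n)) = 1 - (\<Sum>z\<in>E. p (s n) z)"
        using E by (simp add: absorbed_kernel_def)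
      then show ?thesis by (simp only: prod.lessThan_Suc first)
    qed
    finally show ?thesis using sE[of n] by simp
  qed
  ultimately have "measure \<Omega> (hitting_event \<Omega> X a (n + 1)) =
      (\<Sum>s\<in>?P. (if s 0 = x then 1 else 0) * (\<Prod>i<n. p (s i) (s (Suc i))) *
        (if s n \<in> E then 1 - (\<Sum>z\<in>E. p (s n) z) else 0))"
    by (simp cong: sum.cong)
  also have "\<dots> = (mat_op E p ^^ n) (\<lambda>y. if y \<in> E then 1 - (\<Sum>z\<in>E. p y z) else 0) x"
    by (rule path_sum_mat_op[OF E x]) simp
  finally show ?thesis .
qed

text \<open>The missing mass is \<open>1 - P 1\<close>, so the probability is the difference of
  \<open>P ^ n\<close> and \<open>P ^ (n + 1)\<close> applied to the constant 1. Expanding both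
  powers produces the factor \<open>1 - \<mu> k\<close>.\<close>

theorem hitting_probability_spectral:
  assumes E: "finite E" and w: "positive_on E w" and eig: "eigen_riesz_basis E w p \<mu> f"
    and f': "riesz_basis E w f'" and bi: "biorthogonal E w f f'"
    and a: "a \<notin> E" and x: "x \<in> E"
    and mc: "markov_chain (insert a E) (absorbed_kernel E a p) x \<Omega> X"
  shows "measure \<Omega> (hitting_event \<Omega> X a (n + 1)) =
    (\<Sum>k\<in>index_set E. \<mu> k ^ n * (1 - \<mu> k) * l2_inner E w (\<lambda>x. 1) (f' k) * f k x)"
proof -
  note b = mat_op_finite_bounded[OF E w, of p]
  \<comment> \<open>The constant 1 does not vanish off \<open>E\<close> and so is not in
    \<open>l2 E w\<close>; its restriction \<open>u\<close> has the same inner products.\<close>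
  define u where "u = (\<lambda>y. if y \<in> E then 1 else (0::real))"
  have u: "u \<in> l2 E w" by (simp add: l2_finite[OF E] u_def)
  have Pu: "mat_op E p u \<in> l2 E w" by (rule bounded_operator_l2[OF b u])
  have fin: "finite (index_set E)" using E by (auto simp: index_set_def)
  have one: "l2_inner E w (\<lambda>x. 1) h = l2_inner E w u h" for h
    unfolding l2_inner_def by (rule infsum_cong) (simp add: u_def)
  have ex: "(mat_op E p ^^ m) u x = (\<Sum>k\<in>index_set E. \<mu> k ^ m * l2_inner E w u (f' k) * f k x)" for m
    using riesz_expansion_pointwise[OF w b eig f' bi u x, where n = m] fin by (simp add: has_sum_finite_iff)
  have "(\<lambda>y. if y \<in> E then 1 - (\<Sum>z\<in>E. p y z) else 0) = (\<lambda>y. 1 * u y + (-1) * mat_op E p u y)"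
    by (auto simp: u_def mat_op_finite[OF E] fun_eq_iff)
  moreover have "(mat_op E p ^^ n) (\<lambda>y. 1 * u y + (-1) * mat_op E p u y) =
      (\<lambda>y. 1 * (mat_op E p ^^ n) u y + (-1) * (mat_op E p ^^ n) (mat_op E p u) y)"
    using mat_op_pow_bounded[OF w b eig, where n = n] u Pu unfolding bounded_operator_def by blast
  ultimately have "measure \<Omega> (hitting_event \<Omega> X a (n + 1)) = (mat_op E p ^^ n) u x - (mat_op E p ^^ Suc n) u x"
    unfolding hitting_probability[OF E a x mc] by (simp add: funpow_swap1)
  also have "\<dots> = (\<Sum>k\<in>index_set E. \<mu> k ^ n * (1 - \<mu> k) * l2_inner E w (\<lambda>x. 1) (f' k) * f k x)"
    unfolding ex one by (simp add: sum_subtractf[symmetric] algebra_simps)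
  finally show ?thesis .
qed

section \<open>Jacobi matrices with positive diagonal and prescribed spectrum\<close>

text \<open>\<open>jacobi_pair z t u\<close>: \<open>t\<close> and \<open>u\<close> are consecutive monic orthogonal polynomials of a Jacobi
  matrix with positive diagonal, and all polynomials before \<open>t\<close> are positive at \<open>z\<close>.\<close>

inductive jacobi_pair :: "real \<Rightarrow> real poly \<Rightarrow> real poly \<Rightarrow> bool" for z where
  base: "a > 0 \<Longrightarrow> jacobi_pair z [:-a, 1:] 1"
| step: "jacobi_pair z u v \<Longrightarrow> a > 0 \<Longrightarrow> b > 0 \<Longrightarrow> poly u z > 0 \<Longrightarrow>
    jacobi_pair z ([:-a, 1:] * u - smult b v) u"

definition monic_deg :: "nat \<Rightarrow> real poly \<Rightarrow> bool" where
  "monic_deg n p \<longleftrightarrow> coeff p n = 1 \<and> (\<forall>i>n. coeff p i = 0)"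

lemma monic_deg_degree: "monic_deg n p \<Longrightarrow> degree p = n"
  unfolding monic_deg_def by (metis degree_le le_degree le_antisym zero_neq_one)

lemma monic_deg_0: "monic_deg 0 p \<Longrightarrow> p = 1"
  unfolding monic_deg_def by (intro poly_eqI) (auto simp: coeff_1 not_less)

lemma coeff_linear_mult:
  "coeff ([:c, 1:] * p) i = c * coeff p i + (case i of 0 \<Rightarrow> 0 | Suc j \<Rightarrow> coeff p j)" for c :: real
  by (simp add: coeff_pCons split: nat.split)

lemma monic_deg_linear_mult: "monic_deg n p \<Longrightarrow> monic_deg (Suc n) ([:c, 1:] * p)"
  unfolding monic_deg_def coeff_linear_mult by (auto split: nat.split)

lemma monic_deg_prod: "finite S \<Longrightarrow> monic_deg (card S) (\<Prod>x\<in>S. [:- x, 1:])"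
proof (induction S rule: finite_induct)
  case empty then show ?case by (simp add: monic_deg_def coeff_1)
next
  case (insert x S)
  show ?case unfolding prod.insert[OF insert.hyps] card_insert_disjoint[OF insert.hyps]
    by (rule monic_deg_linear_mult[OF insert.IH])
qed

lemma jacobi_pair_monic: "jacobi_pair z t u \<Longrightarrow> \<exists>n. monic_deg (Suc n) t \<and> monic_deg n u"
proof (induction rule: jacobi_pair.induct)
  case (base a)
  show ?case by (intro exI[of _ 0]) (auto simp: monic_deg_def coeff_pCons coeff_1 split: nat.split)
next
  case (step u v a b)
  then obtain n where n: "monic_deg (Suc n) u" "monic_deg n v" by blast
  have "monic_deg (Suc (Suc n)) ([:-a, 1:] * u - smult b v)"
    using monic_deg_linear_mult[OF n(1), of "-a"] n(2) unfolding monic_deg_def coeff_diff coeff_smult by simp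
  with n show ?case by blast
qed

lemma pderiv_linear_mult: "pderiv ([:c, 1:] * u) = u + [:c, 1:] * pderiv u" for u :: "real poly"
  unfolding pderiv_mult by (simp add: pderiv_pCons)

text \<open>A confluent Christoffel-Darboux identity: each step adds
  \<open>(poly u x)\<^sup>2\<close> to \<open>b\<close> times the previous value. At a root of
  \<open>t\<close> it says that \<open>u\<close> and the derivative of \<open>t\<close> have the
  same sign.\<close>

lemma jacobi_pair_wronskian:
  assumes "jacobi_pair z t u"
  shows "poly (pderiv t) x * poly u x - poly t x * poly (pderiv u) x > 0"
  using assms
proof (induction rule: jacobi_pair.induct)
  case (step u v a b)
  have "poly (pderiv ([:-a, 1:] * u - smult b v)) x * poly u x - poly ([:-a, 1:] * u - smult b v) x * poly (pderiv u) x
    = (poly u x)\<^sup>2 + b * (poly (pderiv u) x * poly v x - poly u x * poly (pderiv v) x)"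
    unfolding pderiv_diff pderiv_smult pderiv_linear_mult by (simp add: power2_eq_square algebra_simps)
  also have "\<dots> > 0" using step by (intro add_nonneg_pos mult_pos_pos) auto
  finally show ?case .
qed (simp add: pderiv_pCons)

text \<open>Coefficientwise convergence suits the Euclidean algorithm, whose quotients and
  remainders are read off coefficients. With bounded degrees it implies pointwise
  convergence.\<close>

definition coeff_tendsto :: "(nat \<Rightarrow> real poly) \<Rightarrow> real poly \<Rightarrow> bool" where
  "coeff_tendsto T t \<longleftrightarrow> (\<forall>i. (\<lambda>n. coeff (T n) i) \<longlonglongrightarrow> coeff t i)"

lemma coeff_tendsto_const: "coeff_tendsto (\<lambda>n. t) t"
  by (simp add: coeff_tendsto_def)

lemma coeff_tendsto_add: "coeff_tendsto T t \<Longrightarrow> coeff_tendsto U u \<Longrightarrow> coeff_tendsto (\<lambda>n. T n + U n) (t + u)"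
  unfolding coeff_tendsto_def coeff_add by (auto intro: tendsto_add)

lemma coeff_tendsto_diff: "coeff_tendsto T t \<Longrightarrow> coeff_tendsto U u \<Longrightarrow> coeff_tendsto (\<lambda>n. T n - U n) (t - u)"
  unfolding coeff_tendsto_def coeff_diff by (auto intro: tendsto_diff)

lemma coeff_tendsto_smult: "c \<longlonglongrightarrow> d \<Longrightarrow> coeff_tendsto T t \<Longrightarrow> coeff_tendsto (\<lambda>n. smult (c n) (T n)) (smult d t)"
  unfolding coeff_tendsto_def coeff_smult by (auto intro: tendsto_mult)

lemma coeff_tendsto_linear_mult:
  assumes "c \<longlonglongrightarrow> d" "coeff_tendsto T t"
  shows "coeff_tendsto (\<lambda>n. [:c n, 1:] * T n) ([:d, 1:] * t)"
  unfolding coeff_tendsto_def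
proof
  fix i
  have T: "(\<lambda>n. coeff (T n) j) \<longlonglongrightarrow> coeff t j" for j using assms(2) by (simp add: coeff_tendsto_def)
  show "(\<lambda>n. coeff ([:c n, 1:] * T n) i) \<longlonglongrightarrow> coeff ([:d, 1:] * t) i"
    unfolding coeff_linear_mult by (cases i) (use tendsto_mult[OF assms(1) T] tendsto_add[OF tendsto_mult[OF assms(1) T] T] in auto)
qed

lemma poly_sum_le_degree: "degree p \<le> d \<Longrightarrow> poly p x = (\<Sum>i\<le>d. coeff p i * x ^ i)"
  for p :: "real poly"
  unfolding poly_altdef by (rule sum.mono_neutral_left) (auto simp: coeff_eq_0)

lemma poly_tendsto_coeff:
  assumes T: "coeff_tendsto T t" and d: "\<forall>\<^sub>F n in sequentially. degree (T n) \<le> d" "degree t \<le> d"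
  shows "(\<lambda>n. poly (T n) x) \<longlonglongrightarrow> poly t x"
proof -
  have "(\<lambda>n. \<Sum>i\<le>d. coeff (T n) i * x ^ i) \<longlonglongrightarrow> (\<Sum>i\<le>d. coeff t i * x ^ i)"
    using T unfolding coeff_tendsto_def by (intro tendsto_intros) auto
  moreover have "\<forall>\<^sub>F n in sequentially. (\<Sum>i\<le>d. coeff (T n) i * x ^ i) = poly (T n) x"
    using d(1) by eventually_elim (simp add: poly_sum_le_degree)
  ultimately show ?thesis using poly_sum_le_degree[OF d(2), of x] by (simp add: Lim_transform_eventually)
qed

text \<open>Positivity of the recursion coefficients is an open condition, because the Euclidean algorithm
  that recovers them is continuous.\<close>

lemma jacobi_pair_open:
  assumes "jacobi_pair z t u" "monic_deg (Suc d) t" "monic_deg d u"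
    and "coeff_tendsto T t" "coeff_tendsto U u"
    and "\<forall>\<^sub>F n in sequentially. monic_deg (Suc d) (T n)" "\<forall>\<^sub>F n in sequentially. monic_deg d (U n)"
  shows "\<forall>\<^sub>F n in sequentially. jacobi_pair z (T n) (U n)"
  using assms
proof (induction arbitrary: d T U rule: jacobi_pair.induct)
  case (base a)
  have d: "d = 0" using monic_deg_degree[OF base.prems(2)] by simp
  have "(\<lambda>n. - coeff (T n) 0) \<longlonglongrightarrow> - coeff [:-a, 1:] 0"
    by (rule tendsto_minus[OF base.prems(3)[unfolded coeff_tendsto_def, rule_format]])
  then have "\<forall>\<^sub>F n in sequentially. - coeff (T n) 0 > 0"
    by (rule order_tendstoD(1)) (use base.hyps in simp)
  with base.prems(5,6) show ?case
  proof eventually_elim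
    case (elim n)
    have "T n = [:- (- coeff (T n) 0), 1:]"
      using elim(1) unfolding d monic_deg_def
      by (intro poly_eqI) (auto simp: coeff_pCons split: nat.split)
    moreover have "U n = 1" using elim(2) d monic_deg_0 by simp
    ultimately show ?case using jacobi_pair.base[OF elim(3), of z] by metis
  qed
next
  case (step u v a b)
  let ?t = "[:-a, 1:] * u - smult b v"
  obtain m where m: "monic_deg (Suc m) u" "monic_deg m v" using jacobi_pair_monic[OF step.hyps(1)] by blast
  have d: "d = Suc m" using monic_deg_degree[OF m(1)] monic_deg_degree[OF step.prems(2)] by simp
  \<comment> \<open>The recursion constant \<open>a\<close> is the difference of the subleading
    coefficients of consecutive monic polynomials, hence continuous in the pair.\<close>
  define A where "A n = coeff (U n) m - coeff (T n) (Suc m)" for n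
  have Tl: "(\<lambda>n. coeff (T n) i) \<longlonglongrightarrow> coeff ?t i" and Ul: "(\<lambda>n. coeff (U n) i) \<longlonglongrightarrow> coeff u i" for i
    using step.prems(3,4) unfolding coeff_tendsto_def by blast+
  have "coeff u m - coeff ?t (Suc m) = a"
    using m unfolding monic_deg_def coeff_diff coeff_linear_mult by simp
  then have A: "A \<longlonglongrightarrow> a" unfolding A_def using tendsto_diff[OF Ul[of m] Tl[of "Suc m"]] by simp
  define R where "R n = [:- A n, 1:] * U n - T n" for n
  have "coeff_tendsto R ([:-a, 1:] * u - ?t)"
    unfolding R_def by (intro coeff_tendsto_diff coeff_tendsto_linear_mult tendsto_minus A step.prems)
  then have R: "coeff_tendsto R (smult b v)" by simp
  \<comment> \<open>The remainder is \<open>b\<close> times the preceding monic polynomial, so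
    \<open>b\<close> is its coefficient of degree \<open>m\<close>.\<close>
  define B where "B n = coeff (R n) m" for n
  have B: "B \<longlonglongrightarrow> b"
    using R m(2) unfolding coeff_tendsto_def B_def monic_deg_def by (metis coeff_smult mult.right_neutral)
  define V where "V n = smult (1 / B n) (R n)" for n
  have V: "coeff_tendsto V v"
  proof -
    have "coeff_tendsto V (smult (1 / b) (smult b v))"
      unfolding V_def by (intro coeff_tendsto_smult R tendsto_divide tendsto_const B) (use step.hyps in simp)
    then show ?thesis using step.hyps by simp
  qed
  have B0: "\<forall>\<^sub>F n in sequentially. B n > 0" using order_tendstoD(1)[OF B] step.hyps by blast
  have A0: "\<forall>\<^sub>F n in sequentially. A n > 0" using order_tendstoD(1)[OF A] step.hyps by blast
  have "\<forall>\<^sub>F n in sequentially. monic_deg m (V n)"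
    using step.prems(5,6) B0
  proof eventually_elim
    case (elim n)
    have "coeff (R n) i = 0" if "i > m" for i
    proof -
      consider "i = Suc m" | "i = Suc (Suc m)" | j where "i = Suc j" "j > Suc m"
      proof -
        assume c: "i = Suc m \<Longrightarrow> thesis" "i = Suc (Suc m) \<Longrightarrow> thesis" "\<And>j. i = Suc j \<Longrightarrow> j > Suc m \<Longrightarrow> thesis"
        obtain j where j: "i = Suc j" using \<open>i > m\<close> by (cases i) auto
        have "j = m \<or> j = Suc m \<or> j > Suc m" using \<open>i > m\<close> j by linarith
        with c j show thesis by blast
      qed
      then show ?thesis
        using elim(1,2) unfolding R_def coeff_diff coeff_linear_mult monic_deg_def d
        by cases (auto simp: A_def)
    qed
    then show ?case using elim(3) by (simp add: V_def monic_deg_def B_def)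
  qed
  then have ev: "\<forall>\<^sub>F n in sequentially. jacobi_pair z (U n) (V n)"
    by (intro step.IH[OF m step.prems(4) V]) (use step.prems(6) in \<open>simp add: d\<close>)
  have "(\<lambda>n. poly (U n) z) \<longlonglongrightarrow> poly u z"
    by (rule poly_tendsto_coeff[OF step.prems(4), of d])
      (use step.prems(2,6) monic_deg_degree in \<open>auto elim: eventually_mono\<close>)
  then have "\<forall>\<^sub>F n in sequentially. poly (U n) z > 0" using order_tendstoD(1) step.hyps by blast
  with ev A0 B0 show ?case
  proof eventually_elim
    case (elim n)
    have "T n = [:- A n, 1:] * U n - smult (B n) (V n)"
      using elim(3) by (simp add: V_def R_def)
    then show ?case using jacobi_pair.step[OF elim(1,2,3,4)] by simp
  qed
qed

lemma coeff_prod_linear_root: "finite S \<Longrightarrow> x \<in> S \<Longrightarrow> poly (\<Prod>y\<in>S. [:- y, 1:]) x = 0"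
  for x :: real by (auto simp: poly_prod)

lemma real_poly_ext: "(\<And>x. poly p x = poly q x) \<Longrightarrow> p = q" for p q :: "real poly"
  by (simp add: poly_eq_poly_eq_iff[symmetric] fun_eq_iff)

lemma poly_eq_of_roots:
  fixes p q :: "real poly"
  assumes S: "finite S" and eq: "\<And>x. x \<in> S \<Longrightarrow> poly p x = poly q x"
    and p: "\<And>i. i \<ge> card S \<Longrightarrow> coeff p i = 0" and q: "\<And>i. i \<ge> card S \<Longrightarrow> coeff q i = 0"
  shows "p = q"
proof (rule ccontr)
  assume "p \<noteq> q"
  then have n: "p - q \<noteq> 0" by simp
  have "S \<subseteq> {x. poly (p - q) x = 0}" using eq by auto
  then have "card S \<le> card {x. poly (p - q) x = 0}" by (rule card_mono[OF poly_roots_finite[OF n]])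
  also have "\<dots> \<le> degree (p - q)" using card_poly_roots_bound[OF n] by simp
  finally have "coeff (p - q) (degree (p - q)) = 0" using p q by simp
  with n show False using leading_coeff_0_iff by blast
qed

text \<open>With \<open>m = (\<alpha> + \<beta>) / 2\<close>, \<open>b0 = ((\<alpha> - \<beta>) / 2)\<^sup>2\<close> and \<open>p = ((x - m)\<^sup>2 - b0) p'\<close>, the choice
  \<open>s = (x - m) p' - \<gamma> s'\<close> makes the Euclidean algorithm for \<open>(p, s)\<close> continue with a pair that tends to
  \<open>(p', u')\<close> as \<open>\<gamma> \<rightarrow> 0\<close>, provided that \<open>s'\<close> interpolates \<open>- u' / ((x - \<alpha>) (x - \<beta>))\<close> at the roots of \<open>p'\<close>
  up to a positive factor.\<close>

lemma jacobi_pair_insert_two: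
  assumes S: "finite S" "S \<noteq> {}" and between: "\<And>x. x \<in> S \<Longrightarrow> \<beta> < x \<and> x < \<alpha>"
    and sum: "\<alpha> + \<beta> > 0" and z: "\<alpha> \<le> z"
    and pu: "jacobi_pair z (\<Prod>x\<in>S. [:- x, 1:]) u'"
  shows "\<exists>s. jacobi_pair z (\<Prod>x\<in>insert \<alpha> (insert \<beta> S). [:- x, 1:]) s"
proof -
  define p' where "p' = (\<Prod>x\<in>S. [:- x, 1:])"
  define k where "k = card S - 1"
  have k: "card S = Suc k" using S by (simp add: k_def card_gt_0_iff)
  have mp: "monic_deg (Suc k) p'" using monic_deg_prod[OF S(1)] by (simp add: p'_def k)
  have pu: "jacobi_pair z p' u'" using pu by (simp add: p'_def)
  obtain k' where "monic_deg (Suc k') p'" "monic_deg k' u'" using jacobi_pair_monic[OF pu] by blast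
  then have mu: "monic_deg k u'" using monic_deg_degree[OF mp] monic_deg_degree by (metis Suc_inject)
  have lt: "\<beta> < \<alpha>" using S between by fastforce
  define m where "m = (\<alpha> + \<beta>) / 2"
  define b0 where "b0 = ((\<alpha> - \<beta>) / 2)\<^sup>2"
  have m: "m > 0" using sum by (simp add: m_def)
  have b0: "b0 > 0" using lt by (simp add: b0_def)
  have g: "(x - \<alpha>) * (x - \<beta>) = (x - m)\<^sup>2 - b0" for x
    by (simp add: m_def b0_def power2_eq_square field_simps)
  have g_neg: "b0 - (x - m)\<^sup>2 > 0" if "x \<in> S" for x
    using mult_neg_pos[of "x - \<alpha>" "x - \<beta>"] between[OF that] g[of x] by simp
  have root: "poly p' x = 0" if "x \<in> S" for x unfolding p'_def by (rule coeff_prod_linear_root[OF S(1) that])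
  \<comment> \<open>The factors \<open>l x\<close> are the unnormalised Lagrange polynomials at the
    roots of \<open>p'\<close>.\<close>
  define l where "l x = (\<Prod>y\<in>S - {x}. [:- y, 1:])" for x
  have pl: "p' = [:- x, 1:] * l x" if "x \<in> S" for x
    unfolding p'_def l_def by (rule prod.remove[OF S(1) that])
  have ml: "monic_deg k (l x)" if "x \<in> S" for x
    using monic_deg_prod[of "S - {x}"] S(1) that k by (simp add: l_def)
  have lpos: "poly u' x / poly (l x) x > 0" if "x \<in> S" for x
  proof -
    have "poly (pderiv p') x = poly (l x) x"
      unfolding pl[OF that] pderiv_linear_mult by simp
    then have "poly (l x) x * poly u' x > 0" using jacobi_pair_wronskian[OF pu, of x] root[OF that] by simp
    then show ?thesis by (auto simp: zero_less_mult_iff zero_less_divide_iff)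
  qed
  \<comment> \<open>These interpolation weights are positive: \<open>poly (l x) x\<close> is the
    derivative of \<open>p'\<close> at its root \<open>x\<close> and has the sign of
    \<open>u'\<close> there by the Wronskian, while \<open>x\<close> lies strictly between
    \<open>\<beta>\<close> and \<open>\<alpha>\<close>. Hence their sum \<open>C\<close> can be
    divided out to make \<open>s'\<close> monic.\<close>
  define cf where "cf x = poly u' x / ((b0 - (x - m)\<^sup>2) * poly (l x) x)" for x
  have cf: "cf x > 0" if "x \<in> S" for x
    using divide_pos_pos[OF lpos[OF that] g_neg[OF that]] by (simp add: cf_def mult.commute)
  define C where "C = sum cf S"
  have C: "C > 0" unfolding C_def using S cf by (intro sum_pos) auto
  define s' where "s' = smult (1 / C) (\<Sum>x\<in>S. smult (cf x) (l x))"
  have ms: "monic_deg k s'"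
  proof -
    have "coeff s' k = (1 / C) * (\<Sum>x\<in>S. cf x)"
      unfolding s'_def coeff_smult coeff_sum using ml by (intro arg_cong2[of _ _ _ _ "(*)"] sum.cong) (auto simp: monic_deg_def)
    moreover have "coeff s' i = 0" if "i > k" for i
      unfolding s'_def coeff_smult coeff_sum using ml that by (simp add: monic_deg_def)
    ultimately show ?thesis using C by (simp add: monic_deg_def C_def)
  qed
  have s'_root: "poly s' x = poly u' x / (C * (b0 - (x - m)\<^sup>2))" if x: "x \<in> S" for x
  proof -
    have l0: "poly (l y) x = 0" if "y \<in> S" "y \<noteq> x" for y
      unfolding l_def using S x that by (intro coeff_prod_linear_root) auto
    have "(\<Sum>y\<in>S. cf y * poly (l y) x) = (\<Sum>y\<in>{x}. cf y * poly (l y) x)"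
      using S x l0 by (intro sum.mono_neutral_right) auto
    then have "poly s' x = (1 / C) * (cf x * poly (l x) x)"
      by (simp add: s'_def poly_sum)
    moreover have "poly (l x) x \<noteq> 0" using lpos[OF x] by auto
    ultimately show ?thesis by (simp add: cf_def)
  qed
  \<comment> \<open>With this value \<open>[:- a1, 1:] * s'\<close> agrees with \<open>p'\<close> in
    the two leading coefficients; \<open>pCons 0\<close> also covers \<open>k = 0\<close>.\<close>
  define a1 where "a1 = coeff (pCons 0 s') k - coeff p' k"
  define dd where "dd = p' - [:-m, 1:] * s'"
  have dd_k: "coeff dd k = m - a1"
    using ms by (simp add: dd_def a1_def monic_deg_def)
  have dd_gt: "coeff dd i = 0" if "i > k" for i
  proof -
    obtain j where j: "i = Suc j" using \<open>i > k\<close> by (cases i) auto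
    show ?thesis using ms mp that unfolding dd_def coeff_diff coeff_linear_mult j monic_deg_def
      by (cases "j = k") auto
  qed
  \<comment> \<open>Any null sequence strictly between 0 and \<open>b0\<close> would serve; the
    offset 2 keeps it below \<open>b0\<close> already at \<open>n = 0\<close>.\<close>
  define \<gamma> where "\<gamma> n = b0 / real (n + 2)" for n
  have \<gamma>: "\<gamma> \<longlonglongrightarrow> 0" unfolding \<gamma>_def by real_asymp
  have \<gamma>0: "\<gamma> n > 0" "\<gamma> n < b0" for n using b0 by (auto simp: \<gamma>_def divide_less_eq)
  define b where "b n = b0 - \<gamma> n" for n
  have b: "b \<longlonglongrightarrow> b0" unfolding b_def using tendsto_diff[OF tendsto_const \<gamma>, of b0] by simp
  have bpos: "b n > 0" for n using \<gamma>0 by (simp add: b_def)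
  \<comment> \<open>The value that cancels the coefficient of degree \<open>k + 1\<close> in
    \<open>[:- a2 n, 1:] * t n - s n\<close>. What remains carries the factor
    \<open>\<gamma> n\<close> explicitly; it is \<open>\<gamma> n\<close> times the polynomial
    \<open>w n\<close>, which has a nonzero limit.\<close>
  define a2 where "a2 n = m + (\<gamma> n / b n) * (m - a1)" for n
  have \<gamma>b: "(\<lambda>n. \<gamma> n / b n) \<longlonglongrightarrow> 0" using tendsto_divide[OF \<gamma> b] b0 by simp
  have a2: "a2 \<longlonglongrightarrow> m"
    unfolding a2_def using tendsto_add[OF tendsto_const tendsto_mult[OF \<gamma>b tendsto_const], of m] by simp
  \<comment> \<open>Splitting \<open>b0 = b n + \<gamma> n\<close>, this \<open>t n\<close> makes
    \<open>[:- m, 1:] * s n - smult (b n) (t n)\<close> equal to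
    \<open>((x - m)\<^sup>2 - b0) * p'\<close>: the terms with \<open>s'\<close> cancel.\<close>
  define t where "t n = p' + smult (\<gamma> n / b n) dd" for n
  define s where "s n = [:-m, 1:] * p' - smult (\<gamma> n) s'" for n
  define w where "w n = s' + smult (1 / b n) ([:- a2 n, 1:] * dd - smult (m - a1) p')" for n
  define w0 where "w0 = s' + smult (1 / b0) ([:- m, 1:] * dd - smult (m - a1) p')"
  have top: "coeff ([:- c, 1:] * dd - smult (m - a1) p') i = 0" if "i > k" for c i
  proof -
    obtain j where j: "i = Suc j" using \<open>i > k\<close> by (cases i) auto
    show ?thesis using dd_k dd_gt mp that unfolding coeff_diff coeff_linear_mult coeff_smult j monic_deg_def
      by (cases "j = k") auto
  qed
  have w_top: "coeff (w n) i = 0" if "i > k" for n i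
    using ms that top[OF that] unfolding w_def coeff_add coeff_smult monic_deg_def by simp
  have w: "coeff_tendsto w w0"
    unfolding w_def w0_def
    by (intro coeff_tendsto_add coeff_tendsto_smult coeff_tendsto_diff coeff_tendsto_linear_mult
        coeff_tendsto_const tendsto_divide tendsto_const b tendsto_minus a2) (use b0 in simp)
  \<comment> \<open>At the roots of \<open>p'\<close> the limit equals \<open>s'\<close> times
    \<open>(b0 - (x - m)\<^sup>2) / b0\<close>, which the interpolation turns into a multiple of
    \<open>u'\<close>. Both sides have degree at most \<open>k\<close> and agree at
    \<open>k + 1\<close> points.\<close>
  have w0: "w0 = smult (1 / (C * b0)) u'"
  proof (rule poly_eq_of_roots[OF S(1)])
    fix x assume x: "x \<in> S"
    have "poly w0 x = poly s' x * (b0 - (x - m)\<^sup>2) / b0"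
      using root[OF x] b0 by (simp add: w0_def dd_def power2_eq_square field_simps)
    also have "\<dots> = poly (smult (1 / (C * b0)) u') x"
      using g_neg[OF x] by (simp add: s'_root[OF x])
    finally show "poly w0 x = poly (smult (1 / (C * b0)) u') x" .
  next
    show "coeff w0 i = 0" if "i \<ge> card S" for i
      using ms that top[of i m] k unfolding w0_def coeff_add coeff_smult monic_deg_def by simp
    show "coeff (smult (1 / (C * b0)) u') i = 0" if "i \<ge> card S" for i
      using mu that k by (simp add: monic_deg_def)
  qed
  have wk: "(\<lambda>n. coeff (w n) k) \<longlonglongrightarrow> 1 / (C * b0)"
    using w mu unfolding coeff_tendsto_def w0 coeff_smult monic_deg_def by (metis mult.right_neutral)
  then have wpos: "\<forall>\<^sub>F n in sequentially. coeff (w n) k > 0"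
    by (rule order_tendstoD(1)) (use C b0 in simp)
  define U where "U n = smult (1 / coeff (w n) k) (w n)" for n
  have U: "coeff_tendsto U u'"
  proof -
    have "coeff_tendsto U (smult (1 / (1 / (C * b0))) w0)"
      unfolding U_def by (intro coeff_tendsto_smult w tendsto_divide tendsto_const wk) (use C b0 in simp)
    then show ?thesis using C b0 by (simp add: w0)
  qed
  have mU: "\<forall>\<^sub>F n in sequentially. monic_deg k (U n)"
    using wpos by eventually_elim (use w_top in \<open>simp add: U_def monic_deg_def\<close>)
  have t: "coeff_tendsto t p'"
  proof -
    have "coeff_tendsto t (p' + smult 0 dd)"
      unfolding t_def by (intro coeff_tendsto_add coeff_tendsto_smult coeff_tendsto_const \<gamma>b)
    then show ?thesis by simp
  qed
  have mt: "monic_deg (Suc k) (t n)" for n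
    using mp dd_gt unfolding t_def monic_deg_def by simp
  have s: "coeff_tendsto s ([:-m, 1:] * p')"
  proof -
    have "coeff_tendsto s ([:-m, 1:] * p' - smult 0 s')"
      unfolding s_def by (intro coeff_tendsto_diff coeff_tendsto_smult coeff_tendsto_const \<gamma>)
    then show ?thesis by simp
  qed
  have ms': "monic_deg (Suc (Suc k)) (s n)" for n
    using monic_deg_linear_mult[OF mp, of "-m"] ms unfolding s_def monic_deg_def coeff_diff coeff_smult by simp
  have pz: "poly p' z > 0"
    unfolding p'_def poly_prod using between z by (intro prod_pos) fastforce
  have "(\<lambda>n. poly (t n) z) \<longlonglongrightarrow> poly p' z"
    by (rule poly_tendsto_coeff[OF t, of "Suc k"]) (simp_all add: monic_deg_degree[OF mt] monic_deg_degree[OF mp])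
  then have tz: "\<forall>\<^sub>F n in sequentially. poly (t n) z > 0" using order_tendstoD(1) pz by blast
  have "(\<lambda>n. poly (s n) z) \<longlonglongrightarrow> poly ([:-m, 1:] * p') z"
    by (rule poly_tendsto_coeff[OF s, of "Suc (Suc k)"])
      (simp_all only: monic_deg_degree[OF ms'] monic_deg_degree[OF monic_deg_linear_mult[OF mp]] eventually_True order_refl)
  moreover have "poly ([:-m, 1:] * p') z > 0"
  proof -
    have "m < z" using z lt by (simp add: m_def)
    then have "0 < (z - m) * poly p' z" using pz by simp
    then show ?thesis by (simp add: algebra_simps)
  qed
  ultimately have sz: "\<forall>\<^sub>F n in sequentially. poly (s n) z > 0" using order_tendstoD(1) by blast
  have a2pos: "\<forall>\<^sub>F n in sequentially. a2 n > 0" using order_tendstoD(1)[OF a2] m by blast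
  have "\<forall>\<^sub>F n in sequentially. jacobi_pair z (t n) (U n)"
    by (rule jacobi_pair_open[OF pu mp mu t U _ mU]) (use mt in simp)
  with a2pos wpos tz sz have "\<forall>\<^sub>F n in sequentially.
      jacobi_pair z (\<Prod>x\<in>insert \<alpha> (insert \<beta> S). [:- x, 1:]) (s n)"
  proof eventually_elim
    case (elim n)
    have "s n = [:- a2 n, 1:] * t n - smult (\<gamma> n * coeff (w n) k) (U n)"
    proof (rule real_poly_ext)
      fix x
      have U_w: "coeff (w n) k * poly (U n) x = poly (w n) x"
        using elim(2) by (simp add: U_def)
      have "poly (s n) x = (x - a2 n) * poly (t n) x - \<gamma> n * poly (w n) x"
        using bpos[of n] by (simp add: s_def t_def w_def a2_def field_simps)
      also have "\<dots> = poly ([:- a2 n, 1:] * t n - smult (\<gamma> n * coeff (w n) k) (U n)) x"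
        unfolding U_w[symmetric] by (simp add: algebra_simps)
      finally show "poly (s n) x = poly ([:- a2 n, 1:] * t n - smult (\<gamma> n * coeff (w n) k) (U n)) x" .
    qed
    then have 1: "jacobi_pair z (s n) (t n)"
      using jacobi_pair.step[OF elim(5,1) mult_pos_pos[OF \<gamma>0(1)[of n] elim(2)] elim(3)] by metis
    have "(\<Prod>x\<in>insert \<alpha> (insert \<beta> S). [:- x, 1:]) = [:- m, 1:] * s n - smult (b n) (t n)"
    proof (rule real_poly_ext)
      fix x
      have ne: "\<alpha> \<notin> insert \<beta> S" "\<beta> \<notin> S" using between lt by force+
      have "poly (\<Prod>x\<in>insert \<alpha> (insert \<beta> S). [:- x, 1:]) x = ((x - \<alpha>) * (x - \<beta>)) * poly p' x"
        using ne S(1) by (simp add: p'_def algebra_simps)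
      also have "\<dots> = ((x - m)\<^sup>2 - (b n + \<gamma> n)) * poly p' x" unfolding g by (simp add: b_def)
      also have "\<dots> = poly ([:- m, 1:] * s n - smult (b n) (t n)) x"
        using bpos[of n] by (simp add: s_def t_def dd_def power2_eq_square field_simps)
      finally show "poly (\<Prod>x\<in>insert \<alpha> (insert \<beta> S). [:- x, 1:]) x = poly ([:- m, 1:] * s n - smult (b n) (t n)) x" .
    qed
    then show ?case using jacobi_pair.step[OF 1 m bpos[of n] elim(4)] by metis
  qed
  then show ?thesis using eventually_happens' sequentially_bot by blast
qed

text \<open>\<open>ev\<close> is indexed such that the pairs are \<open>(ev i, ev (a + c - i))\<close>, working inwards.\<close>

lemma jacobi_pair_exists:
  fixes ev :: "nat \<Rightarrow> real"
  assumes "a \<le> c" "\<And>i j. a \<le> i \<Longrightarrow> i < j \<Longrightarrow> j \<le> c \<Longrightarrow> ev j < ev i"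
    and "\<And>i. a \<le> i \<Longrightarrow> i \<le> c \<Longrightarrow> ev i + ev (a + c - i) > 0" and "ev a \<le> z"
  shows "\<exists>u. jacobi_pair z (\<Prod>x\<in>ev ` {a..c}. [:- x, 1:]) u"
  using assms
proof (induction "c - a" arbitrary: a c rule: less_induct)
  case less
  consider "c = a" | "c = Suc a" | "a + 2 \<le> c" using less.prems(1) by linarith
  then show ?case
  proof cases
    case 1
    then show ?thesis using less.prems(3)[of a] jacobi_pair.base[of "ev a" z] by auto
  next
    case 2
    have lt: "ev c < ev a" and pos: "ev a + ev c > 0" using less.prems(2)[of a c] less.prems(3)[of a] 2 by auto
    \<comment> \<open>Two eigenvalues are realised with both diagonal entries equal to their
      mean.\<close>
    define m b0 where "m = (ev a + ev c) / 2" and "b0 = ((ev a - ev c) / 2)\<^sup>2"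
    have "jacobi_pair z ([:- m, 1:] * [:- m, 1:] - smult b0 1) [:- m, 1:]"
      using pos lt less.prems(4) by (intro jacobi_pair.step jacobi_pair.base) (auto simp: m_def b0_def)
    moreover have "ev ` {a..c} = {ev a, ev c}" using 2 by (auto simp: atLeastAtMostSuc_conv)
    moreover have "(\<Prod>x\<in>{ev a, ev c}. [:- x, 1:]) = [:- m, 1:] * [:- m, 1:] - smult b0 1"
      using lt by (simp add: m_def b0_def power2_eq_square field_simps)
    ultimately show ?thesis by auto
  next
    case 3
    let ?S = "ev ` {Suc a..c - 1}"
    have "\<exists>u. jacobi_pair z (\<Prod>x\<in>?S. [:- x, 1:]) u"
    proof (rule less.hyps)
      show "ev i + ev (Suc a + (c - 1) - i) > 0" if "Suc a \<le> i" "i \<le> c - 1" for i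
        using less.prems(3)[of i] that 3 by (simp add: Suc_diff_le)
      show "ev (Suc a) \<le> z" using less.prems(2)[of a "Suc a"] less.prems(4) 3 by auto
    qed (use less.prems 3 in auto)
    then obtain u where "jacobi_pair z (\<Prod>x\<in>?S. [:- x, 1:]) u" ..
    then have "\<exists>s. jacobi_pair z (\<Prod>x\<in>insert (ev a) (insert (ev c) ?S). [:- x, 1:]) s"
      by (intro jacobi_pair_insert_two[of ?S "ev c" "ev a"])
        (use less.prems(2)[of a] less.prems(2)[of _ c] less.prems(3)[of a] less.prems(4) 3 in auto)
    moreover have "insert (ev a) (insert (ev c) ?S) = ev ` {a..c}"
    proof -
      have "{a..c} = insert a (insert c {Suc a..c - 1})" using 3 by auto
      then show ?thesis by simp
    qed
    ultimately show ?thesis by simp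
  qed
qed

text \<open>The inductive predicate exposes only the last two polynomials, while the matrix entries
  and the positive vector of values at \<open>z\<close> require the whole sequence.\<close>

lemma jacobi_pair_recurrence:
  assumes "jacobi_pair z t u"
  obtains n P and a b :: "nat \<Rightarrow> real" where "P 0 = 1" "P (Suc 0) = [:- a 0, 1:]"
    "\<And>k. k < n \<Longrightarrow> P (Suc (Suc k)) = [:- a (Suc k), 1:] * P (Suc k) - smult (b (Suc k)) (P k)"
    "P (Suc n) = t" "P n = u" "\<And>k. k \<le> n \<Longrightarrow> a k > 0" "\<And>k. k \<le> n \<Longrightarrow> b k > 0" "\<And>k. k \<le> n \<Longrightarrow> poly (P k) z > 0"
    "degree t = Suc n"
proof -
  have "\<exists>n P (a :: nat \<Rightarrow> real) b. P 0 = 1 \<and> P (Suc 0) = [:- a 0, 1:] \<and>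
    (\<forall>k<n. P (Suc (Suc k)) = [:- a (Suc k), 1:] * P (Suc k) - smult (b (Suc k)) (P k)) \<and>
    P (Suc n) = t \<and> P n = u \<and> (\<forall>k\<le>n. a k > 0 \<and> b k > 0 \<and> poly (P k) z > 0) \<and> degree t = Suc n"
    using assms
  proof (induction rule: jacobi_pair.induct)
    case (base a)
    then show ?case
      by (intro exI[of _ 0] exI[of _ "\<lambda>k. if k = 0 then 1 else [:- a, 1:]"] exI[of _ "\<lambda>_. a"] exI[of _ "\<lambda>_. 1"]) auto
  next
    case (step u v \<alpha> \<beta>)
    then obtain n P a b where P: "P 0 = 1" "P (Suc 0) = [:- a 0, 1:]"
      "\<And>k. k < n \<Longrightarrow> P (Suc (Suc k)) = [:- a (Suc k), 1:] * P (Suc k) - smult (b (Suc k)) (P k)"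
      "P (Suc n) = u" "P n = v" "\<And>k. k \<le> n \<Longrightarrow> a k > 0 \<and> b k > 0 \<and> poly (P k) z > 0" "degree u = Suc n"
      by blast
    let ?t = "[:- \<alpha>, 1:] * u - smult \<beta> v"
    have "jacobi_pair z ?t u" using step.hyps by (intro jacobi_pair.step)
    then obtain m where "monic_deg (Suc m) ?t" "monic_deg m u" using jacobi_pair_monic by blast
    then have "degree ?t = Suc (Suc n)" using monic_deg_degree P(7) by metis
    then show ?case
      using P step.hyps
      by (intro exI[of _ "Suc n"] exI[of _ "P(Suc (Suc n) := ?t)"] exI[of _ "a(Suc n := \<alpha>)"] exI[of _ "b(Suc n := \<beta>)"])
        (auto simp: less_Suc_eq le_Suc_eq simp del: mult_pCons_left)
  qed
  then obtain n P and a b :: "nat \<Rightarrow> real" where H: "P 0 = 1" "P (Suc 0) = [:- a 0, 1:]"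
    "\<forall>k<n. P (Suc (Suc k)) = [:- a (Suc k), 1:] * P (Suc k) - smult (b (Suc k)) (P k)"
    "P (Suc n) = t" "P n = u" "\<forall>k\<le>n. a k > 0 \<and> b k > 0 \<and> poly (P k) z > 0" "degree t = Suc n"
    by blast
  show ?thesis by (rule that[of P a n b]) (use H in auto)
qed

section \<open>Birth-death chains with prescribed spectrum\<close>

lemma sum_tridiagonal:
  fixes c :: "int \<Rightarrow> real"
  assumes x: "x \<in> {a..b}" and c: "\<And>y. y \<in> {a..b} \<Longrightarrow> y \<noteq> x \<Longrightarrow> y \<noteq> x + 1 \<Longrightarrow> y \<noteq> x - 1 \<Longrightarrow> c y = 0"
  shows "(\<Sum>y\<in>{a..b}. c y) = c x + (if x + 1 \<le> b then c (x + 1) else 0) + (if a \<le> x - 1 then c (x - 1) else 0)"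
proof -
  have "(\<Sum>y\<in>{a..b}. c y) = (\<Sum>y\<in>{x - 1, x, x + 1} \<inter> {a..b}. c y)"
    by (intro sum.mono_neutral_right ballI c) auto
  also have "\<dots> = (\<Sum>y\<in>{x - 1, x, x + 1}. if y \<in> {a..b} then c y else 0)"
    by (simp add: sum.inter_restrict)
  also have "\<dots> = c x + (if x + 1 \<le> b then c (x + 1) else 0) + (if a \<le> x - 1 then c (x - 1) else 0)"
    using x by auto
  finally show ?thesis .
qed

lemma mat_pow_nonneg:
  assumes "finite E" "\<And>x y. x \<in> E \<Longrightarrow> y \<in> E \<Longrightarrow> 0 \<le> p x y"
  shows "x \<in> E \<Longrightarrow> y \<in> E \<Longrightarrow> 0 \<le> mat_pow E p n x y"
proof (induction n arbitrary: x)
  case (Suc n)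
  then show ?case using assms by (simp add: mat_mult_def) (intro sum_nonneg mult_nonneg_nonneg, auto)
qed simp

text \<open>The direct path towards \<open>y\<close> has positive weight, and all other paths of
  that length contribute nonnegatively.\<close>

lemma birth_death_irreducible:
  assumes nn: "\<And>x y. x \<in> {a..b} \<Longrightarrow> y \<in> {a..b} \<Longrightarrow> 0 \<le> q x y"
    and up: "\<And>x. a \<le> x \<Longrightarrow> x < b \<Longrightarrow> 0 < q x (x + 1)" and down: "\<And>x. a < x \<Longrightarrow> x \<le> b \<Longrightarrow> 0 < q x (x - 1)"
    and x: "x \<in> {a..b}" and y: "y \<in> {a..b}"
  shows "0 < mat_pow {a..b} q (nat \<bar>x - y\<bar>) x y"
proof -
  have "0 < mat_pow {a..b} q n x y" if "n = nat \<bar>x - y\<bar>" "x \<in> {a..b}" for n x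
    using that
  proof (induction n arbitrary: x)
    case (Suc n)
    define z where "z = (if x < y then x + 1 else x - 1)"
    have z: "z \<in> {a..b}" "n = nat \<bar>z - y\<bar>" "0 < q x z"
      using Suc.prems y up[of x] down[of x] by (auto simp: z_def)
    have "0 < q x z * mat_pow {a..b} q n z y" using Suc.IH[OF z(2,1)] z(3) by simp
    also have "\<dots> \<le> (\<Sum>z\<in>{a..b}. q x z * mat_pow {a..b} q n z y)"
      using z(1) Suc.prems(2) y nn by (intro member_le_sum) (auto intro!: mult_nonneg_nonneg mat_pow_nonneg)
    finally show ?case by (simp add: mat_mult_def)
  qed simp
  then show ?thesis using x by simp
qed

text \<open>The monic recurrence is the matrix \<open>K\<close> with 1 above the diagonal,
  \<open>a\<close> on it and \<open>b\<close> below it. The values of the polynomials at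
  \<open>ev k\<close> form an eigenvector of \<open>K\<close>. The one for \<open>ev 0 = 1\<close>
  is positive, so conjugation by it makes all row sums 1 and keeps the spectrum.\<close>

theorem birth_death_with_spectrum:
  fixes ev :: "nat \<Rightarrow> real" and N :: nat
  assumes N: "N \<ge> 1" and dec: "\<And>i j. i < j \<Longrightarrow> j \<le> N \<Longrightarrow> ev j < ev i" and one: "ev 0 = 1"
    and pairs: "\<And>i. i \<le> N \<Longrightarrow> ev i + ev (N - i) > 0"
  obtains q \<kappa> f where "q \<in> class_B (Regular 0) (Regular (int N))" "reversible_measure {0..int N} q \<kappa>"
    "\<And>k x. x \<notin> {0..int N} \<Longrightarrow> f k x = 0" "\<And>k. f k \<noteq> (\<lambda>x. 0)"
    "\<And>k. k \<le> N \<Longrightarrow> mat_op {0..int N} q (f k) = (\<lambda>x. ev k * f k x)"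
proof -
  let ?E = "{0..int N}"
  let ?p = "\<Prod>x\<in>ev ` {0..N}. [:- x, 1:]"
  have inj: "inj_on ev {0..N}"
    by (rule inj_onI) (metis atLeastAtMost_iff dec less_irrefl linorder_neqE_nat)
  have deg: "degree ?p = Suc N"
    using monic_deg_degree[OF monic_deg_prod[of "ev ` {0..N}"]] card_image[OF inj] by simp
  obtain u where "jacobi_pair 1 ?p u"
    using jacobi_pair_exists[of 0 N ev 1] dec pairs one by auto
  then obtain n P and a b :: "nat \<Rightarrow> real" where P0: "P 0 = 1" and P1: "P (Suc 0) = [:- a 0, 1:]"
    and PS: "\<And>k. k < n \<Longrightarrow> P (Suc (Suc k)) = [:- a (Suc k), 1:] * P (Suc k) - smult (b (Suc k)) (P k)"
    and Pn: "P (Suc n) = ?p" "P n = u" and a: "\<And>k. k \<le> n \<Longrightarrow> a k > 0" and b: "\<And>k. k \<le> n \<Longrightarrow> b k > 0"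
    and P_pos: "\<And>k. k \<le> n \<Longrightarrow> poly (P k) 1 > 0" and "degree ?p = Suc n"
    by (rule jacobi_pair_recurrence) (rule that)
  then have n: "n = N" using deg by simp
  define K where "K x y = (if y = x then a (nat x) else if y = x + 1 then 1 else if y = x - 1 then b (nat x) else 0)" for x y :: int
  define h where "h x = poly (P (nat x)) 1" for x :: int
  define q where "q x y = K x y * h y / h x" for x y
  have h: "h x > 0" if "x \<in> ?E" for x using P_pos[of "nat x"] that n by (simp add: h_def nat_le_iff)
  have root: "poly (P (Suc N)) (ev k) = 0" if "k \<le> N" for k
    unfolding Pn(1)[unfolded n] using that by (intro coeff_prod_linear_root) auto
  have KP: "(\<Sum>y\<in>?E. K x y * poly (P (nat y)) (ev k)) = ev k * poly (P (nat x)) (ev k)" if x: "x \<in> ?E" and k: "k \<le> N" for x k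
  proof -
    let ?P = "\<lambda>j. poly (P j) (ev k)"
    obtain j where j: "x = int j" "j \<le> N" using x zero_le_imp_eq_int[of x] by auto
    have "(\<Sum>y\<in>?E. K x y * ?P (nat y)) = a j * ?P j + (if x + 1 \<le> int N then ?P (Suc j) else 0)
        + (if 0 \<le> x - 1 then b j * ?P (j - 1) else 0)"
      by (subst sum_tridiagonal[OF x]) (auto simp: K_def j nat_add_distrib nat_diff_distrib)
    \<comment> \<open>The term missing from the last row is the value of \<open>P (Suc N)\<close> at
      an eigenvalue, which is 0.\<close>
    also have "(if x + 1 \<le> int N then ?P (Suc j) else 0) = ?P (Suc j)" using j root[OF k] by (cases "j = N") auto
    also have "a j * ?P j + ?P (Suc j) + (if 0 \<le> x - 1 then b j * ?P (j - 1) else 0) = ev k * ?P j"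
    proof (cases j)
      case 0 then show ?thesis using j by (simp add: P0 P1)
    next
      case (Suc i)
      then show ?thesis using j n by (simp add: PS[of i] algebra_simps)
    qed
    finally show ?thesis using j by simp
  qed
  define f where "f k x = (if x \<in> ?E then poly (P (nat x)) (ev k) / h x else 0)" for k x
  have eig: "mat_op ?E q (f k) = (\<lambda>x. ev k * f k x)" if k: "k \<le> N" for k
  proof
    fix x
    show "mat_op ?E q (f k) x = ev k * f k x"
    proof (cases "x \<in> ?E")
      case True
      have "mat_op ?E q (f k) x = (\<Sum>y\<in>?E. (K x y * poly (P (nat y)) (ev k)) * (1 / h x))"
        using True unfolding mat_op_finite[OF finite_atLeastAtMost_int]
        by (auto simp: q_def f_def intro!: sum.cong dest: h)
      also have "\<dots> = ev k * poly (P (nat x)) (ev k) * (1 / h x)"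
        unfolding sum_distrib_right[symmetric] KP[OF True k] ..
      finally show ?thesis using True by (simp add: f_def)
    qed (auto simp: mat_op_def f_def)
  qed
  have f0: "f k \<noteq> (\<lambda>x. 0)" for k
  proof -
    have "f k 0 \<noteq> 0" using h[of 0] by (simp add: f_def P0)
    then show ?thesis by (auto simp: fun_eq_iff)
  qed
  have row: "(\<Sum>y\<in>?E. q x y) = 1" if x: "x \<in> ?E" for x
  proof -
    have "(\<Sum>y\<in>?E. q x y) = (\<Sum>y\<in>?E. K x y * poly (P (nat y)) (ev 0)) / h x"
      unfolding sum_divide_distrib by (simp add: q_def h_def one)
    also have "\<dots> = 1" using KP[OF x, of 0] h[OF x] by (simp add: one h_def)
    finally show ?thesis .
  qed
  have nn: "0 \<le> q x y" if "x \<in> ?E" "y \<in> ?E" for x y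
  proof -
    have "nat x \<le> n" using that(1) n by auto
    then have "0 \<le> K x y" using a[of "nat x"] b[of "nat x"] unfolding K_def by auto
    then show ?thesis using h[OF that(1)] h[OF that(2)] unfolding q_def by (intro divide_nonneg_pos mult_nonneg_nonneg) auto
  qed
  have up: "0 < q x (x + 1)" if "0 \<le> x" "x < int N" for x
    using that h[of x] h[of "x + 1"] by (simp add: q_def K_def)
  have down: "0 < q x (x - 1)" if "0 < x" "x \<le> int N" for x
    using that h[of x] h[of "x - 1"] b[of "nat x"] n by (simp add: q_def K_def)
  have far: "q x y = 0" if "y \<noteq> x" "y \<noteq> x + 1" "y \<noteq> x - 1" for x y
    using that by (simp add: q_def K_def)
  have diag: "q x x \<noteq> 1" if x: "x \<in> ?E" for x
  proof -
    have "1 = q x x + (if x + 1 \<le> int N then q x (x + 1) else 0) + (if 0 \<le> x - 1 then q x (x - 1) else 0)"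
      using sum_tridiagonal[OF x, of "q x"] far row[OF x] by simp
    then show ?thesis using up[of x] down[of x] x N by (auto split: if_splits)
  qed
  have ss: "state_space (Regular 0) (Regular (int N)) = ?E" by (auto simp: state_space_def)
  have irr: "\<exists>n. 0 < mat_pow ?E q n x y" if "x \<in> ?E" "y \<in> ?E" for x y
    using birth_death_irreducible[of 0 "int N" q, OF nn up down that] by auto
  have "q \<in> class_M (Regular 0) (Regular (int N))"
    unfolding class_M_def Let_def ss mem_Collect_eq
  proof (intro conjI ballI allI impI)
    show "sub_markov ?E q" using nn row by (simp add: sub_markov_def)
    show "\<exists>n. 0 < mat_pow ?E q n x y"
      if "x \<in> strictly_between (Regular 0) (Regular (int N))" "y \<in> strictly_between (Regular 0) (Regular (int N))" for x y
      using irr that strictly_between_state_space[of "Regular 0" "Regular (int N)"] unfolding ss by blast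
  qed (use diag up far N in auto)
  then have "q \<in> class_B (Regular 0) (Regular (int N))"
    unfolding class_B_def birth_death_def Let_def ss mem_Collect_eq
    using down far row by (auto intro!: exI[of _ "{}"])
  \<comment> \<open>The reciprocal products of \<open>b\<close> symmetrise \<open>K\<close>, and
    conjugation by \<open>h\<close> contributes the factor \<open>(h x)\<^sup>2\<close>.\<close>
  moreover define \<kappa> where "\<kappa> x = (h x)\<^sup>2 / (\<Prod>j\<in>{1..nat x}. b j)" for x :: int
  have "reversible_measure ?E q \<kappa>"
  proof -
    have pp: "(\<Prod>j\<in>{1..nat x}. b j) > 0" if "x \<in> ?E" for x using that b n by (intro prod_pos) auto
    have adj: "\<kappa> x * q x (x + 1) = \<kappa> (x + 1) * q (x + 1) x" if x: "0 \<le> x" "x + 1 \<le> int N" for x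
    proof -
      have "nat (x + 1) = Suc (nat x)" using x by simp
      then have "(\<Prod>j\<in>{1..nat (x + 1)}. b j) = (\<Prod>j\<in>{1..nat x}. b j) * b (nat (x + 1))" by simp
      moreover have "b (nat (x + 1)) > 0" using b[of "nat (x + 1)"] x n by simp
      ultimately show ?thesis
        using x pp[of x] h[of x] h[of "x + 1"] by (simp add: \<kappa>_def q_def K_def power2_eq_square)
    qed
    show ?thesis
      unfolding reversible_measure_def
    proof (intro conjI ballI)
      show "0 < \<kappa> x" if "x \<in> ?E" for x using pp[OF that] h[OF that] by (simp add: \<kappa>_def)
      show "\<kappa> x * q x y = \<kappa> y * q y x" if "x \<in> ?E" "y \<in> ?E" for x y
      proof -
        consider "y = x" | "y = x + 1" | "x = y + 1" | "y \<noteq> x" "y \<noteq> x + 1" "x \<noteq> y + 1" by blast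
        then show ?thesis
          by cases (use adj[of x] adj[of y] that far[of y x] far[of x y] in auto)
      qed
    qed
  qed
  moreover have "f k x = 0" if "x \<notin> ?E" for k x using that by (auto simp: f_def)
  ultimately show ?thesis using f0 eig by (intro that[of q \<kappa> f]) blast+
qed

section \<open>Eigenvalues of nonnegative Jacobi matrices\<close>

text \<open>Gaussian elimination: one equation is solved for an unknown \<open>i0\<close> with
  nonzero coefficient and substituted into the others.\<close>

lemma homogeneous_system:
  fixes M :: "'i \<Rightarrow> 'k \<Rightarrow> real"
  assumes "finite K" "finite I" "card K < card I"
  shows "\<exists>d. (\<exists>i\<in>I. d i \<noteq> 0) \<and> (\<forall>k\<in>K. (\<Sum>i\<in>I. d i * M i k) = 0)"
  using assms
proof (induction K arbitrary: I M rule: finite_induct)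
  case empty
  then obtain i where "i \<in> I" by fastforce
  then show ?case by (intro exI[of _ "\<lambda>_. 1"]) auto
next
  case (insert k K)
  show ?case
  proof (cases "\<forall>i\<in>I. M i k = 0")
    case True
    have "card K < card I" using insert by simp
    then obtain d where "\<exists>i\<in>I. d i \<noteq> 0" "\<forall>k\<in>K. (\<Sum>i\<in>I. d i * M i k) = 0"
      using insert.IH[OF insert.prems(1)] by blast
    with True show ?thesis by (intro exI[of _ d]) auto
  next
    case False
    then obtain i0 where i0: "i0 \<in> I" "M i0 k \<noteq> 0" by blast
    define J where "J = I - {i0}"
    define M' where "M' i l = M i l - M i k / M i0 k * M i0 l" for i l
    have "card K < card J" using insert i0 by (simp add: J_def)
    then obtain d where d: "\<exists>i\<in>J. d i \<noteq> 0" "\<forall>l\<in>K. (\<Sum>i\<in>J. d i * M' i l) = 0"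
      using insert.IH[of J M'] insert.prems(1) by (auto simp: J_def)
    define c where "c = - (\<Sum>i\<in>J. d i * (M i k / M i0 k))"
    define d' where "d' = d(i0 := c)"
    have split: "(\<Sum>i\<in>I. d' i * M i l) = c * M i0 l + (\<Sum>i\<in>J. d i * M i l)" for l
    proof -
      have "(\<Sum>i\<in>I. d' i * M i l) = d' i0 * M i0 l + (\<Sum>i\<in>J. d' i * M i l)"
        unfolding J_def by (rule sum.remove) (use insert.prems i0 in auto)
      also have "(\<Sum>i\<in>J. d' i * M i l) = (\<Sum>i\<in>J. d i * M i l)"
        by (rule sum.cong) (auto simp: d'_def J_def)
      finally show ?thesis by (simp add: d'_def)
    qed
    have "(\<Sum>i\<in>I. d' i * M i k) = 0"
      unfolding split c_def using i0 by (simp add: sum_distrib_right)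
    moreover have "(\<Sum>i\<in>I. d' i * M i l) = 0" if "l \<in> K" for l
    proof -
      have "(\<Sum>i\<in>J. d i * M' i l) = (\<Sum>i\<in>J. d i * M i l) - (\<Sum>i\<in>J. d i * (M i k / M i0 k)) * M i0 l"
        by (simp add: M'_def right_diff_distrib sum_subtractf sum_distrib_right mult.assoc)
      then show ?thesis using d(2) that unfolding split c_def by simp
    qed
    moreover have "\<exists>i\<in>I. d' i \<noteq> 0" using d(1) by (auto simp: J_def d'_def)
    ultimately show ?thesis by (intro exI[of _ d']) auto
  qed
qed

text \<open>By Parseval the quadratic form is the sum of the \<open>t k\<close> weighted by squared
  coefficients, so only eigenvalues whose coefficient in \<open>f\<close> is nonzero matter.\<close>

lemma rayleigh_le:
  assumes E: "finite E" and v: "positive_on E \<kappa>" and e: "orthonormal_basis E \<kappa> e"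
    and sa: "\<And>f g. f \<in> l2 E \<kappa> \<Longrightarrow> g \<in> l2 E \<kappa> \<Longrightarrow> l2_inner E \<kappa> (mat_op E q f) g = l2_inner E \<kappa> f (mat_op E q g)"
    and t: "\<And>k. k < card E \<Longrightarrow> mat_op E q (e k) = (\<lambda>x. t k * e k x)"
    and le: "\<And>k. k < card E \<Longrightarrow> l2_inner E \<kappa> f (e k) \<noteq> 0 \<Longrightarrow> t k \<le> c"
    and f: "f \<in> l2 E \<kappa>"
  shows "l2_inner E \<kappa> (mat_op E q f) f \<le> c * l2_inner E \<kappa> f f"
proof -
  interpret hilbert_subspace "supported_on E"
    by unfold_locales (rule subspace_supported_on closed_supported_on)+
  have I: "index_set E = {..<card E}" using E by (auto simp: index_set_def)
  have el2: "e k \<in> l2 E \<kappa>" if "k < card E" for k using e that I by (simp add: orthonormal_basis_def)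
  have onb: "onb (supported_on E) (index_set E) (\<lambda>k. up E \<kappa> (e k))"
    using e orthonormal_basis_up[OF v, of e] el2 I by simp
  have pars: "l2_inner E \<kappa> g h = (\<Sum>k<card E. l2_inner E \<kappa> g (e k) * l2_inner E \<kappa> h (e k))"
    if g: "g \<in> l2 E \<kappa>" and h: "h \<in> l2 E \<kappa>" for g h
  proof -
    have "((\<lambda>k. (up E \<kappa> g \<bullet> up E \<kappa> (e k)) * (up E \<kappa> (e k) \<bullet> up E \<kappa> h)) has_sum up E \<kappa> g \<bullet> up E \<kappa> h) (index_set E)"
      by (rule parseval_inner[OF onb up_supported[OF v g]])
    then have "up E \<kappa> g \<bullet> up E \<kappa> h = (\<Sum>k<card E. (up E \<kappa> g \<bullet> up E \<kappa> (e k)) * (up E \<kappa> (e k) \<bullet> up E \<kappa> h))"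
      by (simp add: I has_sum_finite_iff)
    then show ?thesis
      using g h by (simp add: inner_up[OF v] el2 inner_commute[of "up E \<kappa> (e _)"])
  qed
  have Jf: "mat_op E q f \<in> l2 E \<kappa>" by (rule bounded_operator_l2[OF mat_op_finite_bounded[OF E v] f])
  have Je: "l2_inner E \<kappa> (mat_op E q f) (e k) = t k * l2_inner E \<kappa> f (e k)" if "k < card E" for k
    unfolding sa[OF f el2[OF that]] t[OF that] using E by (simp add: l2_inner_def sum_distrib_left mult_ac)
  have "l2_inner E \<kappa> (mat_op E q f) f = (\<Sum>k<card E. t k * (l2_inner E \<kappa> f (e k))\<^sup>2)"
    unfolding pars[OF Jf f] by (rule sum.cong) (simp_all add: Je power2_eq_square)
  also have "\<dots> \<le> (\<Sum>k<card E. c * (l2_inner E \<kappa> f (e k))\<^sup>2)"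
    using le by (intro sum_mono) (metis lessThan_iff mult_right_mono mult_zero_right order_refl power_zero_numeral zero_le_power2)
  also have "\<dots> = c * l2_inner E \<kappa> f f"
    unfolding pars[OF f f] sum_distrib_left by (simp add: power2_eq_square)
  finally show ?thesis .
qed

text \<open>Let \<open>D\<close> be the diagonal matrix of alternating signs and \<open>J\<close> the Jacobi matrix. Then \<open>J + D J D\<close> is
  twice the diagonal of \<open>J\<close>, hence nonnegative. By counting dimensions there is a \<open>y \<noteq> 0\<close> with
  \<open>\<langle>J y, y\<rangle> \<le> t (card E - 1 - j) \<langle>y, y\<rangle>\<close> and \<open>\<langle>J D y, D y\<rangle> \<le> t j \<langle>y, y\<rangle>\<close>.\<close>

lemma nonneg_jacobi_eigenvalue_pairs:
  assumes E: "E = {a..b :: int}" and \<kappa>: "reversible_measure E q \<kappa>" and q: "sub_markov E q"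
    and far: "\<And>x y. x \<in> E \<Longrightarrow> y \<in> E \<Longrightarrow> y \<noteq> x \<Longrightarrow> y \<noteq> x + 1 \<Longrightarrow> y \<noteq> x - 1 \<Longrightarrow> q x y = 0"
    and e: "orthonormal_basis E \<kappa> e" and t: "\<And>k. k < card E \<Longrightarrow> mat_op E q (e k) = (\<lambda>x. t k * e k x)"
    and dec: "\<And>i j. i \<le> j \<Longrightarrow> j < card E \<Longrightarrow> t j \<le> t i" and j: "j < card E"
  shows "0 \<le> t j + t (card E - 1 - j)"
proof -
  let ?N = "card E"
  have fin: "finite E" by (simp add: E)
  note v = reference_positive_on[OF reversible_reference[OF q \<kappa>]]
  note sa = reversible_self_adjoint[OF q \<kappa>]
  have I: "index_set E = {..<?N}" using fin by (auto simp: index_set_def)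
  have el2: "e k \<in> l2 E \<kappa>" if "k < ?N" for k using e that I by (simp add: orthonormal_basis_def)
  have ip: "l2_inner E \<kappa> (e j) (e k) = (if j = k then 1 else 0)" if "j < ?N" "k < ?N" for j k
    using e that I by (simp add: orthonormal_basis_def biorthogonal_def)
  have fs: "l2_inner E \<kappa> f g = (\<Sum>x\<in>E. f x * g x * \<kappa> x)" for f g by (simp add: l2_inner_def fin)
  define s where "s x = (if even x then 1 else - 1 :: real)" for x :: int
  have ss: "s x * s x = 1" for x by (simp add: s_def)
  \<comment> \<open>The last \<open>j + 1\<close> eigenfunctions supply \<open>j + 1\<close>
    unknowns. Orthogonality of the sign-changed combination to the first \<open>j\<close>
    eigenfunctions imposes \<open>j\<close> equations, one fewer.\<close>
  define I where "I = {?N - 1 - j..<?N}"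
  have cI: "finite I" "card {..<j} < card I" using j by (auto simp: I_def)
  obtain d where d: "\<exists>i\<in>I. d i \<noteq> 0" "\<forall>k\<in>{..<j}. (\<Sum>i\<in>I. d i * l2_inner E \<kappa> (\<lambda>x. s x * e i x) (e k)) = 0"
    using homogeneous_system[OF finite_lessThan cI, of "\<lambda>i k. l2_inner E \<kappa> (\<lambda>x. s x * e i x) (e k)"] by blast
  define y where "y x = (\<Sum>i\<in>I. d i * e i x)" for x
  define w where "w x = s x * y x" for x
  have y: "y \<in> l2 E \<kappa>" using el2 unfolding y_def l2_finite[OF fin] by (simp add: I_def)
  have w: "w \<in> l2 E \<kappa>" using y by (simp add: l2_finite[OF fin] w_def)
  have yk: "l2_inner E \<kappa> y (e k) = (if k \<in> I then d k else 0)" if k: "k < ?N" for k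
  proof -
    have "l2_inner E \<kappa> y (e k) = (\<Sum>i\<in>I. d i * l2_inner E \<kappa> (e i) (e k))"
      unfolding fs y_def sum_distrib_left sum_distrib_right by (subst sum.swap) (simp add: mult_ac)
    also have "\<dots> = (\<Sum>i\<in>I. if i = k then d k else 0)"
      by (rule sum.cong) (use k in \<open>auto simp: ip I_def\<close>)
    finally show ?thesis using cI by simp
  qed
  have wk: "l2_inner E \<kappa> w (e k) = 0" if k: "k < j" for k
  proof -
    have "l2_inner E \<kappa> w (e k) = (\<Sum>i\<in>I. d i * l2_inner E \<kappa> (\<lambda>x. s x * e i x) (e k))"
      unfolding fs w_def y_def sum_distrib_left sum_distrib_right by (subst sum.swap) (simp add: mult_ac)
    then show ?thesis using d(2) k by simp
  qed
  have nw: "l2_inner E \<kappa> w w = l2_inner E \<kappa> y y"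
    unfolding fs w_def by (intro sum.cong refl) (metis (no_types, lifting) mult.assoc mult.left_commute mult_1 ss)
  have y0: "l2_inner E \<kappa> y y > 0"
  proof -
    obtain i where i: "i \<in> I" "d i \<noteq> 0" using d(1) by blast
    have "y \<noteq> (\<lambda>x. 0)"
    proof
      assume "y = (\<lambda>x. 0)"
      then show False using yk[of i] i by (simp add: l2_inner_def I_def)
    qed
    then obtain x where x: "x \<in> E" "y x \<noteq> 0" using y by (auto simp: l2_finite[OF fin])
    have "0 < y x * y x * \<kappa> x" using x v by (auto simp: positive_on_def zero_less_mult_iff)
    also have "\<dots> \<le> l2_inner E \<kappa> y y"
      unfolding fs by (rule member_le_sum) (use x v fin in \<open>auto simp: positive_on_def less_imp_le\<close>)
    finally show ?thesis .
  qed
  have 1: "l2_inner E \<kappa> (mat_op E q w) w \<le> t j * l2_inner E \<kappa> w w"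
  proof (rule rayleigh_le[OF fin v e sa t _ w])
    show "t k \<le> t j" if "k < ?N" "l2_inner E \<kappa> w (e k) \<noteq> 0" for k
      using wk[of k] that dec[of j k] by (meson not_less)
  qed
  have 2: "l2_inner E \<kappa> (mat_op E q y) y \<le> t (?N - 1 - j) * l2_inner E \<kappa> y y"
  proof (rule rayleigh_le[OF fin v e sa t _ y])
    show "t k \<le> t (?N - 1 - j)" if "k < ?N" "l2_inner E \<kappa> y (e k) \<noteq> 0" for k
      using yk[of k] that dec[of "?N - 1 - j" k] by (auto simp: I_def split: if_splits)
  qed
  have "0 \<le> l2_inner E \<kappa> (mat_op E q w) w + l2_inner E \<kappa> (mat_op E q y) y"
  proof -
    have "l2_inner E \<kappa> (mat_op E q w) w + l2_inner E \<kappa> (mat_op E q y) y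
      = (\<Sum>x\<in>E. \<Sum>z\<in>E. q x z * (s x * s z + 1) * (y x * y z * \<kappa> x))"
      unfolding fs by (simp add: mat_op_finite[OF fin] w_def sum_distrib_left sum_distrib_right sum.distrib algebra_simps)
    also have "\<dots> \<ge> 0"
    proof (intro sum_nonneg)
      fix x z assume xz: "x \<in> E" "z \<in> E"
      \<comment> \<open>Neighbouring states have opposite parity, so \<open>s x * s z + 1\<close>
        vanishes there and only the diagonal survives, with factor 2.\<close>
      consider "z = x" | "z = x + 1" | "z = x - 1" | "q x z = 0" using far[OF xz] by blast
      then show "0 \<le> q x z * (s x * s z + 1) * (y x * y z * \<kappa> x)"
      proof cases
        case 1
        have "0 \<le> q x x" "0 < \<kappa> x" using q xz v by (auto simp: sub_markov_def positive_on_def)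
        then show ?thesis using 1 by (simp add: ss mult_nonneg_nonneg less_imp_le)
      qed (auto simp: s_def)
    qed
    finally show ?thesis .
  qed
  then have "0 \<le> (t j + t (?N - 1 - j)) * l2_inner E \<kappa> y y"
    using 1 2 unfolding nw by (simp add: distrib_right)
  then show ?thesis using y0 by (simp add: zero_le_mult_iff)
qed

section \<open>The class MC\<close>

text \<open>A maximum principle, applied at the rightmost point where the absolute value of
  \<open>g\<close> is maximal. Either this is \<open>b\<close>, whose row has mass below 1, or the
  right neighbour carries a strictly smaller value with positive weight.\<close>

lemma dominated_eigenvalue_lt_1:
  fixes q :: matrix
  assumes nn: "\<And>x y. x \<in> {a..b} \<Longrightarrow> y \<in> {a..b} \<Longrightarrow> 0 \<le> q x y"
    and row: "\<And>x. x \<in> {a..b} \<Longrightarrow> (\<Sum>y\<in>{a..b}. q x y) \<le> 1" and last: "(\<Sum>y\<in>{a..b}. q b y) < 1"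
    and up: "\<And>x. a \<le> x \<Longrightarrow> x < b \<Longrightarrow> 0 < q x (x + 1)"
    and off: "\<And>x. x \<notin> {a..b} \<Longrightarrow> g x = 0" and g0: "g \<noteq> (\<lambda>x. 0)"
    and g: "mat_op {a..b} q g = (\<lambda>x. t * g x)"
  shows "\<bar>t\<bar> < 1"
proof -
  let ?E = "{a..b}"
  obtain x0 where x0: "x0 \<in> ?E" "g x0 \<noteq> 0" using off g0 by (metis ext)
  define M where "M = Max ((\<lambda>x. \<bar>g x\<bar>) ` ?E)"
  have le: "\<bar>g x\<bar> \<le> M" if "x \<in> ?E" for x unfolding M_def using that by (intro Max_ge) auto
  have M: "M > 0" using le[OF x0(1)] x0(2) by linarith
  define X where "X = {x \<in> ?E. \<bar>g x\<bar> = M}"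
  have "M \<in> (\<lambda>x. \<bar>g x\<bar>) ` ?E" unfolding M_def using x0 by (intro Max_in) auto
  then have "X \<noteq> {}" by (auto simp: X_def)
  moreover have "finite X" by (rule finite_subset[of _ ?E]) (auto simp: X_def)
  ultimately have mx: "Max X \<in> X" "\<And>y. y \<in> X \<Longrightarrow> y \<le> Max X" by auto
  define x where "x = Max X"
  have x: "x \<in> ?E" "\<bar>g x\<bar> = M" using mx(1) by (auto simp: X_def x_def)
  have "\<bar>t\<bar> * M = \<bar>\<Sum>y\<in>?E. q x y * g y\<bar>"
    using fun_cong[OF g, of x] x by (simp add: mat_op_finite abs_mult)
  also have "\<dots> \<le> (\<Sum>y\<in>?E. q x y * \<bar>g y\<bar>)"
    using nn x by (intro order_trans[OF sum_abs] sum_mono) (simp add: abs_mult)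
  also have "\<dots> < M"
  proof (cases "x = b")
    case True
    have "(\<Sum>y\<in>?E. q x y * \<bar>g y\<bar>) \<le> (\<Sum>y\<in>?E. q x y * M)"
      using nn x le by (intro sum_mono mult_left_mono) auto
    also have "\<dots> = (\<Sum>y\<in>?E. q b y) * M" by (simp add: sum_distrib_right True)
    also have "\<dots> < 1 * M" using last M by (intro mult_strict_right_mono)
    finally show ?thesis by simp
  next
    case False
    then have x1: "x + 1 \<in> ?E" "a \<le> x" "x < b" using x by auto
    have "x + 1 \<notin> X" using mx(2)[of "x + 1"] by (auto simp: x_def)
    then have "\<bar>g (x + 1)\<bar> < M" using le[OF x1(1)] x1 by (auto simp: X_def)
    then have "(\<Sum>y\<in>?E. q x y * \<bar>g y\<bar>) < (\<Sum>y\<in>?E. q x y * M)"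
      using nn x le x1 up by (intro sum_strict_mono_ex1) (auto intro!: mult_left_mono bexI[of _ "x + 1"])
    also have "\<dots> = (\<Sum>y\<in>?E. q x y) * M" by (simp add: sum_distrib_right)
    also have "\<dots> \<le> 1 * M" using row[OF x(1)] M by (intro mult_right_mono) auto
    finally show ?thesis by simp
  qed
  finally show ?thesis using M by simp
qed

context
  fixes r :: int and p :: matrix and \<pi> :: "int \<Rightarrow> real"
  assumes r: "r \<ge> 3" and mc: "(p, \<pi>) \<in> class_MC r"
begin

private abbreviation "E \<equiv> {0..r}"
private abbreviation "E' \<equiv> {0..r - 1}"

section \<open>The reversed chain and its distribution functions\<close>

private definition "ph = time_reversal \<pi> p"
private definition "F = step_cdf E ph"

private lemma pM: "p \<in> class_M (Regular 0) (Regular r)"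
  and rows: "x \<in> E \<Longrightarrow> (\<Sum>y\<in>E. p x y) = 1" and ref: "reference_measure E p \<pi>"
  using mc by (auto simp: class_MC_def)

private lemma ss: "state_space (Regular 0) (Regular r) = E" by (auto simp: state_space_def)

private lemma p_props: "x \<in> E \<Longrightarrow> y \<in> E \<Longrightarrow> 0 \<le> p x y" "x \<in> E \<Longrightarrow> x + 1 \<in> E \<Longrightarrow> 0 < p x (x + 1)"
  "x \<in> E \<Longrightarrow> y \<in> E \<Longrightarrow> x + 2 \<le> y \<Longrightarrow> p x y = 0"
  using pM unfolding class_M_def Let_def ss sub_markov_def by auto

private lemma pi_pos: "x \<in> E \<Longrightarrow> 0 < \<pi> x"
  using ref by (simp add: reference_measure_def)

text \<open>All rows have mass 1, so \<open>\<pi>\<close> and its image have the same finite total;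
  a strict inequality at one state would contradict this.\<close>

private lemma invariant: "y \<in> E \<Longrightarrow> (\<Sum>x\<in>E. \<pi> x * p x y) = \<pi> y"
proof (rule ccontr)
  assume y: "y \<in> E" and ne: "(\<Sum>x\<in>E. \<pi> x * p x y) \<noteq> \<pi> y"
  have le: "(\<Sum>x\<in>E. \<pi> x * p x z) \<le> \<pi> z" if "z \<in> E" for z
    using ref that by (simp add: reference_measure_def)
  have "(\<Sum>z\<in>E. \<Sum>x\<in>E. \<pi> x * p x z) < (\<Sum>z\<in>E. \<pi> z)"
  proof (rule sum_strict_mono_ex1)
    show "\<exists>z\<in>E. (\<Sum>x\<in>E. \<pi> x * p x z) < \<pi> z" using y ne le[OF y] by (intro bexI[of _ y]) auto
  qed (use le in auto)
  moreover have "(\<Sum>z\<in>E. \<Sum>x\<in>E. \<pi> x * p x z) = (\<Sum>x\<in>E. \<pi> x * (\<Sum>z\<in>E. p x z))"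
    by (subst sum.swap) (simp add: sum_distrib_left)
  ultimately show False using rows by simp
qed

private lemma F_sum: "x \<in> E \<Longrightarrow> F y x = (\<Sum>z\<in>{0..x}. ph y z)"
proof -
  assume "x \<in> E"
  then have "E \<inter> {..x} = {0..x}" by auto
  then show ?thesis unfolding F_def step_cdf_def by (simp only: infsum_finite finite_atLeastAtMost_int)
qed

private lemma ph_props: "x \<in> E \<Longrightarrow> y \<in> E \<Longrightarrow> 0 \<le> ph x y" "x \<in> E \<Longrightarrow> y \<in> E \<Longrightarrow> y + 2 \<le> x \<Longrightarrow> ph x y = 0"
  "x \<in> E \<Longrightarrow> x + 1 \<in> E \<Longrightarrow> 0 < ph (x + 1) x"
  using pi_pos p_props by (simp_all add: ph_def time_reversal_def less_imp_le)

private lemma F_r: "y \<in> E \<Longrightarrow> F y r = 1"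
proof -
  assume y: "y \<in> E"
  have "F y r = (\<Sum>z\<in>E. \<pi> z * p z y) / \<pi> y"
    using r by (simp add: F_sum ph_def time_reversal_def sum_divide_distrib)
  then show ?thesis using invariant[OF y] pi_pos[OF y] by simp
qed

private lemma F_zero: "y \<in> E \<Longrightarrow> x \<in> E \<Longrightarrow> x + 2 \<le> y \<Longrightarrow> F y x = 0"
  unfolding F_sum by (rule sum.neutral) (auto intro: ph_props(2))

private lemma F_sub: "x \<in> E \<Longrightarrow> x + 1 \<in> E \<Longrightarrow> 0 < F (x + 1) x"
proof -
  assume x: "x \<in> E" "x + 1 \<in> E"
  have "0 < ph (x + 1) x" by (rule ph_props(3)[OF x])
  also have "\<dots> \<le> F (x + 1) x"
    unfolding F_sum[OF x(1)] using x ph_props(1) by (intro member_le_sum) auto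
  finally show ?thesis .
qed

private lemma F_le_1: "y \<in> E \<Longrightarrow> x \<in> E \<Longrightarrow> F y x \<le> 1"
proof -
  assume y: "y \<in> E" and x: "x \<in> E"
  have rE: "r \<in> E" using r by simp
  have "F y x \<le> F y r"
    unfolding F_sum[OF x] F_sum[OF rE]
    using x y ph_props(1) by (intro sum_mono2) auto
  then show ?thesis using F_r[OF y] by simp
qed

private lemma MC: "x \<in> {0..r - 1} \<Longrightarrow> F (x + 1) x \<le> F x x"
  "x \<in> {0..r - 1} \<Longrightarrow> x \<noteq> r - 1 \<Longrightarrow> F (x + 1) (x + 1) < F x (x + 1)"
  "x \<in> {0..r - 1} \<Longrightarrow> x \<noteq> r - 1 \<Longrightarrow> k \<in> {2..r - 1 - x} \<Longrightarrow> F (x + 1) (x + k) = F x (x + k)"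
  using mc unfolding class_MC_def Let_def F_def ph_def by auto

text \<open>The Siegmund dual of the time reversal, restricted to \<open>{0..r - 1}\<close>: it is killed with
  probability \<open>1 - F 0 y\<close> and absorbed in \<open>r\<close> with probability \<open>F r y\<close>.\<close>

private definition "qs y w = F w y - F (w + 1) y"

text \<open>The three defining inequalities of the class are, in order, a nonnegative diagonal,
  positive downward rates and the absence of longer downward jumps of the dual. The upward part
  comes from the reversal being skip-free downwards.\<close>

private lemma qs_nonneg: "y \<in> E' \<Longrightarrow> w \<in> E' \<Longrightarrow> 0 \<le> qs y w"
  and qs_down: "y \<in> E' \<Longrightarrow> y - 1 \<in> E' \<Longrightarrow> 0 < qs y (y - 1)"
  and qs_up: "y \<in> E' \<Longrightarrow> y + 1 \<in> E' \<Longrightarrow> 0 < qs y (y + 1)"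
  and qs_far: "y \<in> E' \<Longrightarrow> w \<in> E' \<Longrightarrow> w \<noteq> y \<Longrightarrow> w \<noteq> y + 1 \<Longrightarrow> w \<noteq> y - 1 \<Longrightarrow> qs y w = 0"
proof -
  show down: "0 < qs y (y - 1)" if "y \<in> E'" "y - 1 \<in> E'" for y
    using MC(2)[of "y - 1"] that by (simp add: qs_def)
  show up: "0 < qs y (y + 1)" if "y \<in> E'" "y + 1 \<in> E'" for y
    using F_sub[of y] F_zero[of "y + 2" y] that by (simp add: qs_def add.assoc)
  show far: "qs y w = 0" if "y \<in> E'" "w \<in> E'" "w \<noteq> y" "w \<noteq> y + 1" "w \<noteq> y - 1" for y w
  proof (cases "w < y")
    case True
    then show ?thesis using MC(3)[of w "y - w"] that by (simp add: qs_def)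
  next
    case False
    then show ?thesis using F_zero[of w y] F_zero[of "w + 1" y] that by (simp add: qs_def)
  qed
  show "0 \<le> qs y w" if "y \<in> E'" "w \<in> E'" for y w
  proof -
    consider "w = y" | "w = y + 1" | "w = y - 1" | "w \<noteq> y" "w \<noteq> y + 1" "w \<noteq> y - 1" by blast
    then show ?thesis
      by cases (use that MC(1)[of y] up[of y] down[of y] far[of y w] in \<open>auto simp: qs_def\<close>)
  qed
qed

private lemma qs_tail: "y \<in> E' \<Longrightarrow> z \<in> E \<Longrightarrow> (\<Sum>w\<in>{z..r - 1}. qs y w) = F z y - F r y"
proof -
  assume y: "y \<in> E'" and z: "z \<in> E"
  have "(\<Sum>w\<in>{r - int n..r - 1}. qs y w) = F (r - int n) y - F r y" for n
  proof (induction n)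
    case (Suc n)
    have "{r - int (Suc n)..r - 1} = insert (r - int (Suc n)) {r - int n..r - 1}" by auto
    then show ?case using Suc by (simp add: qs_def)
  qed simp
  from this[of "nat (r - z)"] z show ?thesis by simp
qed

text \<open>Row sums telescope to \<open>F 0 y - F r y\<close>. In the last row the absorption mass
  \<open>F r (r - 1)\<close> is positive, and this is what keeps the dual spectrum strictly inside
  the unit interval around 0.\<close>

private lemma qs_row: "y \<in> E' \<Longrightarrow> (\<Sum>w\<in>E'. qs y w) \<le> 1" and qs_last: "(\<Sum>w\<in>E'. qs (r - 1) w) < 1"
proof -
  have "0 \<le> F r y" if "y \<in> E'" for y
    unfolding F_sum[of y] using that r by (subst F_sum) (auto intro!: sum_nonneg ph_props(1))
  then show "(\<Sum>w\<in>E'. qs y w) \<le> 1" if "y \<in> E'" for y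
    using qs_tail[OF that, of 0] F_le_1[of 0 y] that r by fastforce
  show "(\<Sum>w\<in>E'. qs (r - 1) w) < 1"
    using qs_tail[of "r - 1" 0] F_le_1[of 0 "r - 1"] F_sub[of "r - 1"] r by simp
qed

private lemma qs_sub_markov: "sub_markov E' qs"
  using qs_nonneg qs_row by (simp add: sub_markov_def)

private lemma qs_reversible: "\<exists>\<kappa>. reversible_measure E' qs \<kappa>"
proof -
  define \<kappa> where "\<kappa> x = (\<Prod>i<nat x. qs (int i) (int i + 1) / qs (int i + 1) (int i))" for x :: int
  have pos: "0 < \<kappa> x" if "x \<in> E'" for x
    unfolding \<kappa>_def
  proof (intro prod_pos divide_pos_pos)
    fix i assume "i \<in> {..<nat x}"
    then have i: "int i \<in> E'" "int i + 1 \<in> E'" using that by auto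
    show "0 < qs (int i) (int i + 1)" by (rule qs_up[OF i])
    show "0 < qs (int i + 1) (int i)" using qs_down[of "int i + 1"] i by simp
  qed
  have adj: "\<kappa> x * qs x (x + 1) = \<kappa> (x + 1) * qs (x + 1) x" if "x \<in> E'" "x + 1 \<in> E'" for x
  proof -
    have "nat (x + 1) = Suc (nat x)" using that by simp
    moreover have "0 < qs (x + 1) x" using qs_down[of "x + 1"] that by simp
    ultimately show ?thesis using that by (simp add: \<kappa>_def)
  qed
  have "reversible_measure E' qs \<kappa>"
    unfolding reversible_measure_def
  proof (intro conjI ballI pos)
    show "\<kappa> x * qs x y = \<kappa> y * qs y x" if "x \<in> E'" "y \<in> E'" for x y
    proof -
      consider "y = x" | "y = x + 1" | "x = y + 1" | "y \<noteq> x" "y \<noteq> x + 1" "x \<noteq> y + 1" by blast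
      then show ?thesis
        by cases (use adj[of x] adj[of y] that qs_far[of y x] qs_far[of x y] in auto)
    qed
  qed
  then show ?thesis by blast
qed

text \<open>Summation \<open>G f y = (\<Sum>x\<le>y. \<pi> x * f x)\<close> intertwines \<open>p\<close> with the dual; hence eigenfunctions of
  the dual are lifted by taking differences.\<close>

private lemma dual_eigenfunction:
  assumes off: "\<And>x. x \<notin> E' \<Longrightarrow> g x = 0" and g0: "g \<noteq> (\<lambda>x. 0)" and g: "mat_op E' qs g = (\<lambda>x. t * g x)"
  shows "\<exists>f. (\<forall>x. x \<notin> E \<longrightarrow> f x = 0) \<and> f \<noteq> (\<lambda>x. 0) \<and> mat_op E p f = (\<lambda>x. t * f x)"
proof -
  \<comment> \<open>Summation is inverted by differences; the boundary values
    \<open>g (- 1) = 0\<close> and \<open>g r = 0\<close> come from \<open>off\<close>.\<close>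
  define f where "f x = (if x \<in> E then (g x - g (x - 1)) / \<pi> x else 0)" for x
  define G where "G h y = (\<Sum>x\<in>{0..y}. \<pi> x * h x)" for h :: "int \<Rightarrow> real" and y
  have Gstep: "G h y = G h (y - 1) + \<pi> y * h y" if "y \<ge> 0" for h y
  proof -
    have "{0..y} = insert y {0..y - 1}" using that by auto
    then show ?thesis by (simp add: G_def)
  qed
  have G_inj: "h x = k x" if eq: "\<And>y. y \<in> E \<Longrightarrow> G h y = G k y" and x: "x \<in> E" for h k x
  proof -
    have "G h (x - 1) = G k (x - 1)" using eq[of "x - 1"] x by (cases "x = 0") (auto simp: G_def)
    then have "\<pi> x * h x = \<pi> x * k x" using Gstep[of x h] Gstep[of x k] eq[OF x] x by auto
    then show ?thesis using pi_pos[OF x] by auto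
  qed
  have Gf: "G f y = g y" if "y \<in> E" for y
  proof -
    have "G f (int n) = g (int n)" if "int n \<le> r" for n
      using that
    proof (induction n)
      case 0
      have "G f 0 = \<pi> 0 * f 0" by (simp add: G_def)
      also have "\<pi> 0 * f 0 = g 0" using off[of "-1"] pi_pos[of 0] r by (simp add: f_def)
      finally show ?case by simp
    next
      case (Suc n)
      have "G f (int (Suc n)) = G f (int n) + \<pi> (int (Suc n)) * f (int (Suc n))" using Gstep[of "int (Suc n)" f] by simp
      also have "\<pi> (int (Suc n)) * f (int (Suc n)) = g (int (Suc n)) - g (int n)"
        using pi_pos[of "int (Suc n)"] Suc.prems by (simp add: f_def)
      finally show ?case using Suc by simp
    qed
    from this[of "nat y"] that show ?thesis by simp
  qed
  have Gp: "G (mat_op E p f) y = (\<Sum>z\<in>E. \<pi> z * f z * F z y)" if y: "y \<in> E" for y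
  proof -
    have "G (mat_op E p f) y = (\<Sum>x\<in>{0..y}. \<Sum>z\<in>E. \<pi> x * (p x z * f z))"
      using y unfolding G_def by (intro sum.cong) (auto simp: mat_op_finite sum_distrib_left)
    also have "\<dots> = (\<Sum>z\<in>E. \<Sum>x\<in>{0..y}. \<pi> x * (p x z * f z))" by (rule sum.swap)
    also have "\<dots> = (\<Sum>z\<in>E. \<pi> z * f z * F z y)"
    proof (rule sum.cong)
      fix z assume z: "z \<in> E"
      have "(\<Sum>x\<in>{0..y}. \<pi> x * (p x z * f z)) = (\<Sum>x\<in>{0..y}. \<pi> z * f z * ph z x)"
        using pi_pos[OF z] by (intro sum.cong) (auto simp: ph_def time_reversal_def)
      then show "(\<Sum>x\<in>{0..y}. \<pi> x * (p x z * f z)) = \<pi> z * f z * F z y"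
        by (simp add: F_sum[OF y] sum_distrib_left)
    qed simp
    finally show ?thesis .
  qed
  have gr: "g r = 0" using off by simp
  \<comment> \<open>The total of \<open>\<pi> z * f z\<close> is \<open>g r = 0\<close>, which
    removes the contribution \<open>F r y\<close> of absorption in \<open>r\<close>.\<close>
  have sum0: "(\<Sum>z\<in>E. \<pi> z * f z) = 0" using Gf[of r] gr r by (simp add: G_def)
  have "G (mat_op E p f) y = t * g y" if y: "y \<in> E" for y
  proof (cases "y = r")
    case True
    have "G (mat_op E p f) y = (\<Sum>z\<in>E. \<pi> z * f z * 1)"
      unfolding Gp[OF y] using F_r True by (intro sum.cong) auto
    then show ?thesis using sum0 True gr by simp
  next
    case False
    then have y': "y \<in> E'" using y by auto
    \<comment> \<open>The distribution function is rebuilt from the dual rates by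
      \<open>qs_tail\<close>; exchanging the sums then turns partial sums of \<open>f\<close> into
      values of \<open>g\<close>.\<close>
    have "G (mat_op E p f) y = (\<Sum>z\<in>E. \<pi> z * f z * (\<Sum>w\<in>{z..r - 1}. qs y w)) + (\<Sum>z\<in>E. \<pi> z * f z) * F r y"
      unfolding Gp[OF y] sum_distrib_right sum.distrib[symmetric]
      by (intro sum.cong refl) (simp add: qs_tail[OF y'] algebra_simps)
    also have "\<dots> = (\<Sum>z\<in>E. \<Sum>w\<in>E'. if z \<le> w then \<pi> z * f z * qs y w else 0)"
    proof -
      have "\<pi> z * f z * (\<Sum>w\<in>{z..r - 1}. qs y w) = (\<Sum>w\<in>E'. if z \<le> w then \<pi> z * f z * qs y w else 0)" if "z \<in> E" for z
      proof -
        have eq: "{z..r - 1} = {w \<in> E'. z \<le> w}" using that by auto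
        show ?thesis
          unfolding eq sum.inter_filter[OF finite_atLeastAtMost_int] sum_distrib_left by (rule sum.cong) simp_all
      qed
      then show ?thesis unfolding sum0 mult_zero_left add_0_right by (rule sum.cong[OF refl])
    qed
    also have "\<dots> = (\<Sum>w\<in>E'. \<Sum>z\<in>E. if z \<le> w then \<pi> z * f z * qs y w else 0)" by (rule sum.swap)
    also have "\<dots> = (\<Sum>w\<in>E'. qs y w * G f w)"
    proof (rule sum.cong)
      fix w assume w: "w \<in> E'"
      have "{0..w} = {z \<in> E. z \<le> w}" using w by auto
      then have "G f w = (\<Sum>z\<in>E. if z \<le> w then \<pi> z * f z else 0)"
        unfolding G_def by (simp only: sum.inter_filter[symmetric] finite_atLeastAtMost_int)
      then show "(\<Sum>z\<in>E. if z \<le> w then \<pi> z * f z * qs y w else 0) = qs y w * G f w"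
        by (auto simp: sum_distrib_left intro!: sum.cong)
    qed simp
    also have "\<dots> = (\<Sum>w\<in>E'. qs y w * g w)" using Gf by (intro sum.cong) auto
    also have "\<dots> = t * g y" using fun_cong[OF g, of y] y' by (simp add: mat_op_finite)
    finally show ?thesis .
  qed
  then have "G (mat_op E p f) y = G (\<lambda>x. t * f x) y" if "y \<in> E" for y
    using Gf[OF that] that by (simp add: G_def sum_distrib_left mult.left_commute flip: sum_distrib_left)
  then have "mat_op E p f x = t * f x" if "x \<in> E" for x
    using G_inj[of "mat_op E p f" "\<lambda>x. t * f x" x] that by blast
  then have "mat_op E p f = (\<lambda>x. t * f x)" by (auto simp: fun_eq_iff mat_op_def f_def)
  moreover have "f \<noteq> (\<lambda>x. 0)"
  proof
    assume "f = (\<lambda>x. 0)"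
    then have "g y = 0" if "y \<in> E" for y using Gf[OF that] by (simp add: G_def)
    with off have "g y = 0" for y by (cases "y \<in> E") auto
    with g0 show False by auto
  qed
  ultimately show ?thesis by (intro exI[of _ f]) (auto simp: f_def)
qed

text \<open>Nonnegativity of the dual rates \<open>qs x w\<close> is precisely monotonicity between
  the neighbouring starting points \<open>w\<close> and \<open>w + 1\<close>.\<close>

private lemma reversal_monotone: "stochastically_monotone E (time_reversal \<pi> p)"
proof -
  have step: "F (w + 1) x \<le> F w x" if "w \<in> E'" "x \<in> E" for w x
  proof (cases "x = r")
    case True then show ?thesis using F_r[of w] F_r[of "w + 1"] that by simp
  next
    case False then show ?thesis using qs_nonneg[of x w] that by (simp add: qs_def)
  qed
  have "F (y + int n) x \<le> F y x" if "x \<in> E" "y \<in> E" "y + int n \<in> E" for x y n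
    using that(3)
  proof (induction n)
    case (Suc n)
    have "F (y + int n + 1) x \<le> F (y + int n) x" by (rule step) (use Suc.prems that in auto)
    also have "\<dots> \<le> F y x" using Suc that by simp
    finally show ?case by (simp add: ac_simps)
  qed simp
  then have "F y' x \<le> F y x" if "x \<in> E" "y \<in> E" "y' \<in> E" "y \<le> y'" for x y y'
    using that by (metis zle_iff_zadd)
  then show ?thesis by (auto simp: stochastically_monotone_def F_def ph_def)
qed

lemma class_MC_imp_class_SM: "(p, \<pi>) \<in> class_SM (Regular 0) (Regular r)"
proof -
  define N where "N = nat r"
  have N: "int N = r" "N \<ge> 1" using r by (auto simp: N_def)
  have cE': "card E' = N" and cE: "card E = Suc N" using r by (auto simp: N_def)
  obtain \<kappa>' where \<kappa>': "reversible_measure E' qs \<kappa>'" using qs_reversible by blast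
  have far: "qs x y = 0" if "x \<in> E'" "y \<in> E'" "x + 2 \<le> y" for x y using qs_far[of x y] that by simp
  obtain e t where e: "orthonormal_basis E' \<kappa>' e" and t: "\<And>k. k < card E' \<Longrightarrow> mat_op E' qs (e k) = (\<lambda>x. t k * e k x)"
    and inj: "inj_on t {..<card E'}"
    by (rule reversible_simple_spectrum[OF refl qs_sub_markov \<kappa>']) (rule that qs_up far | assumption)+
  \<comment> \<open>The spectral theorem lists the eigenvalues in no particular order.
    \<open>L\<close> sorts them decreasingly, and \<open>\<sigma>\<close> below permutes the
    eigenfunctions accordingly.\<close>
  define L where "L = rev (sorted_list_of_set (t ` {..<N}))"
  have L: "set L = t ` {..<N}" "length L = N"
    using card_image[OF inj] unfolding cE' by (simp_all add: L_def)
  have Ldec: "L ! j < L ! i" if "i < j" "j < N" for i j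
    using strict_sorted_list_of_set[of "t ` {..<N}"] that L(2)
    unfolding L_def by (simp add: rev_nth sorted_wrt_iff_nth_less)
  define \<sigma> where "\<sigma> i = inv_into {..<N} t (L ! i)" for i
  have \<sigma>: "\<sigma> i < N" "t (\<sigma> i) = L ! i" if "i < N" for i
  proof -
    have "L ! i \<in> t ` {..<N}" using L that nth_mem[of i L] by simp
    then show "\<sigma> i < N" "t (\<sigma> i) = L ! i" unfolding \<sigma>_def using inv_into_into[of "L ! i" t "{..<N}"] f_inv_into_f[of "L ! i" t "{..<N}"] by auto
  qed
  have \<sigma>inj: "\<sigma> i = \<sigma> j \<longleftrightarrow> i = j" if "i < N" "j < N" for i j
    using \<sigma>[OF that(1)] \<sigma>[OF that(2)] Ldec[of i j] Ldec[of j i] that by (metis less_irrefl linorder_neqE_nat)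
  have \<sigma>surj: "\<exists>i<N. \<sigma> i = k" if "k < N" for k
  proof -
    have "\<sigma> ` {..<N} = {..<N}"
      by (rule endo_inj_surj) (use \<sigma> \<sigma>inj in \<open>auto simp: inj_on_def\<close>)
    then show ?thesis using that by (metis imageE lessThan_iff)
  qed
  have I': "index_set E' = {..<N}" using cE' by (auto simp: index_set_def)
  have e': "orthonormal_basis E' \<kappa>' (\<lambda>i. e (\<sigma> i))"
    using e \<sigma> \<sigma>inj \<sigma>surj unfolding orthonormal_basis_def biorthogonal_def I' by (auto simp: Ball_def) (metis lessThan_iff)
  have t': "mat_op E' qs (e (\<sigma> i)) = (\<lambda>x. L ! i * e (\<sigma> i) x)" if "i < card E'" for i
    using t[of "\<sigma> i", unfolded cE'] \<sigma>[of i] that[unfolded cE'] by simp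
  have e_props: "\<And>x. x \<notin> E' \<Longrightarrow> e (\<sigma> i) x = 0" "e (\<sigma> i) \<noteq> (\<lambda>x. 0)" if "i < N" for i
  proof -
    have el2: "e (\<sigma> i) \<in> l2 E' \<kappa>'" and nrm: "l2_inner E' \<kappa>' (e (\<sigma> i)) (e (\<sigma> i)) = 1"
      using e' that unfolding orthonormal_basis_def biorthogonal_def I' by simp_all
    show "\<And>x. x \<notin> E' \<Longrightarrow> e (\<sigma> i) x = 0" using el2 by (simp add: l2_def)
    show "e (\<sigma> i) \<noteq> (\<lambda>x. 0)" using nrm by (auto simp: l2_inner_def)
  qed
  have abs: "\<bar>L ! i\<bar> < 1" if i: "i < N" for i
    by (rule dominated_eigenvalue_lt_1[of 0 "r - 1" qs, OF qs_nonneg qs_row qs_last _ e_props(1)[OF i] e_props(2)[OF i] t'])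
      (use i cE' qs_up in auto)
  have pair: "0 \<le> L ! j + L ! (N - 1 - j)" if "j < N" for j
  proof -
    have dec: "L ! j \<le> L ! i" if "i \<le> j" "j < card E'" for i j
      using Ldec[of i j] that unfolding cE' by (cases "i = j") auto
    have "0 \<le> L ! j + L ! (card E' - 1 - j)"
      by (rule nonneg_jacobi_eigenvalue_pairs[OF refl \<kappa>' qs_sub_markov qs_far e' t' dec])
        (assumption | rule that[folded cE'])+
    then show ?thesis unfolding cE' .
  qed
  define ev where "ev i = (if i = 0 then 1 else L ! (i - 1))" for i
  have ev_dec: "ev j < ev i" if "i < j" "j \<le> N" for i j
  proof -
    have "j - 1 < N" "i \<noteq> 0 \<Longrightarrow> i - 1 < j - 1" using that by auto
    then show ?thesis using that abs[of "j - 1"] Ldec[of "i - 1" "j - 1"] by (auto simp: ev_def)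
  qed
  have ev_pairs: "ev i + ev (N - i) > 0" if "i \<le> N" for i
  proof -
    consider "i = 0" | "i = N" | "0 < i" "i < N" using \<open>i \<le> N\<close> by linarith
    then show ?thesis
    proof cases
      case 3
      have "L ! (i - 1) + L ! (N - 1 - (i - 1)) \<ge> 0" using pair[of "i - 1"] 3 by simp
      \<comment> \<open>Prepending 1 shifts the pairing by one position, so the partner is strictly
        larger than the one for which only a weak inequality is known.\<close>
      moreover have "L ! (N - 1 - (i - 1)) < L ! (N - i - 1)" using Ldec[of "N - i - 1" "N - 1 - (i - 1)"] 3 by simp
      ultimately show ?thesis using 3 by (simp add: ev_def)
    qed (use abs[of "N - 1"] N in \<open>auto simp: ev_def\<close>)
  qed
  obtain q \<kappa> g where q: "q \<in> class_B (Regular 0) (Regular (int N))" "reversible_measure {0..int N} q \<kappa>"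
    and g: "\<And>k x. x \<notin> {0..int N} \<Longrightarrow> g k x = 0" "\<And>k. g k \<noteq> (\<lambda>x. 0)"
      "\<And>k. k \<le> N \<Longrightarrow> mat_op {0..int N} q (g k) = (\<lambda>x. ev k * g k x)"
    by (rule birth_death_with_spectrum[of N ev]) (use N ev_dec ev_pairs in \<open>auto simp: ev_def\<close>)
  have "\<exists>f. (\<forall>x. x \<notin> E \<longrightarrow> f x = 0) \<and> f \<noteq> (\<lambda>x. 0) \<and> mat_op E p f = (\<lambda>x. ev k * f x)" if k: "k \<le> N" for k
  proof (cases k)
    case 0
    \<comment> \<open>The eigenvalue 1 belongs to the constants, as rows sum to 1; it is the only
      one not lifted from the dual.\<close>
    define u where "u x = (if x \<in> E then 1 else (0::real))" for x
    have "mat_op E p u x = ev k * u x" for x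
      using rows[of x] 0 by (auto simp: mat_op_finite u_def ev_def)
    moreover have u_off: "u x = 0" if "x \<notin> E" for x using that unfolding u_def by (rule if_not_P)
    moreover have "u 0 \<noteq> 0" using r by (simp add: u_def)
    ultimately show ?thesis by (intro exI[of _ u]) (auto simp: fun_eq_iff intro: u_off)
  next
    case (Suc i)
    then have i: "i < N" "ev k = L ! i" using k by (simp_all add: ev_def)
    show ?thesis unfolding i(2) using dual_eigenfunction[OF e_props[OF i(1)] t'[unfolded cE', OF i(1)]] .
  qed
  then have "\<forall>k. \<exists>f. k \<le> N \<longrightarrow> (\<forall>x. x \<notin> E \<longrightarrow> f x = 0) \<and> f \<noteq> (\<lambda>x. 0) \<and> mat_op E p f = (\<lambda>x. ev k * f x)" by blast
  then obtain f where f: "\<And>k. k \<le> N \<Longrightarrow> (\<forall>x. x \<notin> E \<longrightarrow> f k x = 0) \<and> f k \<noteq> (\<lambda>x. 0) \<and> mat_op E p (f k) = (\<lambda>x. ev k * f k x)"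
    by metis
  have \<pi>: "positive_on E \<pi>" by (rule reference_positive_on[OF ref])
  have \<kappa>: "positive_on E \<kappa>" using q(2) N by (simp add: reversible_measure_def positive_on_def)
  have "\<exists>\<Lambda>. similar_via E p \<pi> q \<kappa> \<Lambda>"
  proof (rule same_simple_spectrum_similar[where t = ev and f = f and g = g])
    show "inj_on ev {..<card E}"
      unfolding cE by (rule inj_onI) (metis ev_dec less_Suc_eq_le lessThan_iff less_irrefl linorder_neqE_nat)
  qed (use \<pi> \<kappa> f g N cE in \<open>auto simp: l2_finite\<close>)
  then have "(p, \<pi>) \<in> class_S_of (Regular 0) (Regular r) q \<kappa>"
    using pM \<pi> by (auto simp: class_S_of_def ss positive_on_def)
  then have "(p, \<pi>) \<in> class_S (Regular 0) (Regular r)"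
    using q N ss unfolding class_S_def by auto
  then show ?thesis using reversal_monotone by (simp add: class_SM_def ss)
qed

end

theorem theorem6p1:
  fixes lb rb :: endpoint
    and E :: "int set"
    and p :: "int \<Rightarrow> int \<Rightarrow> real"
    and \<pi> :: "int \<Rightarrow> real"
  assumes E: "E = state_space lb rb"
    and p: "p \<in> class_M lb rb"
    and \<pi>: "reference_measure E p \<pi>"
  shows
    \<comment> \<open>(1)\<close>
    "(finite E \<longrightarrow>
       (\<forall>q \<kappa>. q \<in> birth_death lb rb \<and> reversible_measure E q \<kappa> \<longrightarrow>
          ((\<exists>\<Lambda>. similar_via E p \<pi> q \<kappa> \<Lambda>) \<longleftrightarrow>
             real_distinct_eigenvalues E p \<and> eigenvalues E p = eigenvalues E q))) \<and>
     \<comment> \<open>(2)\<close>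
     (\<forall>q \<kappa> \<Lambda>. q \<in> class_B lb rb \<and> reversible_measure E q \<kappa> \<and> bounded_operator E \<kappa> \<pi> \<Lambda> \<longrightarrow>
        ((p, \<pi>) \<in> class_S lb rb \<and> similar_via E p \<pi> q \<kappa> \<Lambda> \<longleftrightarrow>
         (p, \<pi>) \<in> class_S_hat lb rb \<and>
           similar_via E q \<kappa> (time_reversal \<pi> p) \<pi> (l2_adjoint E \<kappa> \<pi> \<Lambda>))) \<and>
     (\<forall>q \<kappa> \<Lambda>. q \<in> class_B lb rb \<and> reversible_measure E q \<kappa> \<and>
        (p, \<pi>) \<in> class_S lb rb \<and> similar_via E p \<pi> q \<kappa> \<Lambda> \<longrightarrow>
        \<comment> \<open>(a)\<close>
        (\<forall>h\<in>excessive E p. \<forall>w.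
           (\<exists>c>0. \<exists>C>0. \<forall>x\<in>E. c * ((h x)\<^sup>2 * \<pi> x) \<le> w x \<and> w x \<le> C * ((h x)\<^sup>2 * \<pi> x)) \<longrightarrow>
             (doob_transform h p, w) \<in> class_S lb rb \<and>
             similar_via E (doob_transform h p) w q \<kappa> (\<lambda>f x. \<Lambda> f x / h x)) \<and>
        \<comment> \<open>(b)\<close>
        ((\<forall>x\<in>E. \<forall>y\<in>E. mat_mult E p (time_reversal \<pi> p) x y =
                         mat_mult E (time_reversal \<pi> p) p x y) \<longrightarrow>
           (\<forall>x\<in>E. \<forall>y\<in>E. p x y = time_reversal \<pi> p x y)) \<and>
        \<comment> \<open>(c)\<close>
        (compact_operator E \<pi> (mat_op E p) \<longleftrightarrow> compact_operator E \<kappa> (mat_op E q)) \<and>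
        (trace_class E \<pi> (mat_op E p) \<longleftrightarrow> trace_class E \<kappa> (mat_op E q)) \<and>
        (compact_operator E \<pi> (mat_op E p) \<longrightarrow>
           \<comment> \<open>(d)\<close>
           (\<exists>\<mu> f. eigen_riesz_basis E \<pi> p \<mu> f) \<and>
           (\<forall>\<mu> f. eigen_riesz_basis E \<pi> p \<mu> f \<longrightarrow>
              \<mu> ` index_set E = l2_eigenvalues E \<pi> p \<and>
              (\<exists>f'. riesz_basis E \<pi> f' \<and> biorthogonal E \<pi> f f' \<and>
                 (\<forall>g'. riesz_basis E \<pi> g' \<and> biorthogonal E \<pi> f g' \<longrightarrow>
                    (\<forall>k\<in>index_set E. g' k = f' k)) \<and>
                 (\<forall>g\<in>l2 E \<pi>. \<forall>n.
                    ((\<lambda>F. l2_norm E \<pi> (\<lambda>x. (mat_op E p ^^ n) g x -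
                        (\<Sum>k\<in>F. \<mu> k ^ n * l2_inner E \<pi> g (f' k) * f k x))) \<longlongrightarrow> 0)
                      (finite_subsets_at_top (index_set E))) \<and>
                 (\<forall>x\<in>E. \<forall>y\<in>E. \<forall>n.
                    ((\<lambda>k. \<mu> k ^ n * f k x * f' k y * \<pi> y) has_sum mat_pow E p n x y)
                      (index_set E)))) \<and>
           \<comment> \<open>(f)\<close>
           (\<forall>\<mu> f f'. eigen_riesz_basis E \<pi> p \<mu> f \<and>
              riesz_basis E \<pi> f' \<and> biorthogonal E \<pi> f f' \<longrightarrow>
              (\<forall>l r. lb = Regular l \<and> rb = Absorbing r \<longrightarrow>
                 (\<forall>x\<in>E. \<forall>(\<Omega> :: 'w measure) X n.
                    markov_chain (insert r E) (absorbed_kernel E r p) x \<Omega> X \<longrightarrow>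
                    measure \<Omega> (hitting_event \<Omega> X r (n + 1)) =
                      (\<Sum>k\<in>index_set E.
                         \<mu> k ^ n * (1 - \<mu> k) * l2_inner E \<pi> (\<lambda>x. 1) (f' k) * f k x))) \<and>
              (\<forall>l r. lb = Absorbing l \<and> rb = Regular r \<longrightarrow>
                 (\<forall>x\<in>E. \<forall>(\<Omega> :: 'w measure) X n.
                    markov_chain (insert l E) (absorbed_kernel E l p) x \<Omega> X \<longrightarrow>
                    measure \<Omega> (hitting_event \<Omega> X l (n + 1)) =
                      (\<Sum>k\<in>index_set E.
                         \<mu> k ^ n * (1 - \<mu> k) * l2_inner E \<pi> (\<lambda>x. 1) (f' k) * f k x)))))) \<and>
     \<comment> \<open>(e)\<close>
     (\<forall>r\<ge>3. class_MC r \<subseteq> class_SM (Regular 0) (Regular r))"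
proof -
  have sp: "sub_markov E p" using class_M_sub_markov[OF p] by (simp add: E)
  note p_rev = time_reversal_sub_markov[OF sp \<pi>]
  note w = reference_positive_on[OF \<pi>] and bp = mat_op_bounded[OF sp \<pi>] and bp' = mat_op_bounded[OF p_rev]
    and adj_p = mat_op_adjoint[OF sp \<pi>]
  have adj_p': "l2_inner E \<pi> (mat_op E (time_reversal \<pi> p) f) g = l2_inner E \<pi> f (mat_op E p g)"
    if "f \<in> l2 E \<pi>" "g \<in> l2 E \<pi>" for f g
    using adj_p[OF that(2,1)] by (simp add: l2_inner_commute)
  have B: "sub_markov E q" if "q \<in> class_B lb rb" for q
    using that class_M_sub_markov[of q lb rb] by (simp add: class_B_def birth_death_def Let_def E)
  have in_S: "(p', w') \<in> class_S lb rb"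
    if "q \<in> class_B lb rb" "reversible_measure E q \<kappa>" "p' \<in> class_M lb rb" "positive_on E w'"
      "similar_via E p' w' q \<kappa> \<Lambda>" for p' w' q \<kappa> \<Lambda>
    using that unfolding class_S_def class_S_of_def E positive_on_def by blast
  have in_S_hat: "(p, \<pi>) \<in> class_S_hat lb rb"
    if "q \<in> class_B lb rb" "reversible_measure E q \<kappa>" "similar_via E (time_reversal \<pi> p) \<pi> q \<kappa> \<Lambda>" for q \<kappa> \<Lambda>
    using that p w unfolding class_S_hat_def class_S_hat_of_def E positive_on_def by blast
  have v: "positive_on E \<kappa>" and bq: "bounded_operator E \<kappa> \<kappa> (mat_op E q)"
    and adj_q: "f \<in> l2 E \<kappa> \<Longrightarrow> g \<in> l2 E \<kappa> \<Longrightarrow> l2_inner E \<kappa> (mat_op E q f) g = l2_inner E \<kappa> f (mat_op E q g)"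
    if "q \<in> class_B lb rb" "reversible_measure E q \<kappa>" for q \<kappa> f g
    using reference_positive_on mat_op_bounded reversible_reference reversible_self_adjoint B[OF that(1)] that(2) by blast+
  have compact: "compact_operator E \<pi> (mat_op E p) \<longleftrightarrow> compact_operator E \<kappa> (mat_op E q)"
    if "q \<in> class_B lb rb" "reversible_measure E q \<kappa>" "similar_via E p \<pi> q \<kappa> \<Lambda>" for q \<kappa> \<Lambda>
  proof -
    note v = v[OF that(1,2)] and bq = bq[OF that(1,2)]
    note inv = similar_via_inverse[OF w v bp bq that(3)]
    obtain \<Lambda>' where sim': "similar_via E q \<kappa> p \<pi> \<Lambda>'" by (rule inv)
    show ?thesis using compact_similar[OF w v bp bq that(3)] compact_similar[OF v w bq bp sim'] by blast
  qed
  show ?thesis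
  \<comment> \<open>The goals appear in the order (1), (2), (a), (b), two for (c), three for (d),
    two for (f), and (e).\<close>
  proof (intro conjI allI impI, goal_cases)
    case (1 q \<kappa>)
    then show ?case using finite_similar_iff[OF E _ w] by blast
  next
    case (2 q \<kappa> \<Lambda>)
    then have qB: "q \<in> class_B lb rb" and \<kappa>: "reversible_measure E q \<kappa>" and \<Lambda>: "bounded_operator E \<kappa> \<pi> \<Lambda>" by auto
    note v = v[OF qB \<kappa>] and bq = bq[OF qB \<kappa>] and adj_q = adj_q[OF qB \<kappa>] and \<Lambda>' = l2_adjoint[OF v w \<Lambda>]
    have \<Lambda>'': "l2_inner E \<kappa> (l2_adjoint E \<kappa> \<pi> \<Lambda> f) g = l2_inner E \<pi> f (\<Lambda> g)" if "f \<in> l2 E \<pi>" "g \<in> l2 E \<kappa>" for f g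
      using \<Lambda>'(2)[OF that(2,1)] by (simp add: l2_inner_commute)
    have fwd: "similar_via E q \<kappa> (time_reversal \<pi> p) \<pi> (l2_adjoint E \<kappa> \<pi> \<Lambda>)" if "similar_via E p \<pi> q \<kappa> \<Lambda>"
      by (rule similar_via_adjoint[OF w v \<Lambda> \<Lambda>' bp bp' adj_p bq bq adj_q that])
    have bwd: "similar_via E p \<pi> q \<kappa> \<Lambda>" if "similar_via E q \<kappa> (time_reversal \<pi> p) \<pi> (l2_adjoint E \<kappa> \<pi> \<Lambda>)"
      by (rule similar_via_adjoint[OF v w \<Lambda>'(1) \<Lambda> \<Lambda>'' bq bq adj_q bp' bp adj_p' that])
    \<comment> \<open>The adjoint intertwines \<open>q\<close> with the reversal; it is its inverse
      that witnesses similarity of the reversal to \<open>q\<close>.\<close>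
    have "(p, \<pi>) \<in> class_S_hat lb rb" if "similar_via E p \<pi> q \<kappa> \<Lambda>"
      using in_S_hat[OF qB \<kappa>] by (rule similar_via_inverse[OF v w bq bp' fwd[OF that]])
    moreover have "(p, \<pi>) \<in> class_S lb rb" if "similar_via E p \<pi> q \<kappa> \<Lambda>"
      by (rule in_S[OF qB \<kappa> p w that])
    ultimately show ?case using fwd bwd by blast
  next
    case (3 q \<kappa> \<Lambda>)
    then have qB: "q \<in> class_B lb rb" and \<kappa>: "reversible_measure E q \<kappa>" and sim: "similar_via E p \<pi> q \<kappa> \<Lambda>" by auto
    show ?case
    proof (intro ballI allI impI)
      fix h w' assume h: "h \<in> excessive E p"
        and "\<exists>c>0. \<exists>C>0. \<forall>x\<in>E. c * ((h x)\<^sup>2 * \<pi> x) \<le> w' x \<and> w' x \<le> C * ((h x)\<^sup>2 * \<pi> x)"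
      then obtain c C where c: "c > 0" "C > 0"
        and cC: "\<And>x. x \<in> E \<Longrightarrow> c * ((h x)\<^sup>2 * \<pi> x) \<le> w' x \<and> w' x \<le> C * ((h x)\<^sup>2 * \<pi> x)" by blast
      note d = doob_similar[OF p E w v[OF qB \<kappa>] h c cC sim]
      have "doob_transform h p \<in> class_M lb rb" by (rule doob_class_M[OF p]) (use h E in simp)
      then show "(doob_transform h p, w') \<in> class_S lb rb \<and>
         similar_via E (doob_transform h p) w' q \<kappa> (\<lambda>f x. \<Lambda> f x / h x)"
        using in_S[OF qB \<kappa> _ d] d(2) by blast
    qed
  next
    case (4 q \<kappa> \<Lambda>)
    then show ?case using normal_similar_symmetric[OF sp \<pi> B] by blast
  next
    case (5 q \<kappa> \<Lambda>)
    then show ?case using compact by blast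
  next
    case (6 q \<kappa> \<Lambda>)
    then have qB: "q \<in> class_B lb rb" and \<kappa>: "reversible_measure E q \<kappa>" and sim: "similar_via E p \<pi> q \<kappa> \<Lambda>" by auto
    note v = v[OF qB \<kappa>] and bq = bq[OF qB \<kappa>] and adj_q = adj_q[OF qB \<kappa>]
    obtain \<Lambda>' where sim': "similar_via E q \<kappa> p \<pi> \<Lambda>'" by (rule similar_via_inverse[OF w v bp bq sim])
    show ?case
      using trace_class_similar[OF v w bq bq adj_q bp bp' adj_p sim']
        trace_class_similar[OF w v bp bp' adj_p bq bq adj_q sim] by blast
  next
    case (7 q \<kappa> \<Lambda>)
    then have qB: "q \<in> class_B lb rb" and \<kappa>: "reversible_measure E q \<kappa>" and sim: "similar_via E p \<pi> q \<kappa> \<Lambda>" by auto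
    show ?case
      by (rule compact_similar_eigen_riesz_basis[OF w B[OF qB] \<kappa> sim]) (use 7 compact[OF qB \<kappa> sim] in simp)
  next
    case (8 q \<kappa> \<Lambda> \<mu> f)
    show ?case by (rule eigenvalues_riesz[OF w bp 8(3)])
  next
    case (9 q \<kappa> \<Lambda> \<mu> f)
    then have rf: "riesz_basis E \<pi> f" by (simp add: eigen_riesz_basis_def)
    obtain f' where f': "riesz_basis E \<pi> f'" "biorthogonal E \<pi> f f'"
      using riesz_basis_dual[OF w rf] by metis
    show ?case
    proof (intro exI[of _ f'] conjI f' allI impI ballI)
      fix g' k assume g': "riesz_basis E \<pi> g' \<and> biorthogonal E \<pi> f g'" and k: "k \<in> index_set E"
      show "g' k = f' k"
        by (rule riesz_basis_complete[OF w rf]) (use g' f' k riesz_basis_l2 in \<open>auto simp: biorthogonal_def\<close>)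
    qed (use riesz_spectral_expansion[OF w bp 9(3) f'] in auto)
  next
    case (10 q \<kappa> \<Lambda> \<mu> f f' l r)
    then have "E = {l..<r}" by (auto simp: E state_space_def)
    then show ?case
      using 10(3) by (intro ballI allI impI hitting_probability_spectral[OF _ w]) auto
  next
    case (11 q \<kappa> \<Lambda> \<mu> f f' l r)
    then have "E = {l<..r}" by (auto simp: E state_space_def)
    then show ?case
      using 11(3) by (intro ballI allI impI hitting_probability_spectral[OF _ w]) auto
  next
    case (12 r)
    then show ?case using class_MC_imp_class_SM by auto
  qed
qed

end
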